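(* Let $\mathbb{T}$ be the standard flat two-dimensional torus. There exist a sequence $\{f_k\}_{k=1}^\infty$ of Laplacian Morse-eigenfunctions on $\mathbb{T}$ and a sequence $\{\Omega_k\}_{k=1}^\infty$, with $\Omega_k$ a Neumann domain of $f_k$ for each $k$, such that the sequence $\{\mathrm{pos}(f_k|_{\Omega_k},\Omega_k)\}_{k=1}^\infty$ is unbounded.
   Context: The standard flat torus is $[0,1]\times[0,1]$ with opposite sides identified and the Euclidean metric. A Morse-eigenfunction is a real Laplacian eigenfunction which is a Morse function. For such $f$ let $\varphi$ be the flow of $-\nabla f$ ($\partial_t\varphi(t,x)=-\nabla f|_{\varphi(t,x)}$, $\varphi(0,x)=x$), and for a critical point $x$ put $W^s(x)=\{y:\lim_{t\to\infty}\varphi(t,y)=x\}$, $W^u(x)=\{y:\lim_{t\to-\infty}\varphi(t,y)=x\}$. A Neumann domain of $f$ is a connected component of $W^s(p)\cap W^u(q)$ for some (local) minimum $p$ and (local) maximum $q$ of $f$. The restriction of $f$ to a Neumann domain $\Omega$ is an eigenfunction of the Laplacian on $\Omega$ with Neumann boundary conditions. For a domain $\Omega$ and an eigenfunction $h$ on $\Omega$ satisfying Neumann boundary conditions, $\mathrm{pos}(h,\Omega)$ is the position of (the eigenvalue of) $h$ in the Neumann spectrum of $\Omega$, eigenvalues being listed in nondecreasing order with multiplicity and indexed from $0$, so that $\mathrm{pos}(\mathrm{const},\Omega)=0$; for degenerate eigenvalues the position is the minimal one. *)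

theory Defs
  imports "HOL-Analysis.Analysis"
begin

section \<open>The flat torus\<close>

text \<open>The unit square with opposite sides identified is realised as the quotient of the plane by the
  integer lattice. Its flat structure is carried by the translation action of the plane:
  \<open>p \<oplus> v\<close> is the end point of the geodesic segment that starts at \<open>p\<close> with
  displacement vector \<open>v\<close>.\<close>

definition lattice_equiv :: "real \<times> real \<Rightarrow> real \<times> real \<Rightarrow> bool" where
  "lattice_equiv x y \<longleftrightarrow> fst x - fst y \<in> \<int> \<and> snd x - snd y \<in> \<int>"

lemma equivp_lattice_equiv: "equivp lattice_equiv"
proof (rule equivpI)
  show "reflp lattice_equiv"
    by (simp add: reflp_def lattice_equiv_def)
  show "symp lattice_equiv"
    unfolding symp_def lattice_equiv_def by (metis Ints_minus minus_diff_eq)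
  show "transp lattice_equiv"
  proof (rule transpI)
    fix x y z
    assume "lattice_equiv x y" "lattice_equiv y z"
    then have "(fst x - fst y) + (fst y - fst z) \<in> \<int>" "(snd x - snd y) + (snd y - snd z) \<in> \<int>"
      unfolding lattice_equiv_def by (blast intro: Ints_add)+
    then show "lattice_equiv x z"
      by (simp add: lattice_equiv_def)
  qed
qed

quotient_type torus = "real \<times> real" / lattice_equiv
  by (rule equivp_lattice_equiv)

instantiation torus :: topological_space
begin

text \<open>the quotient topology\<close>
definition open_torus :: "torus set \<Rightarrow> bool" where
  "open_torus U \<longleftrightarrow> open (abs_torus -` U)"

instance
  by standard (auto simp: open_torus_def vimage_Union)

end

lift_definition translate :: "torus \<Rightarrow> real \<times> real \<Rightarrow> torus" (infixl \<open>\<oplus>\<close> 65)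
  is "\<lambda>x v. x + v"
  by (simp add: lattice_equiv_def)

text \<open>The Riemannian area measure: Lebesgue measure on a fundamental square, pushed forward.\<close>
definition torus_area :: "torus measure" where
  "torus_area = distr (restrict_space lborel ({0..<1} \<times> {0..<1})) borel abs_torus"


section \<open>Calculus on the torus\<close>

definition dir_deriv :: "real \<times> real \<Rightarrow> (torus \<Rightarrow> real) \<Rightarrow> torus \<Rightarrow> real" where
  "dir_deriv v f p = deriv (\<lambda>t. f (p \<oplus> t *\<^sub>R v)) 0"

text \<open>\<open>f\<close> is of class \<open>C\<^sup>\<infinity>\<close>: every iterated partial derivative of \<open>f\<close> is (Frechet)
  differentiable everywhere; hence all of them are also continuous.\<close>
definition smooth :: "(torus \<Rightarrow> real) \<Rightarrow> bool" where
  "smooth f \<longleftrightarrow>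
     (\<forall>bs\<in>lists Basis. \<forall>p. (\<lambda>v. foldr dir_deriv bs f (p \<oplus> v)) differentiable (at 0))"

definition grad :: "(torus \<Rightarrow> real) \<Rightarrow> torus \<Rightarrow> real \<times> real" where
  "grad f p = (\<Sum>b\<in>Basis. dir_deriv b f p *\<^sub>R b)"

definition laplacian :: "(torus \<Rightarrow> real) \<Rightarrow> torus \<Rightarrow> real" where
  "laplacian f p = (\<Sum>b\<in>Basis. dir_deriv b (dir_deriv b f) p)"

definition laplacian_eigenfunction :: "(torus \<Rightarrow> real) \<Rightarrow> bool" where
  "laplacian_eigenfunction f \<longleftrightarrow>
     smooth f \<and> (\<exists>p. f p \<noteq> 0) \<and> (\<exists>E::real. \<forall>p. - laplacian f p = E * f p)"

definition critical_point :: "(torus \<Rightarrow> real) \<Rightarrow> torus \<Rightarrow> bool" where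
  "critical_point f p \<longleftrightarrow> grad f p = 0"

text \<open>All critical points are nondegenerate: the Hessian form
  \<open>(v, w) \<mapsto> dir_deriv v (dir_deriv w f) p\<close> has trivial kernel.\<close>
definition morse :: "(torus \<Rightarrow> real) \<Rightarrow> bool" where
  "morse f \<longleftrightarrow> smooth f \<and>
     (\<forall>p. critical_point f p \<longrightarrow>
        (\<forall>v. (\<forall>w. dir_deriv v (dir_deriv w f) p = 0) \<longrightarrow> v = 0))"

definition morse_eigenfunction :: "(torus \<Rightarrow> real) \<Rightarrow> bool" where
  "morse_eigenfunction f \<longleftrightarrow> laplacian_eigenfunction f \<and> morse f"


section \<open>Neumann domains\<close>

text \<open>The orbit of \<open>y\<close> is written through its lift \<open>c\<close> to the plane, relative to \<open>y\<close>;
  \<open>c 0 = 0\<close> expresses \<open>\<phi> 0 y = y\<close>.\<close>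
definition neg_gradient_flow :: "(torus \<Rightarrow> real) \<Rightarrow> (real \<Rightarrow> torus \<Rightarrow> torus) \<Rightarrow> bool" where
  "neg_gradient_flow f \<phi> \<longleftrightarrow>
     (\<forall>y. \<exists>c. c 0 = 0 \<and>
        (\<forall>t. \<phi> t y = y \<oplus> c t \<and> (c has_vector_derivative - grad f (\<phi> t y)) (at t)))"

definition stable_set :: "(real \<Rightarrow> torus \<Rightarrow> torus) \<Rightarrow> torus \<Rightarrow> torus set" where
  "stable_set \<phi> x = {y. ((\<lambda>t. \<phi> t y) \<longlongrightarrow> x) at_top}"

definition unstable_set :: "(real \<Rightarrow> torus \<Rightarrow> torus) \<Rightarrow> torus \<Rightarrow> torus set" where
  "unstable_set \<phi> x = {y. ((\<lambda>t. \<phi> t y) \<longlongrightarrow> x) at_bot}"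

definition local_minimum :: "(torus \<Rightarrow> real) \<Rightarrow> torus \<Rightarrow> bool" where
  "local_minimum f p \<longleftrightarrow> (\<forall>\<^sub>F y in nhds p. f p \<le> f y)"

definition local_maximum :: "(torus \<Rightarrow> real) \<Rightarrow> torus \<Rightarrow> bool" where
  "local_maximum f q \<longleftrightarrow> (\<forall>\<^sub>F y in nhds q. f y \<le> f q)"

definition neumann_domain :: "(torus \<Rightarrow> real) \<Rightarrow> torus set \<Rightarrow> bool" where
  "neumann_domain f \<Omega> \<longleftrightarrow>
     (\<exists>\<phi> p q. neg_gradient_flow f \<phi> \<and> local_minimum f p \<and> local_maximum f q \<and>
        \<Omega> \<in> components (stable_set \<phi> p \<inter> unstable_set \<phi> q))"


section \<open>The Neumann spectrum of a domain\<close>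

text \<open>Functions on \<open>\<Omega>\<close> are total functions on the torus of which only the values on \<open>\<Omega>\<close>
  matter, since they are integrated against the following measure.\<close>
definition area_on :: "torus set \<Rightarrow> torus measure" where
  "area_on \<Omega> = restrict_space torus_area \<Omega>"

definition L2_on :: "torus set \<Rightarrow> (torus \<Rightarrow> 'a::euclidean_space) set" where
  "L2_on \<Omega> = {u. u \<in> borel_measurable (area_on \<Omega>) \<and> integrable (area_on \<Omega>) (\<lambda>x. (norm (u x))\<^sup>2)}"

text \<open>\<open>C\<^sub>c\<^sup>\<infinity>(\<Omega>)\<close>, extended by zero; the supports are compact because the torus is.\<close>
definition test_functions :: "torus set \<Rightarrow> (torus \<Rightarrow> real) set" where
  "test_functions \<Omega> = {\<psi>. smooth \<psi> \<and> closure {x. \<psi> x \<noteq> 0} \<subseteq> \<Omega>}"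

text \<open>\<open>u\<close> lies in the Sobolev space \<open>H\<^sup>1(\<Omega>)\<close> and \<open>G\<close> is its weak gradient.\<close>
definition H1_gradient :: "torus set \<Rightarrow> (torus \<Rightarrow> real) \<Rightarrow> (torus \<Rightarrow> real \<times> real) \<Rightarrow> bool" where
  "H1_gradient \<Omega> u G \<longleftrightarrow> u \<in> L2_on \<Omega> \<and> G \<in> L2_on \<Omega> \<and>
     (\<forall>\<psi>\<in>test_functions \<Omega>. \<forall>b\<in>Basis.
        (\<integral>x. u x * dir_deriv b \<psi> x \<partial>area_on \<Omega>) = - (\<integral>x. (G x \<bullet> b) * \<psi> x \<partial>area_on \<Omega>))"

text \<open>\<open>u\<close> is an eigenfunction, with eigenvalue \<open>\<mu>\<close>, of the Neumann Laplacian on \<open>\<Omega>\<close>, i.e. of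
  the operator associated with the Dirichlet form on the whole of \<open>H\<^sup>1(\<Omega>)\<close>. Testing against all
  of \<open>H\<^sup>1(\<Omega>)\<close> encodes both the differential equation and the Neumann boundary condition; no
  regularity of the boundary is needed (Neumann domains may have cusps).\<close>
definition neumann_eigenfunction :: "torus set \<Rightarrow> real \<Rightarrow> (torus \<Rightarrow> real) \<Rightarrow> bool" where
  "neumann_eigenfunction \<Omega> \<mu> u \<longleftrightarrow> \<not> (AE x in area_on \<Omega>. u x = 0) \<and>
     (\<exists>G. H1_gradient \<Omega> u G \<and>
        (\<forall>v W. H1_gradient \<Omega> v W \<longrightarrow>
           (\<integral>x. G x \<bullet> W x \<partial>area_on \<Omega>) = \<mu> * (\<integral>x. u x * v x \<partial>area_on \<Omega>)))"

text \<open>The Neumann spectrum of \<open>\<Omega>\<close> is discrete, and \<open>\<mu> 0 \<le> \<mu> 1 \<le> \<dots>\<close> is the list of all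
  eigenvalues, each repeated according to its multiplicity: the \<open>\<mu> n\<close> are the eigenvalues of the
  members of a complete orthonormal system of eigenfunctions, so the sequence is determined by
  \<open>\<Omega>\<close>.\<close>
definition neumann_spectrum :: "torus set \<Rightarrow> (nat \<Rightarrow> real) \<Rightarrow> bool" where
  "neumann_spectrum \<Omega> \<mu> \<longleftrightarrow> incseq \<mu> \<and> filterlim \<mu> at_top sequentially \<and>
     (\<exists>e. (\<forall>n. neumann_eigenfunction \<Omega> (\<mu> n) (e n)) \<and>
        (\<forall>m n. (\<integral>x. e m x * e n x \<partial>area_on \<Omega>) = (if m = n then 1 else 0)) \<and>
        (\<forall>g\<in>L2_on \<Omega>. (\<forall>n. (\<integral>x. g x * e n x \<partial>area_on \<Omega>) = 0) \<longrightarrow>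
           (AE x in area_on \<Omega>. g x = 0)))"

text \<open>\<open>pos(h, \<Omega>)\<close> exists and equals \<open>n\<close>. This is a relation, so that a position is only
  attributed to a Neumann eigenfunction \<open>h\<close> on a domain with discrete Neumann spectrum. For a
  degenerate eigenvalue \<open>n\<close> is the minimal index.\<close>
definition has_pos :: "(torus \<Rightarrow> real) \<Rightarrow> torus set \<Rightarrow> nat \<Rightarrow> bool" where
  "has_pos h \<Omega> n \<longleftrightarrow>
     (\<exists>\<mu> E. neumann_spectrum \<Omega> \<mu> \<and> neumann_eigenfunction \<Omega> E h \<and> n = (LEAST k. \<mu> k = E))"

end

theory Submission
  imports Defs "HOL-Library.Function_Algebras" "HOL-Real_Asymp.Real_Asymp" "HOL-Library.Diagonal_Subsequence"
begin

text \<open>For even \<open>k\<close> let \<open>f(x, y) = - cos(2 \<pi> k x) cos(2 \<pi> y)\<close>, with eigenvalue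
  \<open>E = (2 \<pi>)\<^sup>2 (k\<^sup>2 + 1)\<close>. Both \<open>sin(2 \<pi> k x)\<close> and \<open>sin(2 \<pi> y)\<close> to the power \<open>k\<^sup>2\<close> solve the same linear
  equation along the gradient flow, so the zero set of their difference \<open>P\<close> is invariant and consists of the
  separatrices through the saddles. Hence the Neumann domain joining the maximum \<open>(0, 1/2)\<close> to the
  minimum \<open>(1/(2 k), 1/2)\<close> is the explicit domain \<open>0 < x < 1/(2 k)\<close>, \<open>1/4 < y < 3/4\<close>, \<open>P > 0\<close>.

  As \<open>k\<close> grows, this domain becomes thin but keeps its height, and its core looks like a product. Functions of
  \<open>y\<close> alone therefore have Rayleigh quotients bounded independently of \<open>k\<close>: for every \<open>N\<close> there are \<open>N\<close>
  disjointly supported ones with Rayleigh quotients at most a constant \<open>C\<^sub>N\<close>. Since \<open>E\<close> tends to infinity with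
  \<open>k\<close>, the min-max principle shows that at least \<open>N\<close> Neumann eigenvalues lie below \<open>E\<close>.

  The domain is convex. Dilations about its points thus regularise Sobolev functions up to the boundary
  without any boundary regularity, which gives the compactness behind the discreteness of the spectrum.\<close>


section \<open>An abstract spectral theorem\<close>

text \<open>The exponent is forced: along the flow \<open>sin(2 pi k x)\<close> grows at rate
  \<open>(2 pi k)^2 f\<close> and \<open>sin(2 pi y)\<close> at rate \<open>(2 pi)^2 f\<close>, so
  exactly the power \<open>k^2\<close> of the latter keeps pace with the former. Evenness of
  \<open>k\<close> makes this power nonnegative and equal to 1 at both \<open>y = 1/4\<close> and
  \<open>y = 3/4\<close>, so that the curves \<open>P = 0\<close> run through both saddles bounding
  the domain.

  The obstacle is that a position exists only once the Neumann spectrum is known to be discrete with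
  a complete orthonormal system, on a domain whose boundary has corners at the saddles. Density,
  compactness and the boundary condition are therefore all derived from interior test functions. The
  Neumann condition in particular is verified weakly: the gradients satisfy
  \<open>grad f . grad P = - (2 pi k)^2 f P\<close>, so a cutoff depending on \<open>P\<close> alone
  produces an error that stays bounded and tends to 0.

  Uniformity in \<open>k\<close> comes from using trial functions supported where
  \<open>|sin(2 pi y)| < 1/2\<close>: there the power \<open>k^2\<close> is below 1/2 as well, and
  the domain contains a fixed share of the full width.\<close>

locale psd_form =
  fixes V :: "'a::real_vector set" and b :: "'a \<Rightarrow> 'a \<Rightarrow> real"
  assumes V: "subspace V"
    and add_left: "\<lbrakk>u \<in> V; v \<in> V; w \<in> V\<rbrakk> \<Longrightarrow> b (u + v) w = b u w + b v w"
    and scale_left: "\<lbrakk>u \<in> V; w \<in> V\<rbrakk> \<Longrightarrow> b (c *\<^sub>R u) w = c * b u w"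
    and sym: "\<lbrakk>u \<in> V; w \<in> V\<rbrakk> \<Longrightarrow> b u w = b w u"
    and nonneg: "u \<in> V \<Longrightarrow> 0 \<le> b u u"
begin

lemma V_closed [simp]:
  "0 \<in> V" "u \<in> V \<Longrightarrow> v \<in> V \<Longrightarrow> u + v \<in> V" "u \<in> V \<Longrightarrow> c *\<^sub>R u \<in> V"
  "u \<in> V \<Longrightarrow> v \<in> V \<Longrightarrow> u - v \<in> V"
  "(\<And>i. i \<in> I \<Longrightarrow> e i \<in> V) \<Longrightarrow> sum e I \<in> V"
  using V by (auto simp: subspace_0 subspace_add subspace_scale subspace_diff subspace_sum)

lemma minus_left: "\<lbrakk>u \<in> V; v \<in> V; w \<in> V\<rbrakk> \<Longrightarrow> b (u - v) w = b u w - b v w"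
  using add_left[of "u - v" v w] by simp

lemma zero_left: "w \<in> V \<Longrightarrow> b 0 w = 0"
  using scale_left[of 0 w 0] by simp

lemma sum_left: "\<lbrakk>\<And>i. i \<in> I \<Longrightarrow> e i \<in> V; w \<in> V\<rbrakk> \<Longrightarrow> b (sum e I) w = (\<Sum>i\<in>I. b (e i) w)"
proof (induction I rule: infinite_finite_induct)
  case (insert x F)
  then show ?case by (simp add: add_left)
qed (auto simp: zero_left)

lemma add_right: "\<lbrakk>u \<in> V; v \<in> V; w \<in> V\<rbrakk> \<Longrightarrow> b w (u + v) = b w u + b w v"
  using add_left[of u v w] sym by simp

lemma minus_right: "\<lbrakk>u \<in> V; v \<in> V; w \<in> V\<rbrakk> \<Longrightarrow> b w (u - v) = b w u - b w v"
  using minus_left[of u v w] sym by simp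

lemma scale_right: "\<lbrakk>u \<in> V; w \<in> V\<rbrakk> \<Longrightarrow> b w (c *\<^sub>R u) = c * b w u"
  using scale_left[of u w c] sym by simp

lemma sum_right: "\<lbrakk>\<And>i. i \<in> I \<Longrightarrow> e i \<in> V; w \<in> V\<rbrakk> \<Longrightarrow> b w (sum e I) = (\<Sum>i\<in>I. b w (e i))"
  using sum_left[of I e w] sym[of w] by simp

lemma square_add: "\<lbrakk>u \<in> V; v \<in> V\<rbrakk> \<Longrightarrow> b (u + v) (u + v) = b u u + 2 * b u v + b v v"
  by (simp add: add_left add_right sym[of v u])

lemma square_diff: "\<lbrakk>u \<in> V; v \<in> V\<rbrakk> \<Longrightarrow> b (u - v) (u - v) = b u u - 2 * b u v + b v v"
  by (simp add: minus_left minus_right sym[of v u])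

lemma square_scale: "u \<in> V \<Longrightarrow> b (c *\<^sub>R u) (c *\<^sub>R u) = c\<^sup>2 * b u u"
  by (simp add: scale_left scale_right power2_eq_square)

lemma Cauchy_Schwarz:
  assumes "u \<in> V" "v \<in> V" shows "(b u v)\<^sup>2 \<le> b u u * b v v"
proof -
  have *: "0 \<le> b u u + 2 * t * b u v + t\<^sup>2 * b v v" for t
    using nonneg[of "u + t *\<^sub>R v"] assms
    by (simp add: square_add scale_left scale_right mult.assoc power2_eq_square)
  show ?thesis
  proof (cases "b v v = 0")
    case True
    have "b u v = 0"
    proof (rule ccontr)
      \<comment> \<open>If \<open>b v v = 0\<close> the expression is affine in \<open>t\<close>; a
        nonzero slope would make it negative, and the \<open>t\<close> below is chosen to give the
        value -1.\<close>
      assume n: "b u v \<noteq> 0"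
      have "0 \<le> b u u + 2 * (- (b u u + 1) / (2 * b u v)) * b u v"
        using *[of "- (b u u + 1) / (2 * b u v)"] True by simp
      also have "\<dots> = - 1" using n by (simp add: field_simps)
      finally show False by simp
    qed
    then show ?thesis using True by simp
  next
    case False
    then have p: "b v v > 0" using nonneg[OF assms(2)] by simp
    have "0 \<le> b u u + 2 * (- b u v / b v v) * b u v + (- b u v / b v v)\<^sup>2 * b v v"
      by (rule *)
    also have "\<dots> = b u u - (b u v)\<^sup>2 / b v v"
      using p by (simp add: power2_eq_square field_simps)
    finally show ?thesis using p by (simp add: field_simps)
  qed
qed

lemma Cauchy_Schwarz_abs:
  assumes "u \<in> V" "v \<in> V" shows "\<bar>b u v\<bar> \<le> sqrt (b u u) * sqrt (b v v)"
  using real_sqrt_le_mono[OF Cauchy_Schwarz[OF assms]] by (simp add: real_sqrt_mult)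

lemma tendsto_left:
  assumes s: "\<And>n. s n \<in> V" "u \<in> V" "v \<in> V" and lim: "(\<lambda>n. b (s n - u) (s n - u)) \<longlonglongrightarrow> 0"
  shows "(\<lambda>n. b (s n) v) \<longlonglongrightarrow> b u v"
proof (rule LIM_zero_cancel)
  have "(\<lambda>n. sqrt (b (s n - u) (s n - u)) * sqrt (b v v)) \<longlonglongrightarrow> sqrt 0 * sqrt (b v v)"
    by (intro tendsto_intros lim)
  then have 1: "(\<lambda>n. sqrt (b (s n - u) (s n - u)) * sqrt (b v v)) \<longlonglongrightarrow> 0" by simp
  show "(\<lambda>n. b (s n) v - b u v) \<longlonglongrightarrow> 0"
  proof (rule tendsto_0_le[OF 1, of _ 1])
    show "\<forall>\<^sub>F n in sequentially. norm (b (s n) v - b u v) \<le> norm (sqrt (b (s n - u) (s n - u)) * sqrt (b v v)) * 1"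
    proof (rule always_eventually, rule allI)
      fix n
      have "\<bar>b (s n - u) v\<bar> \<le> sqrt (b (s n - u) (s n - u)) * sqrt (b v v)"
        by (rule Cauchy_Schwarz_abs) (simp_all add: s)
      then show "norm (b (s n) v - b u v) \<le> norm (sqrt (b (s n - u) (s n - u)) * sqrt (b v v)) * 1"
        using s nonneg[of "s n - u"] nonneg[of v] by (simp add: minus_left[of "s n" u v])
    qed
  qed
qed

lemma tendsto_square:
  assumes s: "\<And>n. s n \<in> V" "u \<in> V" and lim: "(\<lambda>n. b (s n - u) (s n - u)) \<longlonglongrightarrow> 0"
  shows "(\<lambda>n. b (s n) (s n)) \<longlonglongrightarrow> b u u"
proof -
  have "(\<lambda>n. b (s n - u) (s n - u) + 2 * b (s n) u - b u u) \<longlonglongrightarrow> 0 + 2 * b u u - b u u"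
    by (intro tendsto_intros lim tendsto_left s)
  then show ?thesis using s by (simp add: square_diff)
qed

end

text \<open>Completeness refers to the sum \<open>b + a\<close> and compactness to \<open>b\<close>
  alone, the abstract form of a compact embedding of \<open>H^1\<close> into \<open>L^2\<close>.
  Both forms are only semidefinite, so functions need not be identified modulo null sets; limits are
  determined up to null vectors.\<close>

locale spectral_problem = b: psd_form V b + a: psd_form V a
  for V :: "'a::real_vector set" and b a :: "'a \<Rightarrow> 'a \<Rightarrow> real" +
  assumes complete: "\<lbrakk>\<And>n. s n \<in> V;
      \<And>\<epsilon>. 0 < \<epsilon> \<Longrightarrow> \<exists>N. \<forall>m\<ge>N. \<forall>n\<ge>N. b (s m - s n) (s m - s n) + a (s m - s n) (s m - s n) < \<epsilon>\<rbrakk> \<Longrightarrow>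
      \<exists>u\<in>V. (\<lambda>n. b (s n - u) (s n - u) + a (s n - u) (s n - u)) \<longlonglongrightarrow> 0"
    and compact: "\<lbrakk>\<And>n. s n \<in> V; \<And>n. b (s n) (s n) + a (s n) (s n) \<le> C\<rbrakk> \<Longrightarrow>
      \<exists>r. strict_mono (r :: nat \<Rightarrow> nat) \<and>
        (\<forall>\<epsilon>>0. \<exists>N. \<forall>m\<ge>N. \<forall>n\<ge>N. b (s (r m) - s (r n)) (s (r m) - s (r n)) < \<epsilon>)"
    and infinite_dim: "(\<And>i. i < n \<Longrightarrow> e i \<in> V) \<Longrightarrow> \<exists>v\<in>V. (\<forall>i<n::nat. b v (e i) = 0) \<and> 0 < b v v"
begin

text \<open>Only the values of \<open>e\<close> below \<open>n\<close> enter, as a course-of-values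
  choice requires. The last conjunct is the Euler-Lagrange equation against all of \<open>V\<close>,
  not only against vectors orthogonal to the predecessors; the construction of the next minimiser
  relies on it.\<close>

definition minimiser :: "(nat \<Rightarrow> 'a) \<Rightarrow> nat \<Rightarrow> 'a \<Rightarrow> bool" where
  "minimiser e n r \<longleftrightarrow> r \<in> V \<and> (\<forall>i<n. b r (e i) = 0) \<and> b r r = 1 \<and>
     (\<forall>v\<in>V. (\<forall>i<n. b v (e i) = 0) \<longrightarrow> a r r * b v v \<le> a v v) \<and>
     (\<forall>v\<in>V. a r v = a r r * b r v)"

lemma minimiserD:
  assumes "minimiser e n r"
  shows "r \<in> V" "i < n \<Longrightarrow> b r (e i) = 0" "b r r = 1"
    "\<lbrakk>v \<in> V; \<And>i. i < n \<Longrightarrow> b v (e i) = 0\<rbrakk> \<Longrightarrow> a r r * b v v \<le> a v v"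
    "v \<in> V \<Longrightarrow> a r v = a r r * b r v"
  using assms unfolding minimiser_def by blast+

text \<open>Direct method: a minimising sequence of the Rayleigh quotient on the orthogonal
  complement \<open>W\<close> of the predecessors has a \<open>b\<close>-Cauchy subsequence, the
  parallelogram law upgrades this to Cauchy in \<open>b + a\<close>, and the limit is normalised and
  attains the infimum.\<close>

lemma minimiser_ex:
  assumes e: "\<And>i. i < n \<Longrightarrow> minimiser e i (e i)"
  shows "\<exists>r. minimiser e n r"
proof -
  define W where "W = {v\<in>V. \<forall>i<n. b v (e i) = 0}"
  have eV: "i < n \<Longrightarrow> e i \<in> V" for i using minimiserD(1)[OF e] .
  have orth: "b (e i) (e j) = (if i = j then 1 else 0)" if "i < n" "j < n" for i j
    using minimiserD(2,3)[OF e[OF that(1)]] minimiserD(2,3)[OF e[OF that(2)]] b.sym[OF eV eV, OF that]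
    by (cases i j rule: linorder_cases) simp_all
  have W_V: "v \<in> W \<Longrightarrow> v \<in> V" for v by (auto simp: W_def)
  have W: "subspace W"
    unfolding subspace_def W_def using eV by (auto simp: b.zero_left b.add_left b.scale_left)
  obtain v0 where v0: "v0 \<in> W" "b v0 v0 > 0"
    using infinite_dim[of n e] eV by (auto simp: W_def)
  define S where "S = {a v v |v. v \<in> W \<and> b v v = 1}"
  define \<mu> where "\<mu> = Inf S"
  define v1 where "v1 = (1 / sqrt (b v0 v0)) *\<^sub>R v0"
  have "v1 \<in> W" "b v1 v1 = 1"
    using v0 W_V by (auto simp: v1_def subspace_scale[OF W] b.square_scale power_divide)
  then have S: "S \<noteq> {}" by (auto simp: S_def)
  have bdd: "bdd_below S"
    by (rule bdd_belowI[of _ 0]) (auto simp: S_def a.nonneg W_V)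
  have \<mu>0: "\<mu> \<ge> 0" unfolding \<mu>_def
    by (rule cInf_greatest[OF S]) (auto simp: S_def a.nonneg W_V)
  have min: "\<mu> * b v v \<le> a v v" if "v \<in> W" for v
  proof (cases "b v v = 0")
    case True then show ?thesis using a.nonneg W_V that by auto
  next
    case False
    then have p: "b v v > 0" using b.nonneg[of v] W_V[OF that] by simp
    have "a ((1 / sqrt (b v v)) *\<^sub>R v) ((1 / sqrt (b v v)) *\<^sub>R v) \<in> S"
      unfolding S_def using p that
      by (intro CollectI exI[of _ "(1 / sqrt (b v v)) *\<^sub>R v"])
         (auto simp: W_V subspace_scale[OF W] b.square_scale power_divide)
    from cInf_lower[OF this bdd] show ?thesis
      using p that by (auto simp: W_V \<mu>_def a.square_scale power_divide field_simps)
  qed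
  have "\<exists>v\<in>W. b v v = 1 \<and> a v v < \<mu> + 1 / real (Suc j)" for j
    using cInf_lessD[OF S, of "\<mu> + 1 / real (Suc j)"] by (auto simp: \<mu>_def S_def)
  then obtain s where s: "\<And>j. s j \<in> W" "\<And>j. b (s j) (s j) = 1" "\<And>j. a (s j) (s j) < \<mu> + 1 / real (Suc j)"
    by metis
  have "b (s j) (s j) + a (s j) (s j) \<le> 1 + (\<mu> + 1)" for j
  proof -
    have "1 / real (Suc j) \<le> 1" by simp
    then show ?thesis using s(2)[of j] s(3)[of j] by linarith
  qed
  from compact[of s, OF W_V[OF s(1)] this] obtain r :: "nat \<Rightarrow> nat" where r: "strict_mono r"
    "\<And>\<epsilon>. \<epsilon> > 0 \<Longrightarrow> \<exists>N. \<forall>m\<ge>N. \<forall>n\<ge>N. b (s (r m) - s (r n)) (s (r m) - s (r n)) < \<epsilon>"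
    by blast
  define t where "t j = s (r j)" for j
  have t: "t j \<in> W" "b (t j) (t j) = 1" "a (t j) (t j) < \<mu> + 1 / real (Suc j)" for j
  proof -
    have "1 / real (Suc (r j)) \<le> 1 / real (Suc j)"
      using seq_suble[OF r(1), of j] by (simp add: field_simps)
    then show "a (t j) (t j) < \<mu> + 1 / real (Suc j)" using s(3)[of "r j"] by (simp add: t_def)
  qed (auto simp: t_def s)
  note tV = W_V[OF t(1)]
  \<comment> \<open>Parallelogram law for both forms: \<open>t m + t n\<close> lies in
    \<open>W\<close>, so its energy is at least \<mu> times its mass, and the energy left for the
    difference is small once its mass is.\<close>
  have a_diff: "a (t m - t n) (t m - t n) \<le> 2 / Suc m + 2 / Suc n + \<mu> * b (t m - t n) (t m - t n)" for m n
  proof -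
    have "\<mu> * b (t m + t n) (t m + t n) \<le> a (t m + t n) (t m + t n)"
      by (rule min) (simp add: subspace_add[OF W] t)
    moreover have "b (t m + t n) (t m + t n) = 4 - b (t m - t n) (t m - t n)"
      using tV by (simp add: b.square_add b.square_diff t)
    moreover have "a (t m - t n) (t m - t n) = 2 * a (t m) (t m) + 2 * a (t n) (t n) - a (t m + t n) (t m + t n)"
      using tV by (simp add: a.square_add a.square_diff)
    ultimately show ?thesis using t(3)[of m] t(3)[of n] by (simp add: algebra_simps)
  qed
  have "\<exists>u\<in>V. (\<lambda>n. b (t n - u) (t n - u) + a (t n - u) (t n - u)) \<longlonglongrightarrow> 0"
  proof (rule complete)
    fix \<epsilon> :: real assume \<epsilon>: "\<epsilon> > 0"
    then have "\<epsilon> / (2 * (1 + \<mu>)) > 0" using \<mu>0 by simp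
    from r(2)[OF this] obtain N1 where N1:
      "\<And>m n. m \<ge> N1 \<Longrightarrow> n \<ge> N1 \<Longrightarrow> b (t m - t n) (t m - t n) < \<epsilon> / (2 * (1 + \<mu>))"
      unfolding t_def by blast
    obtain N2 where N2: "8 / \<epsilon> < real N2" using reals_Archimedean2 by blast
    have "b (t m - t n) (t m - t n) + a (t m - t n) (t m - t n) < \<epsilon>" if "m \<ge> max N1 N2" "n \<ge> max N1 N2" for m n
    proof -
      have *: "2 / Suc j < \<epsilon> / 4" if "j \<ge> N2" for j :: nat
      proof -
        have "8 / \<epsilon> < Suc j" using N2 that by linarith
        then show ?thesis using \<epsilon> by (simp add: field_simps)
      qed
      have "(1 + \<mu>) * b (t m - t n) (t m - t n) < (1 + \<mu>) * (\<epsilon> / (2 * (1 + \<mu>)))"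
        by (rule mult_strict_left_mono[OF N1]) (use that \<mu>0 in auto)
      also have "\<dots> = \<epsilon> / 2" using \<mu>0 by (simp add: field_simps)
      finally show ?thesis using a_diff[of m n] *[of m] *[of n] that by (simp add: algebra_simps)
    qed
    then show "\<exists>N. \<forall>m\<ge>N. \<forall>n\<ge>N. b (t m - t n) (t m - t n) + a (t m - t n) (t m - t n) < \<epsilon>" by blast
  qed (rule tV)
  then obtain u where u: "u \<in> V" and lim: "(\<lambda>n. b (t n - u) (t n - u) + a (t n - u) (t n - u)) \<longlonglongrightarrow> 0" by blast
  have limb: "(\<lambda>n. b (t n - u) (t n - u)) \<longlonglongrightarrow> 0"
    by (rule tendsto_sandwich[OF _ _ tendsto_const lim]) (auto simp: u tV b.nonneg a.nonneg)
  have lima: "(\<lambda>n. a (t n - u) (t n - u)) \<longlonglongrightarrow> 0"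
    by (rule tendsto_sandwich[OF _ _ tendsto_const lim]) (auto simp: u tV b.nonneg a.nonneg)
  have u1: "b u u = 1"
    using b.tendsto_square[OF tV u limb] LIMSEQ_unique[OF _ tendsto_const] by (simp add: t)
  have uW: "u \<in> W"
  proof -
    have "b u (e i) = 0" if "i < n" for i
      using b.tendsto_left[OF tV u eV[OF that] limb] t(1) that
      by (auto simp: W_def intro: LIMSEQ_unique[OF _ tendsto_const])
    then show ?thesis using u by (auto simp: W_def)
  qed
  have "a u u \<le> \<mu>"
  proof (rule LIMSEQ_le[OF a.tendsto_square[OF tV u lima]])
    have "(\<lambda>n. \<mu> + 1 / real (Suc n)) \<longlonglongrightarrow> \<mu> + 0"
      using LIMSEQ_inverse_real_of_nat by (intro tendsto_intros) (simp add: inverse_eq_divide)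
    then show "(\<lambda>n. \<mu> + 1 / real (Suc n)) \<longlonglongrightarrow> \<mu>" by simp
    show "\<exists>N. \<forall>n\<ge>N. a (t n) (t n) \<le> \<mu> + 1 / real (Suc n)" using t(3) less_imp_le by blast
  qed
  with min[OF uW] u1 have a_u: "a u u = \<mu>" by simp
  \<comment> \<open>The form \<open>a - \<mu> b\<close> is semidefinite on \<open>W\<close> and
    vanishes at \<open>u\<close>; Cauchy-Schwarz for it puts \<open>u\<close> in its kernel, which
    is the Euler-Lagrange equation on \<open>W\<close> without differentiating a quotient.\<close>
  interpret c: psd_form W "\<lambda>v w. a v w - \<mu> * b v w"
  proof
    show "a v w - \<mu> * b v w = a w v - \<mu> * b w v" if "v \<in> W" "w \<in> W" for v w
      using a.sym[of v w] b.sym[of v w] that W_V by simp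
  qed (use W min W_V in \<open>auto simp: a.add_left b.add_left a.scale_left b.scale_left algebra_simps\<close>)
  have EL_W: "a u v = \<mu> * b u v" if "v \<in> W" for v
    using c.Cauchy_Schwarz[OF uW that] a_u u1 by simp
  \<comment> \<open>For general \<open>v\<close> the projection \<open>p\<close> onto the
    predecessors is subtracted. The term \<open>a u p\<close> vanishes because each
    \<open>e i\<close> satisfies its own equation against all of \<open>V\<close>, in particular
    against \<open>u\<close>.\<close>
  have EL: "a u v = \<mu> * b u v" if v: "v \<in> V" for v
  proof -
    define p where "p = (\<Sum>i<n. b v (e i) *\<^sub>R e i)"
    have p: "p \<in> V" unfolding p_def using eV by (intro b.V_closed(5) b.V_closed(3)) auto
    have pe: "b p (e j) = b v (e j)" if "j < n" for j
    proof -
      have "b p (e j) = (\<Sum>i<n. b v (e i) * b (e i) (e j))"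
        unfolding p_def using eV that by (subst b.sum_left) (auto simp: b.scale_left intro!: sum.cong)
      also have "\<dots> = (\<Sum>i<n. if i = j then b v (e i) else 0)"
        by (intro sum.cong) (auto simp: orth that)
      finally show ?thesis using that by simp
    qed
    have "v - p \<in> W" using v p pe eV by (auto simp: W_def b.minus_left)
    from EL_W[OF this] have "a u v - a u p = \<mu> * (b u v - b u p)"
      using u v p by (simp add: a.minus_right b.minus_right)
    moreover have "b u p = 0"
      unfolding p_def using u eV uW
      by (subst b.sum_right) (auto simp: b.scale_right W_def intro!: sum.neutral)
    moreover have "a u p = 0"
    proof -
      have "a u (e i) = 0" if "i < n" for i
        using minimiserD(5)[OF e[OF that] u] uW that a.sym[OF u eV[OF that]] b.sym[OF u eV[OF that]]
        by (simp add: W_def)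
      then show ?thesis unfolding p_def using u eV
        by (subst a.sum_right) (auto simp: a.scale_right intro!: sum.neutral)
    qed
    ultimately show ?thesis by simp
  qed
  have "minimiser e n u"
    unfolding minimiser_def using uW u1 a_u EL min by (auto simp: W_def)
  then show ?thesis ..
qed

text \<open>The eigenvectors are successive minimisers. The variational inequality is kept in the
  conclusion because it is the half of the min-max principle by which trial functions bound
  eigenvalues from above.\<close>

theorem spectral_theorem:
  obtains e :: "nat \<Rightarrow> 'a" and \<mu> :: "nat \<Rightarrow> real"
  where "incseq \<mu>" "filterlim \<mu> at_top sequentially" "\<And>n. e n \<in> V"
    "\<And>m n. b (e m) (e n) = (if m = n then 1 else 0)"
    "\<And>n v. v \<in> V \<Longrightarrow> a (e n) v = \<mu> n * b (e n) v"
    "\<And>n v. v \<in> V \<Longrightarrow> (\<And>i. i < n \<Longrightarrow> b v (e i) = 0) \<Longrightarrow> \<mu> n * b v v \<le> a v v"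
    "\<And>v. v \<in> V \<Longrightarrow> (\<lambda>n. b (v - (\<Sum>i<n. b v (e i) *\<^sub>R e i)) (v - (\<Sum>i<n. b v (e i) *\<^sub>R e i))) \<longlonglongrightarrow> 0"
proof -
  have "\<exists>e. \<forall>n. minimiser e n (e n)"
  proof (rule dependent_wellorder_choice)
    show "minimiser f x r = minimiser g x r" if "\<And>y. y < x \<Longrightarrow> f y = g y" for r f g x
      using that by (simp add: minimiser_def cong: conj_cong)
  qed (rule minimiser_ex)
  then obtain e where e: "\<And>n. minimiser e n (e n)" by blast
  define \<mu> where "\<mu> n = a (e n) (e n)" for n
  have eV: "e n \<in> V" for n using minimiserD(1)[OF e] .
  have orth: "b (e i) (e j) = (if i = j then 1 else 0)" for i j
    using minimiserD(2,3)[OF e[of i]] minimiserD(2,3)[OF e[of j]] b.sym[OF eV eV, of i j]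
    by (cases i j rule: linorder_cases) simp_all
  have EL: "a (e n) v = \<mu> n * b (e n) v" if "v \<in> V" for n v
    using minimiserD(5)[OF e that] by (simp only: \<mu>_def)
  have min: "\<mu> n * b v v \<le> a v v" if "v \<in> V" "\<And>i. i < n \<Longrightarrow> b v (e i) = 0" for n v
    using minimiserD(4)[OF e] that by (simp only: \<mu>_def)
  have mono: "incseq \<mu>"
  proof (rule incseq_SucI)
    fix n show "\<mu> n \<le> \<mu> (Suc n)"
      using min[of "e (Suc n)" n] eV orth by (simp add: \<mu>_def[of "Suc n"])
  qed
  \<comment> \<open>Bounded eigenvalues would make the \<open>e n\<close> bounded in
    \<open>b + a\<close>, and compactness would give a subsequence with small mutual
    \<open>b\<close>-distances; orthonormal vectors have squared distance 2.\<close>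
  have lim: "filterlim \<mu> at_top sequentially"
  proof (rule ccontr)
    assume "\<not> filterlim \<mu> at_top sequentially"
    then obtain Z where Z: "\<not> (\<forall>\<^sub>F n in sequentially. Z \<le> \<mu> n)" by (auto simp: filterlim_at_top)
    have "\<mu> n \<le> Z" for n
    proof (rule ccontr)
      assume "\<not> \<mu> n \<le> Z"
      then have "\<forall>m\<ge>n. Z \<le> \<mu> m" using incseqD[OF mono] by (meson le_trans linear order_trans)
      then show False using Z by (auto simp: eventually_sequentially)
    qed
    then have "b (e n) (e n) + a (e n) (e n) \<le> 1 + Z" for n
      by (simp add: orth \<mu>_def[symmetric])
    from compact[of e, OF eV this] obtain r :: "nat \<Rightarrow> nat" where r: "strict_mono r"
      "\<forall>\<epsilon>>0. \<exists>N. \<forall>m\<ge>N. \<forall>n\<ge>N. b (e (r m) - e (r n)) (e (r m) - e (r n)) < \<epsilon>" by blast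
    then obtain N where N: "\<And>m n. m \<ge> N \<Longrightarrow> n \<ge> N \<Longrightarrow> b (e (r m) - e (r n)) (e (r m) - e (r n)) < 1"
      using zero_less_one by blast
    have "r N \<noteq> r (Suc N)" using r(1) by (metis strict_mono_eq n_not_Suc_n)
    then show False using N[of N "Suc N"] by (simp add: b.square_diff eV orth)
  qed
  have approx: "(\<lambda>n. b (v - (\<Sum>i<n. b v (e i) *\<^sub>R e i)) (v - (\<Sum>i<n. b v (e i) *\<^sub>R e i))) \<longlonglongrightarrow> 0"
    if v: "v \<in> V" for v
  proof -
    define p where "p n = (\<Sum>i<n. b v (e i) *\<^sub>R e i)" for n
    have p: "p n \<in> V" for n unfolding p_def using eV by (intro b.V_closed(5) b.V_closed(3)) auto
    have pe: "b (v - p n) (e j) = 0" if "j < n" for j n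
    proof -
      have "b (p n) (e j) = (\<Sum>i<n. b v (e i) * b (e i) (e j))"
        using eV by (simp add: p_def b.sum_left b.scale_left)
      also have "\<dots> = (\<Sum>i<n. if i = j then b v (e i) else 0)"
        by (intro sum.cong) (auto simp: orth)
      finally show ?thesis using that v p eV by (simp add: b.minus_left)
    qed
    \<comment> \<open>The eigenvector equations make \<open>p n\<close> and \<open>v - p n\<close>
      orthogonal for \<open>a\<close>, so the remainder has energy at most \<open>a v v\<close>,
      while the variational inequality gives it at least \<open>\<mu> n\<close> times its
      mass.\<close>
    have bound: "\<mu> n * b (v - p n) (v - p n) \<le> a v v" for n
    proof -
      have vp: "v - p n \<in> V" using v p by simp
      have "b (e j) (v - p n) = 0" if "j < n" for j
        using pe[OF that] b.sym[OF eV vp] by simp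
      then have 0: "a (p n) (v - p n) = 0"
        using vp eV by (simp add: p_def a.sum_left a.scale_left EL)
      have "a v v = a (p n + (v - p n)) (p n + (v - p n))" by simp
      also have "\<dots> = a (p n) (p n) + a (v - p n) (v - p n)"
        using a.square_add[OF p[of n] vp] 0 by (simp only: mult_zero_right add_0_right)
      finally show ?thesis using min[OF vp pe[of _ n], of n] a.nonneg[OF p, of n] by simp
    qed
    have lim0: "(\<lambda>n. a v v / \<mu> n) \<longlonglongrightarrow> 0"
      by (rule tendsto_divide_0[OF tendsto_const filterlim_at_top_imp_at_infinity[OF lim]])
    show ?thesis unfolding p_def[symmetric]
    proof (rule tendsto_sandwich[OF _ _ tendsto_const lim0])
      show "\<forall>\<^sub>F n in sequentially. 0 \<le> b (v - p n) (v - p n)"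
        using v p by (simp add: b.nonneg)
      show "\<forall>\<^sub>F n in sequentially. b (v - p n) (v - p n) \<le> a v v / \<mu> n"
      using filterlim_at_top_dense[THEN iffD1, OF lim, rule_format, of 0]
      by eventually_elim (use bound in \<open>simp add: field_simps\<close>)
    qed
  qed
  show ?thesis by (rule that[OF mono lim eV orth EL min approx])
qed

end

section \<open>Square integrable functions\<close>

text \<open>Pointwise vector space structure, so that \<open>L2 M\<close> and later
  \<open>H1\<close> are subspaces of a function type and \<open>psd_form\<close> applies to
  functions directly, without quotients by null functions.\<close>

instantiation "fun" :: (type, real_vector) real_vector
begin
definition scaleR_fun :: "real \<Rightarrow> ('a \<Rightarrow> 'b) \<Rightarrow> 'a \<Rightarrow> 'b" where
  "scaleR_fun c f = (\<lambda>x. c *\<^sub>R f x)"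
instance
  by standard (auto simp: scaleR_fun_def fun_eq_iff algebra_simps)
end

lemma scaleR_fun_apply [simp]: "(c *\<^sub>R f) x = c *\<^sub>R f x"
  by (simp add: scaleR_fun_def)

lemma sum_fun_apply: "(\<Sum>i\<in>I. f i) x = (\<Sum>i\<in>I. f i x :: 'b::comm_monoid_add)"
  by (induction I rule: infinite_finite_induct) auto

definition L2 :: "'a measure \<Rightarrow> ('a \<Rightarrow> 'b::euclidean_space) set" where
  "L2 M = {u. u \<in> borel_measurable M \<and> integrable M (\<lambda>x. (norm (u x))\<^sup>2)}"

lemma L2_measurable [measurable_dest]: "u \<in> L2 M \<Longrightarrow> u \<in> borel_measurable M"
  by (simp add: L2_def)

lemma L2_integrable_square: "u \<in> L2 M \<Longrightarrow> integrable M (\<lambda>x. (norm (u x))\<^sup>2)"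
  by (simp add: L2_def)

lemma L2_integrable_inner:
  assumes "u \<in> L2 M" "v \<in> L2 M" shows "integrable M (\<lambda>x. u x \<bullet> v x)"
proof (rule Bochner_Integration.integrable_bound)
  show "integrable M (\<lambda>x. (norm (u x))\<^sup>2 + (norm (v x))\<^sup>2)"
    using assms by (simp add: L2_integrable_square)
  show "(\<lambda>x. u x \<bullet> v x) \<in> borel_measurable M"
    using assms[THEN L2_measurable] by measurable
  have "norm (u x \<bullet> v x) \<le> norm ((norm (u x))\<^sup>2 + (norm (v x))\<^sup>2)" for x
  proof -
    have "\<bar>u x \<bullet> v x\<bar> \<le> norm (u x) * norm (v x)" by (rule Cauchy_Schwarz_ineq2)
    moreover have "2 * (norm (u x) * norm (v x)) \<le> (norm (u x))\<^sup>2 + (norm (v x))\<^sup>2"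
      using sum_squares_bound[of "norm (u x)" "norm (v x)"] by simp
    moreover have "0 \<le> norm (u x) * norm (v x)" by simp
    ultimately show ?thesis by simp
  qed
  then show "AE x in M. norm (u x \<bullet> v x) \<le> norm ((norm (u x))\<^sup>2 + (norm (v x))\<^sup>2)" by simp
qed

lemma L2_bound:
  assumes "v \<in> L2 M" "u \<in> borel_measurable M" "AE x in M. norm (u x) \<le> norm (v x)"
  shows "u \<in> L2 M"
proof -
  have "integrable M (\<lambda>x. (norm (u x))\<^sup>2)"
  proof (rule Bochner_Integration.integrable_bound[OF L2_integrable_square[OF assms(1)]])
    show "(\<lambda>x. (norm (u x))\<^sup>2) \<in> borel_measurable M" using assms(2) by measurable
    show "AE x in M. norm ((norm (u x))\<^sup>2) \<le> norm ((norm (v x))\<^sup>2)"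
      using assms(3) by eventually_elim (simp add: power_mono)
  qed
  with assms(2) show ?thesis by (simp add: L2_def)
qed

lemma L2_subspace: "subspace (L2 M)"
proof (rule subspaceI)
  show "0 \<in> L2 M" by (simp add: L2_def zero_fun_def)
  show "c *\<^sub>R u \<in> L2 M" if u: "u \<in> L2 M" for c and u :: "'a \<Rightarrow> 'b"
  proof -
    have "c *\<^sub>R u \<in> borel_measurable M"
      unfolding scaleR_fun_def using L2_measurable[OF u] by measurable
    then show ?thesis using L2_integrable_square[OF u] by (simp add: L2_def power_mult_distrib)
  qed
  show "u + v \<in> L2 M" if uv: "u \<in> L2 M" "v \<in> L2 M" for u v :: "'a \<Rightarrow> 'b"
  proof -
    have 1: "u + v \<in> borel_measurable M"
      unfolding plus_fun_def using uv[THEN L2_measurable] by measurable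
    have "(\<lambda>x. (norm ((u + v) x))\<^sup>2) = (\<lambda>x. (norm (u x))\<^sup>2 + (norm (v x))\<^sup>2 + 2 * (u x \<bullet> v x))"
      by (simp add: fun_eq_iff power2_norm_eq_inner inner_add_left inner_add_right inner_commute)
    then have "integrable M (\<lambda>x. (norm ((u + v) x))\<^sup>2)"
      using L2_integrable_square[OF uv(1)] L2_integrable_square[OF uv(2)] L2_integrable_inner[OF uv] by simp
    with 1 show ?thesis by (simp add: L2_def)
  qed
qed

lemma L2_psd_form: "psd_form (L2 M) (\<lambda>u v. \<integral>x. u x \<bullet> v x \<partial>M)"
proof
  show "(\<integral>x. (u + v) x \<bullet> w x \<partial>M) = (\<integral>x. u x \<bullet> w x \<partial>M) + (\<integral>x. v x \<bullet> w x \<partial>M)"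
    if "u \<in> L2 M" "v \<in> L2 M" "w \<in> L2 M" for u v w :: "'a \<Rightarrow> 'b"
    using that by (simp add: inner_add_left L2_integrable_inner)
qed (auto simp: L2_subspace inner_commute intro: Bochner_Integration.integral_nonneg)

lemma L2_diff: "u \<in> L2 M \<Longrightarrow> v \<in> L2 M \<Longrightarrow> (\<lambda>x. u x - v x) \<in> L2 M"
  using subspace_diff[OF L2_subspace, of u M v] by (simp add: fun_diff_def)

lemma L2_Cauchy_Schwarz:
  assumes "u \<in> L2 M" "v \<in> L2 M"
  shows "\<bar>\<integral>x. u x \<bullet> v x \<partial>M\<bar> \<le> sqrt (\<integral>x. (norm (u x))\<^sup>2 \<partial>M) * sqrt (\<integral>x. (norm (v x))\<^sup>2 \<partial>M)"
  using psd_form.Cauchy_Schwarz_abs[OF L2_psd_form assms] by (simp add: power2_norm_eq_inner)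

lemma L2_const: "finite_measure M \<Longrightarrow> (\<lambda>x. c) \<in> L2 M"
  by (simp add: L2_def finite_measure.integrable_const)

lemma L2_bounded:
  fixes u :: "'a \<Rightarrow> 'b::euclidean_space"
  assumes "finite_measure M" "u \<in> borel_measurable M" "\<And>x. x \<in> space M \<Longrightarrow> norm (u x) \<le> C"
  shows "u \<in> L2 M"
proof (rule L2_bound[OF L2_const[OF assms(1), of C] assms(2)])
  show "AE x in M. norm (u x) \<le> norm C"
    by (rule AE_I2) (use assms(3) in fastforce)
qed

lemma L2_norm_le_sqrt:
  assumes fin: "finite_measure M" and u: "u \<in> L2 M"
  shows "integrable M u"
    "(\<integral>x. norm (u x) \<partial>M) \<le> sqrt (measure M (space M)) * sqrt (\<integral>x. (norm (u x))\<^sup>2 \<partial>M)"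
proof -
  have nu: "(\<lambda>x. norm (u x)) \<in> L2 M" using u by (auto simp: L2_def)
  have one: "(\<lambda>x. 1::real) \<in> L2 M" by (rule L2_const[OF fin])
  have "integrable M (\<lambda>x. norm (u x))" using L2_integrable_inner[OF one nu] by simp
  then show "integrable M u" using L2_measurable[OF u] by (simp add: integrable_norm_iff)
  have "\<bar>\<integral>x. norm (u x) \<partial>M\<bar> \<le> sqrt (measure M (space M)) * sqrt (\<integral>x. (norm (u x))\<^sup>2 \<partial>M)"
    using L2_Cauchy_Schwarz[OF one nu] by simp
  then show "(\<integral>x. norm (u x) \<partial>M) \<le> sqrt (measure M (space M)) * sqrt (\<integral>x. (norm (u x))\<^sup>2 \<partial>M)"
    by linarith
qed

lemma L2_dominated_convergence:
  fixes s :: "nat \<Rightarrow> 'a \<Rightarrow> 'b::euclidean_space"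
  assumes g: "(g :: 'a \<Rightarrow> real) \<in> L2 M" and s: "\<And>n. s n \<in> borel_measurable M" and u: "u \<in> borel_measurable M"
    and lim: "AE x in M. (\<lambda>n. s n x) \<longlonglongrightarrow> u x"
    and bound: "\<And>n. AE x in M. norm (s n x - u x) \<le> g x"
  shows "(\<lambda>n. \<integral>x. (norm (s n x - u x))\<^sup>2 \<partial>M) \<longlonglongrightarrow> 0"
proof -
  have "(\<lambda>n. \<integral>x. (norm (s n x - u x))\<^sup>2 \<partial>M) \<longlonglongrightarrow> (\<integral>x. 0 \<partial>M)"
  proof (rule integral_dominated_convergence[where w = "\<lambda>x. (g x)\<^sup>2"])
    show "(\<lambda>x. (norm (s n x - u x))\<^sup>2) \<in> borel_measurable M" for n
      using borel_measurable_diff[OF s u, of n] by measurable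
    show "integrable M (\<lambda>x. (g x)\<^sup>2)" using L2_integrable_square[OF g] by simp
    show "AE x in M. (\<lambda>n. (norm (s n x - u x))\<^sup>2) \<longlonglongrightarrow> 0"
      using lim
    proof eventually_elim
      case (elim x)
      have "(\<lambda>n. (norm (s n x - u x))\<^sup>2) \<longlonglongrightarrow> (norm (u x - u x))\<^sup>2"
        by (intro tendsto_intros elim)
      then show ?case by simp
    qed
    show "AE x in M. norm ((norm (s n x - u x))\<^sup>2) \<le> (g x)\<^sup>2" for n
      using bound[of n] by eventually_elim (simp add: power_mono)
  qed simp_all
  then show ?thesis by simp
qed

text \<open>A subsequence with squared distances below \<open>(1/4)^k\<close> has increments whose
  \<open>L^1\<close> norms are summable, because the measure is finite; hence it converges almost
  everywhere, and Fatou's lemma turns the Cauchy property into convergence of the full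
  sequence.\<close>

theorem Riesz_Fischer:
  fixes s :: "nat \<Rightarrow> 'a \<Rightarrow> 'b::euclidean_space"
  assumes fin: "finite_measure M" and s: "\<And>n. s n \<in> L2 M"
    and Cauchy: "\<And>\<epsilon>. 0 < \<epsilon> \<Longrightarrow> \<exists>N. \<forall>m\<ge>N. \<forall>n\<ge>N. (\<integral>x. (norm (s m x - s n x))\<^sup>2 \<partial>M) < \<epsilon>"
  shows "\<exists>u\<in>L2 M. (\<lambda>n. \<integral>x. (norm (s n x - u x))\<^sup>2 \<partial>M) \<longlonglongrightarrow> 0"
proof -
  note [measurable] = s[THEN L2_measurable]
  define q where "q m n = (\<integral>x. (norm (s m x - s n x))\<^sup>2 \<partial>M)" for m n
  have "\<exists>r. strict_mono r \<and> (\<forall>k. \<forall>m\<ge>r k. \<forall>n\<ge>r k. q m n < (1/4) ^ k)"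
  proof -
    have "\<exists>f. \<forall>k. (\<forall>m\<ge>f k. \<forall>n\<ge>f k. q m n < (1/4) ^ k) \<and> f k < f (Suc k)"
    proof (rule dependent_nat_choice)
      show "\<exists>x. \<forall>m\<ge>x. \<forall>n\<ge>x. q m n < (1/4) ^ 0" using Cauchy[of 1] by (simp add: q_def)
      show "\<exists>y. (\<forall>m\<ge>y. \<forall>n\<ge>y. q m n < (1/4) ^ Suc k) \<and> x < y" for x k
      proof -
        obtain N where "\<forall>m\<ge>N. \<forall>n\<ge>N. q m n < (1/4) ^ Suc k"
          using Cauchy[of "(1/4) ^ Suc k"] by (auto simp: q_def)
        then show ?thesis by (intro exI[of _ "max N (Suc x)"]) auto
      qed
    qed
    then show ?thesis by (auto simp: strict_mono_Suc_iff)
  qed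
  then obtain r where r: "strict_mono r" "\<And>k m n. m \<ge> r k \<Longrightarrow> n \<ge> r k \<Longrightarrow> q m n < (1/4) ^ k"
    by blast
  define d where "d k x = norm (s (r (Suc k)) x - s (r k) x)" for k x
  have [measurable]: "d k \<in> borel_measurable M" for k unfolding d_def by measurable
  have d_int: "integrable M (d k)" and d_le: "(\<integral>x. d k x \<partial>M) \<le> sqrt (measure M (space M)) * (1/2) ^ k" for k
  proof -
    have L: "(\<lambda>x. s (r (Suc k)) x - s (r k) x) \<in> L2 M" by (intro L2_diff s)
    show "integrable M (d k)" unfolding d_def using L2_norm_le_sqrt(1)[OF fin L] by simp
    have "q (r (Suc k)) (r k) < (1/4) ^ k"
      by (rule r(2)) (use strict_mono_less_eq[OF r(1)] in auto)
    then have "sqrt (q (r (Suc k)) (r k)) \<le> sqrt ((1/4) ^ k)" by simp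
    also have "sqrt ((1/4) ^ k) = (1/2::real) ^ k"
      by (simp add: real_sqrt_power real_sqrt_divide)
    finally have "sqrt (q (r (Suc k)) (r k)) \<le> (1/2) ^ k" .
    then show "(\<integral>x. d k x \<partial>M) \<le> sqrt (measure M (space M)) * (1/2) ^ k"
      unfolding d_def using L2_norm_le_sqrt(2)[OF fin L]
      by (elim order_trans) (auto simp: q_def intro!: mult_left_mono)
  qed
  have "(\<integral>\<^sup>+x. (\<Sum>k. ennreal (d k x)) \<partial>M) = (\<Sum>k. \<integral>\<^sup>+x. ennreal (d k x) \<partial>M)"
    by (rule nn_integral_suminf) measurable
  also have "\<dots> = (\<Sum>k. ennreal (\<integral>x. d k x \<partial>M))"
    by (intro suminf_cong nn_integral_eq_integral d_int) (simp add: d_def)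
  also have "\<dots> \<le> (\<Sum>k. ennreal (sqrt (measure M (space M)) * (1/2) ^ k))"
    by (intro suminf_le ennreal_leI d_le) auto
  also have "\<dots> = ennreal (\<Sum>k. sqrt (measure M (space M)) * (1/2) ^ k)"
    by (intro suminf_ennreal2) (auto intro!: summable_mult summable_geometric)
  finally have "(\<integral>\<^sup>+x. (\<Sum>k. ennreal (d k x)) \<partial>M) \<noteq> \<infinity>"
    by (auto simp: top_unique)
  then have "AE x in M. (\<Sum>k. ennreal (d k x)) \<noteq> \<infinity>"
    by (intro nn_integral_PInf_AE) measurable
  then have conv: "AE x in M. convergent (\<lambda>k. s (r k) x)"
  proof eventually_elim
    case (elim x)
    then have "summable (\<lambda>k. d k x)"
      by (intro summable_suminf_not_top) (auto simp: d_def)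
    then have "summable (\<lambda>k. s (r (Suc k)) x - s (r k) x)"
      unfolding d_def by (rule summable_norm_cancel)
    then have "convergent (\<lambda>n. \<Sum>k<n. s (r (Suc k)) x - s (r k) x)"
      by (simp add: summable_iff_convergent)
    then have "convergent (\<lambda>n. s (r n) x - s (r 0) x)"
      by (simp add: sum_lessThan_telescope[of "\<lambda>k. s (r k) x"])
    then have "convergent (\<lambda>n. (s (r n) x - s (r 0) x) + s (r 0) x)"
      by (rule convergent_add[OF _ convergent_const])
    then show ?case by simp
  qed
  define u where "u x = lim (\<lambda>k. s (r k) x)" for x
  have [measurable]: "u \<in> borel_measurable M" unfolding u_def by (rule borel_measurable_lim_metric) measurable
  have lim: "AE x in M. (\<lambda>k. s (r k) x) \<longlonglongrightarrow> u x"
    using conv by eventually_elim (simp add: u_def convergent_LIMSEQ_iff)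
  \<comment> \<open>Stated for nonnegative integrals because \<open>u\<close> is not yet known to be
    square integrable; the same bound yields both membership in \<open>L2\<close> and the
    convergence.\<close>
  have fatou: "(\<integral>\<^sup>+x. ennreal ((norm (s n x - u x))\<^sup>2) \<partial>M) \<le> ennreal ((1/4) ^ k)" if n: "n \<ge> r k" for n k
  proof -
    have "(\<integral>\<^sup>+x. ennreal ((norm (s n x - u x))\<^sup>2) \<partial>M)
        = (\<integral>\<^sup>+x. liminf (\<lambda>j. ennreal ((norm (s n x - s (r j) x))\<^sup>2)) \<partial>M)"
    proof (rule nn_integral_cong_AE)
      show "AE x in M. ennreal ((norm (s n x - u x))\<^sup>2) = liminf (\<lambda>j. ennreal ((norm (s n x - s (r j) x))\<^sup>2))"
        using lim
      proof eventually_elim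
        case (elim x)
        have "(\<lambda>j. ennreal ((norm (s n x - s (r j) x))\<^sup>2)) \<longlonglongrightarrow> ennreal ((norm (s n x - u x))\<^sup>2)"
          by (intro tendsto_intros elim)
        then show ?case by (rule lim_imp_Liminf[symmetric, rotated]) simp
      qed
    qed
    also have "\<dots> \<le> liminf (\<lambda>j. \<integral>\<^sup>+x. ennreal ((norm (s n x - s (r j) x))\<^sup>2) \<partial>M)"
      by (rule nn_integral_liminf) measurable
    also have "\<dots> \<le> ennreal ((1/4) ^ k)"
    proof (rule Liminf_le)
      have "(\<integral>\<^sup>+x. ennreal ((norm (s n x - s (r j) x))\<^sup>2) \<partial>M) \<le> ennreal ((1/4) ^ k)" if "j \<ge> k" for j
      proof -
        have "(\<integral>\<^sup>+x. ennreal ((norm (s n x - s (r j) x))\<^sup>2) \<partial>M) = ennreal (q n (r j))"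
          unfolding q_def
          by (rule nn_integral_eq_integral) (auto intro!: L2_integrable_square L2_diff s)
        also have "\<dots> \<le> ennreal ((1/4) ^ k)"
          using r(2)[OF n, of "r j"] strict_mono_less_eq[OF r(1), of k j] that by (simp add: ennreal_leI)
        finally show ?thesis .
      qed
      then show "\<forall>\<^sub>F j in sequentially. (\<integral>\<^sup>+x. ennreal ((norm (s n x - s (r j) x))\<^sup>2) \<partial>M) \<le> ennreal ((1/4) ^ k)"
        by (auto simp: eventually_sequentially)
    qed simp
    finally show ?thesis .
  qed
  have su: "(\<lambda>x. s n x - u x) \<in> L2 M" if "n \<ge> r 0" for n
  proof -
    have "(\<integral>\<^sup>+x. ennreal ((norm (s n x - u x))\<^sup>2) \<partial>M) < \<infinity>"
      using fatou[OF that] by (simp add: order_le_less_trans)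
    then have "integrable M (\<lambda>x. (norm (s n x - u x))\<^sup>2)"
      by (intro integrableI_nonneg) auto
    then show ?thesis by (auto simp: L2_def)
  qed
  have u: "u \<in> L2 M" using L2_diff[OF s su[OF order_refl], of "r 0"] by simp
  have "(\<lambda>n. \<integral>x. (norm (s n x - u x))\<^sup>2 \<partial>M) \<longlonglongrightarrow> 0"
  proof (rule LIMSEQ_I)
    fix \<epsilon> :: real assume "\<epsilon> > 0"
    then obtain k where k: "(1/4) ^ k < \<epsilon>" using real_arch_pow_inv[of \<epsilon> "1/4"] by auto
    have "norm ((\<integral>x. (norm (s n x - u x))\<^sup>2 \<partial>M) - 0) < \<epsilon>" if "n \<ge> r k" for n
    proof -
      have i: "integrable M (\<lambda>x. (norm (s n x - u x))\<^sup>2)"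
        by (intro L2_integrable_square L2_diff s u)
      have "ennreal (\<integral>x. (norm (s n x - u x))\<^sup>2 \<partial>M) \<le> ennreal ((1/4) ^ k)"
        using fatou[OF that] nn_integral_eq_integral[OF i] by simp
      then have "(\<integral>x. (norm (s n x - u x))\<^sup>2 \<partial>M) \<le> (1/4) ^ k" by (subst (asm) ennreal_le_iff) simp_all
      then show ?thesis using k by (simp add: Bochner_Integration.integral_nonneg)
    qed
    then show "\<exists>N. \<forall>n\<ge>N. norm ((\<integral>x. (norm (s n x - u x))\<^sup>2 \<partial>M) - 0) < \<epsilon>" by blast
  qed
  with u show ?thesis by blast
qed

section \<open>Smooth functions on the plane\<close>

text \<open>The coinductive form asks for one derivative that is again smooth, so smoothness is
  proved by placing a function in a family closed under differentiation.\<close>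

coinductive smooth_real :: "(real \<Rightarrow> real) \<Rightarrow> bool" where
  "\<lbrakk>\<And>t. (\<phi> has_real_derivative \<phi>' t) (at t); smooth_real \<phi>'\<rbrakk> \<Longrightarrow> smooth_real \<phi>"

lemma smooth_real_trig: "smooth_real (\<lambda>t. c * sin t + d * cos t)"
proof (coinduction arbitrary: c d)
  case smooth_real
  have "((\<lambda>t. c * sin t + d * cos t) has_real_derivative - d * sin t + c * cos t) (at t)" for t
    by (auto intro!: derivative_eq_intros)
  then show ?case
    by (intro exI[of _ "\<lambda>t. c * sin t + d * cos t"] exI[of _ "\<lambda>t. - d * sin t + c * cos t"] conjI allI disjI1
        exI[of _ "- d"] exI[of _ c]) simp_all
qed

lemma smooth_real_sin: "smooth_real sin" and smooth_real_cos: "smooth_real cos"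
  using smooth_real_trig[of 1 0] smooth_real_trig[of 0 1] by simp_all

text \<open>The limit 1 at infinity matters as much as the flatness at 0:
  \<open>plateau (n t)\<close> tends to the indicator of \<open>t > 0\<close>, which serves for
  cutoffs and for approximating indicators, and products of two such factors are bumps.\<close>

definition plateau :: "real \<Rightarrow> real" where
  "plateau t = (if 0 < t then exp (- 1 / t) else 0)"

text \<open>The functions \<open>p(1/t) exp(-1/t)\<close> with \<open>p\<close> a polynomial form a
  family closed under differentiation, \<open>p\<close> being replaced by
  \<open>X^2 (p - p')\<close>; each extends by 0 because the exponential beats every
  polynomial.\<close>

lemma smooth_real_plateau: "smooth_real plateau"
proof -
  define g :: "real poly \<Rightarrow> real \<Rightarrow> real"
    where "g p t = (if 0 < t then poly p (1 / t) * exp (- 1 / t) else 0)" for p t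
  have lim0: "((\<lambda>t. poly p (1 / t) * exp (- 1 / t)) \<longlongrightarrow> 0) (at_right 0)" for p :: "real poly"
  proof (induction p)
    case (pCons c p)
    have *: "((\<lambda>t. poly q (1 / t) * exp (- 1 / t)) \<longlongrightarrow> 0) (at_right 0)
       \<longleftrightarrow> ((\<lambda>t. poly q t * exp (- t)) \<longlongrightarrow> 0) at_top" for q :: "real poly"
      unfolding filterlim_at_right_to_top by (simp add: inverse_eq_divide)
    show ?case unfolding *
    proof -
      have "((\<lambda>t. \<Sum>i\<le>degree (pCons c p). coeff (pCons c p) i * (t ^ i * exp (- t))) \<longlongrightarrow> (\<Sum>i\<le>degree (pCons c p). coeff (pCons c p) i * 0)) at_top"
      proof (intro tendsto_intros)
        show "((\<lambda>t::real. t ^ i * exp (- t)) \<longlongrightarrow> 0) at_top" for i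
          using tendsto_power_div_exp_0[of i] by (simp add: exp_minus field_simps)
      qed
      then show "((\<lambda>t. poly (pCons c p) t * exp (- t)) \<longlongrightarrow> 0) at_top"
        by (simp only: poly_altdef sum_distrib_right mult.assoc mult_zero_right sum.neutral_const)
    qed
  qed simp
  have deriv: "(g p has_real_derivative g ([:0, 0, 1:] * (p - pderiv p)) t) (at t)" for p t
  proof (cases t "0 :: real" rule: linorder_cases)
    case less
    have "((\<lambda>t. 0) has_real_derivative 0) (at t)" by simp
    moreover have "\<forall>\<^sub>F x in nhds t. 0 = g p x"
      using eventually_nhds_in_open[of "{..<0}" t] less by (auto elim!: eventually_mono simp: g_def)
    ultimately have "(g p has_real_derivative 0) (at t)"
      by (subst DERIV_cong_ev[OF refl _ refl, of _ "\<lambda>_. 0"]) (auto elim: eventually_mono)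
    then show ?thesis using less by (simp add: g_def)
  next
    case equal
    \<comment> \<open>The difference quotient at 0 is the member of the family with \<open>p\<close>
      multiplied by \<open>X\<close>, so \<open>lim0\<close> covers it.\<close>
    have "((\<lambda>h. g p h / h) \<longlongrightarrow> 0) (at 0)"
    proof (subst filterlim_at_split, intro conjI)
      show "((\<lambda>h. g p h / h) \<longlongrightarrow> 0) (at_left 0)"
        by (rule tendsto_eventually) (auto simp: eventually_at_filter g_def)
      have "((\<lambda>t. poly (pCons 0 p) (1 / t) * exp (- 1 / t)) \<longlongrightarrow> 0) (at_right 0)" by (rule lim0)
      moreover have "\<forall>\<^sub>F t in at_right 0. poly (pCons 0 p) (1 / t) * exp (- 1 / t) = g p t / t"
        by (auto simp: eventually_at_filter g_def)
      ultimately show "((\<lambda>h. g p h / h) \<longlongrightarrow> 0) (at_right 0)"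
        by (rule Lim_transform_eventually)
    qed
    then show ?thesis using equal by (simp add: DERIV_def g_def)
  next
    case greater
    have "((\<lambda>t. poly p (1 / t) * exp (- 1 / t)) has_real_derivative
        poly ([:0, 0, 1:] * (p - pderiv p)) (1 / t) * exp (- 1 / t)) (at t)"
      using greater
      by (auto intro!: derivative_eq_intros simp: power2_eq_square field_simps)
    moreover have "\<forall>\<^sub>F x in nhds t. poly p (1 / x) * exp (- 1 / x) = g p x"
      using eventually_nhds_in_open[of "{0<..}" t] greater by (auto elim!: eventually_mono simp: g_def)
    ultimately have "(g p has_real_derivative poly ([:0, 0, 1:] * (p - pderiv p)) (1 / t) * exp (- 1 / t)) (at t)"
      by (subst (asm) DERIV_cong_ev[OF refl _ refl]) auto
    then show ?thesis using greater by (simp add: g_def)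
  qed
  have "smooth_real (g p)" for p
    by (coinduction arbitrary: p) (use deriv in blast)
  from this[of 1] show ?thesis unfolding g_def plateau_def[abs_def] by (simp cong: if_cong)
qed

text \<open>A class of smooth functions on the plane that is visibly closed under partial derivatives.\<close>
inductive_set planar :: "(real \<times> real \<Rightarrow> real) set" where
  const: "(\<lambda>z. c) \<in> planar"
| fst: "fst \<in> planar"
| snd: "snd \<in> planar"
| add: "F \<in> planar \<Longrightarrow> G \<in> planar \<Longrightarrow> (\<lambda>z. F z + G z) \<in> planar"
| mult: "F \<in> planar \<Longrightarrow> G \<in> planar \<Longrightarrow> (\<lambda>z. F z * G z) \<in> planar"
| comp: "smooth_real \<phi> \<Longrightarrow> F \<in> planar \<Longrightarrow> (\<lambda>z. \<phi> (F z)) \<in> planar"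
| cut: "F \<in> planar \<Longrightarrow> open A \<Longrightarrow> closed C \<Longrightarrow> C \<subseteq> A \<Longrightarrow> (\<And>z. z \<in> A - C \<Longrightarrow> F z = 0) \<Longrightarrow>
    (\<lambda>z. if z \<in> A then F z else 0) \<in> planar"

definition pd :: "real \<times> real \<Rightarrow> (real \<times> real \<Rightarrow> real) \<Rightarrow> real \<times> real \<Rightarrow> real" where
  "pd v F z = deriv (\<lambda>t. F (z + t *\<^sub>R v)) 0"

lemma pd_eq:
  assumes "(F has_derivative L) (at z)" shows "pd v F z = L v"
proof -
  have "((\<lambda>t. F (z + t *\<^sub>R v)) has_derivative (\<lambda>t. L (t *\<^sub>R v))) (at 0)"
    by (rule has_derivative_compose[of "\<lambda>t. z + t *\<^sub>R v" "\<lambda>t. t *\<^sub>R v" 0 UNIV F L, simplified])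
       (use assms in \<open>auto intro!: derivative_eq_intros\<close>)
  moreover have "(\<lambda>t. L (t *\<^sub>R v)) = (\<lambda>t. t * L v)"
    using linear_cmul[OF has_derivative_linear[OF assms]] by auto
  ultimately have "((\<lambda>t. F (z + t *\<^sub>R v)) has_real_derivative L v) (at 0)"
    unfolding has_field_derivative_def by (simp only: mult.commute[of _ "L v"])
  then show ?thesis by (simp add: pd_def DERIV_imp_deriv)
qed

definition has_partials :: "(real \<times> real \<Rightarrow> real) \<Rightarrow> (real \<times> real \<Rightarrow> real) \<Rightarrow> (real \<times> real \<Rightarrow> real) \<Rightarrow> bool" where
  "has_partials F Fx Fy \<longleftrightarrow> Fx \<in> planar \<and> Fy \<in> planar \<and>
     (\<forall>z. (F has_derivative (\<lambda>v. fst v * Fx z + snd v * Fy z)) (at z))"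

lemma has_partialsD:
  assumes "has_partials F Fx Fy"
  shows "(F has_derivative (\<lambda>v. fst v * Fx z + snd v * Fy z)) (at z)" "Fx \<in> planar" "Fy \<in> planar"
  using assms unfolding has_partials_def by blast+

text \<open>Induction along the rules, where \<open>cut\<close> is the case with content. There
  \<open>F\<close> vanishes on the open set \<open>A - C\<close>, hence so do its partials, and
  cutting a partial derivative is again an instance of the rule. A point off \<open>A\<close> lies
  off the closed set \<open>C\<close>, so the extension is zero near it.\<close>

lemma planar_partials: "F \<in> planar \<Longrightarrow> \<exists>Fx Fy. has_partials F Fx Fy"
proof (induction rule: planar.induct)
  case (const c)
  have "has_partials (\<lambda>z. c) (\<lambda>z. 0) (\<lambda>z. 0)"
    by (simp add: has_partials_def planar.const)
  then show ?case by blast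
next
  case fst
  have "has_partials fst (\<lambda>z. 1) (\<lambda>z. 0)"
    unfolding has_partials_def
    by (intro conjI allI planar.const) (simp add: has_derivative_fst[OF has_derivative_ident])
  then show ?case by blast
next
  case snd
  have "has_partials snd (\<lambda>z. 0) (\<lambda>z. 1)"
    unfolding has_partials_def
    by (intro conjI allI planar.const) (simp add: has_derivative_snd[OF has_derivative_ident])
  then show ?case by blast
next
  case (add F G)
  then obtain Fx Fy Gx Gy where F: "has_partials F Fx Fy" and G: "has_partials G Gx Gy" by auto
  have "((\<lambda>z. F z + G z) has_derivative (\<lambda>v. fst v * (Fx z + Gx z) + snd v * (Fy z + Gy z))) (at z)" for z
    by (rule has_derivative_eq_rhs[OF has_derivative_add[OF has_partialsD(1)[OF F] has_partialsD(1)[OF G]]])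
       (simp add: fun_eq_iff algebra_simps)
  then have "has_partials (\<lambda>z. F z + G z) (\<lambda>z. Fx z + Gx z) (\<lambda>z. Fy z + Gy z)"
    using has_partialsD(2,3)[OF F] has_partialsD(2,3)[OF G] by (simp add: has_partials_def planar.add)
  then show ?case by blast
next
  case (mult F G)
  then obtain Fx Fy Gx Gy where F: "has_partials F Fx Fy" and G: "has_partials G Gx Gy" by auto
  have "((\<lambda>z. F z * G z) has_derivative
      (\<lambda>v. fst v * (F z * Gx z + Fx z * G z) + snd v * (F z * Gy z + Fy z * G z))) (at z)" for z
    by (rule has_derivative_eq_rhs[OF has_derivative_mult[OF has_partialsD(1)[OF F] has_partialsD(1)[OF G]]])
       (simp add: fun_eq_iff algebra_simps)
  then have "has_partials (\<lambda>z. F z * G z) (\<lambda>z. F z * Gx z + Fx z * G z) (\<lambda>z. F z * Gy z + Fy z * G z)"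
    using has_partialsD(2,3)[OF F] has_partialsD(2,3)[OF G] mult.hyps
    by (simp add: has_partials_def planar.add planar.mult)
  then show ?case by blast
next
  case (comp \<phi> F)
  then obtain Fx Fy where F: "has_partials F Fx Fy" by auto
  from comp.hyps(1) obtain \<phi>' where \<phi>': "\<And>t. (\<phi> has_real_derivative \<phi>' t) (at t)" "smooth_real \<phi>'"
    by cases auto
  have "((\<lambda>z. \<phi> (F z)) has_derivative (\<lambda>v. fst v * (\<phi>' (F z) * Fx z) + snd v * (\<phi>' (F z) * Fy z))) (at z)" for z
    by (rule has_derivative_eq_rhs[OF has_derivative_compose[OF has_partialsD(1)[OF F] \<phi>'(1)[unfolded has_field_derivative_def]]])
       (simp add: fun_eq_iff algebra_simps)
  then have "has_partials (\<lambda>z. \<phi> (F z)) (\<lambda>z. \<phi>' (F z) * Fx z) (\<lambda>z. \<phi>' (F z) * Fy z)"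
    using has_partialsD(2,3)[OF F] planar.comp[OF \<phi>'(2) comp.hyps(2)]
    by (simp add: has_partials_def planar.mult)
  then show ?case by blast
next
  case (cut F A C)
  then obtain Fx Fy where F: "has_partials F Fx Fy" by auto
  have zero: "Fx z = 0 \<and> Fy z = 0" if z: "z \<in> A - C" for z
  proof -
    have "\<forall>\<^sub>F w in nhds z. w \<in> A - C"
      using z cut.hyps by (intro eventually_nhds_in_open open_Diff) auto
    then have ev: "\<forall>\<^sub>F w in nhds z. 0 = F w" by eventually_elim (use cut.hyps in auto)
    have "(F has_derivative (\<lambda>_. 0)) (at z)"
      by (rule has_derivative_transform_eventually[OF has_derivative_const[of 0]])
         (use ev eventually_nhds_x_imp_x[OF ev] in \<open>auto simp: eventually_at_filter elim: eventually_mono\<close>)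
    then have "(\<lambda>v. fst v * Fx z + snd v * Fy z) = (\<lambda>_. 0)"
      using has_derivative_unique[OF has_partialsD(1)[OF F]] by blast
    from fun_cong[OF this, of "(1, 0)"] fun_cong[OF this, of "(0, 1)"] show ?thesis by simp
  qed
  have "((\<lambda>z. if z \<in> A then F z else 0) has_derivative
      (\<lambda>v. fst v * (if z \<in> A then Fx z else 0) + snd v * (if z \<in> A then Fy z else 0))) (at z)" for z
  proof (cases "z \<in> A")
    case True
    have "\<forall>\<^sub>F w in nhds z. w \<in> A" using True cut.hyps by (intro eventually_nhds_in_open)
    then have ev: "\<forall>\<^sub>F w in nhds z. F w = (if w \<in> A then F w else 0)" by eventually_elim simp
    have "((\<lambda>z. if z \<in> A then F z else 0) has_derivative (\<lambda>v. fst v * Fx z + snd v * Fy z)) (at z)"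
      by (rule has_derivative_transform_eventually[OF has_partialsD(1)[OF F]])
         (use ev True in \<open>auto simp: eventually_at_filter elim: eventually_mono\<close>)
    then show ?thesis using True by simp
  next
    case False
    have "\<forall>\<^sub>F w in nhds z. w \<in> - C" using False cut.hyps by (intro eventually_nhds_in_open) auto
    then have ev: "\<forall>\<^sub>F w in nhds z. 0 = (if w \<in> A then F w else 0)"
      by eventually_elim (use cut.hyps in auto)
    have "((\<lambda>z. if z \<in> A then F z else 0) has_derivative (\<lambda>_. 0)) (at z)"
      by (rule has_derivative_transform_eventually[OF has_derivative_const[of 0]])
         (use ev False in \<open>auto simp: eventually_at_filter elim: eventually_mono\<close>)
    then show ?thesis using False by simp
  qed
  moreover have "(\<lambda>z. if z \<in> A then Fx z else 0) \<in> planar"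
    by (rule planar.cut[OF has_partialsD(2)[OF F] cut.hyps(2-4)]) (use zero in auto)
  moreover have "(\<lambda>z. if z \<in> A then Fy z else 0) \<in> planar"
    by (rule planar.cut[OF has_partialsD(3)[OF F] cut.hyps(2-4)]) (use zero in auto)
  ultimately have "has_partials (\<lambda>z. if z \<in> A then F z else 0)
      (\<lambda>z. if z \<in> A then Fx z else 0) (\<lambda>z. if z \<in> A then Fy z else 0)"
    unfolding has_partials_def by blast
  then show ?case by blast
qed

lemma planar_has_derivative:
  assumes "F \<in> planar"
  shows "(F has_derivative (\<lambda>v. fst v * pd (1, 0) F z + snd v * pd (0, 1) F z)) (at z)"
proof -
  obtain Fx Fy where "has_partials F Fx Fy"
    using planar_partials[OF assms] by auto
  note F = has_partialsD(1)[OF this]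
  show ?thesis using F[of z] pd_eq[OF F, of "(1, 0)" z] pd_eq[OF F, of "(0, 1)" z] by simp
qed

lemma pd_planar_vec: "F \<in> planar \<Longrightarrow> pd v F z = fst v * pd (1, 0) F z + snd v * pd (0, 1) F z"
  by (rule pd_eq[OF planar_has_derivative])

lemma planar_pd: assumes "F \<in> planar" shows "pd v F \<in> planar"
proof -
  obtain Fx Fy where F: "has_partials F Fx Fy"
    using planar_partials[OF assms] by auto
  note * = has_partialsD(2,3)[OF F] and F = has_partialsD(1)[OF F]
  have "pd v F = (\<lambda>z. fst v * Fx z + snd v * Fy z)"
    using pd_eq[OF F] by (intro ext)
  then show ?thesis using * by (auto intro!: planar.add planar.mult planar.const)
qed

lemma planar_continuous: "F \<in> planar \<Longrightarrow> continuous_on A F"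
  by (meson continuous_at_imp_continuous_on has_derivative_continuous planar_has_derivative)

lemma planar_measurable [measurable]: "F \<in> planar \<Longrightarrow> F \<in> borel_measurable borel"
  by (intro borel_measurable_continuous_onI planar_continuous)

lemma planar_cmult: "F \<in> planar \<Longrightarrow> (\<lambda>z. c * F z) \<in> planar"
  by (intro planar.mult planar.const)

lemma planar_minus: "F \<in> planar \<Longrightarrow> (\<lambda>z. - F z) \<in> planar"
  using planar_cmult[of F "- 1"] by simp

lemma planar_diff: "F \<in> planar \<Longrightarrow> G \<in> planar \<Longrightarrow> (\<lambda>z. F z - G z) \<in> planar"
  using planar.add[OF _ planar_minus] by simp

lemma planar_power: "F \<in> planar \<Longrightarrow> (\<lambda>z. F z ^ n) \<in> planar"
  by (induction n) (auto intro: planar.const planar.mult)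

lemma planar_sum: "(\<And>i. i \<in> I \<Longrightarrow> F i \<in> planar) \<Longrightarrow> (\<lambda>z. \<Sum>i\<in>I. F i z) \<in> planar"
  by (induction I rule: infinite_finite_induct) (auto intro: planar.const planar.add)

lemmas planar_intros = planar.const planar.fst planar.snd planar.add planar.mult planar_cmult planar_minus planar_diff planar_power planar_sum
  planar.comp[OF smooth_real_sin] planar.comp[OF smooth_real_cos] planar.comp[OF smooth_real_plateau]

lemma planar_dilation: "F \<in> planar \<Longrightarrow> (\<lambda>z. F (c *\<^sub>R z + d)) \<in> planar"
proof (induction rule: planar.induct)
  case (comp \<phi> F)
  show ?case by (rule planar.comp[OF comp(1,3)])
next
  case fst
  have "(\<lambda>z. c * fst z + fst d) \<in> planar" by (intro planar_intros)
  then show ?case by simp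
next
  case snd
  have "(\<lambda>z. c * snd z + snd d) \<in> planar" by (intro planar_intros)
  then show ?case by simp
next
  case (cut F A C)
  define T where "T z = c *\<^sub>R z + d" for z :: "real \<times> real"
  have T: "continuous_on UNIV T" unfolding T_def by (intro continuous_intros)
  have "(\<lambda>z. if z \<in> T -` A then F (T z) else 0) \<in> planar"
  proof (rule planar.cut)
    show "(\<lambda>z. F (T z)) \<in> planar" unfolding T_def by (rule cut.IH)
    show "open (T -` A)" by (rule open_vimage[OF cut.hyps(2) T])
    show "closed (T -` C)" by (rule closed_vimage[OF cut.hyps(3) T])
  qed (use cut.hyps in auto)
  then show ?case unfolding T_def vimage_def mem_Collect_eq .
qed (simp_all add: planar.const planar.add planar.mult)

lemma pd_add: "F \<in> planar \<Longrightarrow> G \<in> planar \<Longrightarrow> pd v (\<lambda>z. F z + G z) z = pd v F z + pd v G z"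
  by (subst pd_eq[OF has_derivative_add[OF planar_has_derivative planar_has_derivative]])
     (simp_all add: pd_planar_vec[of _ v])

lemma pd_mult: "F \<in> planar \<Longrightarrow> G \<in> planar \<Longrightarrow> pd v (\<lambda>z. F z * G z) z = F z * pd v G z + pd v F z * G z"
  by (subst pd_eq[OF has_derivative_mult[OF planar_has_derivative planar_has_derivative]])
     (simp_all add: pd_planar_vec[of _ v])

lemma pd_comp:
  assumes "F \<in> planar" "(\<phi> has_real_derivative d) (at (F z))"
  shows "pd v (\<lambda>z. \<phi> (F z)) z = d * pd v F z"
  by (subst pd_eq[OF has_derivative_compose[OF planar_has_derivative[OF assms(1)] assms(2)[unfolded has_field_derivative_def]]])
     (simp_all add: pd_planar_vec[OF assms(1), of v])

text \<open>Any compact set carrying \<open>F\<close> is accepted, instead of the closure of the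
  nonzero set, so that sums, products and dilations can exhibit one directly.\<close>

definition test_planar :: "(real \<times> real) set \<Rightarrow> (real \<times> real \<Rightarrow> real) set" where
  "test_planar D = {F \<in> planar. \<exists>K. compact K \<and> K \<subseteq> D \<and> (\<forall>z. z \<notin> K \<longrightarrow> F z = 0)}"

lemma pd_zero_off_closed:
  assumes "closed K" "\<And>z. z \<notin> K \<Longrightarrow> F z = 0" "z \<notin> K" shows "pd v F z = 0"
proof -
  have "\<forall>\<^sub>F w in nhds z. w \<in> - K"
    using assms by (intro eventually_nhds_in_open) auto
  then have ev: "\<forall>\<^sub>F w in nhds z. F w = 0" by eventually_elim (use assms in auto)
  have "(F has_derivative (\<lambda>_. 0)) (at z)"
    by (rule has_derivative_transform_eventually[OF has_derivative_const[of 0]])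
       (use ev assms in \<open>auto simp: eventually_at_filter elim: eventually_mono\<close>)
  then show ?thesis by (simp add: pd_eq)
qed

lemma test_planar_pd: "F \<in> test_planar D \<Longrightarrow> pd v F \<in> test_planar D"
proof -
  assume "F \<in> test_planar D"
  then obtain K where K: "F \<in> planar" "compact K" "K \<subseteq> D" "\<And>z. z \<notin> K \<Longrightarrow> F z = 0"
    unfolding test_planar_def by auto
  from K(1) have "pd v F \<in> planar" by (rule planar_pd)
  moreover have "pd v F z = 0" if "z \<notin> K" for z
    by (rule pd_zero_off_closed[OF compact_imp_closed[OF K(2)] K(4) that])
  ultimately show ?thesis using K(2,3) unfolding test_planar_def by auto
qed

lemma test_planar_mult:
  assumes "F \<in> planar" "G \<in> test_planar D" shows "(\<lambda>z. F z * G z) \<in> test_planar D"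
proof -
  obtain K where K: "G \<in> planar" "compact K" "K \<subseteq> D" "\<And>z. z \<notin> K \<Longrightarrow> G z = 0"
    using assms(2) unfolding test_planar_def by auto
  have "(\<lambda>z. F z * G z) \<in> planar" by (intro planar.mult assms(1) K(1))
  moreover have "F z * G z = 0" if "z \<notin> K" for z using K(4)[OF that] by simp
  ultimately show ?thesis using K(2,3) unfolding test_planar_def by auto
qed

lemma test_planar_mono: "D \<subseteq> D' \<Longrightarrow> test_planar D \<subseteq> test_planar D'"
  unfolding test_planar_def by auto

section \<open>Calculus on the torus\<close>

lemma translate_abs [simp]: "abs_torus z \<oplus> v = abs_torus (z + v)"
  by (rule translate.abs_eq)

definition frac2 :: "real \<times> real \<Rightarrow> real \<times> real" where
  "frac2 z = (frac (fst z), frac (snd z))"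

text \<open>\<open>rep_torus\<close> picks an arbitrary representative; reducing it modulo 1 gives
  the one in the half-open unit square, so that \<open>rep (abs_torus z)\<close> can be
  computed.\<close>

definition rep :: "torus \<Rightarrow> real \<times> real" where
  "rep p = frac2 (rep_torus p)"

lemma abs_torus_eq_iff: "abs_torus x = abs_torus y \<longleftrightarrow> lattice_equiv x y"
  by (rule torus.abs_eq_iff)

lemma frac_cong: "x - y \<in> \<int> \<Longrightarrow> frac x = frac (y :: real)"
  using frac_add_int_right[of "x - y" y] by simp

lemma rep_abs [simp]: "rep (abs_torus z) = frac2 z"
proof -
  have "abs_torus (rep_torus (abs_torus z)) = abs_torus z"
    using Quotient3_abs_rep[OF Quotient3_torus] by simp
  then have "lattice_equiv (rep_torus (abs_torus z)) z" by (simp add: abs_torus_eq_iff)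
  then show ?thesis by (auto simp: rep_def frac2_def lattice_equiv_def intro: frac_cong)
qed

lemma abs_frac2 [simp]: "abs_torus (frac2 z) = abs_torus z"
  unfolding abs_torus_eq_iff lattice_equiv_def by (simp add: frac2_def frac_def)

lemma abs_rep [simp]: "abs_torus (rep p) = p"
  unfolding rep_def abs_frac2 using Quotient3_abs_rep[OF Quotient3_torus] by simp

lemma torus_cases: obtains z where "p = abs_torus z" "frac2 z = z"
proof
  show "p = abs_torus (rep p)" by simp
  show "frac2 (rep p) = rep p" by (simp add: rep_def frac2_def frac_def)
qed

lemma frac2_ident: "z \<in> {0..<1} \<times> {0..<1} \<Longrightarrow> frac2 z = z"
  by (cases z) (simp add: frac2_def frac_eq)

lemma frac2_in: "frac2 z \<in> {0..<1} \<times> {0..<1}"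
  by (simp add: frac2_def frac_lt_1)

lemma open_torus_iff: "open (U :: torus set) \<longleftrightarrow> open (abs_torus -` U)"
  by (simp add: open_torus_def)

lemma continuous_on_abs_torus: "continuous_on A abs_torus"
  by (rule continuous_on_subset[of UNIV]) (auto simp: continuous_on_open_vimage open_torus_iff)

lemma abs_torus_measurable [measurable]: "abs_torus \<in> borel_measurable borel"
  by (rule borel_measurable_continuous_onI[OF continuous_on_abs_torus])

lemma continuous_on_torus_iff:
  fixes f :: "torus \<Rightarrow> 'a::topological_space"
  shows "continuous_on UNIV f \<longleftrightarrow> continuous_on UNIV (\<lambda>z. f (abs_torus z))"
  by (simp add: continuous_on_open_vimage open_torus_iff vimage_def)

lemma dir_deriv_abs: "dir_deriv v f (abs_torus z) = pd v (\<lambda>z. f (abs_torus z)) z"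
  by (simp add: dir_deriv_def pd_def)

lemma has_derivative_shift0:
  assumes "(g has_derivative L) (at (z :: 'a::real_normed_vector))"
  shows "((\<lambda>v. g (z + v)) has_derivative L) (at 0)"
proof -
  have "((\<lambda>v. z + v) has_derivative (\<lambda>v. v)) (at 0)" by (auto intro!: derivative_eq_intros)
  from has_derivative_compose[OF this, of g L] show ?thesis using assms by simp
qed

text \<open>\<open>smooth\<close> speaks about all iterated derivatives; on lifts to the plane these
  remain in the class \<open>planar\<close>, all of whose members are differentiable.\<close>

lemma smooth_planar:
  assumes "(\<lambda>z. f (abs_torus z)) \<in> planar" shows "smooth f"
proof -
  have *: "(\<lambda>z. foldr dir_deriv bs f (abs_torus z)) \<in> planar" for bs
  proof (induction bs)
    case (Cons b bs)
    have "(\<lambda>z. foldr dir_deriv (b # bs) f (abs_torus z)) = pd b (\<lambda>z. foldr dir_deriv bs f (abs_torus z))"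
      by (simp add: dir_deriv_abs fun_eq_iff)
    then show ?case using planar_pd[OF Cons] by simp
  qed (simp add: assms)
  show ?thesis unfolding smooth_def
  proof (intro ballI allI)
    fix bs p
    obtain z where z: "p = abs_torus z" using torus_cases by blast
    show "(\<lambda>v. foldr dir_deriv bs f (p \<oplus> v)) differentiable at 0"
      unfolding z translate_abs
      unfolding differentiable_def
      by (rule exI, rule has_derivative_shift0, rule planar_has_derivative[OF *])
  qed
qed

lemma smooth_continuous:
  assumes "smooth f" "set bs \<subseteq> Basis"
  shows "continuous_on UNIV (foldr dir_deriv bs f)"
  unfolding continuous_on_torus_iff continuous_on_eq_continuous_at[OF open_UNIV]
proof
  fix z
  have "(\<lambda>v. foldr dir_deriv bs f (abs_torus z \<oplus> v)) differentiable at 0"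
    using assms unfolding smooth_def in_lists_conv_set by blast
  then have "isCont (\<lambda>v. foldr dir_deriv bs f (abs_torus (z + v))) 0"
    by (intro differentiable_imp_continuous_within) simp
  then show "isCont (\<lambda>z. foldr dir_deriv bs f (abs_torus z)) z"
    unfolding isCont_def by (intro LIM_offset_zero_cancel[of _ z]) simp_all
qed

lemma smooth_pd:
  assumes "smooth f" "b \<in> Basis"
  shows "((\<lambda>t. f (abs_torus (z + t *\<^sub>R b))) has_real_derivative dir_deriv b f (abs_torus z)) (at 0)"
proof -
  have "(\<lambda>v. f (abs_torus z \<oplus> v)) differentiable at 0"
    using assms(1) unfolding smooth_def by (metis foldr.simps(1) id_apply lists.Nil)
  then obtain L where "((\<lambda>v. f (abs_torus (z + v))) has_derivative L) (at 0)"
    by (auto simp: differentiable_def)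
  then have "((\<lambda>v. f (abs_torus (z + v))) has_derivative L) (at (0 *\<^sub>R b))" by simp
  moreover have "((\<lambda>t. t *\<^sub>R b) has_derivative (\<lambda>t. t *\<^sub>R b)) (at 0)"
    by (auto intro!: derivative_eq_intros)
  ultimately have "((\<lambda>t. f (abs_torus (z + t *\<^sub>R b))) has_derivative (\<lambda>t. L (t *\<^sub>R b))) (at 0)"
    by (rule has_derivative_compose[rotated])
  then have "(\<lambda>t. f (abs_torus (z + t *\<^sub>R b))) differentiable at 0" by (auto simp: differentiable_def)
  then show ?thesis unfolding dir_deriv_def translate_abs
    by (metis DERIV_deriv_iff_real_differentiable)
qed

section \<open>Transplanting compactly supported functions from the open square to the torus\<close>

abbreviation unit_square :: "(real \<times> real) set" where
  "unit_square \<equiv> {0<..<1} \<times> {0<..<1}"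

text \<open>\<open>rep\<close> jumps across the edges of the square, so a lift is smooth only for
  functions that vanish near the edges.\<close>

definition lift :: "(real \<times> real \<Rightarrow> real) \<Rightarrow> torus \<Rightarrow> real" where
  "lift F p = F (rep p)"

lemma frac_locally:
  fixes x :: real
  assumes "0 < frac x"
  shows "\<forall>\<^sub>F y in nhds x. frac y = y - of_int \<lfloor>x\<rfloor>"
proof -
  have "\<forall>\<^sub>F y in nhds x. y \<in> {of_int \<lfloor>x\<rfloor> <..< of_int \<lfloor>x\<rfloor> + 1}"
    by (rule eventually_nhds_in_open) (use assms in \<open>auto simp: frac_def\<close>)
  then show ?thesis
  proof eventually_elim
    case (elim y)
    then have "\<lfloor>y\<rfloor> = \<lfloor>x\<rfloor>" by (simp add: floor_eq_iff)
    then show ?case by (simp add: frac_def)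
  qed
qed

lemma frac_near_Ints:
  fixes x \<delta> :: real
  assumes "frac x = 0" "0 < \<delta>" "\<delta> < 1"
  shows "\<forall>\<^sub>F y in nhds x. \<not> (\<delta> \<le> frac y \<and> frac y \<le> 1 - \<delta>)"
proof -
  have "\<forall>\<^sub>F y in nhds x. y \<in> {x - \<delta> <..< x + \<delta>}"
    by (rule eventually_nhds_in_open) (use assms in auto)
  then show ?thesis
  proof eventually_elim
    case (elim y)
    have xI: "x \<in> \<int>" "x - 1 \<in> \<int>" using assms by auto
    show ?case
    proof (cases "x \<le> y")
      case True
      have "frac y = y - x"
        using True elim assms xI by (intro frac_unique_iff[THEN iffD2]) auto
      then show ?thesis using elim by auto
    next
      case False
      have "frac y = y - x + 1"
        using False elim assms xI by (intro frac_unique_iff[THEN iffD2]) auto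
      then show ?thesis using elim by auto
    qed
  qed
qed

lemma frac2_locally:
  assumes "frac2 z \<in> unit_square"
  shows "\<forall>\<^sub>F w in nhds z. frac2 w = w - (of_int \<lfloor>fst z\<rfloor>, of_int \<lfloor>snd z\<rfloor>)"
proof -
  have "\<forall>\<^sub>F w in nhds z. frac (fst w) = fst w - of_int \<lfloor>fst z\<rfloor>"
    using frac_locally[of "fst z"] assms
    by (intro eventually_compose_filterlim[of _ "nhds (fst z)" fst "nhds z"])
       (auto simp: frac2_def intro!: tendsto_intros filterlim_ident)
  moreover have "\<forall>\<^sub>F w in nhds z. frac (snd w) = snd w - of_int \<lfloor>snd z\<rfloor>"
    using frac_locally[of "snd z"] assms
    by (intro eventually_compose_filterlim[of _ "nhds (snd z)" snd "nhds z"])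
       (auto simp: frac2_def intro!: tendsto_intros filterlim_ident)
  ultimately show ?thesis by eventually_elim (simp add: frac2_def prod_eq_iff)
qed

lemma compact_unit_square_margin:
  assumes "compact K" "K \<subseteq> unit_square"
  obtains \<delta> where "0 < \<delta>" "\<delta> < 1" "\<And>z. z \<in> K \<Longrightarrow> \<delta> \<le> fst z \<and> fst z \<le> 1 - \<delta> \<and> \<delta> \<le> snd z \<and> snd z \<le> 1 - \<delta>"
proof (cases "K = {}")
  case True
  then show ?thesis using that[of "1/2"] by simp
next
  case False
  define m where "m z = min (min (fst z) (1 - fst z)) (min (snd z) (1 - snd z))" for z :: "real \<times> real"
  have "continuous_on K m" unfolding m_def by (intro continuous_intros)
  then obtain z0 where z0: "z0 \<in> K" "\<And>z. z \<in> K \<Longrightarrow> m z0 \<le> m z"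
    using continuous_attains_inf[OF assms(1) False] by blast
  have "0 < m z0" "m z0 < 1" using z0(1) assms(2) by (auto simp: m_def min_def)
  moreover have "m z0 \<le> fst z \<and> fst z \<le> 1 - m z0 \<and> m z0 \<le> snd z \<and> snd z \<le> 1 - m z0" if "z \<in> K" for z
    using z0(2)[OF that] by (simp add: m_def[of z])
  ultimately show ?thesis by (rule that)
qed

text \<open>The fractional part jumps at integers, but near them its values are close to 0 or to 1;
  a compact subset of the open square keeps a positive margin from the edges and is therefore missed
  on a whole neighbourhood.\<close>

lemma frac2_boundary:
  assumes K: "compact K" "K \<subseteq> unit_square" and z: "frac2 z \<notin> unit_square"
  shows "\<forall>\<^sub>F w in nhds z. frac2 w \<notin> K"
proof -
  obtain \<delta> where \<delta>: "0 < \<delta>" "\<delta> < 1" "\<And>z. z \<in> K \<Longrightarrow> \<delta> \<le> fst z \<and> fst z \<le> 1 - \<delta> \<and> \<delta> \<le> snd z \<and> snd z \<le> 1 - \<delta>"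
    using compact_unit_square_margin[OF K] by blast
  have "frac (fst z) = 0 \<or> frac (snd z) = 0"
    using z frac_lt_1[of "fst z"] frac_lt_1[of "snd z"] frac_ge_0[of "fst z"] frac_ge_0[of "snd z"]
    by (auto simp: frac2_def)
  then show ?thesis
  proof
    assume "frac (fst z) = 0"
    then have "\<forall>\<^sub>F w in nhds z. \<not> (\<delta> \<le> frac (fst w) \<and> frac (fst w) \<le> 1 - \<delta>)"
      using frac_near_Ints[of "fst z" \<delta>] \<delta>
      by (intro eventually_compose_filterlim[of _ "nhds (fst z)" fst "nhds z"])
         (auto intro!: tendsto_intros filterlim_ident)
    then show ?thesis
      by eventually_elim (use \<delta>(3) in \<open>metis frac2_def fst_conv\<close>)
  next
    assume "frac (snd z) = 0"
    then have "\<forall>\<^sub>F w in nhds z. \<not> (\<delta> \<le> frac (snd w) \<and> frac (snd w) \<le> 1 - \<delta>)"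
      using frac_near_Ints[of "snd z" \<delta>] \<delta>
      by (intro eventually_compose_filterlim[of _ "nhds (snd z)" snd "nhds z"])
         (auto intro!: tendsto_intros filterlim_ident)
    then show ?thesis
      by eventually_elim (use \<delta>(3) in \<open>metis frac2_def snd_conv\<close>)
  qed
qed

lemma frac2_compact_open:
  assumes K: "compact K" "K \<subseteq> unit_square"
  shows "open {z. frac2 z \<notin> K}"
proof (rule open_subopen[THEN iffD2], rule ballI)
  fix z assume z: "z \<in> {z. frac2 z \<notin> K}"
  have "\<forall>\<^sub>F w in nhds z. frac2 w \<notin> K"
  proof (cases "frac2 z \<in> unit_square")
    case True
    define n :: "real \<times> real" where "n = (of_int \<lfloor>fst z\<rfloor>, of_int \<lfloor>snd z\<rfloor>)"
    have loc: "\<forall>\<^sub>F w in nhds z. frac2 w = w - n"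
      using frac2_locally[OF True] by (simp add: n_def)
    then have "frac2 z = z - n" by (rule eventually_nhds_x_imp_x)
    then have "\<forall>\<^sub>F w in nhds (z - n). w \<in> - K"
      using z compact_imp_closed[OF K(1)] by (intro eventually_nhds_in_open) auto
    then have "\<forall>\<^sub>F w in nhds z. w - n \<in> - K"
      by (rule eventually_compose_filterlim) (intro tendsto_intros filterlim_ident)
    with loc show ?thesis by eventually_elim simp
  next
    case False
    then show ?thesis by (rule frac2_boundary[OF K])
  qed
  then show "\<exists>T. open T \<and> z \<in> T \<and> T \<subseteq> {z. frac2 z \<notin> K}"
    by (auto simp: eventually_nhds)
qed

lemma lift_has_derivative:
  assumes F: "F \<in> test_planar unit_square"
  shows "((\<lambda>w. lift F (abs_torus w)) has_derivative
     (\<lambda>v. fst v * pd (1, 0) F (frac2 z) + snd v * pd (0, 1) F (frac2 z))) (at z)"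
proof -
  obtain K where K: "F \<in> planar" "compact K" "K \<subseteq> unit_square" "\<And>z. z \<notin> K \<Longrightarrow> F z = 0"
    using F unfolding test_planar_def by auto
  show ?thesis
  proof (cases "frac2 z \<in> unit_square")
    case True
    define n :: "real \<times> real" where "n = (of_int \<lfloor>fst z\<rfloor>, of_int \<lfloor>snd z\<rfloor>)"
    have loc: "\<forall>\<^sub>F w in nhds z. frac2 w = w - n"
      using frac2_locally[OF True] by (simp add: n_def)
    then have z: "frac2 z = z - n" by (rule eventually_nhds_x_imp_x)
    have "((\<lambda>w. F (w - n)) has_derivative
       (\<lambda>v. fst v * pd (1, 0) F (frac2 z) + snd v * pd (0, 1) F (frac2 z))) (at z)"
      unfolding z
      by (rule has_derivative_compose[of "\<lambda>w. w - n" "\<lambda>v. v" z UNIV F, OF _ planar_has_derivative[OF K(1)]])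
         (auto intro!: derivative_eq_intros)
    then show ?thesis
      by (rule has_derivative_transform_eventually)
         (use loc z in \<open>auto simp: lift_def eventually_at_filter elim: eventually_mono\<close>)
  next
    case False
    have nK: "frac2 z \<notin> K" using False K(3) by auto
    have 0: "pd v F (frac2 z) = 0" for v
      using compact_imp_closed[OF K(2)] K(4) nK by (rule pd_zero_off_closed)
    have "\<forall>\<^sub>F w in nhds z. lift F (abs_torus w) = 0"
      using frac2_boundary[OF K(2,3) False] by eventually_elim (simp add: lift_def K(4))
    moreover from this have "lift F (abs_torus z) = 0" by (rule eventually_nhds_x_imp_x)
    moreover have "((\<lambda>w. 0) has_derivative (\<lambda>v. fst v * pd (1, 0) F (frac2 z) + snd v * pd (0, 1) F (frac2 z))) (at z)"
      by (simp add: 0)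
    ultimately show ?thesis
      by (elim has_derivative_transform_eventually) (auto simp: eventually_at_filter elim: eventually_mono)
  qed
qed

lemma dir_deriv_lift:
  assumes F: "F \<in> test_planar unit_square"
  shows "dir_deriv v (lift F) = lift (pd v F)"
proof
  fix p
  obtain z where z: "p = abs_torus z" using torus_cases by blast
  have "F \<in> planar" using F by (simp add: test_planar_def)
  then show "dir_deriv v (lift F) p = lift (pd v F) p"
    unfolding z dir_deriv_abs pd_eq[OF lift_has_derivative[OF F]]
    by (simp add: lift_def pd_planar_vec[of F v])
qed

lemma smooth_lift:
  assumes "F \<in> test_planar unit_square" shows "smooth (lift F)"
proof -
  have *: "\<exists>G\<in>test_planar unit_square. foldr dir_deriv bs (lift F) = lift G" for bs
  proof (induction bs)
    case (Cons b bs)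
    then obtain G where "G \<in> test_planar unit_square" "foldr dir_deriv bs (lift F) = lift G" by blast
    then show ?case by (intro bexI[of _ "pd b G"]) (simp_all add: dir_deriv_lift test_planar_pd)
  qed (use assms in auto)
  show ?thesis unfolding smooth_def
  proof (intro ballI allI)
    fix bs p
    obtain z where z: "p = abs_torus z" using torus_cases by blast
    obtain G where G: "G \<in> test_planar unit_square" "foldr dir_deriv bs (lift F) = lift G" using * by blast
    show "(\<lambda>v. foldr dir_deriv bs (lift F) (p \<oplus> v)) differentiable at 0"
      unfolding z translate_abs G(2)
      unfolding differentiable_def
      by (rule exI, rule has_derivative_shift0, rule lift_has_derivative[OF G(1)])
  qed
qed

section \<open>Weak gradients on planar domains\<close>

lemma torus_bounded:
  fixes f :: "torus \<Rightarrow> 'b::real_normed_vector"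
  assumes "continuous_on UNIV f"
  obtains C where "\<And>p. norm (f p) \<le> C"
proof -
  have "continuous_on (cbox (0, 0) (1, 1)) (\<lambda>z. f (abs_torus z))"
    using assms continuous_on_subset unfolding continuous_on_torus_iff by blast
  then have "bounded ((\<lambda>z. f (abs_torus z)) ` cbox (0, 0) (1, 1))"
    by (intro compact_imp_bounded compact_continuous_image compact_cbox)
  then obtain C where C: "\<And>z. z \<in> cbox (0, 0) (1, 1) \<Longrightarrow> norm (f (abs_torus z)) \<le> C"
    by (auto simp: bounded_iff)
  have "norm (f p) \<le> C" for p
  proof -
    have "rep p \<in> cbox (0, 0) (1, 1)" by (simp add: rep_def frac2_def less_imp_le frac_lt_1)
    from C[OF this] show ?thesis by (simp only: abs_rep)
  qed
  then show ?thesis by (rule that)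
qed

lemma Basis_real_prod: "(Basis :: (real \<times> real) set) = {(1, 0), (0, 1)}"
  by (auto simp: Basis_prod_def)

lemma grad_eq: "grad f p = (dir_deriv (1, 0) f p, dir_deriv (0, 1) f p)"
  by (simp add: grad_def Basis_real_prod)

lemma grad_inner_Basis: "b \<in> Basis \<Longrightarrow> grad f p \<bullet> b = dir_deriv b f p"
  by (auto simp: grad_eq Basis_real_prod)

definition ext :: "(real \<times> real) set \<Rightarrow> (torus \<Rightarrow> 'b::real_vector) \<Rightarrow> real \<times> real \<Rightarrow> 'b" where
  "ext D u z = (if z \<in> D then u (abs_torus z) else 0)"

text \<open>Function and gradient are zero off \<open>D\<close>, so all integrals run over the plane
  and dilations become plain changes of variables. The test functions still have support in
  \<open>D\<close>, so the jump of the extension across the boundary does not enter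
  \<open>G\<close>.\<close>

definition weak_gradient ::
    "(real \<times> real) set \<Rightarrow> (real \<times> real \<Rightarrow> real) \<Rightarrow> (real \<times> real \<Rightarrow> real \<times> real) \<Rightarrow> bool" where
  "weak_gradient D U G \<longleftrightarrow> U \<in> L2 lborel \<and> G \<in> L2 lborel \<and> (\<forall>z. z \<notin> D \<longrightarrow> U z = 0 \<and> G z = 0) \<and>
     (\<forall>F\<in>test_planar D. \<forall>b\<in>Basis. (\<integral>z. U z * pd b F z \<partial>lborel) = - (\<integral>z. (G z \<bullet> b) * F z \<partial>lborel))"

text \<open>Fubini with the innermost integral along lines in direction \<open>b\<close>, where the
  fundamental theorem of calculus applies; differentiability along these lines suffices.\<close>

lemma integral_directional_derivative:
  fixes H Hb :: "real \<times> real \<Rightarrow> real"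
  assumes cont: "continuous_on UNIV Hb" and b: "b \<in> Basis"
    and deriv: "\<And>z. ((\<lambda>t. H (z + t *\<^sub>R b)) has_real_derivative Hb z) (at 0)"
    and zero: "\<And>z. z \<notin> unit_square \<Longrightarrow> H z = 0 \<and> Hb z = 0"
  shows "integral\<^sup>L lborel Hb = 0"
proof -
  have "integrable lborel (\<lambda>z. indicator (cbox (0,0) (1,1)) z *\<^sub>R Hb z)"
    by (rule borel_integrable_compact) (auto intro: continuous_on_subset[OF cont])
  moreover have "(\<lambda>z. indicator (cbox (0,0) (1,1)) z *\<^sub>R Hb z) = Hb"
  proof
    fix z :: "real \<times> real"
    show "indicator (cbox (0,0) (1,1)) z *\<^sub>R Hb z = Hb z"
    proof (cases "z \<in> unit_square")
      case True
      then have "z \<in> cbox (0,0) (1,1)" by (cases z) auto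
      then show ?thesis by simp
    next
      case False
      then show ?thesis using zero by simp
    qed
  qed
  ultimately have int: "integrable (lborel \<Otimes>\<^sub>M lborel) Hb" by (simp add: lborel_prod)
  have FTC: "(\<integral>x. h' x \<partial>lborel) = 0"
    if h: "\<And>x. (h has_real_derivative h' x) (at x)" "\<And>x. isCont h' x" "\<And>x. x \<notin> {0<..<1} \<Longrightarrow> h x = 0 \<and> h' x = 0"
    for h h' :: "real \<Rightarrow> real"
  proof -
    have "(\<integral>x. h' x * indicator {0..1} x \<partial>lborel) = h 1 - h 0"
      by (rule integral_FTC_Icc_real) (use h in auto)
    moreover have "(\<lambda>x. h' x * indicator {0..1} x) = h'"
    proof
      fix x show "h' x * indicator {0..1} x = h' x"
        using h(3)[of x] by (cases "x \<in> {0<..<1}") (simp_all add: indicator_def)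
    qed
    ultimately show ?thesis using h(3) by simp
  qed
  have isc: "isCont Hb z" for z using cont unfolding continuous_on_eq_continuous_at[OF open_UNIV] by blast
  from b consider "b = (1, 0)" | "b = (0, 1)" by (auto simp: Basis_real_prod)
  then show ?thesis
  proof cases
    case 1
    have "(\<integral>x. Hb (x, y) \<partial>lborel) = 0" for y
    proof (rule FTC[of "\<lambda>x. H (x, y)"])
      show "((\<lambda>x. H (x, y)) has_real_derivative Hb (x, y)) (at x)" for x
        using deriv[of "(x, y)"] DERIV_shift[of "\<lambda>x. H (x, y)" _ 0 x] by (simp add: 1 add.commute)
      show "isCont (\<lambda>x. Hb (x, y)) x" for x
        by (rule isCont_o2[of x "\<lambda>x. (x, y)" Hb]) (auto intro: continuous_intros isc)
    qed (use zero in auto)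
    then have "(\<integral>y. \<integral>x. Hb (x, y) \<partial>lborel \<partial>lborel) = 0" by simp
    then show ?thesis using lborel_pair.integral_snd[of "\<lambda>x y. Hb (x, y)"] int by (simp add: lborel_prod)
  next
    case 2
    have "(\<integral>y. Hb (x, y) \<partial>lborel) = 0" for x
    proof (rule FTC[of "\<lambda>y. H (x, y)"])
      show "((\<lambda>y. H (x, y)) has_real_derivative Hb (x, y)) (at y)" for y
        using deriv[of "(x, y)"] DERIV_shift[of "\<lambda>y. H (x, y)" _ 0 y] by (simp add: 2 add.commute)
      show "isCont (\<lambda>y. Hb (x, y)) y" for y
        by (rule isCont_o2[of y "\<lambda>y. (x, y)" Hb]) (auto intro: continuous_intros isc)
    qed (use zero in auto)
    then have "(\<integral>x. \<integral>y. Hb (x, y) \<partial>lborel \<partial>lborel) = 0" by simp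
    then show ?thesis using lborel_pair.integral_fst[of "\<lambda>x y. Hb (x, y)"] int by (simp add: lborel_prod)
  qed
qed

text \<open>Inside the open unit square no two points are identified, so the domain on the torus can
  be studied on its planar copy \<open>D\<close>.\<close>

locale planar_domain =
  fixes D :: "(real \<times> real) set"
  assumes open_D: "open D" and D_unit: "D \<subseteq> unit_square"
begin

abbreviation \<Omega> :: "torus set" where "\<Omega> \<equiv> abs_torus ` D"

abbreviation M :: "torus measure" where "M \<equiv> area_on \<Omega>"

lemma frac2_D [simp]: "z \<in> D \<Longrightarrow> frac2 z = z"
  using D_unit by (intro frac2_ident) force

lemma abs_in_Omega: "abs_torus z \<in> \<Omega> \<longleftrightarrow> frac2 z \<in> D"
proof
  assume "abs_torus z \<in> \<Omega>"
  then obtain d where d: "d \<in> D" "abs_torus z = abs_torus d" by auto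
  then have "frac2 z = frac2 d" by (metis rep_abs)
  then show "frac2 z \<in> D" using d by simp
qed (metis abs_frac2 imageI)

text \<open>A point on an edge of the square has a coordinate with fractional part 0, so no
  identification moves it into \<open>D\<close>.\<close>

lemma abs_in_Omega_closed_square: "z \<in> cbox (0, 0) (1, 1) \<Longrightarrow> abs_torus z \<in> \<Omega> \<longleftrightarrow> z \<in> D"
proof -
  assume z: "z \<in> cbox (0, 0) (1, 1)"
  show ?thesis
  proof
    assume "abs_torus z \<in> \<Omega>"
    then have D: "frac2 z \<in> D" by (simp add: abs_in_Omega)
    then have *: "0 < frac (fst z)" "0 < frac (snd z)" using D_unit by (auto simp: frac2_def)
    have "fst z \<noteq> 1" "snd z \<noteq> 1" using * by auto
    then have "frac2 z = z" using z by (intro frac2_ident) (cases z, auto)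
    then show "z \<in> D" using D by simp
  qed simp
qed

lemma open_Omega: "open \<Omega>"
  unfolding open_torus_iff
proof (rule open_subopen[THEN iffD2], rule ballI)
  fix z assume "z \<in> abs_torus -` \<Omega>"
  then have z: "frac2 z \<in> D" by (simp add: abs_in_Omega)
  define n :: "real \<times> real" where "n = (of_int \<lfloor>fst z\<rfloor>, of_int \<lfloor>snd z\<rfloor>)"
  have loc: "\<forall>\<^sub>F w in nhds z. frac2 w = w - n"
    using frac2_locally[of z] z D_unit by (auto simp: n_def)
  then have "frac2 z = z - n" by (rule eventually_nhds_x_imp_x)
  then have "\<forall>\<^sub>F w in nhds (z - n). w \<in> D"
    using z open_D by (intro eventually_nhds_in_open) auto
  then have "\<forall>\<^sub>F w in nhds z. w - n \<in> D"
    by (rule eventually_compose_filterlim) (intro tendsto_intros filterlim_ident)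
  with loc have "\<forall>\<^sub>F w in nhds z. abs_torus w \<in> \<Omega>"
    by eventually_elim (simp add: abs_in_Omega)
  then show "\<exists>T. open T \<and> z \<in> T \<and> T \<subseteq> abs_torus -` \<Omega>"
    by (auto simp: eventually_nhds)
qed

lemma sets_torus_area [simp]: "sets torus_area = sets borel" "space torus_area = UNIV"
  by (simp_all add: torus_area_def)

lemma Omega_sets: "\<Omega> \<inter> space torus_area \<in> sets torus_area"
  using open_Omega by simp

lemma space_M [simp]: "space M = \<Omega>"
  by (simp add: area_on_def space_restrict_space)

lemma finite_measure_M: "finite_measure M"
proof -
  have "emeasure lborel ({0..<1} \<times> {0..<1} :: (real \<times> real) set) \<le> emeasure lborel (cbox (0, 0) (1, 1) :: (real \<times> real) set)"
    by (rule emeasure_mono) auto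
  also have "\<dots> < \<infinity>" by (rule emeasure_lborel_cbox_finite)
  finally have fin: "emeasure lborel ({0..<1} \<times> {0..<1} :: (real \<times> real) set) < \<infinity>" .
  have abs: "abs_torus \<in> measurable (restrict_space lborel ({0..<1} \<times> {0..<1})) borel"
    by (rule measurable_restrict_space1) simp
  have "finite_measure (restrict_space lborel ({0..<1} \<times> {0..<1} :: (real \<times> real) set))"
    using fin by (intro finite_measureI)
      (simp add: space_restrict_space emeasure_restrict_space borel_Times less_top)
  then have "finite_measure torus_area"
    unfolding torus_area_def by (rule finite_measure.finite_measure_distr[OF _ abs])
  then show ?thesis unfolding area_on_def
    by (rule finite_measure_restrict_space) (use Omega_sets in auto)
qed

lemma continuous_measurable_M:
  fixes f :: "torus \<Rightarrow> 'b::topological_space"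
  assumes "continuous_on UNIV f" shows "f \<in> borel_measurable M"
proof -
  have "f \<in> borel_measurable torus_area"
    using borel_measurable_continuous_onI[OF assms] by (simp add: torus_area_def)
  then show ?thesis unfolding area_on_def by (rule measurable_restrict_space1)
qed

lemma L2_continuous:
  fixes f :: "torus \<Rightarrow> 'b::euclidean_space"
  assumes "continuous_on UNIV f" shows "f \<in> L2 M"
proof -
  obtain C where "\<And>p. norm (f p) \<le> C" using torus_bounded[OF assms] by blast
  then show ?thesis
    by (intro L2_bounded[OF finite_measure_M continuous_measurable_M[OF assms]])
qed

lemma ext_measurable:
  fixes u :: "torus \<Rightarrow> 'b::euclidean_space"
  assumes "u \<in> borel_measurable M" shows "ext D u \<in> borel_measurable borel"
proof -
  have u: "(\<lambda>x. indicator \<Omega> x *\<^sub>R u x) \<in> borel_measurable borel"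
    using assms borel_measurable_restrict_space_iff[OF Omega_sets, of u]
    by (simp add: area_on_def torus_area_def)
  have [measurable]: "D \<in> sets borel" using open_D by simp
  have "(\<lambda>z. indicator D z *\<^sub>R (indicator \<Omega> (abs_torus z) *\<^sub>R u (abs_torus z))) \<in> borel_measurable borel"
    using measurable_compose[OF abs_torus_measurable u] by measurable
  also have "(\<lambda>z. indicator D z *\<^sub>R (indicator \<Omega> (abs_torus z) *\<^sub>R u (abs_torus z))) = ext D u"
    by (auto simp: ext_def indicator_def fun_eq_iff)
  finally show ?thesis .
qed

lemma ext_integral:
  fixes u :: "torus \<Rightarrow> 'b::euclidean_space"
  assumes u: "u \<in> borel_measurable M"
  shows "integrable M u \<longleftrightarrow> integrable lborel (ext D u)" "integral\<^sup>L M u = integral\<^sup>L lborel (ext D u)"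
proof -
  let ?sq = "{0..<1} \<times> {0..<1} :: (real \<times> real) set"
  have abs: "abs_torus \<in> measurable (restrict_space lborel ?sq) borel"
    by (rule measurable_restrict_space1) simp
  have v: "(\<lambda>x. indicator \<Omega> x *\<^sub>R u x) \<in> borel_measurable borel"
    using assms borel_measurable_restrict_space_iff[OF Omega_sets, of u]
    by (simp add: area_on_def torus_area_def)
  have sq: "?sq \<inter> space lborel \<in> sets lborel" by (simp add: borel_Times)
  have eq: "(\<lambda>z. indicator ?sq z *\<^sub>R (indicator \<Omega> (abs_torus z) *\<^sub>R u (abs_torus z))) = ext D u"
  proof
    fix z
    show "indicator ?sq z *\<^sub>R (indicator \<Omega> (abs_torus z) *\<^sub>R u (abs_torus z)) = ext D u z"
    proof (cases "z \<in> ?sq")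
      case True
      then have "abs_torus z \<in> \<Omega> \<longleftrightarrow> z \<in> D" by (simp only: abs_in_Omega frac2_ident)
      then show ?thesis using True by (simp add: ext_def indicator_def)
    next
      case False
      then have "z \<notin> D" using D_unit by auto
      then show ?thesis using False by (simp add: ext_def)
    qed
  qed
  show "integrable M u \<longleftrightarrow> integrable lborel (ext D u)"
    unfolding area_on_def integrable_restrict_space[OF Omega_sets] unfolding torus_area_def
    by (subst integrable_distr_eq[OF abs v], subst integrable_restrict_space[OF sq]) (simp only: eq)
  show "integral\<^sup>L M u = integral\<^sup>L lborel (ext D u)"
    unfolding area_on_def integral_restrict_space[OF Omega_sets] unfolding torus_area_def
    by (subst integral_distr[OF abs v], subst integral_restrict_space[OF sq]) (simp only: eq)
qed

lemma ext_L2: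
  fixes u :: "torus \<Rightarrow> 'b::euclidean_space"
  assumes u: "u \<in> L2 M" shows "ext D u \<in> L2 lborel"
proof -
  have m: "(\<lambda>x. (norm (u x))\<^sup>2) \<in> borel_measurable M" using L2_measurable[OF u] by measurable
  have "ext D (\<lambda>x. (norm (u x))\<^sup>2) = (\<lambda>z. (norm (ext D u z))\<^sup>2)" by (auto simp: ext_def)
  then show ?thesis
    using ext_integral(1)[OF m] L2_integrable_square[OF u] ext_measurable[OF L2_measurable[OF u]]
    by (simp add: L2_def)
qed

lemma ext_norm_square:
  fixes u :: "torus \<Rightarrow> 'b::euclidean_space"
  assumes u: "u \<in> borel_measurable M"
  shows "(\<integral>x. (norm (u x))\<^sup>2 \<partial>M) = (\<integral>z. (norm (ext D u z))\<^sup>2 \<partial>lborel)"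
proof -
  have m: "(\<lambda>x. (norm (u x))\<^sup>2) \<in> borel_measurable M" using u by measurable
  have "ext D (\<lambda>x. (norm (u x))\<^sup>2) = (\<lambda>z. (norm (ext D u z))\<^sup>2)" by (auto simp: ext_def)
  then show ?thesis using ext_integral(2)[OF m] by simp
qed

lemma lift_test_functions:
  assumes F: "F \<in> test_planar D" shows "lift F \<in> test_functions \<Omega>"
proof -
  obtain K where K: "F \<in> planar" "compact K" "K \<subseteq> D" "\<And>z. z \<notin> K \<Longrightarrow> F z = 0"
    using F unfolding test_planar_def by auto
  have "F \<in> test_planar unit_square" using test_planar_mono[OF D_unit] F by blast
  then have "smooth (lift F)" by (rule smooth_lift)
  moreover have "closure {x. lift F x \<noteq> 0} \<subseteq> {p. rep p \<in> K}"
  proof (rule closure_minimal)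
    show "{x. lift F x \<noteq> 0} \<subseteq> {p. rep p \<in> K}"
      using K(4)[of "rep _"] unfolding lift_def by blast
    have "open (- {p. rep p \<in> K})"
      unfolding open_torus_iff using frac2_compact_open[OF K(2) order_trans[OF K(3) D_unit]]
      by (simp add: vimage_def)
    then show "closed {p. rep p \<in> K}" by (simp add: closed_def)
  qed
  moreover have "{p. rep p \<in> K} \<subseteq> \<Omega>"   proof
    fix p assume "p \<in> {p. rep p \<in> K}"
    then have "rep p \<in> D" using K(3) by auto
    then have "abs_torus (rep p) \<in> \<Omega>" by (rule imageI)
    then show "p \<in> \<Omega>" by (simp only: abs_rep)
  qed
  ultimately show ?thesis by (auto simp: test_functions_def)
qed

lemma smooth_continuous0: "smooth f \<Longrightarrow> continuous_on UNIV f"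
  using smooth_continuous[of f "[]"] by simp

lemma smooth_continuous1: "smooth f \<Longrightarrow> b \<in> Basis \<Longrightarrow> continuous_on UNIV (dir_deriv b f)"
  using smooth_continuous[of f "[b]"] by simp

text \<open>Testing with lifts of planar test functions moves the Sobolev space to the plane, where
  dilations and changes of variables are available.\<close>

lemma H1_gradient_imp_weak:
  assumes "H1_gradient \<Omega> u G" shows "weak_gradient D (ext D u) (ext D G)"
proof -
  have u: "u \<in> L2 M" and G: "G \<in> L2 M" using assms by (auto simp: H1_gradient_def L2_on_def L2_def)
  have "(\<integral>z. ext D u z * pd b F z \<partial>lborel) = - (\<integral>z. (ext D G z \<bullet> b) * F z \<partial>lborel)"
    if F: "F \<in> test_planar D" and b: "b \<in> Basis" for F b
  proof -
    have Fu: "F \<in> test_planar unit_square" using test_planar_mono[OF D_unit] F by blast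
    note [measurable] = L2_measurable[OF u] L2_measurable[OF G]
      continuous_measurable_M[OF smooth_continuous0[OF smooth_lift[OF Fu]]]
      continuous_measurable_M[OF smooth_continuous1[OF smooth_lift[OF Fu] b]]
    have "(\<integral>x. u x * dir_deriv b (lift F) x \<partial>M) = - (\<integral>x. (G x \<bullet> b) * lift F x \<partial>M)"
      using assms lift_test_functions[OF F] b by (simp add: H1_gradient_def)
    also have "(\<integral>x. u x * dir_deriv b (lift F) x \<partial>M) = (\<integral>z. ext D (\<lambda>x. u x * dir_deriv b (lift F) x) z \<partial>lborel)"
      by (rule ext_integral(2)) measurable
    also have "ext D (\<lambda>x. u x * dir_deriv b (lift F) x) = (\<lambda>z. ext D u z * pd b F z)"
      by (auto simp: ext_def dir_deriv_lift[OF Fu] lift_def)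
    also have "(\<integral>x. (G x \<bullet> b) * lift F x \<partial>M) = (\<integral>z. ext D (\<lambda>x. (G x \<bullet> b) * lift F x) z \<partial>lborel)"
      by (rule ext_integral(2)) measurable
    also have "ext D (\<lambda>x. (G x \<bullet> b) * lift F x) = (\<lambda>z. (ext D G z \<bullet> b) * F z)"
      by (auto simp: ext_def lift_def)
    finally show ?thesis .
  qed
  then show ?thesis by (simp add: weak_gradient_def ext_L2[OF u] ext_L2[OF G]) (simp add: ext_def)
qed

text \<open>Integration by parts: the product of \<open>f\<close> with a test function, extended by
  zero from \<open>D\<close>, has a continuous derivative in direction \<open>b\<close> with
  vanishing integral. Test functions on the torus are only known to be \<open>smooth\<close>, so the
  argument uses derivatives along lines and not the class \<open>planar\<close>.\<close>

lemma H1_gradient_smooth: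
  assumes f: "smooth f" shows "H1_gradient \<Omega> f (grad f)"
proof -
  have "continuous_on UNIV (grad f)"
  proof -
    have "grad f = (\<lambda>p. (dir_deriv (1, 0) f p, dir_deriv (0, 1) f p))" by (simp add: grad_eq fun_eq_iff)
    moreover have "continuous_on UNIV (\<lambda>p. (dir_deriv (1, 0) f p, dir_deriv (0, 1) f p))"
      by (intro continuous_on_Pair smooth_continuous1[OF f]) (simp_all add: Basis_real_prod)
    ultimately show ?thesis by simp
  qed
  then have L: "grad f \<in> L2 M" "f \<in> L2 M" using L2_continuous[of "grad f"] L2_continuous[OF smooth_continuous0[OF f]] by blast+
  have "(\<integral>x. f x * dir_deriv b \<psi> x \<partial>M) = - (\<integral>x. (grad f x \<bullet> b) * \<psi> x \<partial>M)"
    if \<psi>: "\<psi> \<in> test_functions \<Omega>" and b: "b \<in> Basis" for \<psi> b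
  proof -
    define h where "h p = f p * dir_deriv b \<psi> p + dir_deriv b f p * \<psi> p" for p
    have s: "smooth \<psi>" and supp: "closure {x. \<psi> x \<noteq> 0} \<subseteq> \<Omega>" using \<psi> by (auto simp: test_functions_def)
    have c: "continuous_on UNIV f" "continuous_on UNIV (dir_deriv b f)"
      "continuous_on UNIV \<psi>" "continuous_on UNIV (dir_deriv b \<psi>)"
      by (intro smooth_continuous0 smooth_continuous1 f s b)+
    have ch: "continuous_on UNIV h" unfolding h_def by (intro continuous_intros c)
    \<comment> \<open>A point outside \<open>D\<close> has a neighbourhood that misses
      \<open>D\<close> or on which the test function vanishes. At boundary points the second
      alternative holds because the closure of the support is contained in the open domain.\<close>
    have near: "\<exists>T. open T \<and> z \<in> T \<and> (T \<inter> D = {} \<or> (\<forall>w\<in>T. \<psi> (abs_torus w) = 0))" if "z \<notin> D" for z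
    proof (cases "z \<in> cbox (0, 0) (1, 1)")
      case True
      then have "abs_torus z \<notin> closure {x. \<psi> x \<noteq> 0}"
        using that supp abs_in_Omega_closed_square by blast
      moreover have "open (abs_torus -` (- closure {x. \<psi> x \<noteq> 0}))"
        using open_torus_iff[of "- closure {x. \<psi> x \<noteq> 0}"] by auto
      moreover have "\<psi> p = 0" if "p \<in> - closure {x. \<psi> x \<noteq> 0}" for p
        using that closure_subset[of "{x. \<psi> x \<noteq> 0}"] by auto
      ultimately show ?thesis
        by (intro exI[of _ "abs_torus -` (- closure {x. \<psi> x \<noteq> 0})"] conjI disjI2 ballI) blast+
    next
      case False
      have "D \<subseteq> cbox (0, 0) (1, 1)" using D_unit by force
      then have "- cbox (0, 0) (1, 1) \<inter> D = {}" by blast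
      then show ?thesis using False
        by (intro exI[of _ "- cbox (0, 0) (1, 1)"] conjI disjI1 open_Compl closed_cbox) simp_all
    qed
    have near0: "\<forall>\<^sub>F w in nhds z. ext D (\<lambda>p. f p * \<psi> p) w = 0 \<and> ext D h w = 0" if z: "z \<notin> D" for z
    proof -
      obtain T where T: "open T" "z \<in> T" "T \<inter> D = {} \<or> (\<forall>w\<in>T. \<psi> (abs_torus w) = 0)"
        using near[OF z] by blast
      have "ext D (\<lambda>p. f p * \<psi> p) w = 0 \<and> ext D h w = 0" if w: "w \<in> T" for w
      proof (cases "T \<inter> D = {}")
        case True then show ?thesis using w by (auto simp: ext_def)
      next
        case False
        then have T0: "\<And>w. w \<in> T \<Longrightarrow> \<psi> (abs_torus w) = 0" using T by auto
        have "\<forall>\<^sub>F v in nhds (w + 0 *\<^sub>R b). v \<in> T" using T(1) w by (intro eventually_nhds_in_open) auto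
        then have "\<forall>\<^sub>F t in nhds 0. w + t *\<^sub>R b \<in> T"
          by (rule eventually_compose_filterlim) (intro tendsto_intros filterlim_ident)
        then have "\<forall>\<^sub>F t in nhds 0. \<psi> (abs_torus (w + t *\<^sub>R b)) = 0" by eventually_elim (rule T0)
        then have "((\<lambda>t. \<psi> (abs_torus (w + t *\<^sub>R b))) has_real_derivative 0) (at 0)"
          by (subst DERIV_cong_ev[OF refl _ refl, of _ "\<lambda>_. 0"]) auto
        then have "dir_deriv b \<psi> (abs_torus w) = 0"
          using DERIV_unique smooth_pd[OF s b] by blast
        then show ?thesis using T0[OF w] by (simp add: ext_def h_def)
      qed
      then show ?thesis using T by (auto simp: eventually_nhds)
    qed
    have "integral\<^sup>L lborel (ext D h) = 0"
    proof (rule integral_directional_derivative[OF _ b])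
      show "((\<lambda>t. ext D (\<lambda>p. f p * \<psi> p) (z + t *\<^sub>R b)) has_real_derivative ext D h z) (at 0)" for z
      proof (cases "z \<in> D")
        case True
        have "\<forall>\<^sub>F v in nhds (z + 0 *\<^sub>R b). v \<in> D" using open_D True by (intro eventually_nhds_in_open) auto
        then have "\<forall>\<^sub>F t in nhds 0. z + t *\<^sub>R b \<in> D"
          by (rule eventually_compose_filterlim) (intro tendsto_intros filterlim_ident)
        then have ev: "\<forall>\<^sub>F t in nhds 0. ext D (\<lambda>p. f p * \<psi> p) (z + t *\<^sub>R b) = f (abs_torus (z + t *\<^sub>R b)) * \<psi> (abs_torus (z + t *\<^sub>R b))"
          by eventually_elim (simp add: ext_def)
        have "((\<lambda>t. f (abs_torus (z + t *\<^sub>R b)) * \<psi> (abs_torus (z + t *\<^sub>R b))) has_real_derivative ext D h z) (at 0)"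
          by (rule derivative_eq_intros smooth_pd[OF f b] smooth_pd[OF s b])+
             (use True in \<open>simp add: ext_def h_def algebra_simps\<close>)
        then show ?thesis by (subst DERIV_cong_ev[OF refl ev refl])
      next
        case False
        then have "\<forall>\<^sub>F v in nhds (z + 0 *\<^sub>R b). ext D (\<lambda>p. f p * \<psi> p) v = 0"
          using near0[OF False] by (auto elim: eventually_mono)
        then have ev: "\<forall>\<^sub>F t in nhds 0. ext D (\<lambda>p. f p * \<psi> p) (z + t *\<^sub>R b) = 0"
          by (rule eventually_compose_filterlim) (intro tendsto_intros filterlim_ident)
        have "ext D h z = 0" using False by (simp add: ext_def)
        then show ?thesis by (subst DERIV_cong_ev[OF refl ev refl]) auto
      qed
      show "continuous_on UNIV (ext D h)"
        unfolding continuous_on_eq_continuous_at[OF open_UNIV]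
      proof
        fix z
        show "isCont (ext D h) z"
        proof (cases "z \<in> D")
          case True
          have "isCont (\<lambda>z. h (abs_torus z)) z"
            using ch unfolding continuous_on_torus_iff continuous_on_eq_continuous_at[OF open_UNIV] by blast
          moreover have "\<forall>\<^sub>F w in nhds z. ext D h w = h (abs_torus w)"
            using eventually_nhds_in_open[OF open_D True] by eventually_elim (simp add: ext_def)
          ultimately show ?thesis by (subst isCont_cong)
        next
          case False
          have "\<forall>\<^sub>F w in nhds z. ext D h w = 0" using near0[OF False] by (auto elim: eventually_mono)
          then show ?thesis by (subst isCont_cong) auto
        qed
      qed
      show "ext D (\<lambda>p. f p * \<psi> p) z = 0 \<and> ext D h z = 0" if "z \<notin> unit_square" for z
        using that D_unit by (auto simp: ext_def)
    qed
    then have "integral\<^sup>L M h = 0" by (simp add: ext_integral(2)[OF continuous_measurable_M[OF ch]])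
    moreover have "integral\<^sup>L M h = (\<integral>x. f x * dir_deriv b \<psi> x \<partial>M) + (\<integral>x. dir_deriv b f x * \<psi> x \<partial>M)"
      unfolding h_def
    proof (rule Bochner_Integration.integral_add)
      show "integrable M (\<lambda>x. f x * dir_deriv b \<psi> x)" "integrable M (\<lambda>x. dir_deriv b f x * \<psi> x)"
        using L2_integrable_inner[OF L2_continuous[OF c(1)] L2_continuous[OF c(4)]]
          L2_integrable_inner[OF L2_continuous[OF c(2)] L2_continuous[OF c(3)]] by simp_all
    qed
    ultimately show ?thesis by (simp add: grad_inner_Basis[OF b])
  qed
  with L show ?thesis by (auto simp: H1_gradient_def L2_on_def L2_def)
qed

end

section \<open>Density of the test functions\<close>

text \<open>An exhaustion of \<open>D\<close> by test functions, with the pointwise convergence and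
  the uniform bound that dominated convergence consumes.\<close>

locale cutoff_domain = planar_domain D for D +
  fixes cut :: "nat \<Rightarrow> real \<times> real \<Rightarrow> real"
  assumes cut_test: "cut n \<in> test_planar D"
    and cut_bounds: "0 \<le> cut n z" "cut n z \<le> 1"
    and cut_lim: "z \<in> D \<Longrightarrow> (\<lambda>n. cut n z) \<longlonglongrightarrow> 1"

lemma plateau_bounds: "0 \<le> plateau t" "plateau t \<le> 1"
  by (simp_all add: plateau_def)

lemma plateau_tendsto: "(\<lambda>n. plateau (real n * t)) \<longlonglongrightarrow> (if 0 < t then 1 else 0)"
proof (cases "0 < t")
  case True
  have "(\<lambda>n. exp (- 1 / (real n * t))) \<longlonglongrightarrow> 1" using True by real_asymp
  moreover have "\<forall>\<^sub>F n in sequentially. exp (- 1 / (real n * t)) = plateau (real n * t)"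
    using eventually_gt_at_top[of 0] by eventually_elim (use True in \<open>simp add: plateau_def\<close>)
  ultimately show ?thesis using True Lim_transform_eventually by fastforce
next
  case False
  then have "plateau (real n * t) = 0" for n by (auto simp: plateau_def zero_less_mult_iff)
  then show ?thesis using False by simp
qed

context planar_domain begin

lemma D_sets [measurable]: "D \<in> sets borel" using open_D by simp

lemma indicator_D_L2: "(indicator D :: _ \<Rightarrow> real) \<in> L2 lborel"
proof -
  have "emeasure lborel D \<le> emeasure lborel (cbox (0, 0) (1, 1) :: (real \<times> real) set)"
    using D_unit by (intro emeasure_mono) force+
  also have "\<dots> < \<infinity>" by (rule emeasure_lborel_cbox_finite)
  finally have "integrable lborel (indicator D :: _ \<Rightarrow> real)" by simp
  moreover have "(\<lambda>x. (norm (indicator D x :: real))\<^sup>2) = indicator D" by (auto simp: indicator_def)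
  ultimately show ?thesis by (simp add: L2_def)
qed

lemma test_planar_measurable: "F \<in> test_planar D \<Longrightarrow> F \<in> borel_measurable borel"
  using planar_measurable by (simp add: test_planar_def)

lemma test_planar_bounded:
  assumes "F \<in> test_planar D" obtains C where "0 \<le> C" "\<And>z. \<bar>F z\<bar> \<le> C * indicator D z" "\<And>z. \<bar>F z\<bar> \<le> C"
proof -
  obtain K where K: "F \<in> planar" "compact K" "K \<subseteq> D" "\<And>z. z \<notin> K \<Longrightarrow> F z = 0"
    using assms unfolding test_planar_def by auto
  have "bounded (F ` K)"
    by (intro compact_imp_bounded compact_continuous_image planar_continuous K)
  then obtain C where C: "\<And>z. z \<in> K \<Longrightarrow> \<bar>F z\<bar> \<le> C" by (auto simp: bounded_iff)
  have "\<bar>F z\<bar> \<le> \<bar>C\<bar> * indicator D z" "\<bar>F z\<bar> \<le> \<bar>C\<bar>" for z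
  proof -
    have 1: "\<bar>F z\<bar> \<le> \<bar>C\<bar> \<and> (z \<notin> D \<longrightarrow> F z = 0)" for z
    proof (cases "z \<in> K")
      case True then show ?thesis using C[OF True] K(3) by auto
    next
      case False then show ?thesis using K(4)[OF False] by simp
    qed
    show "\<bar>F z\<bar> \<le> \<bar>C\<bar> * indicator D z" using 1[of z] by (cases "z \<in> D") auto
    show "\<bar>F z\<bar> \<le> \<bar>C\<bar>" using 1[of z] by simp
  qed
  then show ?thesis by (intro that[of "\<bar>C\<bar>"]) auto
qed

lemma bounded_L2:
  fixes F :: "real \<times> real \<Rightarrow> 'b::euclidean_space"
  assumes "F \<in> borel_measurable borel" "\<And>z. norm (F z) \<le> C * indicator D z"
  shows "F \<in> L2 lborel"
proof (rule L2_bound)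
  show "(\<lambda>z. C * indicator D z) \<in> L2 lborel"
    using subspace_scale[OF L2_subspace indicator_D_L2, of C] by (simp add: scaleR_fun_def)
  show "AE z in lborel. norm (F z) \<le> norm (C * indicator D z)"
    using assms(2) by (intro AE_I2 order_trans[OF assms(2)]) simp
qed (use assms in simp)

lemma test_planar_zero: "F \<in> test_planar D \<Longrightarrow> z \<notin> D \<Longrightarrow> F z = 0"
  unfolding test_planar_def by blast

lemma test_planar_L2: "F \<in> test_planar D \<Longrightarrow> F \<in> L2 lborel"
  using test_planar_bounded[of F] bounded_L2[OF test_planar_measurable, of F] by (metis real_norm_def)

end

section \<open>Approximation of square integrable functions by test functions\<close>

context cutoff_domain begin

definition approximable :: "(real \<times> real \<Rightarrow> real) set" where
  "approximable = {h \<in> L2 lborel. \<forall>\<epsilon>>0. \<exists>F\<in>test_planar D. (\<integral>z. (h z - F z)\<^sup>2 \<partial>lborel) < \<epsilon>}"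

lemma approximable_L2: "h \<in> approximable \<Longrightarrow> h \<in> L2 lborel"
  by (simp add: approximable_def)

lemma square_integrable_diff:
  "h \<in> L2 M' \<Longrightarrow> g \<in> L2 M' \<Longrightarrow> integrable M' (\<lambda>z. (h z - g z :: real)\<^sup>2)"
  using L2_integrable_square[OF L2_diff, of h M' g] by simp

lemma square_sum_le: "(a + b)\<^sup>2 \<le> 2 * a\<^sup>2 + 2 * (b::real)\<^sup>2"
  using sum_squares_bound[of a b] by (simp add: power2_sum)

lemma approximable_closed:
  assumes h: "h \<in> L2 lborel"
    and lim: "\<And>\<epsilon>. 0 < \<epsilon> \<Longrightarrow> \<exists>g\<in>approximable. (\<integral>z. (h z - g z)\<^sup>2 \<partial>lborel) < \<epsilon>"
  shows "h \<in> approximable"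
  unfolding approximable_def
proof (safe intro!: h)
  fix \<epsilon> :: real assume \<epsilon>: "0 < \<epsilon>"
  then obtain g where g: "g \<in> approximable" "(\<integral>z. (h z - g z)\<^sup>2 \<partial>lborel) < \<epsilon> / 4"
    using lim[of "\<epsilon> / 4"] by auto
  then obtain F where F: "F \<in> test_planar D" "(\<integral>z. (g z - F z)\<^sup>2 \<partial>lborel) < \<epsilon> / 4"
    using \<epsilon> unfolding approximable_def by (auto dest!: spec[of _ "\<epsilon> / 4"])
  have gL: "g \<in> L2 lborel" using g by (simp add: approximable_def)
  note i = square_integrable_diff[OF h gL] square_integrable_diff[OF gL test_planar_L2[OF F(1)]]
  have "(\<integral>z. (h z - F z)\<^sup>2 \<partial>lborel) \<le> (\<integral>z. 2 * (h z - g z)\<^sup>2 + 2 * (g z - F z)\<^sup>2 \<partial>lborel)"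
  proof (rule integral_mono)
    show "integrable lborel (\<lambda>z. (h z - F z)\<^sup>2)" by (rule square_integrable_diff[OF h test_planar_L2[OF F(1)]])
    show "integrable lborel (\<lambda>z. 2 * (h z - g z)\<^sup>2 + 2 * (g z - F z)\<^sup>2)" using i by simp
    show "(h z - F z)\<^sup>2 \<le> 2 * (h z - g z)\<^sup>2 + 2 * (g z - F z)\<^sup>2" for z
      using square_sum_le[of "h z - g z" "g z - F z"] by simp
  qed
  also have "\<dots> < \<epsilon>" using i g(2) F(2) by simp
  finally show "\<exists>F\<in>test_planar D. (\<integral>z. (h z - F z)\<^sup>2 \<partial>lborel) < \<epsilon>" using F(1) by blast
qed

lemma approximable_lim:
  assumes s: "\<And>n. s n \<in> approximable"
    and lim: "\<And>z. (\<lambda>n. s n z) \<longlonglongrightarrow> h z"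
    and g: "g \<in> L2 lborel" and bound: "\<And>n z. \<bar>s n z - h z\<bar> \<le> g z" and hL: "h \<in> L2 lborel"
  shows "h \<in> approximable"
proof (rule approximable_closed[OF hL])
  fix \<epsilon> :: real assume "0 < \<epsilon>"
  have "(\<lambda>n. \<integral>z. (norm (s n z - h z))\<^sup>2 \<partial>lborel) \<longlonglongrightarrow> 0"
    by (rule L2_dominated_convergence[OF g])
       (use L2_measurable[OF approximable_L2[OF s]] L2_measurable[OF hL] lim bound in simp_all)
  then have "\<forall>\<^sub>F n in sequentially. (\<integral>z. (norm (s n z - h z))\<^sup>2 \<partial>lborel) < \<epsilon>"
    using \<open>0 < \<epsilon>\<close> by (rule order_tendstoD)
  then obtain n where "(\<integral>z. (norm (s n z - h z))\<^sup>2 \<partial>lborel) < \<epsilon>"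
    by (auto simp: eventually_sequentially)
  then show "\<exists>g\<in>approximable. (\<integral>z. (h z - g z)\<^sup>2 \<partial>lborel) < \<epsilon>"
    using s[of n] by (auto simp: power2_commute[of "h _"])
qed

lemma test_approximable: "F \<in> test_planar D \<Longrightarrow> F \<in> approximable"
  unfolding approximable_def using test_planar_L2 by (auto intro!: bexI[of _ F])

lemma test_planar_add:
  assumes "F \<in> test_planar D" "G \<in> test_planar D" shows "(\<lambda>z. F z + G z) \<in> test_planar D"
proof -
  obtain K L where K: "F \<in> planar" "compact K" "K \<subseteq> D" "\<And>z. z \<notin> K \<Longrightarrow> F z = 0"
    and L: "G \<in> planar" "compact L" "L \<subseteq> D" "\<And>z. z \<notin> L \<Longrightarrow> G z = 0"
    using assms unfolding test_planar_def by auto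
  have "(\<lambda>z. F z + G z) \<in> planar" by (intro planar.add K L)
  moreover have "compact (K \<union> L)" "K \<union> L \<subseteq> D" using K L by auto
  moreover have "F z + G z = 0" if "z \<notin> K \<union> L" for z using K(4)[of z] L(4)[of z] that by simp
  ultimately show ?thesis unfolding test_planar_def by (auto intro!: exI[of _ "K \<union> L"])
qed

lemma approximable_add:
  assumes h: "h \<in> approximable" and g: "g \<in> approximable" shows "(\<lambda>z. h z + g z) \<in> approximable"
  unfolding approximable_def
proof (safe)
  have hL: "h \<in> L2 lborel" and gL: "g \<in> L2 lborel" using h g by (auto simp: approximable_def)
  show L: "(\<lambda>z. h z + g z) \<in> L2 lborel"
    using subspace_add[OF L2_subspace hL gL] by (simp add: plus_fun_def)
  fix \<epsilon> :: real assume \<epsilon>: "0 < \<epsilon>"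
  obtain F G where F: "F \<in> test_planar D" "(\<integral>z. (h z - F z)\<^sup>2 \<partial>lborel) < \<epsilon> / 4"
    and G: "G \<in> test_planar D" "(\<integral>z. (g z - G z)\<^sup>2 \<partial>lborel) < \<epsilon> / 4"
    using \<epsilon> h g unfolding approximable_def by (auto dest!: spec[of _ "\<epsilon> / 4"])
  note FL = test_planar_L2[OF F(1)] and GL = test_planar_L2[OF G(1)]
  note i = square_integrable_diff[OF hL FL] square_integrable_diff[OF gL GL]
  have "(\<integral>z. ((h z + g z) - (F z + G z))\<^sup>2 \<partial>lborel) \<le> (\<integral>z. 2 * (h z - F z)\<^sup>2 + 2 * (g z - G z)\<^sup>2 \<partial>lborel)"
  proof (rule integral_mono)
    show "integrable lborel (\<lambda>z. ((h z + g z) - (F z + G z))\<^sup>2)"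
      by (rule square_integrable_diff[OF L test_planar_L2[OF test_planar_add[OF F(1) G(1)]]])
    show "integrable lborel (\<lambda>z. 2 * (h z - F z)\<^sup>2 + 2 * (g z - G z)\<^sup>2)" using i by simp
    show "((h z + g z) - (F z + G z))\<^sup>2 \<le> 2 * (h z - F z)\<^sup>2 + 2 * (g z - G z)\<^sup>2" for z
      using square_sum_le[of "h z - F z" "g z - G z"] by (simp add: algebra_simps)
  qed
  also have "\<dots> < \<epsilon>" using i F(2) G(2) by simp
  finally show "\<exists>F\<in>test_planar D. (\<integral>z. (h z + g z - F z)\<^sup>2 \<partial>lborel) < \<epsilon>"
    using test_planar_add[OF F(1) G(1)] by (intro bexI[of _ "\<lambda>z. F z + G z"])
qed

lemma approximable_cmult:
  assumes h: "h \<in> approximable" shows "(\<lambda>z. c * h z) \<in> approximable"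
proof (cases "c = 0")
  case True
  have "(\<lambda>z. 0) \<in> test_planar D" by (auto simp: test_planar_def planar.const intro: exI[of _ "{}"])
  then show ?thesis using True test_approximable by simp
next
  case False
  have hL: "h \<in> L2 lborel" using h by (auto simp: approximable_def)
  show ?thesis unfolding approximable_def
  proof safe
    show "(\<lambda>z. c * h z) \<in> L2 lborel"
      using subspace_scale[OF L2_subspace hL, of c] by (simp add: scaleR_fun_def)
    fix \<epsilon> :: real assume \<epsilon>: "0 < \<epsilon>"
    then have "0 < \<epsilon> / c\<^sup>2" using False by simp
    then obtain F where F: "F \<in> test_planar D" "(\<integral>z. (h z - F z)\<^sup>2 \<partial>lborel) < \<epsilon> / c\<^sup>2"
      using h unfolding approximable_def by blast
    have "(\<integral>z. (c * h z - c * F z)\<^sup>2 \<partial>lborel) = (\<integral>z. c\<^sup>2 * (h z - F z)\<^sup>2 \<partial>lborel)"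
      by (simp add: right_diff_distrib[symmetric] power_mult_distrib)
    also have "\<dots> = c\<^sup>2 * (\<integral>z. (h z - F z)\<^sup>2 \<partial>lborel)" by simp
    also have "\<dots> < \<epsilon>" using F(2) False by (simp add: field_simps)
    finally have "(\<integral>z. (c * h z - c * F z)\<^sup>2 \<partial>lborel) < \<epsilon>" .
    then show "\<exists>F\<in>test_planar D. (\<integral>z. (c * h z - F z)\<^sup>2 \<partial>lborel) < \<epsilon>"
      by (intro bexI[of _ "\<lambda>z. c * F z"] test_planar_mult planar.const F)
  qed
qed

lemma approximable_zero: "(\<lambda>z. 0) \<in> approximable"
  using approximable_cmult[OF test_approximable[OF cut_test[of 0]], of 0] by simp

lemma approximable_sum: "(\<And>i. i \<in> I \<Longrightarrow> h i \<in> approximable) \<Longrightarrow> (\<lambda>z. \<Sum>i\<in>I. h i z) \<in> approximable"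
  by (induction I rule: infinite_finite_induct) (auto intro: approximable_add approximable_zero)

lemma indicator_Int_L2: "A \<in> sets borel \<Longrightarrow> (indicator (A \<inter> D) :: _ \<Rightarrow> real) \<in> L2 lborel"
  by (rule bounded_L2[of _ 1]) (auto simp: indicator_def)

text \<open>Factors \<open>plateau (n t)\<close>, with \<open>t\<close> the signed distances to the
  four sides, tend to the indicator of the open box; the factor \<open>cut n\<close> keeps the
  support compact in \<open>D\<close>.\<close>

lemma approximable_box: "indicator (({a<..<b} \<times> {c<..<d}) \<inter> D) \<in> approximable"
proof -
  define s where "s n z = plateau (real n * (fst z - a)) * plateau (real n * (b - fst z))
      * plateau (real n * (snd z - c)) * plateau (real n * (d - snd z)) * cut n z" for n and z :: "real \<times> real"
  have Q: "({a<..<b} \<times> {c<..<d}) \<in> sets borel" by (simp add: borel_Times)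
  show ?thesis
  proof (rule approximable_lim[where g = "indicator D" and s = s])
  show "(indicator (({a<..<b} \<times> {c<..<d}) \<inter> D) :: real \<times> real \<Rightarrow> real) \<in> L2 lborel"
    by (rule indicator_Int_L2[OF Q])

  show "(indicator D :: real \<times> real \<Rightarrow> real) \<in> L2 lborel" by (rule indicator_D_L2)
  show "s n \<in> approximable" for n
    unfolding s_def
    by (intro test_approximable test_planar_mult cut_test planar_intros)
  have s0: "s n z = 0" if "z \<notin> D" for n z
    using test_planar_zero[OF cut_test that] unfolding s_def by simp
  have s1: "0 \<le> s n z" "s n z \<le> 1" for n z
    unfolding s_def by (auto intro!: mult_nonneg_nonneg mult_le_one plateau_bounds cut_bounds)
  show "\<bar>s n z - indicator (({a<..<b} \<times> {c<..<d}) \<inter> D) z\<bar> \<le> indicator D z" for n z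
    using s0[of z n] s1[of n z] by (cases "z \<in> D") (auto simp: indicator_def)
  show "(\<lambda>n. s n z) \<longlonglongrightarrow> indicator (({a<..<b} \<times> {c<..<d}) \<inter> D) z" for z
  proof (cases "z \<in> D")
    case True
    have "(\<lambda>n. s n z) \<longlonglongrightarrow> (if 0 < fst z - a then 1 else 0) * (if 0 < b - fst z then 1 else 0)
      * (if 0 < snd z - c then 1 else 0) * (if 0 < d - snd z then 1 else 0) * 1"
      unfolding s_def by (intro tendsto_mult plateau_tendsto cut_lim True)
    then show ?thesis using True by (cases z) (auto simp: indicator_def split: if_splits)
  next
    case False
    then show ?thesis by (simp add: s0)
  qed
  qed
qed

text \<open>Open boxes form an intersection-stable generator of the Borel sets, and approximability
  passes to complements within \<open>D\<close> and to countable disjoint unions, so a Dynkin system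
  argument applies.\<close>

lemma approximable_indicator:
  assumes "A \<in> sets borel" shows "indicator (A \<inter> D) \<in> approximable"
proof -
  define G where "G = (\<lambda>(a, b). box a b) ` (UNIV :: ((real \<times> real) \<times> (real \<times> real)) set)"
  have G: "Int_stable G"
    unfolding Int_stable_def G_def
  proof (clarsimp)
    fix a b a' b' c d c' d' :: real
    have "box (a, b) (a', b') \<inter> box (c, d) (c', d') = box (max a c, max b d) (min a' c', min b' d')"
      by (auto simp: box_def Basis_real_prod)
    then show "box (a, b) (a', b') \<inter> box (c, d) (c', d') \<in> (\<lambda>x. case x of (a, b) \<Rightarrow> box a b) ` UNIV"
      by (auto intro: image_eqI[of _ _ "((max a c, max b d), (min a' c', min b' d'))"])
  qed
  have "A \<in> sigma_sets UNIV G" using assms by (simp add: borel_eq_box G_def sets_measure_of)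
  moreover have sub: "G \<subseteq> Pow UNIV" by simp
  have sb: "B \<in> sets borel" if "B \<in> sigma_sets UNIV G" for B
    using that by (simp add: borel_eq_box G_def sets_measure_of)
  from G sub \<open>A \<in> sigma_sets UNIV G\<close> show ?thesis
  proof (induction rule: sigma_sets_induct_disjoint)
    case (basic A)
    then obtain a b c d where "A = box (a, c) (b, d)" by (auto simp: G_def)
    then have "A = {a<..<b} \<times> {c<..<d}" by (auto simp: box_def Basis_real_prod)
    then show ?case by (simp only: approximable_box)
  next
    case empty
    then show ?case using approximable_zero by (simp add: indicator_def[abs_def])
  next
    case (compl A)
    have "indicator D \<in> approximable"
    proof (rule approximable_lim[of cut _ "indicator D"])
      show "\<bar>cut n z - indicator D z\<bar> \<le> indicator D z" for n z
        using cut_bounds[of n z] test_planar_zero[OF cut_test, of z n] by (auto simp: indicator_def)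
      show "(\<lambda>n. cut n z) \<longlonglongrightarrow> indicator D z" for z
      proof (cases "z \<in> D")
        case False
        then have "cut n z = 0" for n by (rule test_planar_zero[OF cut_test])
        then show ?thesis using False by simp
      qed (simp add: cut_lim)
    qed (auto intro: test_approximable cut_test indicator_D_L2)
    from approximable_add[OF this approximable_cmult[OF compl.IH, of "- 1"]]
    have "(\<lambda>z. indicator D z + - 1 * indicator (A \<inter> D) z) \<in> approximable" .
    also have "(\<lambda>z. indicator D z + - 1 * indicator (A \<inter> D) z) = (indicator ((UNIV - A) \<inter> D) :: _ \<Rightarrow> real)"
      by (auto simp: indicator_def)
    finally show ?case .
  next
    case (union A)
    have m: "A i \<in> sets borel" for i using union.hyps sb by auto
    have eq: "(\<Sum>i<n. indicator (A i \<inter> D) z) = (indicator ((\<Union>i<n. A i) \<inter> D) z :: real)" for n z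
    proof -
      have "disjoint_family_on (\<lambda>i. A i \<inter> D) {..<n}"
        using union.hyps(1) by (auto simp: disjoint_family_on_def)
      from indicator_UN_disjoint[OF _ this, of z]
      have "indicator (\<Union>i<n. A i \<inter> D) z = (\<Sum>i<n. indicator (A i \<inter> D) z :: real)" by simp
      then show ?thesis by (simp add: Int_UN_distrib2)
    qed
    show ?case
    proof (rule approximable_lim[of "\<lambda>n z. \<Sum>i<n. indicator (A i \<inter> D) z" _ "indicator D"])
      show "(\<lambda>z. \<Sum>i<n. indicator (A i \<inter> D) z) \<in> approximable" for n
        by (rule approximable_sum[OF union.IH])
      show "(indicator (\<Union> (range A) \<inter> D) :: real \<times> real \<Rightarrow> real) \<in> L2 lborel"
        by (rule indicator_Int_L2) (use m in auto)

      show "\<bar>(\<Sum>i<n. indicator (A i \<inter> D) z) - indicator (\<Union> (range A) \<inter> D) z\<bar> \<le> (indicator D z :: real)" for n z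
        unfolding eq by (auto simp: indicator_def)
      show "(\<lambda>n. \<Sum>i<n. indicator (A i \<inter> D) z) \<longlonglongrightarrow> (indicator (\<Union> (range A) \<inter> D) z :: real)" for z
      proof (cases "z \<in> \<Union> (range A) \<inter> D")
        case True
        then obtain k where k: "z \<in> A k" by auto
        have "\<forall>\<^sub>F n in sequentially. (\<Sum>i<n. indicator (A i \<inter> D) z) = (1 :: real)"
          using eventually_gt_at_top[of k]
          by eventually_elim (subst eq, use k True in \<open>auto simp: indicator_def\<close>)
        then show ?thesis using True by (simp add: tendsto_eventually)
      next
        case False
        then have "(\<Sum>i<n. indicator (A i \<inter> D) z) = (0 :: real)" for n unfolding eq by (auto simp: indicator_def)
        then show ?thesis using False by simp
      qed
    qed (rule indicator_D_L2)
  qed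
qed

theorem test_functions_dense:
  assumes h: "h \<in> L2 lborel" and off: "\<And>z. z \<notin> D \<Longrightarrow> h z = 0"
  shows "h \<in> approximable"
proof -
  have hm: "h \<in> borel_measurable lborel" by (rule L2_measurable[OF h])
  obtain s where s: "\<And>i. simple_function lborel (s i)" "\<And>z. (\<lambda>i. s i z) \<longlonglongrightarrow> h z"
    "\<And>i z. \<bar>s i z\<bar> \<le> 2 * \<bar>h z\<bar>"
    using borel_measurable_implies_sequence_metric[OF hm, of 0] by (auto simp: dist_real_def)
  show ?thesis
  proof (rule approximable_lim[of s])
    show "s i \<in> approximable" for i
    proof -
      have s0: "s i z = 0" if "z \<notin> D" for z using s(3)[of i z] off[OF that] by simp
      have "s i z = (\<Sum>y\<in>s i ` UNIV. y * indicator (s i -` {y} \<inter> D) z)" for z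
      proof -
        have "(\<Sum>y\<in>s i ` UNIV. y * indicator (s i -` {y} \<inter> D) z)
           = (\<Sum>y\<in>s i ` UNIV. if y = s i z then s i z else 0)"
          by (rule sum.cong) (use s0[of z] in \<open>auto simp: indicator_def\<close>)
        also have "\<dots> = s i z" using simple_functionD(1)[OF s(1), of i] by simp
        finally show ?thesis by simp
      qed
      then have "s i = (\<lambda>z. \<Sum>y\<in>s i ` UNIV. y * indicator (s i -` {y} \<inter> D) z)" by blast
      moreover have "(\<lambda>z. \<Sum>y\<in>s i ` UNIV. y * indicator (s i -` {y} \<inter> D) z) \<in> approximable"
        using simple_functionD(2)[OF s(1), of i]
        by (intro approximable_sum approximable_cmult approximable_indicator) auto
      ultimately show ?thesis by simp
    qed
    show "(\<lambda>z. 3 * \<bar>h z\<bar>) \<in> L2 lborel"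
      by (rule L2_bound[of "\<lambda>z. 3 * h z"])
         (use subspace_scale[OF L2_subspace h, of 3] hm in \<open>auto simp: scaleR_fun_def\<close>)
    show "\<bar>s n z - h z\<bar> \<le> 3 * \<bar>h z\<bar>" for n z using s(3)[of n z] by linarith
  qed (use h hm s in auto)
qed

text \<open>By density the bound may be applied to test functions tending to \<open>h\<close> itself
  and then reads \<open>a \<le> K sqrt a\<close> for the squared norm \<open>a\<close>. In this way
  estimates in \<open>L^2\<close> follow from integrals against test functions.\<close>

lemma norm_by_duality:
  assumes h: "h \<in> L2 lborel" and off: "\<And>z. z \<notin> D \<Longrightarrow> h z = 0"
    and bound: "\<And>F. F \<in> test_planar D \<Longrightarrow> \<bar>\<integral>z. h z * F z \<partial>lborel\<bar> \<le> K * sqrt (\<integral>z. (F z)\<^sup>2 \<partial>lborel)"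
  shows "(\<integral>z. (h z)\<^sup>2 \<partial>lborel) \<le> K\<^sup>2"
proof -
  interpret L: psd_form "L2 lborel" "\<lambda>u v :: real \<times> real \<Rightarrow> real. \<integral>z. u z \<bullet> v z \<partial>lborel" by (rule L2_psd_form)
  have "\<exists>F\<in>test_planar D. (\<integral>z. (h z - F z)\<^sup>2 \<partial>lborel) < 1 / real (Suc n)" for n
    using test_functions_dense[OF h off] by (simp add: approximable_def)
  then obtain F where F: "\<And>n. F n \<in> test_planar D" "\<And>n. (\<integral>z. (h z - F n z)\<^sup>2 \<partial>lborel) < 1 / real (Suc n)" by metis
  note FL = test_planar_L2[OF F(1)]
  have lim: "(\<lambda>n. \<integral>z. (F n - h) z \<bullet> (F n - h) z \<partial>lborel) \<longlonglongrightarrow> 0"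
  proof (rule tendsto_sandwich[OF _ _ tendsto_const])
    show "(\<lambda>n. 1 / real (Suc n)) \<longlonglongrightarrow> 0" by real_asymp
    show "\<forall>\<^sub>F n in sequentially. (\<integral>z. (F n - h) z \<bullet> (F n - h) z \<partial>lborel) \<le> 1 / real (Suc n)"
      using F(2) by (auto simp: power2_eq_square algebra_simps intro!: always_eventually less_imp_le)
  qed simp
  have 1: "(\<lambda>n. \<integral>z. F n z \<bullet> h z \<partial>lborel) \<longlonglongrightarrow> (\<integral>z. h z \<bullet> h z \<partial>lborel)"
    by (rule L.tendsto_left[OF FL h h lim])
  have 2: "(\<lambda>n. \<integral>z. F n z \<bullet> F n z \<partial>lborel) \<longlonglongrightarrow> (\<integral>z. h z \<bullet> h z \<partial>lborel)"
    by (rule L.tendsto_square[OF FL h lim])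
  define a where "a = (\<integral>z. (h z)\<^sup>2 \<partial>lborel)"
  have "a \<le> K * sqrt a"
  proof (rule LIMSEQ_le)
    show "(\<lambda>n. \<integral>z. h z * F n z \<partial>lborel) \<longlonglongrightarrow> a" using 1 by (simp add: a_def power2_eq_square mult.commute)
    have "(\<lambda>n. K * sqrt (\<integral>z. F n z \<bullet> F n z \<partial>lborel)) \<longlonglongrightarrow> K * sqrt (\<integral>z. h z \<bullet> h z \<partial>lborel)"
      by (intro tendsto_intros 2)
    then show "(\<lambda>n. K * sqrt (\<integral>z. (F n z)\<^sup>2 \<partial>lborel)) \<longlonglongrightarrow> K * sqrt a"
      by (simp add: a_def power2_eq_square)
    show "\<exists>N. \<forall>n\<ge>N. (\<integral>z. h z * F n z \<partial>lborel) \<le> K * sqrt (\<integral>z. (F n z)\<^sup>2 \<partial>lborel)"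
      using bound[OF F(1)] abs_le_D1 by blast
  qed
  have "0 \<le> a" by (simp add: a_def)
  have "a \<le> K\<^sup>2"
  proof (cases "a = 0")
    case False
    then have "0 < sqrt a" using \<open>0 \<le> a\<close> by simp
    then have "sqrt a \<le> K" using \<open>a \<le> K * sqrt a\<close> \<open>0 \<le> a\<close>
      by (metis mult_le_cancel_right_pos real_sqrt_mult_self abs_of_nonneg)
    then have "(sqrt a)\<^sup>2 \<le> K\<^sup>2" using \<open>0 \<le> a\<close> by (intro power_mono) auto
    then show ?thesis using \<open>0 \<le> a\<close> by simp
  qed simp
  then show ?thesis by (simp add: a_def)
qed

end

section \<open>Rellich compactness on convex domains\<close>

lemma affine_integral:
  fixes f :: "real \<times> real \<Rightarrow> 'b::euclidean_space"
  assumes f: "f \<in> borel_measurable borel" and c: "0 < c"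
  shows "integrable lborel (\<lambda>x. f (t + c *\<^sub>R x)) \<longleftrightarrow> integrable lborel f"
    "(\<integral>x. f (t + c *\<^sub>R x) \<partial>lborel) = (\<integral>x. f x \<partial>lborel) /\<^sub>R c\<^sup>2"
proof -
  have T: "(\<lambda>x. t + c *\<^sub>R x) \<in> borel_measurable lborel" by simp
  have lb: "lborel = density (distr lborel borel (\<lambda>x :: real \<times> real. t + c *\<^sub>R x)) (\<lambda>_. ennreal (c\<^sup>2))"
    using lborel_affine[of c t] c by (simp add: power2_eq_square)
  have "integrable lborel f \<longleftrightarrow> integrable (density (distr lborel borel (\<lambda>x. t + c *\<^sub>R x)) (\<lambda>_. ennreal (c\<^sup>2))) f"
    by (subst lb) simp
  also have "\<dots> \<longleftrightarrow> integrable (distr lborel borel (\<lambda>x. t + c *\<^sub>R x)) (\<lambda>x. c\<^sup>2 *\<^sub>R f x)"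
    by (rule integrable_density) (use f in auto)
  also have "\<dots> \<longleftrightarrow> integrable lborel (\<lambda>x. c\<^sup>2 *\<^sub>R f (t + c *\<^sub>R x))"
    by (rule integrable_distr_eq[OF T]) (use f in auto)
  also have "\<dots> \<longleftrightarrow> integrable lborel (\<lambda>x. f (t + c *\<^sub>R x))"
    using c integrable_scaleR_right[of "1 / c\<^sup>2" lborel "\<lambda>x. c\<^sup>2 *\<^sub>R f (t + c *\<^sub>R x)"]
      integrable_scaleR_right[of "c\<^sup>2" lborel "\<lambda>x. f (t + c *\<^sub>R x)"] by auto
  finally show "integrable lborel (\<lambda>x. f (t + c *\<^sub>R x)) \<longleftrightarrow> integrable lborel f" ..
  have "integral\<^sup>L lborel f = integral\<^sup>L (density (distr lborel borel (\<lambda>x. t + c *\<^sub>R x)) (\<lambda>_. ennreal (c\<^sup>2))) f"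
    by (subst lb) simp
  also have "\<dots> = (\<integral>x. c\<^sup>2 *\<^sub>R f x \<partial>distr lborel borel (\<lambda>x. t + c *\<^sub>R x))"
    by (rule integral_density) (use f in auto)
  also have "\<dots> = (\<integral>x. c\<^sup>2 *\<^sub>R f (t + c *\<^sub>R x) \<partial>lborel)"
    by (rule integral_distr[OF T]) (use f in auto)
  finally show "(\<integral>x. f (t + c *\<^sub>R x) \<partial>lborel) = (\<integral>x. f x \<partial>lborel) /\<^sub>R c\<^sup>2" using c by simp
qed

lemma affine_L2:
  fixes f :: "real \<times> real \<Rightarrow> 'b::euclidean_space"
  assumes f: "f \<in> L2 lborel" and c: "0 < c"
  shows "(\<lambda>x. f (t + c *\<^sub>R x)) \<in> L2 lborel"
    "(\<integral>x. (norm (f (t + c *\<^sub>R x)))\<^sup>2 \<partial>lborel) = (\<integral>x. (norm (f x))\<^sup>2 \<partial>lborel) / c\<^sup>2"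
proof -
  have fm: "f \<in> borel_measurable borel" using L2_measurable[OF f] by simp
  have [measurable]: "(\<lambda>x. (norm (f x))\<^sup>2) \<in> borel_measurable borel" using fm by measurable
  have "(\<lambda>x. f (t + c *\<^sub>R x)) \<in> borel_measurable borel"
    using measurable_compose[OF _ fm, of "\<lambda>x. t + c *\<^sub>R x" borel] by simp
  then show "(\<lambda>x. f (t + c *\<^sub>R x)) \<in> L2 lborel"
    using affine_integral(1)[of "\<lambda>x. (norm (f x))\<^sup>2", OF _ c] L2_integrable_square[OF f] by (simp add: L2_def)
  show "(\<integral>x. (norm (f (t + c *\<^sub>R x)))\<^sup>2 \<partial>lborel) = (\<integral>x. (norm (f x))\<^sup>2 \<partial>lborel) / c\<^sup>2"
    using affine_integral(2)[of "\<lambda>x. (norm (f x))\<^sup>2", OF _ c] by (simp add: divide_inverse_commute)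
qed

definition dil :: "real \<times> real \<Rightarrow> real \<Rightarrow> real \<times> real \<Rightarrow> real \<times> real" where
  "dil y c w = y + c *\<^sub>R (w - y)"

lemma dil_affine: "dil y c w = (y - c *\<^sub>R y) + c *\<^sub>R w"
  by (simp add: dil_def algebra_simps)

lemma dil_inverse: "c \<noteq> 0 \<Longrightarrow> dil y c (dil y (1 / c) z) = z" "c \<noteq> 0 \<Longrightarrow> dil y (1 / c) (dil y c z) = z"
  by (simp_all add: dil_def)

lemma dil_1 [simp]: "dil y 1 w = w"
  by (simp add: dil_def)

lemma pd_dilation: "F \<in> planar \<Longrightarrow> pd v (\<lambda>w. F (dil y c w)) w = c * pd v F (dil y c w)"
proof -
  assume F: "F \<in> planar"
  have "((\<lambda>w. dil y c w) has_derivative (\<lambda>v. c *\<^sub>R v)) (at w)"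
    unfolding dil_def by (auto intro!: derivative_eq_intros)
  from has_derivative_compose[OF this planar_has_derivative[OF F]]
  show ?thesis by (subst pd_eq) (simp_all add: pd_planar_vec[OF F, of v] algebra_simps)
qed

lemma dil_deriv:
  assumes F: "F \<in> planar"
  shows "((\<lambda>c. c\<^sup>2 * F (dil y c w)) has_real_derivative
     2 * c * F (dil y c w) + c\<^sup>2 * (fst (w - y) * pd (1, 0) F (dil y c w) + snd (w - y) * pd (0, 1) F (dil y c w))) (at c)"
proof -
  have "((\<lambda>c. dil y c w) has_derivative (\<lambda>h. h *\<^sub>R (w - y))) (at c)"
    unfolding dil_def by (auto intro!: derivative_eq_intros)
  from has_derivative_compose[OF this planar_has_derivative[OF F]]
  have "((\<lambda>c. F (dil y c w)) has_real_derivative fst (w - y) * pd (1, 0) F (dil y c w) + snd (w - y) * pd (0, 1) F (dil y c w)) (at c)"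
    unfolding has_field_derivative_def
    by (rule has_derivative_eq_rhs) (simp add: fun_eq_iff algebra_simps)
  then show ?thesis by (auto intro!: derivative_eq_intros simp: algebra_simps)
qed

locale convex_cutoff_domain = cutoff_domain D cut for D cut +
  assumes convex_D: "convex D"
begin

lemma dil_in_D: "y \<in> D \<Longrightarrow> z \<in> D \<Longrightarrow> 1 \<le> c \<Longrightarrow> dil y (1 / c) z \<in> D"
proof -
  assume a: "y \<in> D" "z \<in> D" "1 \<le> c"
  have "(1 - 1 / c) *\<^sub>R y + (1 / c) *\<^sub>R z \<in> D"
    by (rule convexD_alt[OF convex_D]) (use a in auto)
  then show ?thesis by (simp add: dil_def algebra_simps)
qed

text \<open>Composition with an expansion contracts the support towards the centre \<open>y\<close>,
  and convexity keeps the contracted support inside \<open>D\<close>. This is how convexity replaces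
  boundary regularity.\<close>

lemma test_dil:
  assumes F: "F \<in> test_planar D" and y: "y \<in> D" and c: "1 \<le> c"
  shows "(\<lambda>w. F (dil y c w)) \<in> test_planar D"
proof -
  obtain K where K: "F \<in> planar" "compact K" "K \<subseteq> D" "\<And>z. z \<notin> K \<Longrightarrow> F z = 0"
    using F unfolding test_planar_def by auto
  have "(\<lambda>w. F (dil y c w)) \<in> planar"
    using planar_dilation[OF K(1), of c "y - c *\<^sub>R y"] by (simp add: dil_affine add.commute)
  moreover have "compact (dil y (1 / c) ` K)"
    unfolding dil_def by (intro compact_continuous_image continuous_intros K)
  moreover have "dil y (1 / c) ` K \<subseteq> D" using dil_in_D[OF y _ c] K(3) by auto
  moreover have "F (dil y c w) = 0" if "w \<notin> dil y (1 / c) ` K" for w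
  proof (rule K(4))
    show "dil y c w \<notin> K" using that dil_inverse(2)[of c y w] c by force
  qed
  ultimately show ?thesis unfolding test_planar_def by (auto intro!: exI[of _ "dil y (1 / c) ` K"])
qed

text \<open>The pairing of \<open>U\<close> with a dilated test function is differentiable in the dilation factor, and
  the derivative of the dilated test function is a divergence; this moves the derivative onto \<open>U\<close>.\<close>
lemma dilation_pairing:
  assumes UG: "weak_gradient D U G" and F: "F \<in> test_planar D" and y: "y \<in> D" and c: "1 \<le> c" "c \<le> 2"
  shows "\<bar>(\<integral>w. U w * (c\<^sup>2 * F (dil y c w)) \<partial>lborel) - (\<integral>w. U w * F w \<partial>lborel)\<bar>
    \<le> (c - 1) * 2 * sqrt (\<integral>z. (norm (G z))\<^sup>2 \<partial>lborel) * sqrt (\<integral>z. (F z)\<^sup>2 \<partial>lborel)"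
proof -
  have U: "U \<in> L2 lborel" and G: "G \<in> L2 lborel" and off: "\<And>z. z \<notin> D \<Longrightarrow> U z = 0"
    and wk: "\<And>F b. F \<in> test_planar D \<Longrightarrow> b \<in> Basis \<Longrightarrow> (\<integral>z. U z * pd b F z \<partial>lborel) = - (\<integral>z. (G z \<bullet> b) * F z \<partial>lborel)"
    using UG by (auto simp: weak_gradient_def)
  have Fp: "F \<in> planar" using F by (simp add: test_planar_def)
  define F1 where "F1 = pd (1, 0) F"
  define F2 where "F2 = pd (0, 1) F"
  have F12: "F1 \<in> test_planar D" "F2 \<in> test_planar D" by (auto simp: F1_def F2_def test_planar_pd F)
  define \<Psi> where "\<Psi> c w = c\<^sup>2 * F (dil y c w)" for c w
  define \<Psi>' where "\<Psi>' c w = 2 * c * F (dil y c w) + c\<^sup>2 * (fst (w - y) * F1 (dil y c w) + snd (w - y) * F2 (dil y c w))" for c w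
  define \<phi> where "\<phi> c = (\<integral>w. U w * \<Psi> c w \<partial>lborel)" for c
  define d where "d c = (\<integral>w. U w * \<Psi>' c w \<partial>lborel)" for c
  have \<Psi>_deriv: "((\<lambda>c. \<Psi> c w) has_real_derivative \<Psi>' c w) (at c)" for c w
    unfolding \<Psi>_def \<Psi>'_def F1_def F2_def by (rule dil_deriv[OF Fp])
  obtain B0 where B0: "0 \<le> B0" "\<And>z. \<bar>F z\<bar> \<le> B0" using test_planar_bounded[OF F] by metis
  obtain B1 where B1: "0 \<le> B1" "\<And>z. \<bar>F1 z\<bar> \<le> B1" using test_planar_bounded[OF F12(1)] by metis
  obtain B2 where B2: "0 \<le> B2" "\<And>z. \<bar>F2 z\<bar> \<le> B2" using test_planar_bounded[OF F12(2)] by metis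
  \<comment> \<open>A bound for the derivative in \<open>c\<close> on the open interval
    \<open>(0, 3)\<close> around \<open>[1, 2]\<close>: there \<open>2 c < 6\<close> and
    \<open>c^2 < 9\<close>, and the coordinates of \<open>w - y\<close> are at most 1 in modulus
    because both points lie in the unit square.\<close>
  define B where "B = 6 * B0 + 9 * (B1 + B2)"
  have diff1: "\<bar>fst (w - y)\<bar> \<le> 1" "\<bar>snd (w - y)\<bar> \<le> 1" if "w \<in> D" for w
  proof -
    have "w \<in> unit_square" "y \<in> unit_square" using that y D_unit by auto
    then show "\<bar>fst (w - y)\<bar> \<le> 1" "\<bar>snd (w - y)\<bar> \<le> 1" by (auto simp: abs_le_iff)
  qed
  have \<Psi>'_bound: "\<bar>\<Psi>' c w\<bar> \<le> B" if "w \<in> D" "c \<in> {0<..<3}" for c w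
  proof -
    have "\<bar>2 * c * F (dil y c w)\<bar> \<le> 6 * B0"
      using mult_mono[of "2 * c" 6 "\<bar>F (dil y c w)\<bar>" B0] B0 that by (simp add: abs_mult)
    moreover have "\<bar>c\<^sup>2 * (fst (w - y) * F1 (dil y c w) + snd (w - y) * F2 (dil y c w))\<bar> \<le> 9 * (B1 + B2)"
    proof -
      have "\<bar>fst (w - y) * F1 (dil y c w)\<bar> \<le> 1 * B1"
        unfolding abs_mult by (rule mult_mono) (use diff1[OF that(1)] B1 in auto)
      moreover have "\<bar>snd (w - y) * F2 (dil y c w)\<bar> \<le> 1 * B2"
        unfolding abs_mult by (rule mult_mono) (use diff1[OF that(1)] B2 in auto)
      ultimately have 1: "\<bar>fst (w - y) * F1 (dil y c w) + snd (w - y) * F2 (dil y c w)\<bar> \<le> B1 + B2" by linarith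
      have "c\<^sup>2 \<le> 3\<^sup>2" using that by (intro power_mono) auto
      then show ?thesis unfolding abs_mult using 1 B1 B2
        by (intro mult_mono) auto
    qed
    ultimately show ?thesis unfolding \<Psi>'_def B_def by linarith
  qed
  have Lip: "\<bar>\<Psi> c' w - \<Psi> c w\<bar> \<le> B * \<bar>c' - c\<bar>" if "w \<in> D" "c \<in> {0<..<3}" "c' \<in> {0<..<3}" for c c' w
    using field_differentiable_bound[of "{0<..<3}" "\<lambda>c. \<Psi> c w" "\<lambda>c. \<Psi>' c w" B c' c]
      \<Psi>_deriv[THEN has_field_derivative_at_within] \<Psi>'_bound that by auto
  have B: "0 \<le> B" using B0 B1 B2 by (simp add: B_def)
  have meas: "(\<lambda>w. H (dil y c w)) \<in> borel_measurable borel" if "H \<in> planar" for H c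
    unfolding dil_def using measurable_compose[OF _ planar_measurable[OF that], of "\<lambda>w. y + c *\<^sub>R (w - y)" borel] by simp
  have m\<Psi>: "\<Psi> c \<in> borel_measurable borel" for c unfolding \<Psi>_def using meas[OF Fp] by measurable
  have m\<Psi>': "\<Psi>' c \<in> borel_measurable borel" for c
    unfolding \<Psi>'_def using meas[OF Fp, of c] meas[of F1 c] meas[of F2 c] F12
      planar_measurable[OF planar_diff[OF planar.fst planar.const, of "fst y"]]
      planar_measurable[OF planar_diff[OF planar.snd planar.const, of "snd y"]]
    by (auto simp: test_planar_def intro!: borel_measurable_add borel_measurable_times borel_measurable_const)
  have U\<Psi>_int: "integrable lborel (\<lambda>w. U w * \<Psi> c w)" for c
  proof -
    have "(\<lambda>w. indicator D w * \<Psi> c w) \<in> L2 lborel"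
    proof (rule bounded_L2)
      show "(\<lambda>w. indicator D w * \<Psi> c w) \<in> borel_measurable borel" using m\<Psi> by measurable
      show "norm (indicator D w * \<Psi> c w) \<le> (c\<^sup>2 * B0) * indicator D w" for w
        using B0 by (auto simp: \<Psi>_def indicator_def abs_mult mult_left_mono)
    qed
    from L2_integrable_inner[OF U this] have "integrable lborel (\<lambda>w. U w * (indicator D w * \<Psi> c w))" by simp
    moreover have "(\<lambda>w. U w * (indicator D w * \<Psi> c w)) = (\<lambda>w. U w * \<Psi> c w)"
      using off by (auto simp: indicator_def fun_eq_iff)
    ultimately show ?thesis by simp
  qed
  have Um: "U \<in> borel_measurable borel" using L2_measurable[OF U] by simp
  have U_int: "integrable lborel U"
  proof -
    have "integrable lborel (\<lambda>w. U w * indicator D w)"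
      using L2_integrable_inner[OF U indicator_D_L2] by simp
    moreover have "(\<lambda>w. U w * indicator D w) = U" using off by (auto simp: indicator_def fun_eq_iff)
    ultimately show ?thesis by simp
  qed
  \<comment> \<open>Differentiation under the integral sign; the Lipschitz bound in \<open>c\<close>
    dominates the difference quotients by a multiple of the integrable function
    \<open>|U|\<close>.\<close>
  have \<phi>_deriv: "(\<phi> has_real_derivative d c) (at c)" if c: "c \<in> {0<..<3}" for c
  proof -
    have "((\<lambda>c'. (\<phi> c' - \<phi> c) / (c' - c)) \<longlongrightarrow> d c) (at c within {0<..<3})"
      unfolding tendsto_at_iff_sequentially
    proof safe
      fix X assume X: "\<forall>i. X i \<in> {0<..<3} - {c}" "X \<longlonglongrightarrow> c"
      have eq: "(\<phi> (X i) - \<phi> c) / (X i - c) = (\<integral>w. U w * ((\<Psi> (X i) w - \<Psi> c w) / (X i - c)) \<partial>lborel)" for i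
      proof -
        have "\<phi> (X i) - \<phi> c = (\<integral>w. U w * \<Psi> (X i) w - U w * \<Psi> c w \<partial>lborel)"
          unfolding \<phi>_def by (rule Bochner_Integration.integral_diff[OF U\<Psi>_int U\<Psi>_int, symmetric])
        then have "(\<phi> (X i) - \<phi> c) / (X i - c) = (\<integral>w. (U w * \<Psi> (X i) w - U w * \<Psi> c w) / (X i - c) \<partial>lborel)"
          by simp
        then show ?thesis by (simp only: right_diff_distrib[symmetric] times_divide_eq_right)
      qed
      show "((\<lambda>c'. (\<phi> c' - \<phi> c) / (c' - c)) \<circ> X) \<longlonglongrightarrow> d c"
        unfolding o_def eq d_def
      proof (rule integral_dominated_convergence[where w = "\<lambda>w. B * \<bar>U w\<bar>"])
        show "(\<lambda>w. U w * \<Psi>' c w) \<in> borel_measurable lborel" using Um m\<Psi>'[of c] by simp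
        show "(\<lambda>w. U w * ((\<Psi> (X i) w - \<Psi> c w) / (X i - c))) \<in> borel_measurable lborel" for i
          using Um m\<Psi>[of c] m\<Psi>[of "X i"] by simp
        show "integrable lborel (\<lambda>w. B * \<bar>U w\<bar>)" using U_int by simp
        have "(\<lambda>i. U w * ((\<Psi> (X i) w - \<Psi> c w) / (X i - c))) \<longlonglongrightarrow> U w * \<Psi>' c w" for w
        proof -
          have "((\<lambda>c'. (\<Psi> c' w - \<Psi> c w) / (c' - c)) \<longlongrightarrow> \<Psi>' c w) (at c)"
            using \<Psi>_deriv[of w c] by (simp add: has_field_derivative_iff)
          then have "((\<lambda>c'. (\<Psi> c' w - \<Psi> c w) / (c' - c)) \<circ> X) \<longlonglongrightarrow> \<Psi>' c w"
            using X unfolding tendsto_at_iff_sequentially by auto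
          then show ?thesis by (intro tendsto_mult tendsto_const) (simp add: o_def)
        qed
        then show "AE w in lborel. (\<lambda>i. U w * ((\<Psi> (X i) w - \<Psi> c w) / (X i - c))) \<longlonglongrightarrow> U w * \<Psi>' c w" by simp
        have "norm (U w * ((\<Psi> (X i) w - \<Psi> c w) / (X i - c))) \<le> B * \<bar>U w\<bar>" for i w
        proof (cases "w \<in> D")
          case True
          have "\<bar>(\<Psi> (X i) w - \<Psi> c w) / (X i - c)\<bar> \<le> B"
            using Lip[OF True c, of "X i"] X(1)[rule_format, of i] by (simp add: divide_le_eq)
          then show ?thesis unfolding real_norm_def abs_mult
            using mult_left_mono[of "\<bar>(\<Psi> (X i) w - \<Psi> c w) / (X i - c)\<bar>" B "\<bar>U w\<bar>"] by (simp add: mult.commute)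
        next
          case False then show ?thesis using off by simp
        qed
        then show "AE w in lborel. norm (U w * ((\<Psi> (X i) w - \<Psi> c w) / (X i - c))) \<le> B * \<bar>U w\<bar>" for i by simp
      qed
    qed
    then show ?thesis unfolding has_field_derivative_iff
      using tendsto_within_open[OF c open_greaterThanLessThan] by blast
  qed
  have F_L2: "F \<in> L2 lborel" by (rule test_planar_L2[OF F])
  define N where "N = 2 * sqrt (\<integral>z. (norm (G z))\<^sup>2 \<partial>lborel) * sqrt (\<integral>z. (F z)\<^sup>2 \<partial>lborel)"
  have d_bound: "\<bar>d c\<bar> \<le> N" if c: "1 \<le> c" for c
  proof -
    define V where "V w = (c * F (dil y c w)) *\<^sub>R (w - y)" for w
    define P where "P w = F (dil y c w)" for w
    have P: "P \<in> test_planar D" unfolding P_def by (rule test_dil[OF F y c])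
    have Pp: "P \<in> planar" using P by (simp add: test_planar_def)
    have lin: "(\<lambda>w. c * (fst w - fst y)) \<in> planar" "(\<lambda>w. c * (snd w - snd y)) \<in> planar"
      by (intro planar_intros)+
    have pd_lin: "pd v (\<lambda>w. c * (fst w - fst y)) w = c * fst v" "pd v (\<lambda>w. c * (snd w - snd y)) w = c * snd v" for v w
      by (rule pd_eq; auto intro!: derivative_eq_intros)+
    define V1 where "V1 w = c * (fst w - fst y) * P w" for w
    define V2 where "V2 w = c * (snd w - snd y) * P w" for w
    have V12: "V1 \<in> test_planar D" "V2 \<in> test_planar D"
      unfolding V1_def V2_def by (intro test_planar_mult lin P)+
    have pdP: "pd v P w = c * pd v F (dil y c w)" for v w
      unfolding P_def by (rule pd_dilation[OF Fp])
    \<comment> \<open>The derivative in \<open>c\<close> is the divergence of the field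
      \<open>c F(dil y c w) (w - y)\<close>: the divergence of \<open>w - y\<close> is 2, matching
      the derivative of the factor \<open>c^2\<close>.\<close>
    have div: "\<Psi>' c w = pd (1, 0) V1 w + pd (0, 1) V2 w" for w
      unfolding V1_def V2_def pd_mult[OF lin(1) Pp] pd_mult[OF lin(2) Pp] pd_lin pdP
      by (simp add: \<Psi>'_def P_def F1_def F2_def power2_eq_square algebra_simps)
    have i1: "integrable lborel (\<lambda>w. U w * pd (1, 0) V1 w)" "integrable lborel (\<lambda>w. U w * pd (0, 1) V2 w)"
      using L2_integrable_inner[OF U test_planar_L2[OF test_planar_pd[OF V12(1)]]]
        L2_integrable_inner[OF U test_planar_L2[OF test_planar_pd[OF V12(2)]]] by simp_all
    have Gb: "(\<lambda>z. G z \<bullet> b) \<in> L2 lborel" if "b \<in> Basis" for b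
      by (rule L2_bound[OF G]) (use L2_measurable[OF G] that Basis_le_norm[OF that] in auto)
    have i2: "integrable lborel (\<lambda>z. (G z \<bullet> (1, 0)) * V1 z)" "integrable lborel (\<lambda>z. (G z \<bullet> (0, 1)) * V2 z)"
      using L2_integrable_inner[OF Gb test_planar_L2[OF V12(1)], of "(1, 0)"]
        L2_integrable_inner[OF Gb test_planar_L2[OF V12(2)], of "(0, 1)"] by (simp_all add: Basis_real_prod)
    have "d c = (\<integral>w. U w * pd (1, 0) V1 w + U w * pd (0, 1) V2 w \<partial>lborel)"
      unfolding d_def div by (simp add: distrib_left)
    also have "\<dots> = (\<integral>w. U w * pd (1, 0) V1 w \<partial>lborel) + (\<integral>w. U w * pd (0, 1) V2 w \<partial>lborel)"
      by (rule Bochner_Integration.integral_add[OF i1])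
    also have "\<dots> = - ((\<integral>z. (G z \<bullet> (1, 0)) * V1 z \<partial>lborel) + (\<integral>z. (G z \<bullet> (0, 1)) * V2 z \<partial>lborel))"
      using wk[OF V12(1), of "(1, 0)"] wk[OF V12(2), of "(0, 1)"] by (simp add: Basis_real_prod)
    also have "\<dots> = - (\<integral>z. (G z \<bullet> (1, 0)) * V1 z + (G z \<bullet> (0, 1)) * V2 z \<partial>lborel)"
      by (simp only: Bochner_Integration.integral_add[OF i2])
    also have "(\<lambda>z. (G z \<bullet> (1, 0)) * V1 z + (G z \<bullet> (0, 1)) * V2 z) = (\<lambda>z. G z \<bullet> V z)"
      by (auto simp: V_def V1_def V2_def P_def inner_prod_def algebra_simps)
    finally have dc: "d c = - (\<integral>z. G z \<bullet> V z \<partial>lborel)" .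
    have cF: "(\<lambda>w. c * F (dil y c w)) \<in> L2 lborel"
      using subspace_scale[OF L2_subspace test_planar_L2[OF P], of c] by (simp add: scaleR_fun_def P_def)
    have c2F: "(\<lambda>w. 2 * (c * F (dil y c w))) \<in> L2 lborel"
      using subspace_scale[OF L2_subspace cF, of 2] by (simp add: scaleR_fun_def)
    \<comment> \<open>The crude bound 2 for distances in the unit square is the source of the factor
      2 in the estimate. The factor \<open>c\<close> is absorbed by the change of variables, which
      divides the squared norm by \<open>c^2\<close>.\<close>
    have V_le: "norm (V w) \<le> \<bar>2 * (c * F (dil y c w))\<bar>" for w
    proof (cases "w \<in> D")
      case True
      have "norm (w - y) \<le> \<bar>fst (w - y)\<bar> + \<bar>snd (w - y)\<bar>"
        using norm_Pair_le[of "fst (w - y)" "snd (w - y)"] by (simp only: prod.collapse real_norm_def)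
      then have "norm (w - y) \<le> 2" using diff1[OF True] by linarith
      then show ?thesis using mult_left_mono[of "norm (w - y)" 2 "\<bar>c * F (dil y c w)\<bar>"] by (simp add: V_def abs_mult mult.commute)
    next
      case False
      then show ?thesis using test_planar_zero[OF P] by (simp add: V_def P_def)
    qed
    have V: "V \<in> L2 lborel"
    proof (rule L2_bound[OF c2F])
      show "V \<in> borel_measurable lborel" unfolding V_def using meas[OF Fp, of c] by measurable
    qed (use V_le in simp)
    have N1: "(\<integral>w. (norm (V w))\<^sup>2 \<partial>lborel) \<le> (\<integral>w. (norm (2 * (c * F (dil y c w))))\<^sup>2 \<partial>lborel)"
      by (rule integral_mono[OF L2_integrable_square[OF V] L2_integrable_square[OF c2F]])
         (rule power_mono, use V_le in \<open>simp_all only: real_norm_def norm_ge_zero\<close>)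
    also have "\<dots> = (2 * c)\<^sup>2 * (\<integral>w. (norm (F (dil y c w)))\<^sup>2 \<partial>lborel)"
      unfolding real_norm_def power2_abs mult.assoc[symmetric] power_mult_distrib[of "2 * c"] by simp
    also have "\<dots> = 2\<^sup>2 * (\<integral>z. (F z)\<^sup>2 \<partial>lborel)"
      using affine_L2(2)[OF F_L2, of c "y - c *\<^sub>R y"] c by (simp add: dil_affine power_mult_distrib field_simps)
    finally have "sqrt (\<integral>w. (norm (V w))\<^sup>2 \<partial>lborel) \<le> sqrt (2\<^sup>2 * (\<integral>z. (F z)\<^sup>2 \<partial>lborel))" by simp
    then have "sqrt (\<integral>w. (norm (V w))\<^sup>2 \<partial>lborel) \<le> 2 * sqrt (\<integral>z. (F z)\<^sup>2 \<partial>lborel)"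
      by (simp add: real_sqrt_mult)
    then have "sqrt (\<integral>z. (norm (G z))\<^sup>2 \<partial>lborel) * sqrt (\<integral>w. (norm (V w))\<^sup>2 \<partial>lborel) \<le> N"
      using mult_left_mono[of _ _ "sqrt (\<integral>z. (norm (G z))\<^sup>2 \<partial>lborel)"] by (fastforce simp: N_def mult_ac)
    then show ?thesis using L2_Cauchy_Schwarz[OF G V] by (simp add: dc)
  qed
  have "\<bar>\<phi> c - \<phi> 1\<bar> \<le> N * (c - 1)"
    using field_differentiable_bound[of "{1..c}" \<phi> d N c 1] \<phi>_deriv[THEN has_field_derivative_at_within] d_bound c by auto
  then have "\<bar>\<phi> c - \<phi> 1\<bar> \<le> (c - 1) * N" by (simp only: mult.commute)
  moreover have "(c - 1) * N = (c - 1) * 2 * sqrt (\<integral>z. (norm (G z))\<^sup>2 \<partial>lborel) * sqrt (\<integral>z. (F z)\<^sup>2 \<partial>lborel)"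
    unfolding N_def by (simp only: mult.assoc)
  ultimately show ?thesis by (simp only: \<phi>_def \<Psi>_def dil_1 power_one mult_1)
qed

text \<open>Substituting \<open>w = dil y (1/c) z\<close> turns the pairing of the dilated
  \<open>U\<close> with a test function into the pairing of \<open>U\<close> with
  \<open>c^2 F(dil y c w)\<close>, the factor being the Jacobian. \<open>dilation_pairing\<close>
  and duality then give an \<open>L^2\<close> bound that is linear in \<open>c - 1\<close> and
  uniform in the centre \<open>y\<close>.\<close>

lemma dilation_estimate:
  assumes UG: "weak_gradient D U G" and y: "y \<in> D" and c: "1 \<le> c" "c \<le> 2"
  shows "(\<integral>z. (indicator D z * U (dil y (1 / c) z) - U z)\<^sup>2 \<partial>lborel)
    \<le> ((c - 1) * 2)\<^sup>2 * (\<integral>z. (norm (G z))\<^sup>2 \<partial>lborel)"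
    "(\<lambda>z. indicator D z * U (dil y (1 / c) z) - U z) \<in> L2 lborel"
proof -
  have U: "U \<in> L2 lborel" and off: "\<And>z. z \<notin> D \<Longrightarrow> U z = 0"
    using UG by (auto simp: weak_gradient_def)
  have Um: "U \<in> borel_measurable borel" using L2_measurable[OF U] by simp
  have Ud: "(\<lambda>z. U (dil y (1 / c) z)) \<in> L2 lborel"
    unfolding dil_affine by (rule affine_L2(1)[OF U]) (use c in simp)
  have L1: "(\<lambda>z. indicator D z * U (dil y (1 / c) z)) \<in> L2 lborel"
    by (rule L2_bound[OF Ud]) (use L2_measurable[OF Ud] in \<open>auto simp: indicator_def\<close>)
  show L: "(\<lambda>z. indicator D z * U (dil y (1 / c) z) - U z) \<in> L2 lborel" by (rule L2_diff[OF L1 U])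
  have "(\<integral>z. (indicator D z * U (dil y (1 / c) z) - U z)\<^sup>2 \<partial>lborel)
      \<le> ((c - 1) * 2 * sqrt (\<integral>z. (norm (G z))\<^sup>2 \<partial>lborel))\<^sup>2"
  proof (rule norm_by_duality[OF L])
    fix F assume F: "F \<in> test_planar D"
    have Fm: "F \<in> borel_measurable borel" by (rule test_planar_measurable[OF F])
    note FL = test_planar_L2[OF F]
    have "(\<integral>z. (indicator D z * U (dil y (1 / c) z) - U z) * F z \<partial>lborel)
        = (\<integral>z. indicator D z * U (dil y (1 / c) z) * F z - U z * F z \<partial>lborel)"
      by (simp add: left_diff_distrib)
    also have "\<dots> = (\<integral>z. indicator D z * U (dil y (1 / c) z) * F z \<partial>lborel) - (\<integral>z. U z * F z \<partial>lborel)"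
      using L2_integrable_inner[OF L1 FL] L2_integrable_inner[OF U FL]
      by (intro Bochner_Integration.integral_diff) simp_all
    also have "(\<lambda>z. indicator D z * U (dil y (1 / c) z) * F z) = (\<lambda>z. U (dil y (1 / c) z) * F (dil y c (dil y (1 / c) z)))"
    proof
      fix z
      show "indicator D z * U (dil y (1 / c) z) * F z = U (dil y (1 / c) z) * F (dil y c (dil y (1 / c) z))"
        using test_planar_zero[OF F, of z] c by (cases "z \<in> D") (simp_all add: dil_inverse)
    qed
    also have "(\<integral>z. U (dil y (1 / c) z) * F (dil y c (dil y (1 / c) z)) \<partial>lborel) = (\<integral>w. U w * (c\<^sup>2 * F (dil y c w)) \<partial>lborel)"
    proof -
      have "(\<lambda>w. U w * F (dil y c w)) \<in> borel_measurable borel"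
        unfolding dil_def using Um measurable_compose[OF _ Fm, of "\<lambda>w. y + c *\<^sub>R (w - y)" borel] by simp
      from affine_integral(2)[OF this, of "1 / c" "y - (1 / c) *\<^sub>R y"]
      have "(\<integral>z. U (dil y (1 / c) z) * F (dil y c (dil y (1 / c) z)) \<partial>lborel) = c\<^sup>2 * (\<integral>w. U w * F (dil y c w) \<partial>lborel)"
        using c by (simp add: dil_affine[of y "1 / c"] power_divide)
      also have "\<dots> = (\<integral>w. c\<^sup>2 * (U w * F (dil y c w)) \<partial>lborel)" by simp
      finally show ?thesis by (simp only: mult.left_commute)
    qed
    finally show "\<bar>\<integral>z. (indicator D z * U (dil y (1 / c) z) - U z) * F z \<partial>lborel\<bar>
        \<le> (c - 1) * 2 * sqrt (\<integral>z. (norm (G z))\<^sup>2 \<partial>lborel) * sqrt (\<integral>z. (F z)\<^sup>2 \<partial>lborel)"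
      using dilation_pairing[OF UG F y c] by simp
  qed (use off in simp)
  also have "\<dots> = ((c - 1) * 2)\<^sup>2 * (\<integral>z. (norm (G z))\<^sup>2 \<partial>lborel)"
    by (simp add: power_mult_distrib)
  finally show "(\<integral>z. (indicator D z * U (dil y (1 / c) z) - U z)\<^sup>2 \<partial>lborel)
    \<le> ((c - 1) * 2)\<^sup>2 * (\<integral>z. (norm (G z))\<^sup>2 \<partial>lborel)" .
qed

end

section \<open>Weak convergence tested on boxes, and averaged dilations\<close>

definition rational_box :: "nat \<Rightarrow> (real \<times> real) set" where
  "rational_box n = (case from_nat n :: (rat \<times> rat) \<times> (rat \<times> rat) of
     ((a, b), (c, d)) \<Rightarrow> cbox (of_rat a, of_rat b) (of_rat c, of_rat d))"

lemma rational_box_exhausts: "\<exists>n. rational_box n = cbox (of_rat a, of_rat b) (of_rat c, of_rat d)"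
  by (rule exI[of _ "to_nat ((a, b), (c, d))"]) (simp add: rational_box_def)

lemma rational_box_sets [measurable]: "rational_box n \<in> sets borel"
  by (simp add: rational_box_def split: prod.split)

context convex_cutoff_domain begin

text \<open>Rational boxes shrink to the given closed box from outside; at every point their
  indicators are eventually equal to its indicator, so no exceptional null set has to be
  discussed.\<close>

lemma rational_box_approx:
  assumes "0 < \<epsilon>"
  shows "\<exists>n. (\<integral>z. ((indicator (rational_box n) z - indicator (cbox a b) z) * indicator D z)\<^sup>2 \<partial>lborel) < (\<epsilon>::real)"
proof -
  have "\<exists>q. x - 1 / real (Suc k) < of_rat q \<and> of_rat q < x" for x :: real and k
    by (rule of_rat_dense) simp
  then obtain lo where lo: "\<And>x k. x - 1 / real (Suc k) < of_rat (lo x k)" "\<And>x k. of_rat (lo x k) < (x::real)" by metis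
  have "\<exists>q. x < of_rat q \<and> of_rat q < x + 1 / real (Suc k)" for x :: real and k
    by (rule of_rat_dense) simp
  then obtain hi where hi: "\<And>x k. of_rat (hi x k) < x + 1 / real (Suc k)" "\<And>x k. (x::real) < of_rat (hi x k)" by metis
  define B where "B k = (cbox (of_rat (lo (fst a) k), of_rat (lo (snd a) k)) (of_rat (hi (fst b) k), of_rat (hi (snd b) k)) :: (real \<times> real) set)" for k
  have ev: "\<forall>\<^sub>F k in sequentially. (indicator (B k) z :: real) = indicator (cbox a b) z" for z
  proof (cases "z \<in> cbox a b")
    case True
    then have "z \<in> B k" for k
      using lo(2)[of "fst a" k] lo(2)[of "snd a" k] hi(2)[of "fst b" k] hi(2)[of "snd b" k]
      by (cases a; cases b; cases z) (auto simp: B_def intro: less_imp_le order_trans)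
    then show ?thesis using True by simp
  next
    case False
    have lim: "(\<lambda>k. 1 / real (Suc k)) \<longlonglongrightarrow> 0" by real_asymp
    have small: "\<forall>\<^sub>F k in sequentially. 1 / real (Suc k) < d" if "0 < d" for d
      by (rule order_tendstoD(2)[OF lim that])
    have "\<forall>\<^sub>F k in sequentially. z \<notin> B k"
    proof -
      consider "fst z < fst a" | "fst b < fst z" | "snd z < snd a" | "snd b < snd z"
        using False by (cases a; cases b; cases z) force
      then show ?thesis
      proof cases
        case 1
        then have "0 < fst a - fst z" by simp
        from small[OF this] show ?thesis
        proof eventually_elim
          case (elim k) then show ?case using lo(1)[of "fst a" k] by (cases z) (auto simp: B_def)
        qed
      next
        case 2
        then have "0 < fst z - fst b" by simp
        from small[OF this] show ?thesis
        proof eventually_elim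
          case (elim k) then show ?case using hi(1)[of "fst b" k] by (cases z) (auto simp: B_def)
        qed
      next
        case 3
        then have "0 < snd a - snd z" by simp
        from small[OF this] show ?thesis
        proof eventually_elim
          case (elim k) then show ?case using lo(1)[of "snd a" k] by (cases z) (auto simp: B_def)
        qed
      next
        case 4
        then have "0 < snd z - snd b" by simp
        from small[OF this] show ?thesis
        proof eventually_elim
          case (elim k) then show ?case using hi(1)[of "snd b" k] by (cases z) (auto simp: B_def)
        qed
      qed
    qed
    then show ?thesis by eventually_elim (use False in simp)
  qed
  have Bm [measurable]: "B k \<in> sets borel" for k by (simp add: B_def)
  have "(\<lambda>k. \<integral>z. ((indicat_real (B k) z - indicat_real (cbox a b) z) * indicator D z)\<^sup>2 \<partial>lborel) \<longlonglongrightarrow> integral\<^sup>L (lborel :: (real \<times> real) measure) (\<lambda>z. 0 :: real)"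
  proof (rule integral_dominated_convergence[where w = "indicator D :: real \<times> real \<Rightarrow> real"])
    show "integrable lborel (indicator D :: _ \<Rightarrow> real)"
      using L2_integrable_inner[OF indicator_D_L2 indicator_D_L2] by (simp add: indicator_inter_arith[symmetric])
    show "AE z in lborel. (\<lambda>k. ((indicat_real (B k) z - indicat_real (cbox a b) z) * indicator D z)\<^sup>2) \<longlonglongrightarrow> (0::real)"
    proof (rule AE_I2, rule tendsto_eventually)
      fix z show "\<forall>\<^sub>F k in sequentially. ((indicat_real (B k) z - indicat_real (cbox a b) z) * indicator D z)\<^sup>2 = (0::real)"
        using ev[of z] by eventually_elim simp
    qed
    show "AE z in lborel. norm (((indicat_real (B k) z - indicat_real (cbox a b) z) * indicator D z)\<^sup>2) \<le> (indicator D z :: real)" for k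
      by (rule AE_I2) (auto simp: indicator_def)
  qed (use D_sets in measurable)
  then have "\<forall>\<^sub>F k in sequentially. (\<integral>z. ((indicat_real (B k) z - indicat_real (cbox a b) z) * indicator D z)\<^sup>2 \<partial>lborel) < \<epsilon>"
    using assms by (intro order_tendstoD(2)) simp_all
  then obtain k where k: "(\<integral>z. ((indicat_real (B k) z - indicat_real (cbox a b) z) * indicator D z)\<^sup>2 \<partial>lborel) < \<epsilon>"
    by (auto simp: eventually_sequentially)
  moreover obtain n where "rational_box n = B k" using rational_box_exhausts unfolding B_def by blast
  ultimately show ?thesis by metis
qed

text \<open>Weak sequential compactness, tested on boxes: a diagonal subsequence handles the
  countably many rational boxes, and the uniform \<open>L^2\<close> bound carries convergence over
  to all boxes by Cauchy-Schwarz.\<close>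

lemma weak_subsequence:
  fixes U :: "nat \<Rightarrow> real \<times> real \<Rightarrow> real"
  assumes U: "\<And>j. U j \<in> L2 lborel" and off: "\<And>j z. z \<notin> D \<Longrightarrow> U j z = 0"
    and C: "\<And>j. (\<integral>z. (U j z)\<^sup>2 \<partial>lborel) \<le> C"
  shows "\<exists>r. strict_mono (r :: nat \<Rightarrow> nat) \<and> (\<forall>a b. convergent (\<lambda>j. \<integral>z. indicator (cbox a b) z * U (r j) z \<partial>lborel))"
proof -
  define I where "I S j = (\<integral>z. indicator S z * U j z \<partial>lborel)" for S j
  have C0: "0 \<le> C" using C[of 0] by (meson order_trans Bochner_Integration.integral_nonneg zero_le_power2)
  have ID: "(\<lambda>z. g z * indicator D z) \<in> L2 lborel"
    if "g \<in> borel_measurable borel" "\<And>z. \<bar>g z\<bar> \<le> 1" for g :: "real \<times> real \<Rightarrow> real"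
    using that by (intro bounded_L2[of _ 1]) (auto simp: indicator_def)
  have CS: "\<bar>\<integral>z. g z * U j z \<partial>lborel\<bar> \<le> sqrt (\<integral>z. (g z * indicator D z)\<^sup>2 \<partial>lborel) * sqrt C"
    and Iint: "integrable lborel (\<lambda>z. g z * U j z)"
    if g: "g \<in> borel_measurable borel" "\<And>z. \<bar>g z\<bar> \<le> 1" for g j
  proof -
    have eq: "(\<lambda>z. g z * indicator D z * U j z) = (\<lambda>z. g z * U j z)"
      using off by (auto simp: indicator_def fun_eq_iff)
    show "integrable lborel (\<lambda>z. g z * U j z)"
      using L2_integrable_inner[OF ID[OF g] U[of j]] by (simp add: eq)
    have "\<bar>\<integral>z. g z * U j z \<partial>lborel\<bar> \<le> sqrt (\<integral>z. (g z * indicator D z)\<^sup>2 \<partial>lborel) * sqrt (\<integral>z. (U j z)\<^sup>2 \<partial>lborel)"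
      using L2_Cauchy_Schwarz[OF ID[OF g] U[of j]] by (simp add: eq)
    also have "\<dots> \<le> sqrt (\<integral>z. (g z * indicator D z)\<^sup>2 \<partial>lborel) * sqrt C"
      using C[of j] by (intro mult_left_mono) auto
    finally show "\<bar>\<integral>z. g z * U j z \<partial>lborel\<bar> \<le> sqrt (\<integral>z. (g z * indicator D z)\<^sup>2 \<partial>lborel) * sqrt C" .
  qed
  interpret subseqs "\<lambda>n s. convergent (\<lambda>j. I (rational_box n) (s j))"
  proof
    fix n and s :: "nat \<Rightarrow> nat"
    have "bounded (range (\<lambda>j. I (rational_box n) (s j)))"
      unfolding I_def bounded_iff using CS[of "indicator (rational_box n)"] by (auto simp: indicator_def)
    then obtain l r where r: "strict_mono (r :: nat \<Rightarrow> nat)" "((\<lambda>j. I (rational_box n) (s j)) \<circ> r) \<longlonglongrightarrow> l"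
      using bounded_imp_convergent_subsequence by blast
    then show "\<exists>r'. strict_mono r' \<and> convergent (\<lambda>j. I (rational_box n) ((s \<circ> r') j))"
      by (auto simp: convergent_def o_def)
  qed
  define r where "r = diagseq"
  have r: "strict_mono r" unfolding r_def by (rule subseq_diagseq)
  have rat: "convergent (\<lambda>j. I (rational_box n) (r j))" for n
  proof -
    have "convergent (\<lambda>j. I (rational_box n) ((diagseq \<circ> ((+) (Suc n))) j))"
    proof (rule diagseq_holds)
      fix r s :: "nat \<Rightarrow> nat" and n
      assume "strict_mono r" "convergent (\<lambda>j. I (rational_box n) (s j))"
      then show "convergent (\<lambda>j. I (rational_box n) ((s \<circ> r) j))"
        using convergent_subseq_convergent[of "\<lambda>j. I (rational_box n) (s j)" r] by (simp add: o_def)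
    qed
    then have "convergent (\<lambda>j. I (rational_box n) (r (j + Suc n)))"
      by (simp add: r_def o_def add.commute)
    then show ?thesis using convergent_ignore_initial_segment[of "\<lambda>j. I (rational_box n) (r j)" "Suc n"] by simp
  qed
  have "convergent (\<lambda>j. I (cbox a b) (r j))" for a b
  proof (rule Cauchy_convergent, rule metric_CauchyI)
    fix \<epsilon> :: real assume \<epsilon>: "0 < \<epsilon>"
    \<comment> \<open>Chosen so that replacing the box by a rational one costs at most \<epsilon>/4
      uniformly in \<open>j\<close>; the summand 1 keeps the denominator positive when
      \<open>C = 0\<close>.\<close>
    define \<delta> where "\<delta> = \<epsilon> / (4 * (sqrt C + 1))"
    have \<delta>: "0 < \<delta>" using \<epsilon> C0 by (auto simp: \<delta>_def intro!: divide_pos_pos add_nonneg_pos)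
    obtain n where n: "(\<integral>z. ((indicator (rational_box n) z - indicator (cbox a b) z) * indicator D z)\<^sup>2 \<partial>lborel) < \<delta>\<^sup>2"
      using rational_box_approx[of "\<delta>\<^sup>2" a b] \<delta> by auto
    have near: "\<bar>I (rational_box n) j - I (cbox a b) j\<bar> \<le> \<epsilon> / 4" for j
    proof -
      have "I (rational_box n) j - I (cbox a b) j = (\<integral>z. indicator (rational_box n) z * U j z - indicator (cbox a b) z * U j z \<partial>lborel)"
        unfolding I_def
        by (rule Bochner_Integration.integral_diff[symmetric]; rule Iint) (auto simp: indicator_def)
      also have "\<dots> = (\<integral>z. (indicator (rational_box n) z - indicator (cbox a b) z) * U j z \<partial>lborel)"
        by (simp add: left_diff_distrib)
      finally have "\<bar>I (rational_box n) j - I (cbox a b) j\<bar> \<le>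
          sqrt (\<integral>z. ((indicator (rational_box n) z - indicator (cbox a b) z) * indicator D z)\<^sup>2 \<partial>lborel) * sqrt C"
        using CS[of "\<lambda>z. indicator (rational_box n) z - indicator (cbox a b) z" j] by (auto simp: indicator_def)
      also have "\<dots> \<le> \<delta> * (sqrt C + 1)"
      proof (rule mult_mono)
        have "sqrt (\<integral>z. ((indicator (rational_box n) z - indicator (cbox a b) z) * indicator D z)\<^sup>2 \<partial>lborel) \<le> sqrt (\<delta>\<^sup>2)"
          using n by (intro real_sqrt_le_mono) simp
        then show "sqrt (\<integral>z. ((indicator (rational_box n) z - indicator (cbox a b) z) * indicator D z)\<^sup>2 \<partial>lborel) \<le> \<delta>"
          using \<delta> by simp
      qed (use \<delta> C0 in auto)
      also have "\<dots> = \<epsilon> / 4"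
      proof -
        have "sqrt C + 1 > 0" using C0 by (simp add: add_nonneg_pos)
        then show ?thesis by (simp add: \<delta>_def field_simps del: distrib_left_numeral)
      qed
      finally show ?thesis .
    qed
    obtain N where N: "\<And>i j. i \<ge> N \<Longrightarrow> j \<ge> N \<Longrightarrow> dist (I (rational_box n) (r i)) (I (rational_box n) (r j)) < \<epsilon> / 4"
      using metric_CauchyD[OF convergent_Cauchy[OF rat[of n]], of "\<epsilon> / 4"] \<epsilon> by auto
    have "dist (I (cbox a b) (r i)) (I (cbox a b) (r j)) < \<epsilon>" if "i \<ge> N" "j \<ge> N" for i j
      using N[OF that] near[of "r i"] near[of "r j"] \<epsilon> unfolding dist_real_def by linarith
    then show "\<exists>N. \<forall>i\<ge>N. \<forall>j\<ge>N. dist (I (cbox a b) (r i)) (I (cbox a b) (r j)) < \<epsilon>" by blast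
  qed
  then show ?thesis using r unfolding I_def by blast
qed

text \<open>Averaging the dilations of \<open>U\<close> over their centres in a small box regularises \<open>U\<close> without
  leaving the convex set \<open>D\<close>.\<close>
definition average :: "real \<times> real \<Rightarrow> real \<times> real \<Rightarrow> real \<Rightarrow> (real \<times> real \<Rightarrow> real) \<Rightarrow> real \<times> real \<Rightarrow> real" where
  "average l u c U z = indicator D z * (\<integral>y. indicator (cbox l u) y * U (dil y (1 / c) z) \<partial>lborel) / measure lborel (cbox l u)"

lemma dil_centre: "dil y (1 / c) z = (1 / c) *\<^sub>R z + (1 - 1 / c) *\<^sub>R y"
  by (simp add: dil_def algebra_simps)

context
  fixes l u :: "real \<times> real" and c :: real
  assumes box: "cbox l u \<subseteq> D" "0 < measure lborel (cbox l u)" and c: "1 < c" "c \<le> 2"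
begin

lemma centre_pos: "0 < 1 - 1 / c"
  using c by (simp add: field_simps)

lemma box_integrable_indicator: "integrable lborel (indicator (cbox l u) :: _ \<Rightarrow> real)"
  using emeasure_lborel_cbox_finite[of l u] by simp

lemma indicator_box_L2: "(indicator (cbox l u) :: _ \<Rightarrow> real) \<in> L2 lborel"
  by (rule bounded_L2[of _ 1]) (use box in \<open>auto simp: indicator_def\<close>)

lemma centre_L2:
  assumes "U \<in> L2 lborel"
  shows "(\<lambda>y. U (dil y (1 / c) z)) \<in> L2 lborel"
    "(\<integral>y. (U (dil y (1 / c) z))\<^sup>2 \<partial>lborel) = (\<integral>y. (U y)\<^sup>2 \<partial>lborel) / (1 - 1 / c)\<^sup>2"
  using affine_L2[OF assms centre_pos, of "(1 / c) *\<^sub>R z"] by (simp_all only: dil_centre real_norm_def power2_abs)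

lemma box_centre_integrable:
  "U \<in> L2 lborel \<Longrightarrow> integrable lborel (\<lambda>y. indicator (cbox l u) y * U (dil y (1 / c) z) :: real)"
  using L2_integrable_inner[OF indicator_box_L2 centre_L2(1)] by simp

text \<open>For fixed \<open>z\<close> the point \<open>dil y (1 / c) z\<close> is affine in the
  centre \<open>y\<close> with ratio \<open>1 - 1 / c\<close>, so Cauchy-Schwarz in \<open>y\<close>
  bounds the average by the norm of \<open>U\<close>. The bound degenerates as \<open>c\<close>
  tends to 1 but does not depend on \<open>z\<close>.\<close>

lemma average_bound:
  assumes U: "U \<in> L2 lborel" and C: "(\<integral>y. (U y)\<^sup>2 \<partial>lborel) \<le> C"
  shows "\<bar>average l u c U z\<bar> \<le> sqrt (C / (1 - 1 / c)\<^sup>2) / sqrt (measure lborel (cbox l u))"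
proof -
  define m where "m = measure lborel (cbox l u)"
  have m: "0 < m" using box by (simp add: m_def)
  have ind: "(\<integral>y. (indicator (cbox l u) y)\<^sup>2 \<partial>lborel) = m"
    by (simp add: m_def power2_eq_square indicator_inter_arith[symmetric])
  have "\<bar>\<integral>y. indicator (cbox l u) y * U (dil y (1 / c) z) \<partial>lborel\<bar> \<le> sqrt m * sqrt (\<integral>y. (U (dil y (1 / c) z))\<^sup>2 \<partial>lborel)"
    using L2_Cauchy_Schwarz[OF indicator_box_L2 centre_L2(1)[OF U, of z]] ind by simp
  also have "\<dots> \<le> sqrt m * sqrt (C / (1 - 1 / c)\<^sup>2)"
    unfolding centre_L2(2)[OF U] using m C centre_pos by (intro mult_left_mono) (auto simp: divide_right_mono)
  finally have "\<bar>\<integral>y. indicator (cbox l u) y * U (dil y (1 / c) z) \<partial>lborel\<bar> / m \<le> sqrt m * sqrt (C / (1 - 1 / c)\<^sup>2) / m"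
    using m by (simp add: divide_right_mono)
  also have "\<dots> = sqrt (C / (1 - 1 / c)\<^sup>2) / sqrt m"
    using m by (simp add: field_simps real_sqrt_mult_self)
  finally have *: "\<bar>\<integral>y. indicator (cbox l u) y * U (dil y (1 / c) z) \<partial>lborel\<bar> / m \<le> sqrt (C / (1 - 1 / c)\<^sup>2) / sqrt m" .
  have "\<bar>average l u c U z\<bar> \<le> \<bar>\<integral>y. indicator (cbox l u) y * U (dil y (1 / c) z) \<partial>lborel\<bar> / m"
    using m by (auto simp: average_def m_def[symmetric] indicator_def abs_mult)
  with * show ?thesis by (simp add: m_def)
qed

lemma joint_measurable:
  assumes "U \<in> borel_measurable borel"
  shows "(\<lambda>(z, y). U (dil y (1 / c) z)) \<in> borel_measurable (borel \<Otimes>\<^sub>M borel)"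
proof -
  have "(\<lambda>p. U ((1 / c) *\<^sub>R fst p + (1 - 1 / c) *\<^sub>R snd p)) \<in> borel_measurable (borel \<Otimes>\<^sub>M borel)"
    by (rule measurable_compose[OF _ assms]) measurable
  then show ?thesis by (simp add: dil_centre case_prod_beta')
qed

lemma average_measurable:
  assumes U: "U \<in> L2 lborel"
  shows "average l u c U \<in> borel_measurable borel"
proof -
  have Um: "U \<in> borel_measurable borel" using L2_measurable[OF U] by simp
  have "(\<lambda>(z, y). indicator (cbox l u) y * U (dil y (1 / c) z)) \<in> borel_measurable (borel \<Otimes>\<^sub>M lborel)"
    using joint_measurable[OF Um] by (simp add: case_prod_beta')
  then have "(\<lambda>z. \<integral>y. indicator (cbox l u) y * U (dil y (1 / c) z) \<partial>lborel) \<in> borel_measurable borel"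
    by (rule lborel.borel_measurable_lebesgue_integral)
  then show ?thesis unfolding average_def[abs_def] using D_sets by measurable
qed

lemma average_L2:
  assumes U: "U \<in> L2 lborel" shows "average l u c U \<in> L2 lborel"
proof (rule bounded_L2[OF average_measurable[OF U]])
  fix z
  show "norm (average l u c U z) \<le> (sqrt ((\<integral>y. (U y)\<^sup>2 \<partial>lborel) / (1 - 1 / c)\<^sup>2) / sqrt (measure lborel (cbox l u))) * indicator D z"
    using average_bound[OF U order_refl, of z] by (cases "z \<in> D") (auto simp: average_def)
qed

text \<open>The squared error of a mean is at most the mean of the squared errors, by Cauchy-Schwarz
  over the box of centres; after Fubini the claim is \<open>dilation_estimate\<close> at each single
  centre.\<close>

lemma average_estimate:
  assumes UG: "weak_gradient D U G" and C: "(\<integral>z. (norm (G z))\<^sup>2 \<partial>lborel) \<le> C"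
  shows "(\<integral>z. (average l u c U z - U z)\<^sup>2 \<partial>lborel) \<le> ((c - 1) * 2)\<^sup>2 * C"
proof -
  define m where "m = measure lborel (cbox l u)"
  have m: "0 < m" using box by (simp add: m_def)
  have U: "U \<in> L2 lborel" and off: "\<And>z. z \<notin> D \<Longrightarrow> U z = 0"
    using UG by (auto simp: weak_gradient_def)
  have Um [measurable]: "U \<in> borel_measurable borel" using L2_measurable[OF U] by simp
  note [measurable] = average_measurable[OF U]
  define K where "K z y = (indicator D z * U (dil y (1 / c) z) - U z)\<^sup>2" for z y
  have [measurable]: "(\<lambda>(z, y). U (dil y (1 / c) z)) \<in> borel_measurable (lborel \<Otimes>\<^sub>M lborel)"
    using joint_measurable[OF Um] by simp
  have meas1: "(\<lambda>(z, y). ennreal (indicator (cbox l u) y * K z y)) \<in> borel_measurable (lborel \<Otimes>\<^sub>M lborel)"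
    unfolding K_def by measurable
  have ptw: "ennreal ((average l u c U z - U z)\<^sup>2) \<le> ennreal (1 / m) * (\<integral>\<^sup>+y. ennreal (indicator (cbox l u) y * K z y) \<partial>lborel)" for z
  proof (cases "z \<in> D")
    case True
    have g: "(\<lambda>y. indicator (cbox l u) y * (U (dil y (1 / c) z) - U z)) \<in> L2 lborel"
    proof -
      have "(\<lambda>y. indicator (cbox l u) y * U (dil y (1 / c) z)) \<in> L2 lborel"
        by (rule L2_bound[OF centre_L2(1)[OF U, of z]])
           (use L2_measurable[OF centre_L2(1)[OF U, of z]] in \<open>auto simp: indicator_def\<close>)
      moreover have "(\<lambda>y. U z * indicator (cbox l u) y) \<in> L2 lborel"
        using subspace_scale[OF L2_subspace indicator_box_L2, of "U z"] by (simp add: scaleR_fun_def)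
      ultimately show ?thesis using L2_diff by (fastforce simp: right_diff_distrib mult.commute)
    qed
    have "(average l u c U z - U z) * m = (\<integral>y. indicator (cbox l u) y * U (dil y (1 / c) z) \<partial>lborel) - (\<integral>y. indicator (cbox l u) y * U z \<partial>lborel)"
      using True m by (simp add: average_def m_def[symmetric] field_simps)
    also have "\<dots> = (\<integral>y. indicator (cbox l u) y * U (dil y (1 / c) z) - indicator (cbox l u) y * U z \<partial>lborel)"
      using box_centre_integrable[OF U, of z] box_integrable_indicator
      by (intro Bochner_Integration.integral_diff[symmetric]) auto
    also have "\<dots> = (\<integral>y. indicator (cbox l u) y \<bullet> (indicator (cbox l u) y * (U (dil y (1 / c) z) - U z)) \<partial>lborel)"
      by (intro Bochner_Integration.integral_cong) (auto simp: indicator_def)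
    finally have "\<bar>(average l u c U z - U z) * m\<bar> \<le> sqrt m * sqrt (\<integral>y. (indicator (cbox l u) y * (U (dil y (1 / c) z) - U z))\<^sup>2 \<partial>lborel)"
      using L2_Cauchy_Schwarz[OF indicator_box_L2 g]
      by (simp add: m_def power2_eq_square indicator_inter_arith[symmetric])
    then have "\<bar>(average l u c U z - U z) * m\<bar>\<^sup>2 \<le> (sqrt m * sqrt (\<integral>y. (indicator (cbox l u) y * (U (dil y (1 / c) z) - U z))\<^sup>2 \<partial>lborel))\<^sup>2"
      by (rule power_mono) simp
    then have "(average l u c U z - U z)\<^sup>2 * m\<^sup>2 \<le> m * (\<integral>y. (indicator (cbox l u) y * (U (dil y (1 / c) z) - U z))\<^sup>2 \<partial>lborel)"
      using m by (simp add: power_mult_distrib)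
    then have 1: "(average l u c U z - U z)\<^sup>2 \<le> 1 / m * (\<integral>y. (indicator (cbox l u) y * (U (dil y (1 / c) z) - U z))\<^sup>2 \<partial>lborel)"
    proof -
      have arith: "a * m\<^sup>2 \<le> m * b \<Longrightarrow> a \<le> 1 / m * b" for a b
        using m by (simp add: field_simps power2_eq_square)
      show ?thesis by (rule arith) fact
    qed
    have eq: "(indicator (cbox l u) y * (U (dil y (1 / c) z) - U z))\<^sup>2 = indicator (cbox l u) y * K z y" for y
      using True by (auto simp: K_def indicator_def)
    have "(\<integral>\<^sup>+y. ennreal (indicator (cbox l u) y * K z y) \<partial>lborel) = ennreal (\<integral>y. indicator (cbox l u) y * K z y \<partial>lborel)"
      using L2_integrable_square[OF g] by (intro nn_integral_eq_integral) (auto simp: eq K_def)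
    note int_eq = this
    have "ennreal ((average l u c U z - U z)\<^sup>2) \<le> ennreal (1 / m * (\<integral>y. indicator (cbox l u) y * K z y \<partial>lborel))"
      by (rule ennreal_leI) (rule 1[unfolded eq])
    also have "\<dots> = ennreal (1 / m) * ennreal (\<integral>y. indicator (cbox l u) y * K z y \<partial>lborel)"
      using m by (intro ennreal_mult') simp
    finally show ?thesis unfolding int_eq .
  next
    case False
    then show ?thesis using off[OF False] by (simp add: average_def)
  qed
  have inner: "(\<integral>\<^sup>+z. ennreal (indicator (cbox l u) y * K z y) \<partial>lborel) \<le> ennreal (((c - 1) * 2)\<^sup>2 * C) * indicator (cbox l u) y" for y
  proof (cases "y \<in> cbox l u")
    case True
    then have y: "y \<in> D" using box by auto
    note de = dilation_estimate[OF UG y less_imp_le[OF c(1)] c(2)]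
    have "(\<integral>\<^sup>+z. ennreal (K z y) \<partial>lborel) = ennreal (\<integral>z. K z y \<partial>lborel)"
      using L2_integrable_square[OF de(2)] by (intro nn_integral_eq_integral) (auto simp: K_def)
    also have "\<dots> \<le> ennreal (((c - 1) * 2)\<^sup>2 * (\<integral>z. (norm (G z))\<^sup>2 \<partial>lborel))"
      using de(1) by (simp add: K_def ennreal_leI)
    also have "\<dots> \<le> ennreal (((c - 1) * 2)\<^sup>2 * C)" using C by (intro ennreal_leI mult_left_mono) auto
    finally show ?thesis using True by simp
  qed simp
  have "(\<integral>\<^sup>+z. ennreal ((average l u c U z - U z)\<^sup>2) \<partial>lborel)
      \<le> (\<integral>\<^sup>+z. ennreal (1 / m) * (\<integral>\<^sup>+y. ennreal (indicator (cbox l u) y * K z y) \<partial>lborel) \<partial>lborel)"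
    by (intro nn_integral_mono ptw)
  also have "\<dots> = ennreal (1 / m) * (\<integral>\<^sup>+z. \<integral>\<^sup>+y. ennreal (indicator (cbox l u) y * K z y) \<partial>lborel \<partial>lborel)"
    by (rule nn_integral_cmult) (use lborel.borel_measurable_nn_integral[OF meas1] in simp)
  also have "(\<integral>\<^sup>+z. \<integral>\<^sup>+y. ennreal (indicator (cbox l u) y * K z y) \<partial>lborel \<partial>lborel)
      = (\<integral>\<^sup>+y. \<integral>\<^sup>+z. ennreal (indicator (cbox l u) y * K z y) \<partial>lborel \<partial>lborel)"
    using lborel_pair.Fubini'[of "\<lambda>z y. ennreal (indicator (cbox l u) y * K z y)"] meas1 by simp
  also have "\<dots> \<le> (\<integral>\<^sup>+y. ennreal (((c - 1) * 2)\<^sup>2 * C) * indicator (cbox l u) y \<partial>lborel)"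
    by (intro nn_integral_mono inner)
  also have "\<dots> = ennreal (((c - 1) * 2)\<^sup>2 * C) * ennreal m"
    using emeasure_lborel_cbox_finite[of l u]
    by (subst nn_integral_cmult_indicator) (simp_all add: m_def emeasure_eq_ennreal_measure)
  also have "ennreal (1 / m) * (ennreal (((c - 1) * 2)\<^sup>2 * C) * ennreal m) = ennreal (((c - 1) * 2)\<^sup>2 * C)"
  proof -
    have "0 \<le> C" using C by (meson order_trans Bochner_Integration.integral_nonneg zero_le_power2)
    then show ?thesis using m by (simp add: ennreal_mult[symmetric])
  qed
  finally have "(\<integral>\<^sup>+z. ennreal ((average l u c U z - U z)\<^sup>2) \<partial>lborel) \<le> ennreal (((c - 1) * 2)\<^sup>2 * C)"
    by (simp add: mult_left_mono)
  moreover have "integrable lborel (\<lambda>z. (average l u c U z - U z)\<^sup>2)"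
    by (rule square_integrable_diff[OF average_L2[OF U] U])
  moreover have "0 \<le> C" using C by (meson order_trans Bochner_Integration.integral_nonneg zero_le_power2)
  ultimately show ?thesis by (subst (asm) nn_integral_eq_integral) auto
qed

text \<open>Substituting the centre away shows the average at \<open>z\<close> to be a multiple of
  the integral of \<open>U\<close> over a box depending on \<open>z\<close>. Convergence of box
  integrals thus becomes pointwise convergence of averages.\<close>

lemma average_box:
  assumes U: "U \<in> borel_measurable borel" and z: "z \<in> D"
  shows "average l u c U z = (\<integral>w. indicator (cbox ((1 / c) *\<^sub>R z + (1 - 1 / c) *\<^sub>R l) ((1 / c) *\<^sub>R z + (1 - 1 / c) *\<^sub>R u)) w * U w \<partial>lborel)
      / (1 - 1 / c)\<^sup>2 / measure lborel (cbox l u)"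
proof -
  let ?T = "\<lambda>y. (1 / c) *\<^sub>R z + (1 - 1 / c) *\<^sub>R y"
  have ind: "(indicator (cbox (?T l) (?T u)) (?T y) :: real) = indicator (cbox l u) y" for y
    using centre_pos by (cases l; cases u; cases y; cases z) (auto simp: indicator_def)
  have m: "(\<lambda>w. indicator (cbox (?T l) (?T u)) w * U w) \<in> borel_measurable borel" using U by measurable
  have "(\<integral>y. indicator (cbox l u) y * U (dil y (1 / c) z) \<partial>lborel) = (\<integral>y. indicator (cbox (?T l) (?T u)) (?T y) * U (?T y) \<partial>lborel)"
    by (simp only: ind dil_centre)
  also have "\<dots> = (\<integral>w. indicator (cbox (?T l) (?T u)) w * U w \<partial>lborel) / (1 - 1 / c)\<^sup>2"
    using affine_integral(2)[OF m centre_pos, of "(1 / c) *\<^sub>R z"] by (simp add: divide_inverse_commute)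
  finally show ?thesis using z by (simp add: average_def)
qed

end

text \<open>Averaging with \<open>c\<close> near 1 changes every \<open>U j\<close> little,
  uniformly in \<open>j\<close>, by the gradient bound. For fixed \<open>c\<close> the averages
  along the weakly convergent subsequence converge pointwise and are uniformly bounded, hence
  converge in \<open>L^2\<close> by dominated convergence.\<close>

theorem Rellich:
  assumes W: "\<And>j. weak_gradient D (U j) (G j)"
    and CU: "\<And>j. (\<integral>z. (U j z)\<^sup>2 \<partial>lborel) \<le> C" and CG: "\<And>j. (\<integral>z. (norm (G j z))\<^sup>2 \<partial>lborel) \<le> C"
    and box: "cbox l u \<subseteq> D" "0 < measure lborel (cbox l u)"
  shows "\<exists>r. strict_mono (r :: nat \<Rightarrow> nat) \<and>
    (\<forall>\<epsilon>>0. \<exists>N. \<forall>m\<ge>N. \<forall>n\<ge>N. (\<integral>z. (U (r m) z - U (r n) z)\<^sup>2 \<partial>lborel) < \<epsilon>)"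
proof -
  have U: "\<And>j. U j \<in> L2 lborel" and off: "\<And>j z. z \<notin> D \<Longrightarrow> U j z = 0"
    using W by (auto simp: weak_gradient_def)
  have Um: "U j \<in> borel_measurable borel" for j using L2_measurable[OF U] by simp
  obtain r where r: "strict_mono (r :: nat \<Rightarrow> nat)"
    and conv: "\<And>a b. convergent (\<lambda>j. \<integral>z. indicator (cbox a b) z * U (r j) z \<partial>lborel)"
    using weak_subsequence[of U C] U off CU by blast
  have C0: "0 \<le> C" using CU[of 0] by (meson order_trans Bochner_Integration.integral_nonneg zero_le_power2)
  have "\<exists>N. \<forall>m\<ge>N. \<forall>n\<ge>N. (\<integral>z. (U (r m) z - U (r n) z)\<^sup>2 \<partial>lborel) < \<epsilon>" if \<epsilon>: "0 < \<epsilon>" for \<epsilon>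
  proof -
    define h where "h = min 1 (sqrt (\<epsilon> / (64 * (C + 1))))"
    define c where "c = 1 + h"
    have "0 < \<epsilon> / (64 * (C + 1))" using \<epsilon> C0 by simp
    then have h: "0 < h" "h \<le> 1" "h\<^sup>2 \<le> \<epsilon> / (64 * (C + 1))"
      using power_mono[of h "sqrt (\<epsilon> / (64 * (C + 1)))" 2] by (auto simp: h_def)
    have c: "1 < c" "c \<le> 2" using h by (auto simp: c_def)
    \<comment> \<open>The squared distance will be split into four squared errors with weight 4
      each: two below \<epsilon>/12 and two below \<epsilon>/24, which adds up to \<epsilon>. The
      choice of \<open>h\<close> gives even \<epsilon>/16 for this one, and \<open>C + 1\<close>
      avoids a division by 0.\<close>
    have small: "((c - 1) * 2)\<^sup>2 * C < \<epsilon> / 12"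
    proof -
      have "((c - 1) * 2)\<^sup>2 * C \<le> 4 * (\<epsilon> / (64 * (C + 1))) * (C + 1)"
      proof (rule mult_mono)
        show "((c - 1) * 2)\<^sup>2 \<le> 4 * (\<epsilon> / (64 * (C + 1)))" using h(3) by (simp add: c_def power_mult_distrib)
      qed (use C0 \<epsilon> in auto)
      also have "\<dots> = \<epsilon> / 16" using C0 by (simp add: field_simps)
      finally show ?thesis using \<epsilon> by simp
    qed
    define A where "A j = average l u c (U (r j))" for j
    have AL: "A j \<in> L2 lborel" for j unfolding A_def by (rule average_L2[OF box c U])
    have est: "(\<integral>z. (A j z - U (r j) z)\<^sup>2 \<partial>lborel) < \<epsilon> / 12" for j
      unfolding A_def by (rule order_le_less_trans[OF average_estimate[OF box c W CG] small])
    define K where "K = sqrt (C / (1 - 1 / c)\<^sup>2) / sqrt (measure lborel (cbox l u))"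
    have Ab: "\<bar>A j z\<bar> \<le> K" for j z
      unfolding A_def K_def by (rule average_bound[OF box c U CU])
    have A0: "A j z = 0" if "z \<notin> D" for j z using that by (simp add: A_def average_def)
    have Aconv: "convergent (\<lambda>j. A j z)" for z
    proof (cases "z \<in> D")
      case True
      show ?thesis unfolding A_def average_box[OF box c Um True]
        unfolding divide_inverse by (intro convergent_mult conv convergent_const)
    next
      case False then show ?thesis by (simp add: A0 convergent_const)
    qed
    define Al where "Al z = lim (\<lambda>j. A j z)" for z
    have Alim: "(\<lambda>j. A j z) \<longlonglongrightarrow> Al z" for z using Aconv[of z] by (simp add: Al_def convergent_LIMSEQ_iff)
    have Alm: "Al \<in> borel_measurable lborel"
      by (rule borel_measurable_LIMSEQ_real[OF Alim]) (rule L2_measurable[OF AL])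
    have Alb: "\<bar>Al z\<bar> \<le> K" for z
      by (rule LIMSEQ_le_const2[OF tendsto_rabs[OF Alim]]) (use Ab in auto)
    have Al0: "Al z = 0" if "z \<notin> D" for z
      using LIMSEQ_unique[OF Alim, of z 0] A0[OF that] by simp
    have "(\<lambda>z. (2 * K) * indicator D z) \<in> L2 lborel"
      using subspace_scale[OF L2_subspace indicator_D_L2, of "2 * K"] by (simp add: scaleR_fun_def)
    then have "(\<lambda>j. \<integral>z. (norm (A j z - Al z))\<^sup>2 \<partial>lborel) \<longlonglongrightarrow> 0"
    proof (rule L2_dominated_convergence)
      show "AE z in lborel. norm (A j z - Al z) \<le> 2 * K * indicator D z" for j
      proof (rule AE_I2)
        fix z show "norm (A j z - Al z) \<le> 2 * K * indicator D z"
          using Ab[of j z] Alb[of z] A0[of z j] Al0[of z] by (cases "z \<in> D") auto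
      qed
    qed (use Alm Alim L2_measurable[OF AL] in auto)
    then have "\<forall>\<^sub>F j in sequentially. (\<integral>z. (norm (A j z - Al z))\<^sup>2 \<partial>lborel) < \<epsilon> / 24"
      using \<epsilon> by (intro order_tendstoD(2)) auto
    then obtain N where N: "\<And>j. j \<ge> N \<Longrightarrow> (\<integral>z. (A j z - Al z)\<^sup>2 \<partial>lborel) < \<epsilon> / 24"
      by (auto simp: eventually_sequentially)
    have AlL: "Al \<in> L2 lborel"
    proof (rule bounded_L2[of _ K])
      show "norm (Al z) \<le> K * indicator D z" for z using Alb[of z] Al0[of z] by (cases "z \<in> D") auto
    qed (use Alm in simp)
    have "(\<integral>z. (U (r m) z - U (r n) z)\<^sup>2 \<partial>lborel) < \<epsilon>" if mn: "m \<ge> N" "n \<ge> N" for m n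
    proof -
      note i = square_integrable_diff[OF AL U, of m "r m"] square_integrable_diff[OF AL U, of n "r n"]
        square_integrable_diff[OF AL AlL, of m] square_integrable_diff[OF AL AlL, of n]
      have "(\<integral>z. (U (r m) z - U (r n) z)\<^sup>2 \<partial>lborel)
          \<le> (\<integral>z. 4 * (A m z - U (r m) z)\<^sup>2 + 4 * (A n z - U (r n) z)\<^sup>2 + 4 * (A m z - Al z)\<^sup>2 + 4 * (A n z - Al z)\<^sup>2 \<partial>lborel)"
      proof (rule integral_mono)
        show "integrable lborel (\<lambda>z. (U (r m) z - U (r n) z)\<^sup>2)" by (rule square_integrable_diff[OF U U])
        show "integrable lborel (\<lambda>z. 4 * (A m z - U (r m) z)\<^sup>2 + 4 * (A n z - U (r n) z)\<^sup>2 + 4 * (A m z - Al z)\<^sup>2 + 4 * (A n z - Al z)\<^sup>2)"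
          using i by simp
        show "(U (r m) z - U (r n) z)\<^sup>2 \<le> 4 * (A m z - U (r m) z)\<^sup>2 + 4 * (A n z - U (r n) z)\<^sup>2 + 4 * (A m z - Al z)\<^sup>2 + 4 * (A n z - Al z)\<^sup>2" for z
        proof -
          have "(U (r m) z - U (r n) z)\<^sup>2 = (((A n z - U (r n) z) + - (A m z - U (r m) z)) + ((A m z - Al z) + - (A n z - Al z)))\<^sup>2"
            by (simp add: algebra_simps)
          also have "\<dots> \<le> 2 * ((A n z - U (r n) z) + - (A m z - U (r m) z))\<^sup>2 + 2 * ((A m z - Al z) + - (A n z - Al z))\<^sup>2"
            by (rule square_sum_le)
          also have "\<dots> \<le> 2 * (2 * (A n z - U (r n) z)\<^sup>2 + 2 * (- (A m z - U (r m) z))\<^sup>2) + 2 * (2 * (A m z - Al z)\<^sup>2 + 2 * (- (A n z - Al z))\<^sup>2)"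
            by (intro add_mono mult_left_mono square_sum_le) auto
          finally show ?thesis by (simp only: power2_minus distrib_left mult.assoc[symmetric])
        qed
      qed
      also have "\<dots> = 4 * (\<integral>z. (A m z - U (r m) z)\<^sup>2 \<partial>lborel) + 4 * (\<integral>z. (A n z - U (r n) z)\<^sup>2 \<partial>lborel)
          + 4 * (\<integral>z. (A m z - Al z)\<^sup>2 \<partial>lborel) + 4 * (\<integral>z. (A n z - Al z)\<^sup>2 \<partial>lborel)"
        using i by simp
      also have "\<dots> < \<epsilon>" using est[of m] est[of n] N[OF mn(1)] N[OF mn(2)] by linarith
      finally show ?thesis .
    qed
    then show ?thesis by blast
  qed
  then show ?thesis using r by blast
qed

end

section \<open>The Neumann spectrum\<close>

text \<open>The index \<open>j \<le> m\<close> counts \<open>m + 1\<close> unknowns against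
  \<open>m\<close> equations. Eliminating the last unknown by a pivot row \<open>p\<close> leaves
  one equation and one unknown fewer; without a pivot the last unit vector is a solution.\<close>

lemma underdetermined_system:
  fixes a :: "nat \<Rightarrow> nat \<Rightarrow> real"
  shows "\<exists>c. (\<exists>j\<le>m. c j \<noteq> 0) \<and> (\<forall>i<m. (\<Sum>j\<le>m. a i j * c j) = 0)"
proof (induction m arbitrary: a)
  case 0
  show ?case by (rule exI[of _ "\<lambda>_. 1"]) simp
next
  case (Suc m)
  show ?case
  proof (cases "\<forall>i\<le>m. a i (Suc m) = 0")
    case True
    show ?thesis
      by (rule exI[of _ "\<lambda>j. if j = Suc m then 1 else 0"])
         (use True in \<open>auto simp: less_Suc_eq_le\<close>)
  next
    case False
    then obtain p where p: "p \<le> m" "a p (Suc m) \<noteq> 0" by auto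
    define row where "row i = (if i < p then i else Suc i)" for i
    define a' where "a' i j = a (row i) j - a (row i) (Suc m) / a p (Suc m) * a p j" for i j
    obtain c where c: "\<exists>j\<le>m. c j \<noteq> 0" "\<And>i. i < m \<Longrightarrow> (\<Sum>j\<le>m. a' i j * c j) = 0"
      using Suc.IH[of a'] by auto
    define s where "s = (\<Sum>j\<le>m. a p j * c j)"
    define d where "d j = (if j = Suc m then - s / a p (Suc m) else c j)" for j
    have sum_d: "(\<Sum>j\<le>Suc m. a i j * d j) = (\<Sum>j\<le>m. a i j * c j) - a i (Suc m) * s / a p (Suc m)" for i
      by (simp add: d_def)
    have "(\<Sum>j\<le>Suc m. a i j * d j) = 0" if i: "i < Suc m" for i
    proof (cases "i = p")
      case True
      then show ?thesis unfolding sum_d using p by (simp add: s_def)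
    next
      case False
      define i' where "i' = (if i < p then i else i - 1)"
      have i': "i' < m" "row i' = i" using False i p by (auto simp: i'_def row_def)
      have "0 = (\<Sum>j\<le>m. a i j * c j - a i (Suc m) / a p (Suc m) * (a p j * c j))"
        using c(2)[OF i'(1)] by (simp add: a'_def i'(2) algebra_simps)
      also have "\<dots> = (\<Sum>j\<le>m. a i j * c j) - a i (Suc m) / a p (Suc m) * s"
        by (simp add: sum_subtractf sum_distrib_left s_def)
      finally show ?thesis unfolding sum_d by simp
    qed
    moreover have "\<exists>j\<le>Suc m. d j \<noteq> 0"
    proof -
      obtain j where "j \<le> m" "c j \<noteq> 0" using c(1) by auto
      then show ?thesis by (intro exI[of _ j]) (simp add: d_def)
    qed
    ultimately show ?thesis by (intro exI[of _ d]) blast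
  qed
qed

section \<open>The Sobolev space with its mass and stiffness forms\<close>

context planar_domain begin

text \<open>Disjointness is phrased as pointwise vanishing of the products of values and of
  gradients. This makes the mass and stiffness matrices diagonal, so that the common Rayleigh bound
  survives linear combinations.\<close>

definition bump_family :: "nat \<Rightarrow> real \<Rightarrow> (nat \<Rightarrow> torus \<Rightarrow> real) \<Rightarrow> bool" where
  "bump_family n C h \<longleftrightarrow>
     (\<forall>j<n. smooth (h j) \<and> 0 < (\<integral>x. (h j x)\<^sup>2 \<partial>M) \<and> (\<integral>x. (norm (grad (h j) x))\<^sup>2 \<partial>M) \<le> C * (\<integral>x. (h j x)\<^sup>2 \<partial>M)) \<and>
     (\<forall>i<n. \<forall>j<n. i \<noteq> j \<longrightarrow> (\<forall>x. h i x * h j x = 0 \<and> grad (h i) x \<bullet> grad (h j) x = 0))"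

text \<open>An element of the Sobolev space is stored together with its weak gradient.\<close>
definition H1 :: "(torus \<Rightarrow> real \<times> (real \<times> real)) set" where
  "H1 = {w. H1_gradient \<Omega> (\<lambda>x. fst (w x)) (\<lambda>x. snd (w x))}"

definition mass :: "(torus \<Rightarrow> real \<times> (real \<times> real)) \<Rightarrow> (torus \<Rightarrow> real \<times> (real \<times> real)) \<Rightarrow> real" where
  "mass w w' = (\<integral>x. fst (w x) \<bullet> fst (w' x) \<partial>M)"

definition stiffness :: "(torus \<Rightarrow> real \<times> (real \<times> real)) \<Rightarrow> (torus \<Rightarrow> real \<times> (real \<times> real)) \<Rightarrow> real" where
  "stiffness w w' = (\<integral>x. snd (w x) \<bullet> snd (w' x) \<partial>M)"

lemma L2_on_eq: "L2_on \<Omega> = L2 M"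
  by (simp add: L2_on_def L2_def)

lemma H1_L2:
  assumes "w \<in> H1" shows "(\<lambda>x. fst (w x)) \<in> L2 M" "(\<lambda>x. snd (w x)) \<in> L2 M"
  using assms by (auto simp: H1_def H1_gradient_def L2_on_eq)

lemma test_functions_L2:
  assumes "\<psi> \<in> test_functions \<Omega>" "b \<in> Basis"
  shows "\<psi> \<in> L2 M" "dir_deriv b \<psi> \<in> L2 M" "(\<lambda>x. \<psi> x *\<^sub>R b) \<in> L2 M"
proof -
  have s: "smooth \<psi>" using assms by (simp add: test_functions_def)
  show "\<psi> \<in> L2 M" "dir_deriv b \<psi> \<in> L2 M"
    using smooth_continuous0[OF s] smooth_continuous1[OF s assms(2)] by (auto intro: L2_continuous)
  show "(\<lambda>x. \<psi> x *\<^sub>R b) \<in> L2 M"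
    by (rule L2_continuous) (intro continuous_intros smooth_continuous0[OF s])
qed

lemma H1_iff:
  "w \<in> H1 \<longleftrightarrow> (\<lambda>x. fst (w x)) \<in> L2 M \<and> (\<lambda>x. snd (w x)) \<in> L2 M \<and>
     (\<forall>\<psi>\<in>test_functions \<Omega>. \<forall>b\<in>Basis.
        (\<integral>x. fst (w x) \<bullet> dir_deriv b \<psi> x \<partial>M) + (\<integral>x. snd (w x) \<bullet> (\<psi> x *\<^sub>R b) \<partial>M) = 0)"
  by (simp add: H1_def H1_gradient_def L2_on_eq eq_neg_iff_add_eq_0 mult.commute)

lemma H1_subspace: "subspace H1"
proof (rule subspaceI)
  interpret r: psd_form "L2 M" "\<lambda>u v :: torus \<Rightarrow> real. \<integral>x. u x \<bullet> v x \<partial>M" by (rule L2_psd_form)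
  interpret g: psd_form "L2 M" "\<lambda>u v :: torus \<Rightarrow> real \<times> real. \<integral>x. u x \<bullet> v x \<partial>M" by (rule L2_psd_form)
  show "0 \<in> H1" using r.V_closed(1) g.V_closed(1) by (simp add: H1_iff zero_fun_def)
  show "w + w' \<in> H1" if w: "w \<in> H1" and w': "w' \<in> H1" for w w'
  proof -
    note a = H1_L2[OF w] H1_L2[OF w']
    have "(\<lambda>x. fst (w x) + fst (w' x)) \<in> L2 M" "(\<lambda>x. snd (w x) + snd (w' x)) \<in> L2 M"
      using r.V_closed(2)[OF a(1,3)] g.V_closed(2)[OF a(2,4)] by (simp_all add: plus_fun_def)
    moreover have "(\<integral>x. (fst (w x) + fst (w' x)) \<bullet> dir_deriv b \<psi> x \<partial>M) + (\<integral>x. (snd (w x) + snd (w' x)) \<bullet> (\<psi> x *\<^sub>R b) \<partial>M) = 0"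
      if \<psi>: "\<psi> \<in> test_functions \<Omega>" "b \<in> Basis" for \<psi> b
    proof -
      have "(\<integral>x. fst (w x) \<bullet> dir_deriv b \<psi> x \<partial>M) + (\<integral>x. snd (w x) \<bullet> (\<psi> x *\<^sub>R b) \<partial>M) = 0"
        "(\<integral>x. fst (w' x) \<bullet> dir_deriv b \<psi> x \<partial>M) + (\<integral>x. snd (w' x) \<bullet> (\<psi> x *\<^sub>R b) \<partial>M) = 0"
        using w w' \<psi> unfolding H1_iff by blast+
      then show ?thesis
        using r.add_left[OF a(1,3) test_functions_L2(2)[OF \<psi>]] g.add_left[OF a(2,4) test_functions_L2(3)[OF \<psi>]]
        unfolding plus_fun_apply by linarith
    qed
    ultimately show ?thesis by (simp add: H1_iff)
  qed
  show "c *\<^sub>R w \<in> H1" if w: "w \<in> H1" for c w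
  proof -
    note a = H1_L2[OF w]
    have "(\<lambda>x. c *\<^sub>R fst (w x)) \<in> L2 M" "(\<lambda>x. c *\<^sub>R snd (w x)) \<in> L2 M"
      using r.V_closed(3)[OF a(1), of c] g.V_closed(3)[OF a(2), of c] by (simp_all add: scaleR_fun_def)
    moreover have "(\<integral>x. (c *\<^sub>R fst (w x)) \<bullet> dir_deriv b \<psi> x \<partial>M) + (\<integral>x. (c *\<^sub>R snd (w x)) \<bullet> (\<psi> x *\<^sub>R b) \<partial>M) = 0"
      if \<psi>: "\<psi> \<in> test_functions \<Omega>" "b \<in> Basis" for \<psi> b
    proof -
      have "(\<integral>x. fst (w x) \<bullet> dir_deriv b \<psi> x \<partial>M) + (\<integral>x. snd (w x) \<bullet> (\<psi> x *\<^sub>R b) \<partial>M) = 0"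
        using w \<psi> by (simp add: H1_iff)
      then have "c * ((\<integral>x. fst (w x) \<bullet> dir_deriv b \<psi> x \<partial>M) + (\<integral>x. snd (w x) \<bullet> (\<psi> x *\<^sub>R b) \<partial>M)) = 0" by simp
      then show ?thesis unfolding inner_scaleR_left integral_mult_right_zero by (simp only: distrib_left)
    qed
    ultimately show ?thesis by (simp add: H1_iff)
  qed
qed

lemma psd_mass: "psd_form H1 mass" and psd_stiffness: "psd_form H1 stiffness"
proof -
  interpret r: psd_form "L2 M" "\<lambda>u v :: torus \<Rightarrow> real. \<integral>x. u x \<bullet> v x \<partial>M" by (rule L2_psd_form)
  interpret g: psd_form "L2 M" "\<lambda>u v :: torus \<Rightarrow> real \<times> real. \<integral>x. u x \<bullet> v x \<partial>M" by (rule L2_psd_form)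
  show "psd_form H1 mass"
  proof
    show "mass (u + v) w = mass u w + mass v w" if "u \<in> H1" "v \<in> H1" "w \<in> H1" for u v w
      using r.add_left[OF H1_L2(1)[OF that(1)] H1_L2(1)[OF that(2)] H1_L2(1)[OF that(3)]]
      by (simp add: mass_def plus_fun_def)
    show "mass u w = mass w u" for u w by (simp add: mass_def mult.commute)
    show "mass (c *\<^sub>R u) w = c * mass u w" for c u w by (simp add: mass_def mult.assoc)
  qed (auto simp: H1_subspace mass_def intro!: Bochner_Integration.integral_nonneg)
  show "psd_form H1 stiffness"
  proof
    show "stiffness (u + v) w = stiffness u w + stiffness v w" if "u \<in> H1" "v \<in> H1" "w \<in> H1" for u v w
      using g.add_left[OF H1_L2(2)[OF that(1)] H1_L2(2)[OF that(2)] H1_L2(2)[OF that(3)]]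
      by (simp add: stiffness_def plus_fun_def)
  qed (auto simp: H1_subspace stiffness_def inner_commute intro!: Bochner_Integration.integral_nonneg)
qed

definition smooth_pair :: "(torus \<Rightarrow> real) \<Rightarrow> torus \<Rightarrow> real \<times> (real \<times> real)" where
  "smooth_pair f x = (f x, grad f x)"

lemma smooth_pair_H1: "smooth f \<Longrightarrow> smooth_pair f \<in> H1"
  using H1_gradient_smooth by (simp add: H1_def smooth_pair_def)

text \<open>Trial space for min-max: \<open>n + 1\<close> bumps against \<open>n\<close>
  orthogonality constraints leave a nontrivial combination, whose Rayleigh quotient is at most
  \<open>C\<close> because both forms are diagonal on the bumps. The same lemma supplies the
  infinite dimension of \<open>H1\<close>.\<close>

lemma bump_combination:
  assumes h: "bump_family (Suc n) C h" and e: "\<And>i. i < n \<Longrightarrow> e i \<in> H1"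
  shows "\<exists>v\<in>H1. (\<forall>i<n. mass v (e i) = 0) \<and> 0 < mass v v \<and> stiffness v v \<le> C * mass v v"
proof -
  interpret b: psd_form H1 mass by (rule psd_mass)
  interpret a: psd_form H1 stiffness by (rule psd_stiffness)
  define w where "w j = smooth_pair (h j)" for j
  have w: "w j \<in> H1" if "j \<le> n" for j
    using h that unfolding w_def bump_family_def by (intro smooth_pair_H1) auto
  have pos: "0 < mass (w j) (w j)" and le: "stiffness (w j) (w j) \<le> C * mass (w j) (w j)" if "j \<le> n" for j
    using h that
    by (auto simp: bump_family_def w_def mass_def stiffness_def smooth_pair_def power2_norm_eq_inner[symmetric] power2_eq_square[symmetric])
  have orth: "mass (w i) (w j) = 0" "stiffness (w i) (w j) = 0" if "i \<le> n" "j \<le> n" "i \<noteq> j" for i j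
  proof -
    have *: "h i x * h j x = 0" "grad (h i) x \<bullet> grad (h j) x = 0" for x
      using h that unfolding bump_family_def by auto
    show "mass (w i) (w j) = 0" "stiffness (w i) (w j) = 0"
      by (simp_all add: w_def mass_def stiffness_def smooth_pair_def * del: mult_eq_0_iff)
  qed
  obtain c where c: "\<exists>j\<le>n. c j \<noteq> 0" "\<And>i. i < n \<Longrightarrow> (\<Sum>j\<le>n. mass (w j) (e i) * c j) = 0"
    using underdetermined_system[of n "\<lambda>i j. mass (w j) (e i)"] by auto
  define v where "v = (\<Sum>j\<le>n. c j *\<^sub>R w j)"
  have cw: "c j *\<^sub>R w j \<in> H1" if "j \<le> n" for j using w[OF that] by simp
  have v: "v \<in> H1" unfolding v_def using cw by (intro b.V_closed(5)) auto
  have "mass v (e i) = 0" if "i < n" for i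
    unfolding v_def using c(2)[OF that] cw w e[OF that]
    by (subst b.sum_left) (auto simp: b.scale_left mult.commute)
  moreover have quad: "B v v = (\<Sum>j\<le>n. (c j)\<^sup>2 * B (w j) (w j))"
    if "psd_form H1 B" "\<And>i j. i \<le> n \<Longrightarrow> j \<le> n \<Longrightarrow> i \<noteq> j \<Longrightarrow> B (w i) (w j) = 0" for B
  proof -
    interpret B: psd_form H1 B by (rule that(1))
    have "B v v = (\<Sum>i\<le>n. B (c i *\<^sub>R w i) v)"
      using v cw by (subst v_def, subst B.sum_left) auto
    also have "\<dots> = (\<Sum>i\<le>n. \<Sum>j\<le>n. B (c i *\<^sub>R w i) (c j *\<^sub>R w j))"
      unfolding v_def using cw by (intro sum.cong B.sum_right refl) auto
    also have "\<dots> = (\<Sum>i\<le>n. \<Sum>j\<le>n. if j = i then (c i)\<^sup>2 * B (w i) (w i) else 0)"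
      using w that(2) by (intro sum.cong refl) (auto simp: B.scale_left B.scale_right power2_eq_square)
    also have "\<dots> = (\<Sum>j\<le>n. (c j)\<^sup>2 * B (w j) (w j))" by simp
    finally show ?thesis .
  qed
  have qm: "mass v v = (\<Sum>j\<le>n. (c j)\<^sup>2 * mass (w j) (w j))"
    by (rule quad[OF psd_mass orth(1)])
  have qs: "stiffness v v = (\<Sum>j\<le>n. (c j)\<^sup>2 * stiffness (w j) (w j))"
    by (rule quad[OF psd_stiffness orth(2)])
  have "0 < mass v v"
  proof -
    obtain j where "j \<le> n" "c j \<noteq> 0" using c(1) by auto
    moreover have "0 \<le> (c i)\<^sup>2 * mass (w i) (w i)" if "i \<le> n" for i
      using pos[OF that] by (intro mult_nonneg_nonneg) auto
    ultimately show ?thesis unfolding qm using pos[of j]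
      by (intro sum_pos2[of _ j]) auto
  qed
  moreover have "stiffness v v \<le> C * mass v v"
    unfolding qm qs sum_distrib_left
  proof (rule sum_mono)
    fix j assume "j \<in> {..n}"
    then have "(c j)\<^sup>2 * stiffness (w j) (w j) \<le> (c j)\<^sup>2 * (C * mass (w j) (w j))"
      by (intro mult_left_mono le) auto
    then show "(c j)\<^sup>2 * stiffness (w j) (w j) \<le> C * ((c j)\<^sup>2 * mass (w j) (w j))" by (simp add: mult.left_commute)
  qed
  ultimately show ?thesis using v by blast
qed

text \<open>Values and gradients converge separately by Riesz-Fischer, and the integration by parts
  identity is continuous in both, so it passes to the limit.\<close>

lemma H1_complete:
  assumes s: "\<And>n. s n \<in> H1"
    and Cauchy: "\<And>\<epsilon>. 0 < \<epsilon> \<Longrightarrow> \<exists>N. \<forall>m\<ge>N. \<forall>n\<ge>N. mass (s m - s n) (s m - s n) + stiffness (s m - s n) (s m - s n) < \<epsilon>"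
  shows "\<exists>u\<in>H1. (\<lambda>n. mass (s n - u) (s n - u) + stiffness (s n - u) (s n - u)) \<longlonglongrightarrow> 0"
proof -
  interpret b: psd_form H1 mass by (rule psd_mass)
  interpret a: psd_form H1 stiffness by (rule psd_stiffness)
  interpret r: psd_form "L2 M" "\<lambda>u v :: torus \<Rightarrow> real. \<integral>x. u x \<bullet> v x \<partial>M" by (rule L2_psd_form)
  interpret g: psd_form "L2 M" "\<lambda>u v :: torus \<Rightarrow> real \<times> real. \<integral>x. u x \<bullet> v x \<partial>M" by (rule L2_psd_form)
  have "\<exists>u\<in>L2 M. (\<lambda>n. \<integral>x. (norm (fst (s n x) - u x))\<^sup>2 \<partial>M) \<longlonglongrightarrow> 0"
  proof (rule Riesz_Fischer[OF finite_measure_M H1_L2(1)[OF s]])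
    fix \<epsilon> :: real assume "0 < \<epsilon>"
    from Cauchy[OF this] obtain N where N: "\<And>m n. m \<ge> N \<Longrightarrow> n \<ge> N \<Longrightarrow> mass (s m - s n) (s m - s n) + stiffness (s m - s n) (s m - s n) < \<epsilon>" by blast
    have "(\<integral>x. (norm (fst (s m x) - fst (s n x)))\<^sup>2 \<partial>M) < \<epsilon>" if "m \<ge> N" "n \<ge> N" for m n
      using N[OF that] a.nonneg[OF a.V_closed(4)[OF s s], of m n]
      by (simp add: mass_def power2_norm_eq_inner power2_eq_square)
    then show "\<exists>N. \<forall>m\<ge>N. \<forall>n\<ge>N. (\<integral>x. (norm (fst (s m x) - fst (s n x)))\<^sup>2 \<partial>M) < \<epsilon>" by blast
  qed
  then obtain u where u: "u \<in> L2 M" "(\<lambda>n. \<integral>x. (norm (fst (s n x) - u x))\<^sup>2 \<partial>M) \<longlonglongrightarrow> 0" by blast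
  have "\<exists>G\<in>L2 M. (\<lambda>n. \<integral>x. (norm (snd (s n x) - G x))\<^sup>2 \<partial>M) \<longlonglongrightarrow> 0"
  proof (rule Riesz_Fischer[OF finite_measure_M H1_L2(2)[OF s]])
    fix \<epsilon> :: real assume "0 < \<epsilon>"
    from Cauchy[OF this] obtain N where N: "\<And>m n. m \<ge> N \<Longrightarrow> n \<ge> N \<Longrightarrow> mass (s m - s n) (s m - s n) + stiffness (s m - s n) (s m - s n) < \<epsilon>" by blast
    have "(\<integral>x. (norm (snd (s m x) - snd (s n x)))\<^sup>2 \<partial>M) < \<epsilon>" if "m \<ge> N" "n \<ge> N" for m n
      using N[OF that] b.nonneg[OF b.V_closed(4)[OF s s], of m n]
      by (simp add: stiffness_def power2_norm_eq_inner)
    then show "\<exists>N. \<forall>m\<ge>N. \<forall>n\<ge>N. (\<integral>x. (norm (snd (s m x) - snd (s n x)))\<^sup>2 \<partial>M) < \<epsilon>" by blast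
  qed
  then obtain G where G: "G \<in> L2 M" "(\<lambda>n. \<integral>x. (norm (snd (s n x) - G x))\<^sup>2 \<partial>M) \<longlonglongrightarrow> 0" by blast
  define w where "w x = (u x, G x)" for x
  have limb: "(\<lambda>n. mass (s n - w) (s n - w)) \<longlonglongrightarrow> 0"
    using u(2) by (simp add: mass_def w_def power2_norm_eq_inner power2_eq_square)
  have lima: "(\<lambda>n. stiffness (s n - w) (s n - w)) \<longlonglongrightarrow> 0"
    using G(2) by (simp add: stiffness_def w_def power2_norm_eq_inner)
  have "w \<in> H1" unfolding H1_iff
  proof (intro conjI ballI)
    show "(\<lambda>x. fst (w x)) \<in> L2 M" "(\<lambda>x. snd (w x)) \<in> L2 M" using u G by (simp_all add: w_def)
    fix \<psi> and b :: "real \<times> real" assume \<psi>: "\<psi> \<in> test_functions \<Omega>" "b \<in> Basis"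
    have "(\<lambda>n. (\<integral>x. fst (s n x) \<bullet> dir_deriv b \<psi> x \<partial>M) + (\<integral>x. snd (s n x) \<bullet> (\<psi> x *\<^sub>R b) \<partial>M))
      \<longlonglongrightarrow> (\<integral>x. u x \<bullet> dir_deriv b \<psi> x \<partial>M) + (\<integral>x. G x \<bullet> (\<psi> x *\<^sub>R b) \<partial>M)"
    proof (rule tendsto_add)
      show "(\<lambda>n. \<integral>x. fst (s n x) \<bullet> dir_deriv b \<psi> x \<partial>M) \<longlonglongrightarrow> (\<integral>x. u x \<bullet> dir_deriv b \<psi> x \<partial>M)"
        by (rule r.tendsto_left[OF H1_L2(1)[OF s] u(1) test_functions_L2(2)[OF \<psi>]])
           (use u(2) in \<open>simp add: power2_norm_eq_inner power2_eq_square\<close>)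
      show "(\<lambda>n. \<integral>x. snd (s n x) \<bullet> (\<psi> x *\<^sub>R b) \<partial>M) \<longlonglongrightarrow> (\<integral>x. G x \<bullet> (\<psi> x *\<^sub>R b) \<partial>M)"
        by (rule g.tendsto_left[OF H1_L2(2)[OF s] G(1) test_functions_L2(3)[OF \<psi>]])
           (use G(2) in \<open>simp add: power2_norm_eq_inner\<close>)
    qed
    moreover have "(\<integral>x. fst (s n x) \<bullet> dir_deriv b \<psi> x \<partial>M) + (\<integral>x. snd (s n x) \<bullet> (\<psi> x *\<^sub>R b) \<partial>M) = 0" for n
      using s[of n] \<psi> by (auto simp: H1_iff)
    ultimately show "(\<integral>x. fst (w x) \<bullet> dir_deriv b \<psi> x \<partial>M) + (\<integral>x. snd (w x) \<bullet> (\<psi> x *\<^sub>R b) \<partial>M) = 0"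
      using LIMSEQ_unique[OF _ tendsto_const] by (fastforce simp: w_def)
  qed
  moreover have "(\<lambda>n. mass (s n - w) (s n - w) + stiffness (s n - w) (s n - w)) \<longlonglongrightarrow> 0"
    using tendsto_add[OF limb lima] by simp
  ultimately show ?thesis by blast
qed

end

text \<open>The box supplies the centres of the averaged dilations; the bump families supply the
  infinite dimension that the spectral theorem asks for.\<close>

locale neumann_problem = convex_cutoff_domain D cut for D cut +
  fixes l u :: "real \<times> real"
  assumes box: "cbox l u \<subseteq> D" "0 < measure lborel (cbox l u)"
    and bumps: "\<exists>C h. bump_family n C h"
begin

lemma H1_compact:
  assumes s: "\<And>n. s n \<in> H1" and C: "\<And>n. mass (s n) (s n) + stiffness (s n) (s n) \<le> C"
  shows "\<exists>r. strict_mono (r :: nat \<Rightarrow> nat) \<and>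
        (\<forall>\<epsilon>>0. \<exists>N. \<forall>m\<ge>N. \<forall>n\<ge>N. mass (s (r m) - s (r n)) (s (r m) - s (r n)) < \<epsilon>)"
proof -
  interpret b: psd_form H1 mass by (rule psd_mass)
  interpret a: psd_form H1 stiffness by (rule psd_stiffness)
  define U where "U n = ext D (\<lambda>x. fst (s n x))" for n
  define G where "G n = ext D (\<lambda>x. snd (s n x))" for n
  have W: "weak_gradient D (U n) (G n)" for n
    unfolding U_def G_def using s[of n] by (intro H1_gradient_imp_weak) (simp add: H1_def)
  have CU: "(\<integral>z. (U n z)\<^sup>2 \<partial>lborel) \<le> C" for n
    using ext_norm_square[OF L2_measurable[OF H1_L2(1)[OF s[of n]]]] C[of n] a.nonneg[OF s[of n]]
    by (simp add: U_def mass_def power2_eq_square)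
  have CG: "(\<integral>z. (norm (G n z))\<^sup>2 \<partial>lborel) \<le> C" for n
    using ext_norm_square[OF L2_measurable[OF H1_L2(2)[OF s[of n]]]] C[of n] b.nonneg[OF s[of n]]
    by (simp add: G_def stiffness_def power2_norm_eq_inner)
  have eq: "mass (s m - s n) (s m - s n) = (\<integral>z. (U m z - U n z)\<^sup>2 \<partial>lborel)" for m n
  proof -
    have "ext D (\<lambda>x. fst (s m x) - fst (s n x)) = (\<lambda>z. U m z - U n z)"
      by (auto simp: ext_def U_def)
    moreover have "(\<lambda>x. fst (s m x) - fst (s n x)) \<in> borel_measurable M"
      by (rule L2_measurable[OF L2_diff[OF H1_L2(1)[OF s] H1_L2(1)[OF s]]])
    ultimately show ?thesis using ext_norm_square[of "\<lambda>x. fst (s m x) - fst (s n x)"]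
      by (simp add: mass_def power2_eq_square)
  qed
  show ?thesis unfolding eq by (rule Rellich[OF W CU CG box])
qed

sublocale spectral_problem H1 mass stiffness
proof (intro spectral_problem.intro spectral_problem_axioms.intro psd_mass psd_stiffness H1_complete H1_compact)
  fix n and e :: "nat \<Rightarrow> torus \<Rightarrow> real \<times> (real \<times> real)"
  assume "\<And>i. i < n \<Longrightarrow> e i \<in> H1"
  then show "\<exists>v\<in>H1. (\<forall>i<n. mass v (e i) = 0) \<and> 0 < mass v v"
    using bumps[of "Suc n"] bump_combination by blast
qed

text \<open>Duality with constant 0: a square integrable function orthogonal to all test functions
  has norm 0.\<close>

lemma AE_zero_of_orthogonal_H1:
  assumes g: "g \<in> L2 M" and orth: "\<And>F. F \<in> test_planar D \<Longrightarrow> (\<integral>x. g x * lift F x \<partial>M) = 0"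
  shows "AE x in M. g x = 0"
proof -
  have le: "(\<integral>z. (ext D g z)\<^sup>2 \<partial>lborel) \<le> 0\<^sup>2"
  proof (rule norm_by_duality[OF ext_L2[OF g]])
    show "ext D g z = 0" if "z \<notin> D" for z using that by (simp add: ext_def)
    fix F assume F: "F \<in> test_planar D"
    have "continuous_on UNIV (lift F)"
      using smooth_continuous0 lift_test_functions[OF F] by (simp add: test_functions_def)
    then have m: "(\<lambda>x. g x * lift F x) \<in> borel_measurable M"
      using L2_measurable[OF g] continuous_measurable_M by measurable
    have "ext D (\<lambda>x. g x * lift F x) = (\<lambda>z. ext D g z * F z)" by (auto simp: ext_def lift_def)
    then have "(\<integral>z. ext D g z * F z \<partial>lborel) = 0"
      using orth[OF F] ext_integral(2)[OF m] by simp
    then show "\<bar>\<integral>z. ext D g z * F z \<partial>lborel\<bar> \<le> 0 * sqrt (\<integral>z. (F z)\<^sup>2 \<partial>lborel)" by simp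
  qed
  have "(\<integral>x. (g x)\<^sup>2 \<partial>M) = (\<integral>z. (ext D g z)\<^sup>2 \<partial>lborel)"
    using ext_norm_square[OF L2_measurable[OF g]] by simp
  also have "\<dots> = 0"
    using le by (intro antisym) (simp_all only: zero_power2 integral_nonneg_AE AE_I2 zero_le_power2)
  finally have "(\<integral>x. (g x)\<^sup>2 \<partial>M) = 0" .
  then have "AE x in M. (g x)\<^sup>2 = 0"
    using integral_nonneg_eq_0_iff_AE[of M "\<lambda>x. (g x)\<^sup>2"] L2_integrable_square[OF g] by simp
  then show ?thesis by simp
qed

text \<open>The value \<open>E\<close> occurs in the list, since otherwise \<open>f\<close> would be
  orthogonal to a complete system. The \<open>N\<close> bumps with Rayleigh quotients at most
  \<open>C < E\<close> push the first \<open>N\<close> eigenvalues to at most \<open>C\<close>, so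
  the least index carrying \<open>E\<close> is at least \<open>N\<close>.\<close>

theorem has_pos_lower_bound:
  assumes f: "neumann_eigenfunction \<Omega> E f" and h: "bump_family N C h" and CE: "C < E"
  shows "\<exists>n\<ge>N. has_pos f \<Omega> n"
proof -
  obtain e \<mu> where mono: "incseq \<mu>" and lim: "filterlim \<mu> at_top sequentially" and eV: "\<And>n. e n \<in> H1"
    and orth: "\<And>m n. mass (e m) (e n) = (if m = n then 1 else 0)"
    and EL: "\<And>n v. v \<in> H1 \<Longrightarrow> stiffness (e n) v = \<mu> n * mass (e n) v"
    and min: "\<And>n v. v \<in> H1 \<Longrightarrow> (\<And>i. i < n \<Longrightarrow> mass v (e i) = 0) \<Longrightarrow> \<mu> n * mass v v \<le> stiffness v v"
    and approx: "\<And>v. v \<in> H1 \<Longrightarrow> (\<lambda>n. mass (v - (\<Sum>i<n. mass v (e i) *\<^sub>R e i)) (v - (\<Sum>i<n. mass v (e i) *\<^sub>R e i))) \<longlonglongrightarrow> 0"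
    by (rule spectral_theorem) blast
  define \<epsilon> where "\<epsilon> n x = fst (e n x)" for n x
  \<comment> \<open>The spectral theorem expands elements of \<open>H1\<close> only. A general
    \<open>g\<close> in \<open>L^2\<close> is handled by testing it with lifts of planar test
    functions, which lie in \<open>H1\<close> and determine \<open>g\<close> almost
    everywhere.\<close>
  have complete: "AE x in M. g x = 0"
    if g: "g \<in> L2 M" and g0: "\<And>n. (\<integral>x. g x * \<epsilon> n x \<partial>M) = 0" for g
  proof (rule AE_zero_of_orthogonal_H1[OF g])
    fix F assume F: "F \<in> test_planar D"
    define v where "v = smooth_pair (lift F)"
    have v: "v \<in> H1" unfolding v_def
      using lift_test_functions[OF F] by (intro smooth_pair_H1) (simp add: test_functions_def)
    define p where "p n = v - (\<Sum>i<n. mass v (e i) *\<^sub>R e i)" for n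
    have p: "p n \<in> H1" for n unfolding p_def
      using v eV by (intro b.V_closed(4) b.V_closed(5) b.V_closed(3)) auto
    have ip: "integrable M (\<lambda>x. g x * fst (w x))" if "w \<in> H1" for w
      using L2_integrable_inner[OF g H1_L2(1)[OF that]] by simp
    have "(\<integral>x. g x * fst (p n x) \<partial>M) = (\<integral>x. g x * lift F x \<partial>M)" for n
    proof -
      have "(\<lambda>x. g x * fst (p n x)) = (\<lambda>x. g x * fst (v x) - (\<Sum>i<n. mass v (e i) * (g x * fst (e i x))))"
        by (simp add: p_def fun_eq_iff sum_fun_apply fst_sum sum_distrib_left right_diff_distrib mult.left_commute)
      then have "(\<integral>x. g x * fst (p n x) \<partial>M) = (\<integral>x. g x * fst (v x) \<partial>M) - (\<Sum>i<n. mass v (e i) * (\<integral>x. g x * fst (e i x) \<partial>M))"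
        using ip v eV by simp
      also have "(\<Sum>i<n. mass v (e i) * (\<integral>x. g x * fst (e i x) \<partial>M)) = 0"
        using g0 by (intro sum.neutral) (simp add: \<epsilon>_def)
      finally show ?thesis by (simp add: v_def smooth_pair_def)
    qed
    then have bound: "\<bar>\<integral>x. g x * lift F x \<partial>M\<bar> \<le> sqrt (\<integral>x. (norm (g x))\<^sup>2 \<partial>M) * sqrt (mass (p n) (p n))" for n
      using L2_Cauchy_Schwarz[OF g H1_L2(1)[OF p[of n]]] by (simp add: mass_def power2_eq_square)
    have "(\<lambda>n. sqrt (\<integral>x. (norm (g x))\<^sup>2 \<partial>M) * sqrt (mass (p n) (p n))) \<longlonglongrightarrow> sqrt (\<integral>x. (norm (g x))\<^sup>2 \<partial>M) * sqrt 0"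
      unfolding p_def by (intro tendsto_intros approx[OF v])
    then have "\<bar>\<integral>x. g x * lift F x \<partial>M\<bar> \<le> sqrt (\<integral>x. (norm (g x))\<^sup>2 \<partial>M) * sqrt 0"
      by (rule LIMSEQ_le_const) (use bound in blast)
    then show "(\<integral>x. g x * lift F x \<partial>M) = 0" by simp
  qed
  have "neumann_eigenfunction \<Omega> (\<mu> n) (\<epsilon> n)" for n
    unfolding neumann_eigenfunction_def
  proof
    show "\<not> (AE x in M. \<epsilon> n x = 0)"
    proof
      assume "AE x in M. \<epsilon> n x = 0"
      then have "AE x in M. fst (e n x) \<bullet> fst (e n x) = 0" by eventually_elim (simp add: \<epsilon>_def)
      then have "mass (e n) (e n) = 0" unfolding mass_def by (rule integral_eq_zero_AE)
      then show False using orth[of n n] by simp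
    qed
    show "\<exists>G. H1_gradient \<Omega> (\<epsilon> n) G \<and>
      (\<forall>v W. H1_gradient \<Omega> v W \<longrightarrow> (\<integral>x. G x \<bullet> W x \<partial>M) = \<mu> n * (\<integral>x. \<epsilon> n x * v x \<partial>M))"
    proof (intro exI[of _ "\<lambda>x. snd (e n x)"] conjI allI impI)
      show "H1_gradient \<Omega> (\<epsilon> n) (\<lambda>x. snd (e n x))" using eV[of n] by (simp add: H1_def \<epsilon>_def[abs_def])
      fix v W assume "H1_gradient \<Omega> v W"
      then have "(\<lambda>x. (v x, W x)) \<in> H1" by (simp add: H1_def)
      from EL[OF this, of n] show "(\<integral>x. snd (e n x) \<bullet> W x \<partial>M) = \<mu> n * (\<integral>x. \<epsilon> n x * v x \<partial>M)"
        by (simp add: stiffness_def mass_def \<epsilon>_def)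
    qed
  qed
  then have "neumann_spectrum \<Omega> \<mu>"
    unfolding neumann_spectrum_def L2_on_eq
  proof (intro conjI mono lim exI[of _ \<epsilon>] allI ballI impI)
    show "(\<integral>x. \<epsilon> m x * \<epsilon> n x \<partial>M) = (if m = n then 1 else 0)" for m n
      using orth[of m n] by (simp add: mass_def \<epsilon>_def)
  qed (use complete in auto)
  moreover have ex: "\<exists>k. \<mu> k = E"
  proof (rule ccontr)
    assume no: "\<not> (\<exists>k. \<mu> k = E)"
    obtain G where G: "H1_gradient \<Omega> f G"
      "\<And>v W. H1_gradient \<Omega> v W \<Longrightarrow> (\<integral>x. G x \<bullet> W x \<partial>M) = E * (\<integral>x. f x * v x \<partial>M)"
      using f by (auto simp: neumann_eigenfunction_def)
    define w where "w x = (f x, G x)" for x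
    have w: "w \<in> H1" using G(1) by (simp add: H1_def w_def)
    have "(\<integral>x. f x * \<epsilon> n x \<partial>M) = 0" for n
    proof -
      have "stiffness w (e n) = E * mass w (e n)"
        using G(2)[of "\<lambda>x. fst (e n x)" "\<lambda>x. snd (e n x)"] eV[of n] by (simp add: H1_def stiffness_def mass_def w_def)
      moreover have "stiffness w (e n) = \<mu> n * mass w (e n)"
        using EL[OF w, of n] a.sym[OF w eV] b.sym[OF w eV] by simp
      ultimately have "E * mass w (e n) = \<mu> n * mass w (e n)" by (simp only:)
      then have "mass w (e n) = 0" using no by (metis mult_right_cancel)
      then show ?thesis by (simp add: mass_def w_def \<epsilon>_def)
    qed
    then have "AE x in M. f x = 0"
      using complete H1_L2(1)[OF w] by (simp add: w_def)
    then show False using f by (simp add: neumann_eigenfunction_def)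
  qed
  moreover have "N \<le> (LEAST k. \<mu> k = E)"
  proof (rule ccontr)
    assume "\<not> N \<le> (LEAST k. \<mu> k = E)"
    then obtain k where k: "\<mu> k = E" "k < N" using LeastI_ex[OF ex] by (metis not_le)
    \<comment> \<open>With \<open>N = n + 1\<close> there are \<open>n + 1\<close> bumps for the
      \<open>n\<close> constraints \<open>e 0, ..., e (n - 1)\<close>; the trial vector bounds
      \<open>\<mu> n\<close>, the largest of the first \<open>N\<close> eigenvalues.\<close>
    then obtain n where n: "N = Suc n" "k \<le> n" by (cases N) auto
    obtain v where v: "v \<in> H1" "\<And>i. i < n \<Longrightarrow> mass v (e i) = 0" "0 < mass v v" "stiffness v v \<le> C * mass v v"
      using bump_combination[of n C h e] h n eV by auto
    have "\<mu> n * mass v v \<le> C * mass v v" using min[OF v(1,2), of n] v(4) by simp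
    then have "\<mu> n \<le> C" using v(3) by simp
    moreover have "E \<le> \<mu> n" using incseqD[OF mono n(2)] k by simp
    ultimately show False using CE by simp
  qed
  ultimately show ?thesis unfolding has_pos_def using f by blast
qed

end

section \<open>Ordinary differential equations\<close>

text \<open>The signed integral from 0 to \<open>t\<close> for either sign of \<open>t\<close>: at
  most one of the two intervals is nondegenerate.\<close>

definition primitive :: "(real \<Rightarrow> 'a::euclidean_space) \<Rightarrow> real \<Rightarrow> 'a" where
  "primitive g t = integral {0..t} g - integral {t..0} g"

lemma primitive_0 [simp]: "primitive g 0 = 0"
  by (simp add: primitive_def)

lemma primitive_has_vector_derivative:
  assumes g: "continuous_on UNIV g"
  shows "(primitive g has_vector_derivative g t) (at t)"
proof -
  define a where "a = min t 0 - 1"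
  define b where "b = max t 0 + 1"
  have int: "g integrable_on {x..y}" for x y
    by (rule integrable_continuous_real) (rule continuous_on_subset[OF g], simp)
  have eq: "primitive g s = integral {a..s} g - integral {a..0} g" if s: "a \<le> s" for s
  proof (cases "0 \<le> s")
    case True
    have "integral {a..0} g + integral {0..s} g = integral {a..s} g"
      by (rule Henstock_Kurzweil_Integration.integral_combine) (use True int in \<open>auto simp: a_def\<close>)
    moreover have "integral {s..0} g = 0" using True by (cases "s = 0") auto
    ultimately show ?thesis by (simp add: primitive_def algebra_simps)
  next
    case False
    have "integral {a..s} g + integral {s..0} g = integral {a..0} g"
      by (rule Henstock_Kurzweil_Integration.integral_combine) (use False s int in auto)
    moreover have "integral {0..s} g = 0" using False by simp
    ultimately show ?thesis by (simp add: primitive_def algebra_simps)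
  qed
  have t: "t \<in> {a<..<b}" by (auto simp: a_def b_def)
  have "((\<lambda>s. integral {a..s} g) has_vector_derivative g t) (at t within {a..b})"
    by (rule integral_has_vector_derivative) (use t continuous_on_subset[OF g] in auto)
  then have "((\<lambda>s. integral {a..s} g) has_vector_derivative g t) (at t)"
    using t at_within_interior[of t "{a..b}"] by simp
  then have "((\<lambda>s. integral {a..s} g - integral {a..0} g) has_vector_derivative g t) (at t)"
    by (auto intro!: derivative_eq_intros)
  then show ?thesis
    by (rule has_vector_derivative_transform_within_open[of _ _ _ "{a<..<b}"]) (use t eq in auto)
qed

text \<open>A majorant in \<open>|s|\<close> treats both directions of time at once; negative times
  are reduced to positive ones by reflection.\<close>

lemma primitive_bound:
  assumes g: "continuous_on UNIV g" and \<psi>: "\<And>s. (\<psi> has_real_derivative \<psi>' s) (at s)" "\<psi> 0 = 0"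
    and le: "\<And>s. norm (g s) \<le> \<psi>' \<bar>s\<bar>"
  shows "norm (primitive g t) \<le> \<psi> \<bar>t\<bar>"
proof -
  have cont: "continuous_on A (primitive g)" for A
    by (rule continuous_at_imp_continuous_on)
       (use primitive_has_vector_derivative[OF g] has_vector_derivative_continuous in blast)
  have cont\<psi>: "continuous_on A \<psi>" for A
    by (rule continuous_at_imp_continuous_on) (use \<psi>(1) DERIV_isCont in blast)
  have \<psi>v: "(\<psi> has_vector_derivative \<psi>' s) (at s)" for s
    using \<psi>(1) by (simp add: has_real_derivative_iff_has_vector_derivative)
  have neg: "((\<lambda>s. primitive g (- s)) has_vector_derivative - g (- s)) (at s)" for s
  proof -
    have "(uminus has_vector_derivative - 1) (at s)" by (auto intro!: derivative_eq_intros)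
    from vector_diff_chain_at[OF this primitive_has_vector_derivative[OF g, of "- s"]]
    show ?thesis by (simp add: o_def)
  qed
  have contneg: "continuous_on A (\<lambda>s. primitive g (- s))" for A
    by (rule continuous_at_imp_continuous_on)
       (use neg has_vector_derivative_continuous in blast)
  consider "t = 0" | "0 < t" | "t < 0" by linarith
  then show ?thesis
  proof cases
    case 1 then show ?thesis using \<psi> by simp
  next
    case 2
    have "norm (primitive g t - primitive g 0) \<le> \<psi> t - \<psi> 0"
    proof (rule differentiable_bound_general[OF 2 cont cont\<psi> primitive_has_vector_derivative[OF g] \<psi>v])
      show "norm (g s) \<le> \<psi>' s" if "0 < s" for s using le[of s] that by simp
    qed
    then show ?thesis using 2 \<psi> by simp
  next
    case 3
    then have "0 < - t" by simp
    then have "norm (primitive g (- (- t)) - primitive g (- 0)) \<le> \<psi> (- t) - \<psi> 0"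
    proof (rule differentiable_bound_general[OF _ contneg cont\<psi> neg \<psi>v])
      show "norm (- g (- s)) \<le> \<psi>' s" if "0 < s" for s using le[of "- s"] that by simp
    qed
    then show ?thesis using 3 \<psi> by simp
  qed
qed

lemma primitive_diff:
  assumes "continuous_on UNIV g" "continuous_on UNIV h"
  shows "primitive (\<lambda>s. g s - h s) t = primitive g t - primitive h t"
proof -
  have "g integrable_on {x..y}" "h integrable_on {x..y}" for x y
    by (rule integrable_continuous_real; rule continuous_on_subset[of UNIV]; use assms in simp)+
  then show ?thesis by (simp add: primitive_def Henstock_Kurzweil_Integration.integral_diff)
qed

text \<open>Picard--Lindeloef on the whole line: in the sup norm weighted by \<open>exp (- 2 L \<bar>t\<bar>)\<close> the integral
  operator is a contraction with constant \<open>1/2\<close>.\<close>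
theorem global_solution_ex:
  fixes v :: "'a::euclidean_space \<Rightarrow> 'a"
  assumes lip: "\<And>x y. norm (v x - v y) \<le> L * norm (x - y)" and L: "0 < L" and bound: "\<And>x. norm (v x) \<le> B"
  shows "\<exists>c. c 0 = 0 \<and> (\<forall>t. (c has_vector_derivative v (z + c t)) (at t))"
proof -
  have vcont: "continuous_on UNIV v"
  proof (rule continuous_onI)
    fix x \<epsilon> assume "(0::real) < \<epsilon>"
    have "dist (v x') (v x) \<le> \<epsilon>" if "dist x' x < \<epsilon> / L" for x'
    proof -
      have "norm (v x' - v x) \<le> L * norm (x' - x)" by (rule lip)
      also have "\<dots> \<le> L * (\<epsilon> / L)" using that L by (intro mult_left_mono) (auto simp: dist_norm)
      finally show ?thesis using L by (simp add: dist_norm)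
    qed
    then show "\<exists>d>0. \<forall>x'\<in>UNIV. dist x' x < d \<longrightarrow> dist (v x') (v x) \<le> \<epsilon>"
      using \<open>0 < \<epsilon>\<close> L by (intro exI[of _ "\<epsilon> / L"]) auto
  qed
  \<comment> \<open>The unknown is the rescaled curve \<open>y(t) = exp(-2 L |t|) c(t)\<close>,
    which turns the weighted norm into the ordinary norm on bounded continuous functions;
    \<open>T\<close> is the integral operator in these terms.\<close>
  define g where "g y s = v (z + exp (2 * L * \<bar>s\<bar>) *\<^sub>R apply_bcontfun y s)" for y :: "real \<Rightarrow>\<^sub>C 'a" and s
  have gcont: "continuous_on UNIV (g y)" for y
    unfolding g_def
    by (rule continuous_on_compose2[OF vcont]) (auto intro!: continuous_intros)
  define T where "T y t = exp (- (2 * L * \<bar>t\<bar>)) *\<^sub>R primitive (g y) t" for y t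
  have pcont: "continuous_on UNIV (primitive (g y))" for y
    by (rule continuous_at_imp_continuous_on)
       (use primitive_has_vector_derivative[OF gcont] has_vector_derivative_continuous in blast)
  have B: "0 \<le> B" using bound[of 0] norm_ge_zero order_trans by blast
  have Tb: "T y \<in> bcontfun" for y
  proof (rule bcontfun_normI)
    show "continuous_on UNIV (T y)" unfolding T_def by (intro continuous_intros pcont)
    fix t
    have "norm (primitive (g y) t) \<le> B * \<bar>t\<bar>"
      by (rule primitive_bound[OF gcont, of "\<lambda>s. B * s" "\<lambda>_. B"])
         (auto intro!: derivative_eq_intros simp: g_def bound)
    moreover have "2 * L * \<bar>t\<bar> \<le> exp (2 * L * \<bar>t\<bar>)"
      using exp_ge_add_one_self[of "2 * L * \<bar>t\<bar>"] by linarith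
    ultimately have "norm (primitive (g y) t) \<le> B / (2 * L) * exp (2 * L * \<bar>t\<bar>)"
      using L B mult_left_mono[of "2 * L * \<bar>t\<bar>" "exp (2 * L * \<bar>t\<bar>)" "B / (2 * L)"] by simp
    then show "norm (T y t) \<le> B / (2 * L)"
      using L by (simp add: T_def exp_minus field_simps)
  qed
  define \<T> where "\<T> y = Bcontfun (T y)" for y
  have app: "apply_bcontfun (\<T> y) = T y" for y
    unfolding \<T>_def by (rule Bcontfun_inverse[OF Tb])
  have "dist (\<T> x) (\<T> y) \<le> 1/2 * dist x y" for x y
  proof (rule dist_bound)
    fix t
    define d where "d = dist x y"
    have "norm (g x s - g y s) \<le> L * d * exp (2 * L * \<bar>s\<bar>)" for s
    proof -
      have "norm (g x s - g y s) \<le> L * norm (exp (2 * L * \<bar>s\<bar>) *\<^sub>R (apply_bcontfun x s - apply_bcontfun y s))"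
        unfolding g_def using lip[of "z + exp (2 * L * \<bar>s\<bar>) *\<^sub>R apply_bcontfun x s" "z + exp (2 * L * \<bar>s\<bar>) *\<^sub>R apply_bcontfun y s"]
        by (simp add: algebra_simps)
      also have "\<dots> = L * exp (2 * L * \<bar>s\<bar>) * dist (apply_bcontfun x s) (apply_bcontfun y s)"
        by (simp add: dist_norm)
      also have "\<dots> \<le> L * exp (2 * L * \<bar>s\<bar>) * d"
        unfolding d_def using L by (intro mult_left_mono dist_bounded) simp
      finally show ?thesis by (simp add: mult_ac)
    qed
    \<comment> \<open>Integrating \<open>L d exp(2 L s)\<close> gives
      \<open>d/2 (exp(2 L t) - 1)\<close>: the 2 in the exponent of the weight is the source of the
      contraction constant 1/2.\<close>
    then have "norm (primitive (\<lambda>s. g x s - g y s) t) \<le> d / 2 * (exp (2 * L * \<bar>t\<bar>) - 1)"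
      using L by (intro primitive_bound[where \<psi> = "\<lambda>s. d / 2 * (exp (2 * L * s) - 1)" and \<psi>' = "\<lambda>s. L * d * exp (2 * L * s)"])
        (auto intro!: derivative_eq_intros continuous_intros gcont)
    also have "\<dots> \<le> d / 2 * exp (2 * L * \<bar>t\<bar>)" by (intro mult_left_mono) (auto simp: d_def)
    finally have "norm (primitive (g x) t - primitive (g y) t) \<le> d / 2 * exp (2 * L * \<bar>t\<bar>)"
      by (simp add: primitive_diff gcont)
    then have "exp (- (2 * L * \<bar>t\<bar>)) * norm (primitive (g x) t - primitive (g y) t)
        \<le> exp (- (2 * L * \<bar>t\<bar>)) * (d / 2 * exp (2 * L * \<bar>t\<bar>))"
      by (intro mult_left_mono) auto
    moreover have "exp (- a) * (d / 2 * exp a) = d / 2" for a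
    proof -
      have "exp (- a) * (d / 2 * exp a) = d / 2 * (exp (- a) * exp a)" by (simp only: mult_ac)
      then show ?thesis by (simp add: exp_minus)
    qed
    ultimately have "exp (- (2 * L * \<bar>t\<bar>)) * norm (primitive (g x) t - primitive (g y) t) \<le> d / 2"
      by (simp only:)
    then have "norm (exp (- (2 * L * \<bar>t\<bar>)) *\<^sub>R (primitive (g x) t - primitive (g y) t)) \<le> d / 2"
      by simp
    then show "dist (apply_bcontfun (\<T> x) t) (apply_bcontfun (\<T> y) t) \<le> 1/2 * dist x y"
      by (simp add: app T_def dist_norm scaleR_diff_right d_def)
  qed
  then have "\<exists>!y. \<T> y = y" by (intro banach_fix_type[of "1/2"]) auto
  then obtain y where y: "\<T> y = y" by blast
  define c where "c = primitive (g y)"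
  have ge: "g y s = v (z + c s)" for s
  proof -
    have "apply_bcontfun y s = exp (- (2 * L * \<bar>s\<bar>)) *\<^sub>R c s"
      using app[of y] by (simp add: y T_def c_def)
    then show ?thesis by (simp add: g_def exp_minus)
  qed
  have "(c has_vector_derivative v (z + c t)) (at t)" for t
    unfolding ge[symmetric] unfolding c_def by (rule primitive_has_vector_derivative[OF gcont])
  moreover have "c 0 = 0" by (simp add: c_def)
  ultimately show ?thesis by blast
qed

text \<open>Gronwall for the squared distance \<open>n\<close>: its derivative is at most
  \<open>2 L n\<close> in modulus, so \<open>n exp(-2 L t)\<close> does not increase and
  \<open>n exp(2 L t)\<close> does not decrease, which covers the times after and before
  \<open>t0\<close>.\<close>

lemma solution_unique:
  fixes v :: "'a::euclidean_space \<Rightarrow> 'a"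
  assumes lip: "\<And>x y. norm (v x - v y) \<le> L * norm (x - y)" and L: "0 < L"
    and x: "\<And>t. (x has_vector_derivative v (x t)) (at t)" and y: "\<And>t. (y has_vector_derivative v (y t)) (at t)"
    and eq: "x t0 = y t0"
  shows "x t = y t"
proof -
  define n where "n t = (x t - y t) \<bullet> (x t - y t)" for t
  define n' where "n' t = 2 * ((x t - y t) \<bullet> (v (x t) - v (y t)))" for t
  have d: "((\<lambda>t. x t - y t) has_vector_derivative v (x t) - v (y t)) (at t)" for t
    by (intro has_vector_derivative_diff x y)
  have n: "(n has_real_derivative n' t) (at t)" for t
    unfolding n_def n'_def has_field_derivative_def
    by (rule has_derivative_eq_rhs[OF has_derivative_inner[OF d[unfolded has_vector_derivative_def] d[unfolded has_vector_derivative_def]]])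
       (simp add: fun_eq_iff inner_commute)
  have n': "\<bar>n' t\<bar> \<le> 2 * L * n t" for t
  proof -
    have "\<bar>(x t - y t) \<bullet> (v (x t) - v (y t))\<bar> \<le> norm (x t - y t) * norm (v (x t) - v (y t))"
      by (rule Cauchy_Schwarz_ineq2)
    also have "\<dots> \<le> norm (x t - y t) * (L * norm (x t - y t))" by (intro mult_left_mono lip) simp
    also have "\<dots> = L * n t" by (simp add: n_def power2_norm_eq_inner[symmetric] power2_eq_square)
    finally show ?thesis by (simp add: n'_def)
  qed
  have e: "((\<lambda>t. n t * exp (a * t)) has_real_derivative (n' t + a * n t) * exp (a * t)) (at t)" for a t
  proof -
    have "((\<lambda>t. exp (a * t)) has_real_derivative a * exp (a * t)) (at t)"
      by (auto intro!: derivative_eq_intros)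
    from DERIV_mult'[OF n this] show ?thesis by (simp add: algebra_simps)
  qed
  have e1: "((\<lambda>t. n t * exp (- 2 * L * t)) has_real_derivative (n' t - 2 * L * n t) * exp (- 2 * L * t)) (at t)" for t
    using e[of "- 2 * L" t] by simp
  have e2: "((\<lambda>t. n t * exp (2 * L * t)) has_real_derivative (n' t + 2 * L * n t) * exp (2 * L * t)) (at t)" for t
    by (rule e)
  have "n t \<le> 0"
  proof (cases "t0 \<le> t")
    case True
    have "n t * exp (- 2 * L * t) \<le> n t0 * exp (- 2 * L * t0)"
    proof (rule DERIV_nonpos_imp_nonincreasing[OF True])
      fix s
      have "(n' s - 2 * L * n s) * exp (- 2 * L * s) \<le> 0"
        using n'[of s] by (intro mult_nonpos_nonneg) auto
      then show "\<exists>y. ((\<lambda>t. n t * exp (- 2 * L * t)) has_real_derivative y) (at s) \<and> y \<le> 0"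
        using e1 by blast
    qed
    then show ?thesis using eq by (simp add: n_def mult_le_0_iff)
  next
    case False
    then have "t \<le> t0" by simp
    then have "n t * exp (2 * L * t) \<le> n t0 * exp (2 * L * t0)"
    proof (rule DERIV_nonneg_imp_nondecreasing)
      fix s
      have "0 \<le> (n' s + 2 * L * n s) * exp (2 * L * s)"
        using n'[of s] by (intro mult_nonneg_nonneg) auto
      then show "\<exists>y. ((\<lambda>t. n t * exp (2 * L * t)) has_real_derivative y) (at s) \<and> 0 \<le> y"
        using e2 by blast
    qed
    then show ?thesis using eq by (simp add: n_def mult_le_0_iff)
  qed
  moreover have "0 \<le> n t" by (simp add: n_def)
  ultimately have "n t = 0" by (rule antisym)
  then show ?thesis by (simp add: n_def)
qed

lemma monotone_bounded_convergent_at_top: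
  fixes g :: "real \<Rightarrow> real"
  assumes mono: "\<And>s t. t0 \<le> s \<Longrightarrow> s \<le> t \<Longrightarrow> g s \<le> g t" and bound: "\<And>t. t0 \<le> t \<Longrightarrow> g t \<le> B"
  shows "\<exists>l. (g \<longlongrightarrow> l) at_top"
proof -
  define l where "l = (SUP t\<in>{t0..}. g t)"
  have bdd: "bdd_above (g ` {t0..})" using bound by (auto intro!: bdd_aboveI[of _ B])
  have "(g \<longlongrightarrow> l) at_top"
  proof (rule order_tendstoI)
    fix a assume "a < l"
    then obtain s where s: "t0 \<le> s" "a < g s"
      unfolding l_def using less_cSUP_iff[OF _ bdd] by auto
    show "\<forall>\<^sub>F t in at_top. a < g t"
      using eventually_ge_at_top[of s] by eventually_elim (use mono[OF s(1)] s(2) in force)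
  next
    fix a assume a: "l < a"
    show "\<forall>\<^sub>F t in at_top. g t < a"
      using eventually_ge_at_top[of t0]
    proof eventually_elim
      case (elim t)
      then have "g t \<le> l" unfolding l_def by (intro cSUP_upper bdd) auto
      then show ?case using a by simp
    qed
  qed
  then show ?thesis ..
qed

text \<open>By the mean value theorem on \<open>[t, t + 1]\<close> the increments of
  \<open>g\<close>, which tend to 0, are values of the derivative at points tending to infinity. It
  identifies limits of orbits as critical points.\<close>

lemma limit_of_derivative_zero:
  fixes g :: "real \<Rightarrow> real"
  assumes g: "(g \<longlongrightarrow> l) at_top" and d: "\<And>t. (g has_real_derivative g' t) (at t)" and g': "(g' \<longlongrightarrow> m) at_top"
  shows "m = 0"
proof -
  have "\<exists>\<xi>. t < \<xi> \<and> \<xi> < t + 1 \<and> g (t + 1) - g t = g' \<xi>" for t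
    using MVT2[of t "t + 1" g g'] d by auto
  then obtain \<xi> where \<xi>: "\<And>t. t < \<xi> t" "\<And>t. g (t + 1) - g t = g' (\<xi> t)" by metis
  have "filterlim \<xi> at_top at_top"
    by (rule filterlim_at_top_mono[OF filterlim_ident]) (intro always_eventually allI less_imp_le \<xi>(1))
  then have "((\<lambda>t. g' (\<xi> t)) \<longlongrightarrow> m) at_top" by (rule filterlim_compose[OF g'])
  moreover have "((\<lambda>t. g (t + 1) - g t) \<longlongrightarrow> l - l) at_top"
  proof (intro tendsto_diff g filterlim_compose[OF g])
    show "filterlim (\<lambda>t::real. t + 1) at_top at_top"
      by (rule filterlim_at_top_mono[OF filterlim_ident]) auto
  qed
  ultimately show ?thesis unfolding \<xi>(2)
    by (intro tendsto_unique[OF trivial_limit_at_top_linorder]) simp_all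
qed

section \<open>The eigenfunction and its gradient flow\<close>

text \<open>Gronwall for the square of \<open>g\<close>, with weight \<open>exp(-2 A t)\<close>
  forward and \<open>exp(2 A t)\<close> backward in time. Applied along orbits it makes the zero
  sets of the two sines and of \<open>P\<close> invariant.\<close>

lemma linear_differential_inequality_zero:
  fixes g :: "real \<Rightarrow> real"
  assumes g: "\<And>t. (g has_real_derivative g' t) (at t)" and bound: "\<And>t. \<bar>g' t\<bar> \<le> A * \<bar>g t\<bar>" and "g t0 = 0"
  shows "g t = 0"
proof -
  have d: "((\<lambda>t. (g t)\<^sup>2 * exp (a * t)) has_real_derivative (2 * g t * g' t + a * (g t)\<^sup>2) * exp (a * t)) (at t)" for a t
  proof -
    have "((\<lambda>t. exp (a * t)) has_real_derivative a * exp (a * t)) (at t)"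
      by (auto intro!: derivative_eq_intros)
    from DERIV_mult'[OF DERIV_power[OF g, of 2 t] this] show ?thesis by (simp add: algebra_simps)
  qed
  have le: "\<bar>2 * g t * g' t\<bar> \<le> 2 * A * (g t)\<^sup>2" for t
  proof -
    have "\<bar>g t\<bar> * \<bar>g' t\<bar> \<le> \<bar>g t\<bar> * (A * \<bar>g t\<bar>)" by (intro mult_left_mono bound) simp
    then show ?thesis by (simp add: abs_mult power2_eq_square mult_ac abs_mult_self_eq)
  qed
  have "(g t)\<^sup>2 \<le> 0"
  proof (cases "t0 \<le> t")
    case True
    have "(g t)\<^sup>2 * exp (- 2 * A * t) \<le> (g t0)\<^sup>2 * exp (- 2 * A * t0)"
    proof (rule DERIV_nonpos_imp_nonincreasing[OF True])
      fix s
      have "(2 * g s * g' s + (- 2 * A) * (g s)\<^sup>2) * exp (- 2 * A * s) \<le> 0"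
        using le[of s] by (intro mult_nonpos_nonneg) auto
      then show "\<exists>y. ((\<lambda>t. (g t)\<^sup>2 * exp (- 2 * A * t)) has_real_derivative y) (at s) \<and> y \<le> 0"
        using d by blast
    qed
    then show ?thesis using assms(3) by (simp add: mult_le_0_iff)
  next
    case False
    then have "t \<le> t0" by simp
    then have "(g t)\<^sup>2 * exp (2 * A * t) \<le> (g t0)\<^sup>2 * exp (2 * A * t0)"
    proof (rule DERIV_nonneg_imp_nondecreasing)
      fix s
      have "0 \<le> (2 * g s * g' s + (2 * A) * (g s)\<^sup>2) * exp (2 * A * s)"
        using le[of s] by (intro mult_nonneg_nonneg) auto
      then show "\<exists>y. ((\<lambda>t. (g t)\<^sup>2 * exp (2 * A * t)) has_real_derivative y) (at s) \<and> 0 \<le> y"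
        using d by blast
    qed
    then show ?thesis using assms(3) by (simp add: mult_le_0_iff)
  qed
  then show ?thesis by simp
qed

text \<open>A loss of positivity would produce a zero by the intermediate value theorem, and a zero
  at one time forces vanishing at all times.\<close>

lemma linear_differential_inequality_pos:
  fixes g :: "real \<Rightarrow> real"
  assumes g: "\<And>t. (g has_real_derivative g' t) (at t)" and bound: "\<And>t. \<bar>g' t\<bar> \<le> A * \<bar>g t\<bar>" and "0 < g t0"
  shows "0 < g t"
proof (rule ccontr)
  assume "\<not> 0 < g t"
  have cont: "isCont g s" for s using g DERIV_isCont by blast
  have "\<exists>s. g s = 0"
  proof (cases "t \<le> t0")
    case True
    then show ?thesis using IVT[of g t 0 t0] \<open>\<not> 0 < g t\<close> assms(3) cont by auto
  next
    case False
    then show ?thesis using IVT2[of g t 0 t0] \<open>\<not> 0 < g t\<close> assms(3) cont by auto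
  qed
  then obtain s where "g s = 0" by blast
  then have "g t0 = 0" by (rule linear_differential_inequality_zero[OF g bound])
  then show False using assms(3) by simp
qed

lemma sin_cos_lipschitz: "\<bar>sin a - sin b\<bar> \<le> \<bar>a - b\<bar>" "\<bar>cos a - cos b\<bar> \<le> \<bar>a - (b::real)\<bar>"
proof -
  show "\<bar>sin a - sin b\<bar> \<le> \<bar>a - b\<bar>"
    using field_differentiable_bound[of UNIV sin cos 1 a b] DERIV_sin abs_cos_le_one by auto
  show "\<bar>cos a - cos b\<bar> \<le> \<bar>a - b\<bar>"
    using field_differentiable_bound[of UNIV cos "\<lambda>x. - sin x" 1 a b] DERIV_cos abs_sin_le_one by auto
qed

lemma product_lipschitz:
  fixes p q p' q' :: real
  assumes "\<bar>p\<bar> \<le> 1" "\<bar>q'\<bar> \<le> 1" "\<bar>p - p'\<bar> \<le> a" "\<bar>q - q'\<bar> \<le> b"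
  shows "\<bar>p * q - p' * q'\<bar> \<le> a + b"
proof -
  have "\<bar>p * (q - q')\<bar> \<le> 1 * b" unfolding abs_mult using assms by (intro mult_mono) auto
  moreover have "\<bar>(p - p') * q'\<bar> \<le> a * 1" unfolding abs_mult using assms by (intro mult_mono) auto
  moreover have "p * q - p' * q' = p * (q - q') + (p - p') * q'" by (simp add: algebra_simps)
  ultimately show ?thesis by linarith
qed

text \<open>Even \<open>k\<close> makes the exponent \<open>k\<^sup>2\<close> even, so the power of
  \<open>sin (2 \<pi> y)\<close> is nonnegative and symmetric about \<open>y = 1/2\<close>;
  \<open>k \<ge> 2\<close> keeps the width at most 1/4.\<close>

locale product_eigenfunction =
  fixes k :: nat
  assumes even_k: "even k" and k_ge_2: "2 \<le> k"
begin

definition \<kappa> :: real where "\<kappa> = 2 * pi * real k"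

definition F :: "real \<times> real \<Rightarrow> real" where "F z = - cos (\<kappa> * fst z) * cos (2 * pi * snd z)"
definition Fx :: "real \<times> real \<Rightarrow> real" where "Fx z = \<kappa> * (sin (\<kappa> * fst z) * cos (2 * pi * snd z))"
definition Fy :: "real \<times> real \<Rightarrow> real" where "Fy z = 2 * pi * (cos (\<kappa> * fst z) * sin (2 * pi * snd z))"

definition f :: "torus \<Rightarrow> real" where "f p = F (rep p)"

definition E :: real where "E = \<kappa>\<^sup>2 + (2 * pi)\<^sup>2"

lemma \<kappa>_pos: "0 < \<kappa>"
  using k_ge_2 by (simp add: \<kappa>_def)

lemma \<kappa>_width: "\<kappa> * (1 / (2 * real k)) = pi"
  using k_ge_2 by (simp add: \<kappa>_def)

lemma shift_int: "cos (2 * pi * real m * frac x) = cos (2 * pi * real m * x)" "sin (2 * pi * real m * frac x) = sin (2 * pi * real m * x)"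
proof -
  have "2 * pi * real m * frac x = 2 * pi * real m * x - 2 * pi * of_int (int m * \<lfloor>x\<rfloor>)"
    by (simp add: frac_def algebra_simps)
  then show "cos (2 * pi * real m * frac x) = cos (2 * pi * real m * x)" "sin (2 * pi * real m * frac x) = sin (2 * pi * real m * x)"
    by (simp_all only: cos_diff sin_diff cos_int_2pin sin_int_2pin mult_1_right mult_zero_right diff_zero add_0_right)
qed

lemma frac2_periodic:
  "cos (\<kappa> * fst (frac2 z)) = cos (\<kappa> * fst z)" "sin (\<kappa> * fst (frac2 z)) = sin (\<kappa> * fst z)"
  "cos (2 * pi * snd (frac2 z)) = cos (2 * pi * snd z)" "sin (2 * pi * snd (frac2 z)) = sin (2 * pi * snd z)"
  "cos (2 * pi * fst (frac2 z) - c) = cos (2 * pi * fst z - c)"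
  using shift_int[of k] shift_int[of 1] by (simp_all add: frac2_def \<kappa>_def cos_diff)

lemma f_abs [simp]: "f (abs_torus z) = F z"
  by (simp add: f_def F_def frac2_periodic)

lemma F_planar: "F \<in> planar" and Fx_planar: "Fx \<in> planar" and Fy_planar: "Fy \<in> planar"
  unfolding F_def Fx_def Fy_def by (intro planar_intros)+

lemma pd_F: "pd v F z = fst v * Fx z + snd v * Fy z"
  unfolding F_def Fx_def Fy_def
  by (rule pd_eq) (auto intro!: derivative_eq_intros simp: algebra_simps)

lemma pd_Fx: "pd v Fx z = fst v * (\<kappa>\<^sup>2 * (cos (\<kappa> * fst z) * cos (2 * pi * snd z))) - snd v * (2 * pi * \<kappa> * (sin (\<kappa> * fst z) * sin (2 * pi * snd z)))"
  unfolding Fx_def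
  by (rule pd_eq) (auto intro!: derivative_eq_intros simp: algebra_simps power2_eq_square)

lemma pd_Fy: "pd v Fy z = snd v * ((2 * pi)\<^sup>2 * (cos (\<kappa> * fst z) * cos (2 * pi * snd z))) - fst v * (2 * pi * \<kappa> * (sin (\<kappa> * fst z) * sin (2 * pi * snd z)))"
  unfolding Fy_def
  by (rule pd_eq) (auto intro!: derivative_eq_intros simp: algebra_simps power2_eq_square)

lemma smooth_f: "smooth f"
  by (rule smooth_planar) (simp add: F_planar)

lemma dir_deriv_f: "dir_deriv w f (abs_torus z) = fst w * Fx z + snd w * Fy z"
  by (simp add: dir_deriv_abs pd_F)

lemma dir_deriv2_f: "dir_deriv v (dir_deriv w f) (abs_torus z) = fst w * pd v Fx z + snd w * pd v Fy z"
proof -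
  have "dir_deriv v (dir_deriv w f) (abs_torus z) = pd v (\<lambda>z. fst w * Fx z + snd w * Fy z) z"
    unfolding dir_deriv_abs[of v "dir_deriv w f"] dir_deriv_f ..
  also have "\<dots> = fst w * pd v Fx z + snd w * pd v Fy z"
    by (simp add: pd_add planar_cmult Fx_planar Fy_planar pd_mult planar.const pd_eq[OF has_derivative_const])
  finally show ?thesis .
qed

lemma grad_f: "grad f (abs_torus z) = (Fx z, Fy z)"
  by (simp add: grad_eq dir_deriv_f)

lemma laplacian_f: "- laplacian f p = E * f p"
proof -
  obtain z where z: "p = abs_torus z" using torus_cases by blast
  show ?thesis
    by (simp add: z laplacian_def Basis_real_prod dir_deriv2_f pd_Fx pd_Fy E_def F_def algebra_simps)
qed

text \<open>At a critical point either both sines or both cosines vanish. In the first case the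
  Hessian is diagonal, in the second off-diagonal, and the remaining entries are nonzero; hence its
  kernel is trivial.\<close>

lemma morse_eigenfunction_f: "morse_eigenfunction f"
  unfolding morse_eigenfunction_def laplacian_eigenfunction_def
proof (intro conjI smooth_f)
  show "\<exists>p. f p \<noteq> 0" by (rule exI[of _ "abs_torus (0, 0)"]) (simp add: F_def)
  show "\<exists>E. \<forall>p. - laplacian f p = E * f p" using laplacian_f by blast
  show "morse f" unfolding morse_def
  proof (intro conjI smooth_f allI impI)
    fix p v assume crit: "critical_point f p" and ker: "\<forall>w. dir_deriv v (dir_deriv w f) p = 0"
    obtain z where z: "p = abs_torus z" using torus_cases by blast
    let ?sx = "sin (\<kappa> * fst z)" and ?cx = "cos (\<kappa> * fst z)" and ?sy = "sin (2 * pi * snd z)" and ?cy = "cos (2 * pi * snd z)"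
    have \<kappa>0: "\<kappa> \<noteq> 0" using \<kappa>_pos by simp
    have "Fx z = 0" "Fy z = 0" using crit by (simp_all add: critical_point_def z grad_f zero_prod_def)
    then have c: "?sx = 0 \<or> ?cy = 0" "?cx = 0 \<or> ?sy = 0" using \<kappa>0 by (auto simp: Fx_def Fy_def)
    have "pd v Fx z = 0" "pd v Fy z = 0"
      using ker[rule_format, of "(1, 0)"] ker[rule_format, of "(0, 1)"] by (simp_all add: z dir_deriv2_f)
    then have e: "fst v * (\<kappa>\<^sup>2 * (?cx * ?cy)) = snd v * (2 * pi * \<kappa> * (?sx * ?sy))"
      "snd v * ((2 * pi)\<^sup>2 * (?cx * ?cy)) = fst v * (2 * pi * \<kappa> * (?sx * ?sy))"
      by (simp_all add: pd_Fx pd_Fy)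
    have pyth: "?sx\<^sup>2 + ?cx\<^sup>2 = 1" "?sy\<^sup>2 + ?cy\<^sup>2 = 1" by simp_all
    show "v = 0"
    proof (cases "?sx = 0")
      case True
      then have "?cx \<noteq> 0" using pyth(1) by auto
      then have "?sy = 0" "?cy \<noteq> 0" using c(2) pyth(2) by auto
      then show ?thesis using e True \<open>?cx \<noteq> 0\<close> \<kappa>0 by (simp add: prod_eq_iff)
    next
      case False
      then have "?cy = 0" "?sy \<noteq> 0" using c(1) pyth(2) by auto
      then show ?thesis using e False \<kappa>0 by (simp add: prod_eq_iff)
    qed
  qed
qed

section \<open>The gradient flow on the plane and on the torus\<close>

definition vf :: "real \<times> real \<Rightarrow> real \<times> real" where "vf z = (- Fx z, - Fy z)"

text \<open>The sum of the Lipschitz constants \<open>\<kappa> (\<kappa> + 2 \<pi>)\<close> and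
  \<open>2 \<pi> (\<kappa> + 2 \<pi>)\<close> of the two components of the field.\<close>

definition L :: real where "L = (\<kappa> + 2 * pi)\<^sup>2"

lemma L_pos: "0 < L"
proof -
  have "0 < \<kappa> + 2 * pi" using \<kappa>_pos pi_gt_zero by linarith
  then show ?thesis unfolding L_def by (rule zero_less_power)
qed

lemma vf_lipschitz: "norm (vf x - vf y) \<le> L * norm (x - y)"
proof -
  have fs: "\<bar>fst x - fst y\<bar> \<le> norm (x - y)" "\<bar>snd x - snd y\<bar> \<le> norm (x - y)"
    by (metis norm_fst_le prod.collapse real_norm_def fst_diff, metis norm_snd_le prod.collapse real_norm_def snd_diff)
  have a: "\<bar>\<kappa> * fst x - \<kappa> * fst y\<bar> \<le> \<kappa> * norm (x - y)" "\<bar>2 * pi * snd x - 2 * pi * snd y\<bar> \<le> 2 * pi * norm (x - y)"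
    using fs \<kappa>_pos by (simp_all add: right_diff_distrib[symmetric] abs_mult)
  have b: "\<bar>sin (\<kappa> * fst x) - sin (\<kappa> * fst y)\<bar> \<le> \<kappa> * norm (x - y)"
    "\<bar>cos (\<kappa> * fst x) - cos (\<kappa> * fst y)\<bar> \<le> \<kappa> * norm (x - y)"
    "\<bar>sin (2 * pi * snd x) - sin (2 * pi * snd y)\<bar> \<le> 2 * pi * norm (x - y)"
    "\<bar>cos (2 * pi * snd x) - cos (2 * pi * snd y)\<bar> \<le> 2 * pi * norm (x - y)"
    by (rule order_trans[OF sin_cos_lipschitz(1) a(1)] order_trans[OF sin_cos_lipschitz(2) a(1)]
        order_trans[OF sin_cos_lipschitz(1) a(2)] order_trans[OF sin_cos_lipschitz(2) a(2)])+
  have 1: "\<bar>Fx x - Fx y\<bar> \<le> \<kappa> * (\<kappa> * norm (x - y) + 2 * pi * norm (x - y))"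
    unfolding Fx_def right_diff_distrib[symmetric] abs_mult using \<kappa>_pos
    by (intro mult_mono product_lipschitz b) auto
  have 2: "\<bar>Fy x - Fy y\<bar> \<le> 2 * pi * (\<kappa> * norm (x - y) + 2 * pi * norm (x - y))"
    unfolding Fy_def right_diff_distrib[symmetric] abs_mult[of "2 * pi"]
    by (intro mult_mono product_lipschitz b) auto
  have "norm (vf x - vf y) \<le> \<bar>Fx x - Fx y\<bar> + \<bar>Fy x - Fy y\<bar>"
    using norm_Pair_le[of "- Fx x - (- Fx y)" "- Fy x - (- Fy y)"] by (simp add: vf_def abs_minus_commute)
  also have "\<dots> \<le> L * norm (x - y)" using 1 2 by (simp add: L_def power2_eq_square algebra_simps)
  finally show ?thesis .
qed

lemma vf_bounded: "norm (vf z) \<le> \<kappa> + 2 * pi"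
proof -
  have "\<bar>Fx z\<bar> \<le> \<kappa> * (1 * 1)" unfolding Fx_def abs_mult using \<kappa>_pos by (intro mult_mono) auto
  moreover have "\<bar>Fy z\<bar> \<le> 2 * pi * (1 * 1)" unfolding Fy_def abs_mult[of "2 * pi"] abs_mult[of "cos _"] by (intro mult_mono) auto
  ultimately show ?thesis using norm_Pair_le[of "- Fx z" "- Fy z"] by (simp add: vf_def)
qed

definition solution :: "(real \<Rightarrow> real \<times> real) \<Rightarrow> bool" where
  "solution \<gamma> \<longleftrightarrow> (\<forall>t. (\<gamma> has_vector_derivative vf (\<gamma> t)) (at t))"

lemma solution_ex: "\<exists>\<gamma>. solution \<gamma> \<and> \<gamma> 0 = z"
proof -
  obtain c where c: "c 0 = 0" "\<And>t. (c has_vector_derivative vf (z + c t)) (at t)"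
    using global_solution_ex[of vf L "\<kappa> + 2 * pi" z, OF vf_lipschitz L_pos vf_bounded] by blast
  have "solution (\<lambda>t. z + c t)" unfolding solution_def
    using c(2) by (auto intro!: derivative_eq_intros)
  then show ?thesis using c(1) by (intro exI[of _ "\<lambda>t. z + c t"]) simp
qed

lemma solution_constant:
  assumes "solution \<gamma>" "vf (\<gamma> t0) = 0" shows "\<gamma> t = \<gamma> t0"
  using solution_unique[of vf L \<gamma> "\<lambda>_. \<gamma> t0" t0 t, OF vf_lipschitz L_pos] assms
  by (simp add: solution_def)

text \<open>The orbit is the image of a planar solution starting at the canonical representative, so
  each orbit comes with the lift that \<open>neg_gradient_flow\<close> asks for, after subtracting
  the starting point.\<close>

definition \<phi> :: "real \<Rightarrow> torus \<Rightarrow> torus" where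
  "\<phi> t p = abs_torus ((SOME \<gamma>. solution \<gamma> \<and> \<gamma> 0 = rep p) t)"

lemma \<phi>_solution:
  obtains \<gamma> where "solution \<gamma>" "\<gamma> 0 = rep p" "\<And>t. \<phi> t p = abs_torus (\<gamma> t)"
proof (rule that[of "SOME \<gamma>. solution \<gamma> \<and> \<gamma> 0 = rep p"])
  show "solution (SOME \<gamma>. solution \<gamma> \<and> \<gamma> 0 = rep p)" "(SOME \<gamma>. solution \<gamma> \<and> \<gamma> 0 = rep p) 0 = rep p"
    using someI_ex[OF solution_ex[of "rep p"]] by auto
qed (simp add: \<phi>_def)

lemma neg_gradient_flow_\<phi>: "neg_gradient_flow f \<phi>"
  unfolding neg_gradient_flow_def
proof
  fix p
  obtain \<gamma> where \<gamma>: "solution \<gamma>" "\<gamma> 0 = rep p" "\<And>t. \<phi> t p = abs_torus (\<gamma> t)"    using \<phi>_solution[of p] by blast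
  show "\<exists>c. c 0 = 0 \<and> (\<forall>t. \<phi> t p = p \<oplus> c t \<and> (c has_vector_derivative - grad f (\<phi> t p)) (at t))"
  proof (intro exI[of _ "\<lambda>t. \<gamma> t - rep p"] conjI allI)
    fix t
    have "abs_torus (\<gamma> t) = abs_torus (rep p) \<oplus> (\<gamma> t - rep p)" unfolding translate_abs by simp
    then show "\<phi> t p = p \<oplus> (\<gamma> t - rep p)" by (simp add: \<gamma>(3))
    have "(\<gamma> has_vector_derivative vf (\<gamma> t)) (at t)" using \<gamma>(1) by (simp add: solution_def)
    then have "((\<lambda>t. \<gamma> t - rep p) has_vector_derivative vf (\<gamma> t)) (at t)"
      by (auto intro!: derivative_eq_intros)
    then show "((\<lambda>t. \<gamma> t - rep p) has_vector_derivative - grad f (\<phi> t p)) (at t)"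
      by (simp add: \<gamma>(3) grad_f vf_def)
  qed (simp add: \<gamma>)
qed

lemma F_bound: "\<bar>F z\<bar> \<le> 1"
  unfolding F_def abs_mult using mult_mono[of "\<bar>- cos (\<kappa> * fst z)\<bar>" 1 "\<bar>cos (2 * pi * snd z)\<bar>" 1] by simp

lemma linear_bound: "\<bar>c * F z * g\<bar> \<le> \<bar>c\<bar> * \<bar>g\<bar>"
  unfolding abs_mult using mult_mono[of "\<bar>c\<bar> * \<bar>F z\<bar>" "\<bar>c\<bar> * 1" "\<bar>g\<bar>" "\<bar>g\<bar>"] F_bound[of z] by (simp add: mult_left_le)

context
  fixes \<gamma> assumes sol: "solution \<gamma>"
begin

lemma x_deriv: "((\<lambda>t. fst (\<gamma> t)) has_real_derivative - Fx (\<gamma> t)) (at t)"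
  and y_deriv: "((\<lambda>t. snd (\<gamma> t)) has_real_derivative - Fy (\<gamma> t)) (at t)"
proof -
  have d: "(\<gamma> has_derivative (\<lambda>h. h *\<^sub>R vf (\<gamma> t))) (at t)"
    using sol by (simp add: solution_def has_vector_derivative_def)
  show "((\<lambda>t. fst (\<gamma> t)) has_real_derivative - Fx (\<gamma> t)) (at t)"
    unfolding has_field_derivative_def
    by (rule has_derivative_eq_rhs[OF has_derivative_fst[OF d]]) (simp add: vf_def fun_eq_iff)
  show "((\<lambda>t. snd (\<gamma> t)) has_real_derivative - Fy (\<gamma> t)) (at t)"
    unfolding has_field_derivative_def
    by (rule has_derivative_eq_rhs[OF has_derivative_snd[OF d]]) (simp add: vf_def fun_eq_iff)
qed

lemma \<gamma>_isCont: "isCont \<gamma> t"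
  using sol has_vector_derivative_continuous[of \<gamma> "vf (\<gamma> t)" t UNIV] by (simp add: solution_def)

lemma sin_x_deriv: "((\<lambda>t. sin (\<kappa> * fst (\<gamma> t))) has_real_derivative \<kappa>\<^sup>2 * F (\<gamma> t) * sin (\<kappa> * fst (\<gamma> t))) (at t)"
  by (rule derivative_eq_intros x_deriv refl)+ (simp add: Fx_def F_def power2_eq_square)

lemma sin_y_deriv: "((\<lambda>t. sin (2 * pi * snd (\<gamma> t))) has_real_derivative (2 * pi)\<^sup>2 * F (\<gamma> t) * sin (2 * pi * snd (\<gamma> t))) (at t)"
  by (rule derivative_eq_intros y_deriv refl)+ (simp add: Fy_def F_def power2_eq_square)

end

text \<open>The zero set of \<open>P\<close> consists of the separatrices.\<close>
definition P :: "real \<times> real \<Rightarrow> real" where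
  "P z = sin (\<kappa> * fst z) - sin (2 * pi * snd z) ^ (k\<^sup>2)"

lemma P_planar: "P \<in> planar"
  unfolding P_def by (intro planar_intros)

lemma \<kappa>_sq: "real (k\<^sup>2) * (2 * pi)\<^sup>2 = \<kappa>\<^sup>2"
  by (simp add: \<kappa>_def power_mult_distrib)

text \<open>The exponent compensates the ratio of the two growth rates,
  \<open>k\<^sup>2 (2 \<pi>)\<^sup>2 = \<kappa>\<^sup>2\<close>. One factor \<open>s\<close> is
  restored to the power \<open>k\<^sup>2 - 1\<close> that differentiation leaves.\<close>

lemma power_deriv_aux: "real (k\<^sup>2) * (s ^ (k\<^sup>2 - 1) * ((2 * pi)\<^sup>2 * F z * s)) = \<kappa>\<^sup>2 * F z * s ^ (k\<^sup>2)"
proof -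
  have "k\<^sup>2 = Suc (k\<^sup>2 - 1)" using k_ge_2 by simp
  then have "s ^ (k\<^sup>2) = s * s ^ (k\<^sup>2 - 1)" by (metis power_Suc)
  then have "real (k\<^sup>2) * (s ^ (k\<^sup>2 - 1) * ((2 * pi)\<^sup>2 * F z * s)) = (real (k\<^sup>2) * (2 * pi)\<^sup>2) * F z * s ^ (k\<^sup>2)"
    by (simp only: mult_ac)
  then show ?thesis unfolding \<kappa>_sq .
qed

lemma P_deriv:
  assumes "solution \<gamma>"
  shows "((\<lambda>t. P (\<gamma> t)) has_real_derivative \<kappa>\<^sup>2 * F (\<gamma> t) * P (\<gamma> t)) (at t)"
proof -
  have "((\<lambda>t. sin (2 * pi * snd (\<gamma> t)) ^ (k\<^sup>2)) has_real_derivative \<kappa>\<^sup>2 * F (\<gamma> t) * sin (2 * pi * snd (\<gamma> t)) ^ (k\<^sup>2)) (at t)"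
    using DERIV_power[OF sin_y_deriv[OF assms, of t], of "k\<^sup>2"] unfolding power_deriv_aux[symmetric] by (simp add: mult_ac)
  from DERIV_diff[OF sin_x_deriv[OF assms, of t] this] show ?thesis
    unfolding P_def by (simp only: right_diff_distrib)
qed

lemma P_pos_invariant: "solution \<gamma> \<Longrightarrow> 0 < P (\<gamma> s) \<Longrightarrow> 0 < P (\<gamma> t)"
  by (rule linear_differential_inequality_pos[OF P_deriv linear_bound])

lemma P_zero_invariant: "solution \<gamma> \<Longrightarrow> P (\<gamma> s) = 0 \<Longrightarrow> P (\<gamma> t) = 0"
  by (rule linear_differential_inequality_zero[OF P_deriv linear_bound])

end

section \<open>The domain bounded by separatrices\<close>

lemma less_sin_iff_arcsin:
  assumes "0 < X" "X < pi" "0 \<le> q" "q < 1"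
  shows "q < sin X \<longleftrightarrow> arcsin q < X \<and> X < pi - arcsin q"
proof -
  have a: "0 \<le> arcsin q" "arcsin q < pi / 2" "sin (arcsin q) = q"
    using assms arcsin_lt_bounded[of q] arcsin_le_arcsin[of 0 q] by auto
  have mono: "q < sin Y \<longleftrightarrow> arcsin q < Y" if "0 < Y" "Y \<le> pi / 2" for Y
    using sin_mono_less_eq[of "arcsin q" Y] a that by simp
  show ?thesis
  proof (cases "X \<le> pi / 2")
    case True
    then show ?thesis using mono[of X] a assms by auto
  next
    case False
    then show ?thesis using mono[of "pi - X"] a assms by auto
  qed
qed

text \<open>Up to a negative factor this quotient is the slope of the boundary curve of the domain
  as a function of \<open>s = sin (2 \<pi> y)\<close>. It is odd in \<open>s\<close>, which leaves
  nonnegative arguments, where the squares compare term by term after cross-multiplication.\<close>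

lemma odd_ratio_mono:
  fixes s t :: real
  assumes r: "even r" "2 \<le> r" and st: "s \<le> t"
  shows "s ^ (r - 1) / sqrt (\<Sum>j<r. (s\<^sup>2) ^ j) \<le> t ^ (r - 1) / sqrt (\<Sum>j<r. (t\<^sup>2) ^ j)"
proof -
  define R where "R s = s ^ (r - 1) / sqrt (\<Sum>j<r. (s\<^sup>2) ^ j)" for s :: real
  have sum_pos: "0 < (\<Sum>j<r. (s\<^sup>2) ^ j)" for s :: real
  proof -
    have "0 < (s\<^sup>2) ^ 0" by simp
    then show ?thesis using r by (intro sum_pos2[of _ 0]) auto
  qed
  have odd: "odd (r - 1)" using r by simp
  have R_minus: "R (- s) = - R s" for s using odd by (simp add: R_def)
  have R_nonneg: "0 \<le> R s" if "0 \<le> s" for s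
    using that sum_pos[of s] by (auto simp: R_def intro!: divide_nonneg_pos)
  have pos: "R s \<le> R t" if "0 \<le> s" "s \<le> t" for s t
  proof -
    have ST: "s\<^sup>2 \<le> t\<^sup>2" using that by (intro power_mono) simp_all
    have "(s\<^sup>2) ^ (r - 1) * (\<Sum>j<r. (t\<^sup>2) ^ j) \<le> (t\<^sup>2) ^ (r - 1) * (\<Sum>j<r. (s\<^sup>2) ^ j)"
      unfolding sum_distrib_left
    proof (rule sum_mono)
      fix j assume "j \<in> {..<r}"
      then have split: "X ^ (r - 1) = X ^ j * X ^ (r - 1 - j)" for X :: real
        by (simp add: power_add[symmetric])
      have "(s\<^sup>2) ^ j * (s\<^sup>2) ^ (r - 1 - j) * (t\<^sup>2) ^ j \<le> (s\<^sup>2) ^ j * (t\<^sup>2) ^ (r - 1 - j) * (t\<^sup>2) ^ j"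
        by (intro mult_right_mono mult_left_mono power_mono[OF ST]) auto
      then show "(s\<^sup>2) ^ (r - 1) * (t\<^sup>2) ^ j \<le> (t\<^sup>2) ^ (r - 1) * (s\<^sup>2) ^ j"
        unfolding split by (simp only: mult_ac)
    qed
    then have "sqrt ((s\<^sup>2) ^ (r - 1) * (\<Sum>j<r. (t\<^sup>2) ^ j)) \<le> sqrt ((t\<^sup>2) ^ (r - 1) * (\<Sum>j<r. (s\<^sup>2) ^ j))"
      by simp
    moreover have "sqrt ((X\<^sup>2) ^ (r - 1)) = X ^ (r - 1)" if "0 \<le> X" for X :: real
      using that by (simp add: real_sqrt_power)
    ultimately have "s ^ (r - 1) * sqrt (\<Sum>j<r. (t\<^sup>2) ^ j) \<le> t ^ (r - 1) * sqrt (\<Sum>j<r. (s\<^sup>2) ^ j)"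
      using that by (simp add: real_sqrt_mult)
    then show ?thesis using sum_pos[of s] sum_pos[of t] unfolding R_def
      by (simp add: divide_le_eq le_divide_eq mult.commute)
  qed
  have "R s \<le> R t"
  proof (cases "0 \<le> s")
    case True
    then show ?thesis by (rule pos[OF _ st])
  next
    case False
    show ?thesis
    proof (cases "0 \<le> t")
      case True
      then show ?thesis using R_nonneg[of t] R_nonneg[of "- s"] False R_minus[of s] by simp
    next
      case False
      then show ?thesis using pos[of "- t" "- s"] st by (simp add: R_minus)
    qed
  qed
  then show ?thesis by (simp add: R_def)
qed

lemma sin_decreasing_middle:
  assumes "1/4 \<le> y1" "y1 \<le> y2" "y2 \<le> 3/4"
  shows "sin (2 * pi * y2) \<le> sin (2 * pi * y1)"
proof -
  have "sin (2 * pi * y1 - pi) \<le> sin (2 * pi * y2 - pi)"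
  proof (rule sin_monotone_2pi_le)
    have "pi * (1/4) \<le> pi * y1" "pi * y1 \<le> pi * y2" "pi * y2 \<le> pi * (3/4)" using assms by auto
    then show "- (pi / 2) \<le> 2 * pi * y1 - pi" "2 * pi * y1 - pi \<le> 2 * pi * y2 - pi" "2 * pi * y2 - pi \<le> pi / 2"
      by (simp_all add: field_simps)
  qed
  then show ?thesis by (simp add: sin_diff)
qed

lemma cos_neg_middle:
  assumes "1/4 < y" "y < 3/4" shows "cos (2 * pi * y) < 0"
proof -
  have "pi * (1/4) < pi * y" "pi * y < pi * (3/4)" using assms by auto
  then have "0 < cos (2 * pi * y - pi)" by (intro cos_gt_zero_pi) (simp_all add: field_simps)
  then show ?thesis by (simp add: cos_diff)
qed

lemma plateau_derivative:
  obtains \<beta> where "\<And>t. (plateau has_real_derivative \<beta> t) (at t)" "smooth_real \<beta>" "\<And>t. t \<le> 0 \<Longrightarrow> \<beta> t = 0"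
proof -
  from smooth_real_plateau obtain \<beta> where \<beta>: "\<And>t. (plateau has_real_derivative \<beta> t) (at t)" "smooth_real \<beta>"
    by cases auto
  \<comment> \<open>Where \<open>plateau\<close> is 0 it attains its minimum, so the derivative
    vanishes there, including at the junction \<open>t = 0\<close>.\<close>
  have "\<beta> t = 0" if "t \<le> 0" for t
    by (rule DERIV_local_min[OF \<beta>(1), of 1]) (use that plateau_bounds in \<open>auto simp: plateau_def\<close>)
  with \<beta> show ?thesis by (rule that)
qed

context product_eigenfunction begin

definition width :: real where "width = 1 / (2 * real k)"

lemma width: "0 < width" "width \<le> 1/4" "\<kappa> * width = pi"
  using k_ge_2 \<kappa>_width by (auto simp: width_def field_simps)

definition D :: "(real \<times> real) set" where
  "D = {z. 0 < fst z \<and> fst z < width \<and> 1/4 < snd z \<and> snd z < 3/4 \<and> 0 < P z}"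

lemma ksq: "even (k\<^sup>2)" "4 \<le> k\<^sup>2"
  using even_k k_ge_2 power_mono[of 2 k 2] by auto

lemma \<kappa>_range: "0 < x \<Longrightarrow> x < width \<Longrightarrow> 0 < \<kappa> * x \<and> \<kappa> * x < pi"
  using \<kappa>_pos width mult_strict_left_mono[of x width \<kappa>] by simp

lemma open_D: "open D"
proof -
  have "D = {0<..<width} \<times> {1/4<..<3/4} \<inter> {z. 0 < P z}" by (auto simp: D_def)
  moreover have "open ({0<..<width} \<times> {1/4<..<3/4 :: real})"
    by (rule open_Times) (rule open_greaterThanLessThan)+
  moreover have "open {z. 0 < P z}"
    by (rule open_Collect_less) (auto intro: planar_continuous P_planar)
  ultimately show ?thesis by (simp only: open_Int)
qed

lemma D_unit: "D \<subseteq> unit_square"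
  using width by (auto simp: D_def)

text \<open>On the sides of the rectangle \<open>P \<le> 0\<close>: the first sine vanishes at
  \<open>x = 0\<close> and \<open>x = width\<close>, and the even power is 1 at
  \<open>y = 1/4\<close> and \<open>y = 3/4\<close>. The open conditions in \<open>D\<close> may
  thus be replaced by closed ones, which gives compact superlevel sets of \<open>P\<close> and the
  invariance of \<open>D\<close>.\<close>

lemma closed_rectangle_in_D:
  assumes z: "z \<in> cbox (0, 1/4) (width, 3/4)" "0 < P z" shows "z \<in> D"
proof -
  obtain x y where xy: "z = (x, y)" by (cases z)
  have pos: "0 \<le> sin (2 * pi * y) ^ (k\<^sup>2)" using ksq by (simp add: zero_le_even_power)
  then have "0 < sin (\<kappa> * x)" using z by (simp add: P_def xy)
  then have "x \<noteq> 0" "x \<noteq> width" using width by auto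
  moreover have "y \<noteq> 1/4"
  proof
    assume "y = 1/4"
    then have "2 * pi * y = pi / 2" by simp
    then have "sin (2 * pi * y) = 1" by (simp only: sin_pi_half)
    then show False using z sin_le_one[of "\<kappa> * x"] by (simp add: P_def xy)
  qed
  moreover have "y \<noteq> 3/4"
  proof
    assume "y = 3/4"
    then have "2 * pi * y = pi + pi / 2" by simp
    then have "sin (2 * pi * y) = - 1" by (simp only: sin_add sin_pi cos_pi sin_pi_half)
    then have "1 < sin (\<kappa> * x)" using z ksq by (simp add: P_def xy)
    then show False using sin_le_one[of "\<kappa> * x"] by linarith
  qed
  ultimately show ?thesis using z by (auto simp: D_def xy)
qed

text \<open>The branch of \<open>P = 0\<close> with \<open>\<kappa> x \<le> \<pi>/2\<close>; the
  right edge is its mirror image, because the sine is symmetric about \<pi>/2.\<close>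

definition left_edge :: "real \<Rightarrow> real" where
  "left_edge y = arcsin (sin (2 * pi * y) ^ (k\<^sup>2)) / \<kappa>"

lemma sin_middle: "1/4 < y \<Longrightarrow> y < 3/4 \<Longrightarrow> \<bar>sin (2 * pi * y)\<bar> < 1"
proof -
  assume "1/4 < y" "y < 3/4"
  then have "0 < (cos (2 * pi * y))\<^sup>2" using cos_neg_middle[of y] by simp
  then have "(sin (2 * pi * y))\<^sup>2 < 1" using sin_cos_squared_add[of "2 * pi * y"] by linarith
  then show ?thesis by (simp add: abs_square_less_1)
qed

lemma power_middle:
  assumes "1/4 < y" "y < 3/4"
  shows "0 \<le> sin (2 * pi * y) ^ (k\<^sup>2)" "sin (2 * pi * y) ^ (k\<^sup>2) < 1"
proof -
  show "0 \<le> sin (2 * pi * y) ^ (k\<^sup>2)" using ksq by (simp add: zero_le_even_power)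
  have "\<bar>sin (2 * pi * y)\<bar> ^ (k\<^sup>2) \<le> \<bar>sin (2 * pi * y)\<bar> ^ 1"
    using ksq by (intro power_decreasing) auto
  then have "\<bar>sin (2 * pi * y)\<bar> ^ (k\<^sup>2) < 1" using sin_middle[OF assms] by simp
  then show "sin (2 * pi * y) ^ (k\<^sup>2) < 1" using ksq by (simp add: power_even_abs)
qed

text \<open>Written as the region between a graph and its reflection, \<open>D\<close> is convex as
  soon as \<open>left_edge\<close> is.\<close>

lemma D_between: "D = {z. 1/4 < snd z \<and> snd z < 3/4 \<and> left_edge (snd z) < fst z \<and> fst z < width - left_edge (snd z)}"
proof -
  have "z \<in> D \<longleftrightarrow> 1/4 < snd z \<and> snd z < 3/4 \<and> left_edge (snd z) < fst z \<and> fst z < width - left_edge (snd z)" for z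
  proof (cases "1/4 < snd z \<and> snd z < 3/4")
    case True
    define q where "q = sin (2 * pi * snd z) ^ (k\<^sup>2)"
    have q: "0 \<le> q" "q < 1" using power_middle True by (auto simp: q_def)
    have a: "0 \<le> arcsin q" using arcsin_le_arcsin[of 0 q] q by simp
    have 1: "left_edge (snd z) < fst z \<longleftrightarrow> arcsin q < \<kappa> * fst z"
      using \<kappa>_pos by (simp add: left_edge_def q_def divide_less_eq mult.commute)
    have 2: "fst z < width - left_edge (snd z) \<longleftrightarrow> \<kappa> * fst z < pi - arcsin q"
    proof -
      have "width - left_edge (snd z) = (pi - arcsin q) / \<kappa>"
        using \<kappa>_pos width(3) by (simp add: left_edge_def q_def field_simps)
      then show ?thesis using \<kappa>_pos by (simp add: less_divide_eq mult.commute)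
    qed
    have 3: "0 < fst z \<and> fst z < width \<longleftrightarrow> 0 < \<kappa> * fst z \<and> \<kappa> * fst z < pi"
      using \<kappa>_pos mult_less_cancel_left_pos[OF \<kappa>_pos, of "fst z" width] width(3) by (simp add: zero_less_mult_iff)
    show ?thesis
      using True 1 2 3 less_sin_iff_arcsin[OF _ _ q, of "\<kappa> * fst z"] a
      by (auto simp: D_def P_def q_def[symmetric])
  qed (auto simp: D_def)
  then show ?thesis by auto
qed

text \<open>With \<open>s = sin (2 \<pi> y)\<close>, the geometric sum factors
  \<open>1 - s^(2 k^2)\<close> into \<open>1 - s^2\<close> and \<Sigma>, and the root of
  \<open>1 - s^2\<close> cancels against the cosine, which is negative in the middle range. The
  slope is a negative multiple of an increasing function of \<open>s\<close>, and \<open>s\<close>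
  decreases in \<open>y\<close>.\<close>

lemma left_edge_convex: "convex_on {1/4<..<3/4} left_edge"
proof (rule convex_on_realI)
  define \<rho> where "\<rho> s = s ^ (k\<^sup>2 - 1) / sqrt (\<Sum>j<k\<^sup>2. (s\<^sup>2) ^ j)" for s :: real
  define c where "c = 2 * pi * real (k\<^sup>2) / \<kappa>"
  have c: "0 \<le> c" using \<kappa>_pos by (simp add: c_def)
  show "connected {1/4<..<3/4 :: real}" by (rule connected_Ioo)
  show "(left_edge has_real_derivative - c * \<rho> (sin (2 * pi * y))) (at y)" if y: "y \<in> {1/4<..<3/4}" for y
  proof -
    define s where "s = sin (2 * pi * y)"
    have s: "\<bar>s\<bar> < 1" using y sin_middle by (simp add: s_def)
    have q: "0 \<le> s ^ (k\<^sup>2)" "s ^ (k\<^sup>2) < 1" using y power_middle by (auto simp: s_def)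
    have s2: "0 < 1 - s\<^sup>2" using s by (simp add: abs_square_less_1)
    have cos: "cos (2 * pi * y) = - sqrt (1 - s\<^sup>2)"
    proof -
      have "sqrt (1 - s\<^sup>2) = sqrt ((cos (2 * pi * y))\<^sup>2)" by (simp add: s_def cos_squared_eq)
      then show ?thesis using y cos_neg_middle[of y] by simp
    qed
    define \<Sigma> where "\<Sigma> = (\<Sum>j<k\<^sup>2. (s\<^sup>2) ^ j)"
    have geo: "1 - (s ^ (k\<^sup>2))\<^sup>2 = (1 - s\<^sup>2) * \<Sigma>"
      using one_diff_power_eq[of "s\<^sup>2" "k\<^sup>2"] by (simp add: \<Sigma>_def power_mult[symmetric] mult.commute)
    have "0 < 1 - (s ^ (k\<^sup>2))\<^sup>2" using q by (simp add: abs_square_less_1)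
    then have \<Sigma>: "0 < \<Sigma>" using geo s2 by (simp add: zero_less_mult_iff)
    have "((\<lambda>y. sin (2 * pi * y) ^ (k\<^sup>2)) has_real_derivative real (k\<^sup>2) * (s ^ (k\<^sup>2 - 1) * (cos (2 * pi * y) * (2 * pi)))) (at y)"
      by (auto intro!: derivative_eq_intros simp: s_def)
    from DERIV_chain2[OF DERIV_arcsin this] q
    have "((\<lambda>y. arcsin (sin (2 * pi * y) ^ (k\<^sup>2))) has_real_derivative
        inverse (sqrt (1 - (s ^ (k\<^sup>2))\<^sup>2)) * (real (k\<^sup>2) * (s ^ (k\<^sup>2 - 1) * (cos (2 * pi * y) * (2 * pi))))) (at y)"
      by (simp add: s_def)
    then have "(left_edge has_real_derivative
        inverse (sqrt (1 - (s ^ (k\<^sup>2))\<^sup>2)) * (real (k\<^sup>2) * (s ^ (k\<^sup>2 - 1) * (cos (2 * pi * y) * (2 * pi)))) / \<kappa>) (at y)"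
      unfolding left_edge_def by (rule DERIV_cdivide)
    moreover have "inverse (sqrt (1 - (s ^ (k\<^sup>2))\<^sup>2)) * (real (k\<^sup>2) * (s ^ (k\<^sup>2 - 1) * (cos (2 * pi * y) * (2 * pi)))) / \<kappa> = - c * \<rho> s"
    proof -
      have "inverse (A * B) * (n * (p * (- A * (2 * pi)))) / \<kappa> = - (2 * pi * n / \<kappa>) * (p / B)"
        if "A \<noteq> 0" "B \<noteq> 0" for A B n p :: real
        using that \<kappa>_pos by (simp add: field_simps)
      from this[of "sqrt (1 - s\<^sup>2)" "sqrt \<Sigma>"] show ?thesis
        using s2 \<Sigma> unfolding geo cos \<rho>_def c_def \<Sigma>_def[symmetric] real_sqrt_mult by simp
    qed
    ultimately show ?thesis by (simp add: s_def)
  qed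
  show "- c * \<rho> (sin (2 * pi * y1)) \<le> - c * \<rho> (sin (2 * pi * y2))"
    if "y1 \<in> {1/4<..<3/4}" "y2 \<in> {1/4<..<3/4}" "y1 \<le> y2" for y1 y2
  proof -
    have "\<rho> (sin (2 * pi * y2)) \<le> \<rho> (sin (2 * pi * y1))"
      unfolding \<rho>_def by (rule odd_ratio_mono) (use ksq that sin_decreasing_middle in auto)
    then show ?thesis using c by (simp add: mult_left_mono)
  qed
qed

lemma convex_D: "convex D"
proof (rule convexI)
  fix z1 z2 :: "real \<times> real" and u v :: real
  assume z: "z1 \<in> D" "z2 \<in> D" and uv: "0 \<le> u" "0 \<le> v" "u + v = 1"
  \<comment> \<open>One of the weights may be 0 but not both, so strict inequalities
    survive.\<close>
  have strict: "u * a + v * b < u * a' + v * b'" if "a < a'" "b < b'" for a b a' b'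
  proof (cases "u = 0")
    case True then show ?thesis using uv that by simp
  next
    case False
    then have "u * a < u * a'" using uv that by simp
    moreover have "v * b \<le> v * b'" using uv that by (intro mult_left_mono) auto
    ultimately show ?thesis by linarith
  qed
  note d = z[unfolded D_between, simplified]
  have uvc: "u * c + v * c = c" for c using uv by (metis distrib_right mult_1)
  have y: "1/4 < u * snd z1 + v * snd z2" "u * snd z1 + v * snd z2 < 3/4"
    using strict[of "1/4" "snd z1" "1/4" "snd z2"] strict[of "snd z1" "3/4" "snd z2" "3/4"] d
      uvc[of "1/4"] uvc[of "3/4"] by auto
  have e: "left_edge (u * snd z1 + v * snd z2) \<le> u * left_edge (snd z1) + v * left_edge (snd z2)"
    using left_edge_convex uv d unfolding convex_on_def by auto
  have "u * left_edge (snd z1) + v * left_edge (snd z2) < u * fst z1 + v * fst z2"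
    by (rule strict) (use d in auto)
  moreover have "u * fst z1 + v * fst z2 < u * (width - left_edge (snd z1)) + v * (width - left_edge (snd z2))"
    by (rule strict) (use d in auto)
  moreover have "u * (width - left_edge (snd z1)) + v * (width - left_edge (snd z2))
      = width - (u * left_edge (snd z1) + v * left_edge (snd z2))"
    using uvc[of width] by (simp add: algebra_simps)
  ultimately show "u *\<^sub>R z1 + v *\<^sub>R z2 \<in> D" using y e by (auto simp: D_between)
qed

text \<open>Subtracting 1 confines the support to \<open>n P \<ge> 1\<close>, a compact subset of
  \<open>D\<close>. Dependence on \<open>P\<close> alone makes the gradient of the cutoff parallel
  to that of \<open>P\<close>, which the Neumann condition exploits. The rectangle selects one cell
  of the periodic set \<open>P > 0\<close>.\<close>

definition cutoff :: "nat \<Rightarrow> real \<times> real \<Rightarrow> real" where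
  "cutoff n z = (if z \<in> {0<..<width} \<times> {1/4<..<3/4} then plateau (real n * P z - 1) else 0)"

lemma superlevel:
  fixes n :: nat
  defines "K \<equiv> {z \<in> cbox (0, 1/4) (width, 3/4). 1 \<le> real n * P z}"
  shows "compact K" "K \<subseteq> D" "\<And>z. z \<in> {0<..<width} \<times> {1/4<..<3/4} - K \<Longrightarrow> plateau (real n * P z - 1) = 0"
proof -
  have "closed {z. 1 \<le> real n * P z}"
    by (intro closed_Collect_le continuous_on_const continuous_on_mult planar_continuous P_planar)
  moreover have "K = cbox (0, 1/4) (width, 3/4) \<inter> {z. 1 \<le> real n * P z}" by (auto simp: K_def)
  ultimately show "compact K" by (simp add: compact_Int_closed)
  show "K \<subseteq> D"
  proof
    fix z assume z: "z \<in> K"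
    then have "0 < real n * P z" by (simp add: K_def)
    then have "0 < P z" by (simp add: zero_less_mult_iff)
    then show "z \<in> D" using z closed_rectangle_in_D by (simp add: K_def)
  qed
  show "plateau (real n * P z - 1) = 0" if "z \<in> {0<..<width} \<times> {1/4<..<3/4} - K" for z
    using that by (auto simp: K_def plateau_def)
qed

lemma cutoff_planar: "cutoff n \<in> planar"
  unfolding cutoff_def
proof (rule planar.cut)
  show "(\<lambda>z. plateau (real n * P z - 1)) \<in> planar" by (intro planar_intros P_planar)
  show "open ({0<..<width} \<times> {1/4<..<3/4 :: real})" by (rule open_Times) (rule open_greaterThanLessThan)+
  show "closed {z \<in> cbox (0, 1/4) (width, 3/4). 1 \<le> real n * P z}" by (rule compact_imp_closed[OF superlevel(1)])
  show "{z \<in> cbox (0, 1/4) (width, 3/4). 1 \<le> real n * P z} \<subseteq> {0<..<width} \<times> {1/4<..<3/4}"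
    using superlevel(2)[of n] by (auto simp: D_def)
qed (rule superlevel(3))

lemma cutoff_test: "cutoff n \<in> test_planar D"
  unfolding test_planar_def
proof (intro CollectI conjI cutoff_planar exI allI impI)
  fix z assume "z \<notin> {z \<in> cbox (0, 1/4) (width, 3/4). 1 \<le> real n * P z}"
  then show "cutoff n z = 0" using superlevel(3)[of z n] by (auto simp: cutoff_def)
qed (rule superlevel)+

sublocale convex_cutoff_domain D cutoff
proof
  show "open D" "D \<subseteq> unit_square" "convex D" by (rule open_D D_unit convex_D)+
  show "cutoff n \<in> test_planar D" for n by (rule cutoff_test)
  show "0 \<le> cutoff n z" "cutoff n z \<le> 1" for n z by (auto simp: cutoff_def plateau_bounds)
  show "(\<lambda>n. cutoff n z) \<longlonglongrightarrow> 1" if z: "z \<in> D" for z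
  proof -
    have P: "0 < P z" using z by (simp add: D_def)
    have "(\<lambda>n. exp (- 1 / (real n * P z - 1))) \<longlonglongrightarrow> 1" using P by real_asymp
    moreover have "\<forall>\<^sub>F n in sequentially. exp (- 1 / (real n * P z - 1)) = cutoff n z"
    proof -
      obtain N where N: "1 / P z < real N" using reals_Archimedean2 by blast
      show ?thesis using eventually_ge_at_top[of N]
      proof eventually_elim
        case (elim n)
        then have "1 / P z < real n" using N by linarith
        then have "1 < real n * P z" using P by (simp add: divide_less_eq)
        then show ?case using z by (simp add: cutoff_def plateau_def D_def mem_Times_iff)
      qed
    qed
    ultimately show ?thesis by (rule Lim_transform_eventually)
  qed
qed

end

section \<open>Bumps with bounded Rayleigh quotients\<close>

context product_eigenfunction begin

lemma power_left_middle: "1 \<le> \<kappa> * x / pi * 6 \<Longrightarrow> \<kappa> * x / pi * 6 \<le> 5 \<Longrightarrow> 1/2 \<le> sin (\<kappa> * x)"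
proof -
  assume a: "1 \<le> \<kappa> * x / pi * 6" "\<kappa> * x / pi * 6 \<le> 5"
  then have b: "pi / 6 \<le> \<kappa> * x" "\<kappa> * x \<le> pi - pi / 6" by (simp_all add: field_simps)
  have half: "sin (pi / 6) = 1/2" by (rule sin_30)
  show ?thesis
  proof (cases "\<kappa> * x \<le> pi / 2")
    case True
    then show ?thesis using sin_monotone_2pi_le[of "pi / 6" "\<kappa> * x"] b half by simp
  next
    case False
    then show ?thesis using sin_monotone_2pi_le[of "pi / 6" "pi - \<kappa> * x"] b half by simp
  qed
qed

text \<open>For \<open>x\<close> in the middle two thirds,
  \<open>sin (\<kappa> x) \<ge> 1/2\<close>, while a number below 1/2 in modulus has its power below
  1/2. The share of the width is independent of \<open>k\<close>, which is what makes the Rayleigh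
  quotients uniform.\<close>

lemma core_in_D:
  assumes x: "width / 6 \<le> x" "x \<le> 5 / 6 * width" and y: "1/4 \<le> y" "y \<le> 3/4" and s: "\<bar>sin (2 * pi * y)\<bar> < 1/2"
  shows "(x, y) \<in> D"
proof (rule closed_rectangle_in_D)
  show "(x, y) \<in> cbox (0, 1/4) (width, 3/4)" using x y width(1) by simp
  have "\<kappa> * (width / 6) \<le> \<kappa> * x" "\<kappa> * x \<le> \<kappa> * (5 / 6 * width)"
    using x \<kappa>_pos by (auto intro!: mult_left_mono)
  then have "1/2 \<le> sin (\<kappa> * x)" using width(3) by (intro power_left_middle) (simp_all add: field_simps)
  moreover have "sin (2 * pi * y) ^ (k\<^sup>2) < 1/2"
  proof -
    have "\<bar>sin (2 * pi * y)\<bar> ^ (k\<^sup>2) \<le> \<bar>sin (2 * pi * y)\<bar> ^ 1"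
      using ksq s by (intro power_decreasing) auto
    then show ?thesis using s ksq by (simp add: power_even_abs)
  qed
  ultimately show "0 < P (x, y)" by (simp add: P_def)
qed

lemma integral_strip:
  fixes g :: "real \<Rightarrow> real"
  assumes g: "continuous_on UNIV g" and ab: "a \<le> b"
  shows "integrable lborel (\<lambda>z. indicator (cbox (a, 1/4) (b, 3/4)) z * g (snd z))"
    "(\<integral>z. indicator (cbox (a, 1/4) (b, 3/4)) z * g (snd z) \<partial>lborel) = (b - a) * integral {1/4..3/4} g"
proof -
  show int: "integrable lborel (\<lambda>z. indicator (cbox (a, 1/4) (b, 3/4)) z * g (snd z))"
    using borel_integrable_compact[of "cbox (a, 1/4) (b, 3/4)" "\<lambda>z. g (snd z)"]
    by (simp add: compact_cbox continuous_on_compose2[OF g] continuous_on_snd)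
  have gi: "integrable lborel (\<lambda>y. indicator {1/4..3/4} y *\<^sub>R g y)"
    by (rule borel_integrable_compact) (auto intro: continuous_on_subset[OF g])
  have eq: "(\<lambda>z. indicator (cbox (a, 1/4) (b, 3/4)) z * g (snd z)) = (\<lambda>(x, y). indicator {a..b} x * (indicator {1/4..3/4} y * g y))"
    by (auto simp: indicator_def fun_eq_iff)
  have int': "integrable (lborel \<Otimes>\<^sub>M lborel) (\<lambda>(x, y). indicator {a..b} x * (indicator {1/4..3/4} y * g y))"
    using int unfolding eq by (simp add: lborel_prod)
  have "(\<integral>z. indicator (cbox (a, 1/4) (b, 3/4)) z * g (snd z) \<partial>lborel)
      = (\<integral>x. \<integral>y. indicator {a..b} x * (indicator {1/4..3/4} y * g y) \<partial>lborel \<partial>lborel)"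
    using lborel_pair.integral_fst[OF int'] unfolding eq by (simp add: lborel_prod)
  also have "\<dots> = (\<integral>x. indicator {a..b} x * (\<integral>y. indicator {1/4..3/4} y * g y \<partial>lborel) \<partial>lborel)" by simp
  also have "(\<integral>y. indicator {1/4..3/4} y * g y \<partial>lborel) = integral {1/4..3/4} g"
    using set_borel_integral_eq_integral(2)[of "{1/4..3/4}" g] gi
    by (simp add: set_integrable_def set_lebesgue_integral_def)
  also have "(\<integral>x. indicator {a..b} x * integral {1/4..3/4} g \<partial>lborel) = (b - a) * integral {1/4..3/4} g"
    using ab by simp
  finally show "(\<integral>z. indicator (cbox (a, 1/4) (b, 3/4)) z * g (snd z) \<partial>lborel) = (b - a) * integral {1/4..3/4} g" .
qed

end

text \<open>Disjointly supported bumps in the variable \<open>s = sin (2 \<pi> y)\<close> restricted to \<open>0 < s < 1/2\<close>.\<close>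
definition bump :: "nat \<Rightarrow> nat \<Rightarrow> real \<Rightarrow> real" where
  "bump n j s = plateau (2 * real n * s - real j) * plateau (real (Suc j) - 2 * real n * s)"

lemma bump_derivative_ex:
  "\<exists>b. (\<forall>n j s. (bump n j has_real_derivative b n j s) (at s)) \<and> (\<forall>n j. continuous_on UNIV (b n j)) \<and>
     (\<forall>n j s. \<not> (real j < 2 * real n * s \<and> 2 * real n * s < real (Suc j)) \<longrightarrow> b n j s = 0)"
proof -
  obtain \<beta> where \<beta>: "\<And>t. (plateau has_real_derivative \<beta> t) (at t)" "smooth_real \<beta>" "\<And>t. t \<le> 0 \<Longrightarrow> \<beta> t = 0"
    by (rule plateau_derivative) blast
  define b where "b n j s = plateau (2 * real n * s - real j) * (\<beta> (real (Suc j) - 2 * real n * s) * (- 2 * real n))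
      + \<beta> (2 * real n * s - real j) * (2 * real n) * plateau (real (Suc j) - 2 * real n * s)" for n j s
  have cont: "continuous_on UNIV plateau"
    by (rule continuous_at_imp_continuous_on) (use \<beta>(1) DERIV_isCont in blast)
  from \<beta>(2) obtain \<beta>' where "\<And>t. (\<beta> has_real_derivative \<beta>' t) (at t)" by cases auto
  then have cont\<beta>: "continuous_on UNIV \<beta>"
    by (intro continuous_at_imp_continuous_on) (use DERIV_isCont in blast)
  have "(bump n j has_real_derivative b n j s) (at s)" for n j s
  proof -
    have 1: "((\<lambda>s. plateau (2 * real n * s - real j)) has_real_derivative \<beta> (2 * real n * s - real j) * (2 * real n)) (at s)"
      by (rule DERIV_chain2[OF \<beta>(1)]) (auto intro!: derivative_eq_intros)
    have 2: "((\<lambda>s. plateau (real (Suc j) - 2 * real n * s)) has_real_derivative \<beta> (real (Suc j) - 2 * real n * s) * (- 2 * real n)) (at s)"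
      by (rule DERIV_chain2[OF \<beta>(1)]) (auto intro!: derivative_eq_intros)
    show ?thesis unfolding bump_def[abs_def] b_def by (rule DERIV_mult'[OF 1 2])
  qed
  moreover have "continuous_on UNIV (b n j)" for n j
    unfolding b_def
    by (intro continuous_intros continuous_on_compose2[OF cont] continuous_on_compose2[OF cont\<beta>]) auto
  moreover have "b n j s = 0" if "\<not> (real j < 2 * real n * s \<and> 2 * real n * s < real (Suc j))" for n j s
    using that \<beta>(3) by (auto simp: b_def plateau_def)
  ultimately show ?thesis by (intro exI[of _ b]) blast
qed

text \<open>The derivative of \<open>plateau\<close> is known only by existence, so one derivative
  is chosen for all \<open>n\<close>, \<open>j\<close> at once, together with its continuity and
  support; \<open>k\<close> does not occur in it.\<close>

definition bump' :: "nat \<Rightarrow> nat \<Rightarrow> real \<Rightarrow> real" where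
  "bump' = (SOME b. (\<forall>n j s. (bump n j has_real_derivative b n j s) (at s)) \<and> (\<forall>n j. continuous_on UNIV (b n j)) \<and>
     (\<forall>n j s. \<not> (real j < 2 * real n * s \<and> 2 * real n * s < real (Suc j)) \<longrightarrow> b n j s = 0))"

lemma bump': "(bump n j has_real_derivative bump' n j s) (at s)" "continuous_on UNIV (bump' n j)"
  "\<not> (real j < 2 * real n * s \<and> 2 * real n * s < real (Suc j)) \<Longrightarrow> bump' n j s = 0"
  using someI_ex[OF bump_derivative_ex] unfolding bump'_def[symmetric] by blast+

lemma bump_pos_iff: "bump n j s \<noteq> 0 \<longleftrightarrow> real j < 2 * real n * s \<and> 2 * real n * s < real (Suc j)"
  by (simp add: bump_def plateau_def)

lemma bump_support:
  assumes "bump n j s \<noteq> 0 \<or> bump' n j s \<noteq> 0" "j < n"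
  shows "real j < 2 * real n * s" "2 * real n * s < real (Suc j)" "0 < s" "s < 1/2"
proof -
  show a: "real j < 2 * real n * s" "2 * real n * s < real (Suc j)"
    using assms bump'(3)[of j n s] bump_pos_iff[of n j s] by blast+
  have n: "0 < real n" using assms by simp
  have "0 < 2 * real n * s" using a by (meson le_less_trans of_nat_0_le_iff)
  then show "0 < s" using n by (simp add: zero_less_mult_iff)
  have "2 * real n * s < real n" using a(2) assms(2) by linarith
  then show "s < 1/2" using n by simp
qed

lemma bump_continuous: "continuous_on A (bump n j)"
  by (rule continuous_at_imp_continuous_on) (use bump'(1) DERIV_isCont in blast)

text \<open>The Rayleigh quotients of the bumps are controlled independently of \<open>k\<close>.\<close>
definition bump_constant :: "nat \<Rightarrow> real" where
  "bump_constant n = (\<Sum>j<n. 3/2 * integral {1/4..3/4} (\<lambda>y. (bump' n j (sin (2 * pi * y)) * (cos (2 * pi * y) * (2 * pi)))\<^sup>2)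
     / integral {1/4..3/4} (\<lambda>y. (bump n j (sin (2 * pi * y)))\<^sup>2))"

lemma bump_mass_pos:
  assumes "j < n" shows "0 < integral {1/4..3/4} (\<lambda>y. (bump n j (sin (2 * pi * y)))\<^sup>2)"
proof -
  have cont: "continuous_on {1/4..3/4} (\<lambda>y. (bump n j (sin (2 * pi * y)))\<^sup>2)"
    by (intro continuous_intros continuous_on_compose2[OF bump_continuous[of UNIV]]) auto
  \<comment> \<open>The midpoint of the interval on which the bump is nonzero; \<open>y\<close>
    below is its preimage under the sine in the middle range.\<close>
  define s where "s = (real j + 1/2) / (2 * real n)"
  have n: "0 < real n" using assms by simp
  have b: "bump n j s \<noteq> 0" using n by (simp add: bump_pos_iff s_def)
  have s: "0 < s" "s < 1/2" using bump_support(3,4)[of n j s] b assms by auto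
  define y where "y = 1/2 - arcsin s / (2 * pi)"
  have "2 * pi * y = pi - arcsin s" by (simp add: y_def field_simps)
  then have siny: "sin (2 * pi * y) = s" using s by simp
  have "0 \<le> arcsin s" "arcsin s \<le> pi / 2" using s arcsin_ubound[of s] arcsin_le_arcsin[of 0 s] by auto
  then have y: "y \<in> {1/4..3/4}" by (auto simp: y_def field_simps)
  have "integral {1/4..3/4} (\<lambda>y. (bump n j (sin (2 * pi * y)))\<^sup>2) \<noteq> 0"
    using integral_eq_0_iff[OF cont] y b siny by auto
  moreover have "0 \<le> integral {1/4..3/4} (\<lambda>y. (bump n j (sin (2 * pi * y)))\<^sup>2)"
    by (rule Henstock_Kurzweil_Integration.integral_nonneg) (auto intro: integrable_continuous_real cont)
  ultimately show ?thesis by simp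
qed

context product_eigenfunction begin

definition torus_bump :: "nat \<Rightarrow> nat \<Rightarrow> torus \<Rightarrow> real" where
  "torus_bump n j p = bump n j (sin (2 * pi * snd (rep p)))"

lemma torus_bump_abs: "torus_bump n j (abs_torus z) = bump n j (sin (2 * pi * snd z))"
  by (simp add: torus_bump_def frac2_periodic)

lemma smooth_torus_bump: "smooth (torus_bump n j)"
  by (rule smooth_planar) (unfold torus_bump_abs bump_def, intro planar_intros)

lemma grad_torus_bump:
  "grad (torus_bump n j) (abs_torus z) = (0, bump' n j (sin (2 * pi * snd z)) * (cos (2 * pi * snd z) * (2 * pi)))"
proof -
  have "((\<lambda>z. bump n j (sin (2 * pi * snd z))) has_derivative
      (\<lambda>v. (cos (2 * pi * snd z) * (2 * pi) * snd v) * bump' n j (sin (2 * pi * snd z)))) (at z)"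
  proof -
    have "((\<lambda>z. sin (2 * pi * snd z)) has_derivative (\<lambda>v. cos (2 * pi * snd z) * (2 * pi) * snd v)) (at z)"
      by (auto intro!: derivative_eq_intros)
    from has_derivative_compose[OF this bump'(1)[unfolded has_field_derivative_def]]
    show ?thesis by (simp add: mult.commute)
  qed
  then show ?thesis by (simp add: grad_eq dir_deriv_abs torus_bump_abs pd_eq mult_ac)
qed

text \<open>The mass is bounded below on the core rectangle of width \<open>2/3 width\<close>, the
  energy above on the whole rectangle of width \<open>width\<close>. The width cancels, leaving the
  factor 3/2 and integrals in \<open>y\<close> alone.\<close>

lemma bump_family: "bump_family n (bump_constant n) (torus_bump n)"
  unfolding bump_family_def
proof (intro conjI allI impI smooth_torus_bump)
  fix j assume j: "j < n"
  define g where "g y = (bump n j (sin (2 * pi * y)))\<^sup>2" for y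
  define h where "h y = (bump' n j (sin (2 * pi * y)) * (cos (2 * pi * y) * (2 * pi)))\<^sup>2" for y
  have cg: "continuous_on UNIV g" unfolding g_def
    by (intro continuous_intros continuous_on_compose2[OF bump_continuous[of UNIV]]) auto
  have ch: "continuous_on UNIV h" unfolding h_def
    by (intro continuous_intros continuous_on_compose2[OF bump'(2)]) auto
  have sm: "smooth (torus_bump n j)" by (rule smooth_torus_bump)
  have mb: "torus_bump n j \<in> L2 M" and mgb: "grad (torus_bump n j) \<in> L2 M"
    using H1_L2[OF smooth_pair_H1[OF sm]] by (simp_all add: smooth_pair_def)
  have b_eq: "(\<integral>x. (torus_bump n j x)\<^sup>2 \<partial>M) = (\<integral>z. indicator D z * g (snd z) \<partial>lborel)"
    and b_int: "integrable lborel (\<lambda>z. indicator D z * g (snd z))"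
  proof -
    have eq: "(\<lambda>z. (norm (ext D (torus_bump n j) z))\<^sup>2) = (\<lambda>z. indicator D z * g (snd z))"
      by (auto simp: ext_def g_def torus_bump_abs indicator_def)
    show "(\<integral>x. (torus_bump n j x)\<^sup>2 \<partial>M) = (\<integral>z. indicator D z * g (snd z) \<partial>lborel)"
      using ext_norm_square[OF L2_measurable[OF mb]] unfolding eq by simp
    show "integrable lborel (\<lambda>z. indicator D z * g (snd z))"
      using L2_integrable_square[OF ext_L2[OF mb]] unfolding eq .
  qed
  have a_eq: "(\<integral>x. (norm (grad (torus_bump n j) x))\<^sup>2 \<partial>M) = (\<integral>z. indicator D z * h (snd z) \<partial>lborel)"
    and a_int: "integrable lborel (\<lambda>z. indicator D z * h (snd z))"
  proof -
    have eq: "(\<lambda>z. (norm (ext D (grad (torus_bump n j)) z))\<^sup>2) = (\<lambda>z. indicator D z * h (snd z))"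
      by (auto simp: ext_def h_def grad_torus_bump indicator_def norm_Pair)
    show "(\<integral>x. (norm (grad (torus_bump n j) x))\<^sup>2 \<partial>M) = (\<integral>z. indicator D z * h (snd z) \<partial>lborel)"
      using ext_norm_square[OF L2_measurable[OF mgb]] unfolding eq by simp
    show "integrable lborel (\<lambda>z. indicator D z * h (snd z))"
      using L2_integrable_square[OF ext_L2[OF mgb]] unfolding eq .
  qed
  have g0: "0 \<le> g y" and h0: "0 \<le> h y" for y by (auto simp: g_def h_def)
  define A where "A = integral {1/4..3/4} h"
  define B where "B = integral {1/4..3/4} g"
  have B: "0 < B" unfolding B_def g_def by (rule bump_mass_pos[OF j])
  have A: "0 \<le> A" unfolding A_def
    by (rule Henstock_Kurzweil_Integration.integral_nonneg)
       (auto intro: h0 integrable_continuous_real continuous_on_subset[OF ch])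
  have "2 / 3 * width * B = (5 / 6 * width - width / 6) * B" by simp
  also have "\<dots> = (\<integral>z. indicator (cbox (width / 6, 1/4) (5 / 6 * width, 3/4)) z * g (snd z) \<partial>lborel)"
    unfolding B_def by (rule integral_strip(2)[OF cg, symmetric]) (use width in simp)
  also have "\<dots> \<le> (\<integral>z. indicator D z * g (snd z) \<partial>lborel)"
  proof (rule integral_mono[OF integral_strip(1)[OF cg] b_int])
    show "width / 6 \<le> 5 / 6 * width" using width by simp
    fix z
    show "indicator (cbox (width / 6, 1/4) (5 / 6 * width, 3/4)) z * g (snd z) \<le> indicator D z * g (snd z)"
    proof (cases "z \<in> cbox (width / 6, 1/4) (5 / 6 * width, 3/4) \<and> g (snd z) \<noteq> 0")
      case True
      then have "bump n j (sin (2 * pi * snd z)) \<noteq> 0" by (simp add: g_def)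
      then have "0 < sin (2 * pi * snd z)" "sin (2 * pi * snd z) < 1/2"
        using bump_support(3,4)[of n j "sin (2 * pi * snd z)"] j by blast+
      then have "\<bar>sin (2 * pi * snd z)\<bar> < 1/2" by simp
      then have "z \<in> D" using True core_in_D[of "fst z" "snd z"] by (cases z) auto
      then show ?thesis using True by simp
    next
      case False
      then show ?thesis using g0 by (auto simp: indicator_def)
    qed
  qed
  finally have lower: "2 / 3 * width * B \<le> (\<integral>x. (torus_bump n j x)\<^sup>2 \<partial>M)" by (simp add: b_eq)
  show pos: "0 < (\<integral>x. (torus_bump n j x)\<^sup>2 \<partial>M)"
    by (rule less_le_trans[OF _ lower]) (use B width in simp)
  have "(\<integral>z. indicator D z * h (snd z) \<partial>lborel) \<le> (\<integral>z. indicator (cbox (0, 1/4) (width, 3/4)) z * h (snd z) \<partial>lborel)"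
  proof (rule integral_mono[OF a_int integral_strip(1)[OF ch]])
    show "0 \<le> width" using width by simp
    fix z
    have "z \<in> D \<Longrightarrow> z \<in> cbox (0, 1/4) (width, 3/4)" by (cases z) (auto simp: D_def)
    then show "indicator D z * h (snd z) \<le> indicator (cbox (0, 1/4) (width, 3/4)) z * h (snd z)"
      using h0 by (auto simp: indicator_def)
  qed
  also have "\<dots> = width * A"
    unfolding A_def using integral_strip(2)[OF ch, of 0 width] width by simp
  also have "\<dots> = 3/2 * A / B * (2 / 3 * width * B)" using B by simp
  also have "\<dots> \<le> 3/2 * A / B * (\<integral>x. (torus_bump n j x)\<^sup>2 \<partial>M)"
    using A B by (intro mult_left_mono lower) auto
  \<comment> \<open>The constant sums the quotients of all bumps, a convenient upper bound for their
    maximum.\<close>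
  also have "\<dots> \<le> bump_constant n * (\<integral>x. (torus_bump n j x)\<^sup>2 \<partial>M)"
  proof (rule mult_right_mono)
    have "3/2 * integral {1/4..3/4} (\<lambda>y. (bump' n j (sin (2 * pi * y)) * (cos (2 * pi * y) * (2 * pi)))\<^sup>2)
     / integral {1/4..3/4} (\<lambda>y. (bump n j (sin (2 * pi * y)))\<^sup>2) \<le> bump_constant n"
      unfolding bump_constant_def
    proof (rule member_le_sum)
      show "0 \<le> 3/2 * integral {1/4..3/4} (\<lambda>y. (bump' n i (sin (2 * pi * y)) * (cos (2 * pi * y) * (2 * pi)))\<^sup>2)
          / integral {1/4..3/4} (\<lambda>y. (bump n i (sin (2 * pi * y)))\<^sup>2)" if "i \<in> {..<n} - {j}" for i
      proof (rule divide_nonneg_pos[OF mult_nonneg_nonneg])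
        show "0 \<le> integral {1/4..3/4} (\<lambda>y. (bump' n i (sin (2 * pi * y)) * (cos (2 * pi * y) * (2 * pi)))\<^sup>2)"
        proof (rule Henstock_Kurzweil_Integration.integral_nonneg)
          show "(\<lambda>y. (bump' n i (sin (2 * pi * y)) * (cos (2 * pi * y) * (2 * pi)))\<^sup>2) integrable_on {1/4..3/4}"
            by (intro integrable_continuous_real continuous_intros continuous_on_compose2[OF bump'(2)]) auto
        qed simp
        show "0 < integral {1/4..3/4} (\<lambda>y. (bump n i (sin (2 * pi * y)))\<^sup>2)"
          using that by (intro bump_mass_pos) auto
      qed simp
    qed (use j in auto)
    then show "3/2 * A / B \<le> bump_constant n" by (simp add: A_def B_def g_def[abs_def] h_def[abs_def])
  qed simp
  finally show "(\<integral>x. (norm (grad (torus_bump n j) x))\<^sup>2 \<partial>M) \<le> bump_constant n * (\<integral>x. (torus_bump n j x)\<^sup>2 \<partial>M)"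
    by (simp add: a_eq)
next
  fix i j p assume ij: "i < n" "j < n" "i \<noteq> j"
  obtain z where z: "p = abs_torus z" using torus_cases by blast
  define s where "s = sin (2 * pi * snd z)"
  have disj: "(bump n i s = 0 \<and> bump' n i s = 0) \<or> (bump n j s = 0 \<and> bump' n j s = 0)"
  proof (rule ccontr)
    assume "\<not> ?thesis"
    then have "bump n i s \<noteq> 0 \<or> bump' n i s \<noteq> 0" "bump n j s \<noteq> 0 \<or> bump' n j s \<noteq> 0" by auto
    from bump_support(1,2)[OF this(1) ij(1)] bump_support(1,2)[OF this(2) ij(2)]
    have "real i < real (Suc j)" "real j < real (Suc i)" by linarith+
    then show False using ij(3) by simp
  qed
  show "torus_bump n i p * torus_bump n j p = 0"
    using disj by (auto simp: z torus_bump_abs s_def)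
  show "grad (torus_bump n i) p \<bullet> grad (torus_bump n j) p = 0"
    using disj by (auto simp: z grad_torus_bump s_def)
qed

sublocale neumann_problem D cutoff "(width / 6, 11/24)" "(5 / 6 * width, 13/24)"
proof
  show "cbox (width / 6, 11/24) (5 / 6 * width, 13/24) \<subseteq> D"
  proof
    fix z assume "z \<in> cbox (width / 6, 11/24) (5 / 6 * width, 13/24 :: real)"
    then obtain x y where z: "z = (x, y)" "width / 6 \<le> x" "x \<le> 5 / 6 * width" "11/24 \<le> y" "y \<le> 13/24"
      by (cases z) auto
    \<comment> \<open>The half-height 1/24 about \<open>y = 1/2\<close> bounds the sine by \<pi>/12,
      which is below 1/2 because \<pi> < 4.\<close>
    have "\<bar>sin (2 * pi * y)\<bar> = \<bar>sin (2 * pi * y - pi)\<bar>" by (simp add: sin_diff)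
    also have "\<dots> \<le> \<bar>2 * pi * y - pi\<bar>" by (rule abs_sin_x_le_abs_x)
    also have "2 * pi * y - pi = 2 * pi * (y - 1/2)" by (simp add: algebra_simps)
    also have "\<bar>2 * pi * (y - 1/2)\<bar> = 2 * pi * \<bar>y - 1/2\<bar>" by (simp only: abs_mult) simp
    also have "\<dots> \<le> 2 * pi * (1/24)"
    proof (intro mult_left_mono)
      show "\<bar>y - 1/2\<bar> \<le> 1/24" using z(4,5) by linarith
    qed simp
    also have "\<dots> < 1/2" using pi_less_4 by simp
    finally show "z \<in> D" unfolding z(1) using z by (intro core_in_D) auto
  qed
  show "0 < measure lborel (cbox (width / 6, 11/24) (5 / 6 * width, 13/24 :: real))"
    using width unfolding content_pos_lt_eq by (auto simp: Basis_real_prod)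
  show "\<exists>C h. bump_family n C h" for n using bump_family by blast
qed

end

section \<open>The Neumann boundary condition\<close>

lemma pd_transfer:
  assumes "F \<in> planar" "open S" "z \<in> S" "\<And>w. w \<in> S \<Longrightarrow> F w = G w" shows "pd v G z = pd v F z"
  using has_derivative_transform_within_open[OF planar_has_derivative[OF assms(1)] assms(2,3,4)]
  by (subst pd_eq) (auto simp: pd_planar_vec[OF assms(1), of v])

text \<open>With \<open>t = n P\<close> this is the error factor arising when the cutoff is
  differentiated along the gradient of the eigenfunction: it is bounded uniformly in
  \<open>n\<close> and tends to 0 pointwise. In \<open>u = 1 / (t - 1)\<close> it equals
  \<open>(u + u^2) exp(-u)\<close>.\<close>

lemma scaled_plateau_derivative:
  assumes \<beta>: "\<And>t. (plateau has_real_derivative \<beta> t) (at t)" "\<And>t. t \<le> 0 \<Longrightarrow> \<beta> t = 0"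
  shows "0 \<le> t \<Longrightarrow> \<bar>t * \<beta> (t - 1)\<bar> \<le> 2" "0 < a \<Longrightarrow> (\<lambda>n. real n * a * \<beta> (real n * a - 1)) \<longlonglongrightarrow> 0"
proof -
  have eq: "\<beta> s = exp (- 1 / s) / s\<^sup>2" if "0 < s" for s
  proof (rule DERIV_unique[OF \<beta>(1)])
    have "((\<lambda>s. exp (- 1 / s)) has_real_derivative exp (- 1 / s) / s\<^sup>2) (at s)"
      using that by (auto intro!: derivative_eq_intros simp: power2_eq_square field_simps)
    then show "(plateau has_real_derivative exp (- 1 / s) / s\<^sup>2) (at s)"
      by (rule has_field_derivative_transform_within_open[of _ _ _ "{0<..}"]) (use that in \<open>auto simp: plateau_def\<close>)
  qed
  show "\<bar>t * \<beta> (t - 1)\<bar> \<le> 2" if "0 \<le> t"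
  proof (cases "1 < t")
    case True
    define u where "u = 1 / (t - 1)"
    have u: "0 < u" "t = 1 + 1 / u" using True by (simp_all add: u_def)
    have "1 + u + u\<^sup>2 / 2 \<le> exp u" using u by (intro exp_lower_Taylor_quadratic) simp
    then have "u + u\<^sup>2 \<le> 2 * exp u" using u by simp
    then have "(u + u\<^sup>2) * exp (- u) \<le> 2 * exp u * exp (- u)" by (intro mult_right_mono) simp_all
    also have "\<dots> = 2" by (simp add: exp_minus)
    finally have "(u + u\<^sup>2) * exp (- u) \<le> 2" .
    moreover have "t * \<beta> (t - 1) = (u + u\<^sup>2) * exp (- u)"
    proof -
      have "\<beta> (1 / u) = exp (- u) * u\<^sup>2" using eq[of "1 / u"] u by (simp add: power_divide)
      then show ?thesis using u by (simp add: power2_eq_square distrib_right)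
    qed
    ultimately show ?thesis using u by simp
  qed (simp add: \<beta>(2))
  show "(\<lambda>n. real n * a * \<beta> (real n * a - 1)) \<longlonglongrightarrow> 0" if a: "0 < a"
  proof (rule Lim_transform_eventually)
    show "(\<lambda>n. real n * a * (exp (- 1 / (real n * a - 1)) / (real n * a - 1)\<^sup>2)) \<longlonglongrightarrow> 0"
      using a by real_asymp
    have "\<forall>\<^sub>F n in sequentially. 1 < real n * a" using a by real_asymp
    then show "\<forall>\<^sub>F n in sequentially. real n * a * (exp (- 1 / (real n * a - 1)) / (real n * a - 1)\<^sup>2)
        = real n * a * \<beta> (real n * a - 1)"
      by eventually_elim (simp add: eq)
  qed
qed

context product_eigenfunction begin

text \<open>The form of \<open>P_deriv\<close> without a flow, up to sign. In particular the two
  gradients are orthogonal on \<open>P = 0\<close>, the classical Neumann condition.\<close>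

lemma grad_F_grad_P: "Fx z * pd (1, 0) P z + Fy z * pd (0, 1) P z = - (\<kappa>\<^sup>2 * F z * P z)"
proof -
  define s where "s = sin (2 * pi * snd z)"
  have d: "(P has_derivative (\<lambda>v. fst v * (\<kappa> * cos (\<kappa> * fst z))
      - snd v * (real (k\<^sup>2) * (s ^ (k\<^sup>2 - 1) * (2 * pi * cos (2 * pi * snd z)))))) (at z)"
    unfolding P_def s_def by (auto intro!: derivative_eq_intros simp: algebra_simps)
  have "Fx z * pd (1, 0) P z + Fy z * pd (0, 1) P z
      = - (\<kappa>\<^sup>2 * F z * sin (\<kappa> * fst z)) + real (k\<^sup>2) * (s ^ (k\<^sup>2 - 1) * ((2 * pi)\<^sup>2 * F z * s))"
    by (simp add: pd_eq[OF d] Fx_def Fy_def F_def s_def power2_eq_square algebra_simps)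
  also have "\<dots> = - (\<kappa>\<^sup>2 * F z * P z)"
    unfolding power_deriv_aux by (simp add: P_def s_def algebra_simps)
  finally show ?thesis .
qed

text \<open>No flux crosses the separatrices: since \<open>\<nabla>F \<bullet> \<nabla>P = - \<kappa>\<^sup>2 F P\<close>, the error term produced by a cutoff that is
  a function of \<open>n P\<close> is bounded uniformly in \<open>n\<close>, and Green's formula follows by dominated convergence.\<close>
lemma neumann_eigenfunction_f: "neumann_eigenfunction (abs_torus ` D) E f"
  unfolding neumann_eigenfunction_def
proof (intro conjI exI[of _ "grad f"] allI impI)
  show H: "H1_gradient (abs_torus ` D) f (grad f)" by (rule H1_gradient_smooth[OF smooth_f])
  have fL: "f \<in> L2 M" and gL: "grad f \<in> L2 M" using H by (auto simp: H1_gradient_def L2_on_def L2_def)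
  show "\<not> (AE x in M. f x = 0)"
  proof
    assume ae: "AE x in M. f x = 0"
    have "(\<integral>z. (norm (ext D f z))\<^sup>2 \<partial>lborel) = (\<integral>x. (norm (f x))\<^sup>2 \<partial>M)"
      by (rule ext_norm_square[OF L2_measurable[OF fL], symmetric])
    also have "\<dots> = (\<integral>x. 0 \<partial>M)"
      by (rule integral_cong_AE) (use ae L2_measurable[OF fL] in auto)
    finally have "AE z in lborel. (norm (ext D f z))\<^sup>2 = 0"
      using integral_nonneg_eq_0_iff_AE[OF L2_integrable_square[OF ext_L2[OF fL]]] by simp
    then have ae0: "AE z in lborel. ext D f z = 0" by simp
    \<comment> \<open>If \<open>f\<close> vanished almost everywhere on the domain, the open set
      \<open>S\<close> would be null and hence empty; the point \<open>(width / 4, 1/2)\<close>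
      shows that it is not.\<close>
    define S where "S = D \<inter> {z. F z \<noteq> 0}"
    have oS: "open S" unfolding S_def
      by (intro open_Int open_D open_Collect_neq planar_continuous F_planar continuous_on_const)
    have "AE z in lborel. z \<notin> S" using ae0 by eventually_elim (auto simp: S_def ext_def)
    then have "S \<in> null_sets lborel" using oS by (subst AE_iff_null_sets) auto
    then have "negligible S" by (simp add: negligible_iff_null_sets null_sets_completionI)
    then have "S = {}" using oS open_not_negligible by blast
    moreover have "(width / 4, 1/2) \<in> S"
    proof -
      have "\<kappa> * (width / 4) = pi / 4" using width by simp
      then show ?thesis using width k_ge_2
        by (simp add: S_def D_def P_def F_def sin_45 cos_45 power_0_left)
    qed
    ultimately show False by simp
  qed
  fix v W assume vW: "H1_gradient (abs_torus ` D) v W"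
  have vL: "v \<in> L2 M" and WL: "W \<in> L2 M" using vW by (auto simp: H1_gradient_def L2_on_def L2_def)
  define U where "U = ext D v"
  define G where "G = ext D W"
  have UL: "U \<in> L2 lborel" and GL: "G \<in> L2 lborel" and off: "\<And>z. z \<notin> D \<Longrightarrow> U z = 0 \<and> G z = 0"
    and weak: "\<And>\<psi> b. \<psi> \<in> test_planar D \<Longrightarrow> b \<in> Basis \<Longrightarrow> (\<integral>z. U z * pd b \<psi> z \<partial>lborel) = - (\<integral>z. (G z \<bullet> b) * \<psi> z \<partial>lborel)"
    using H1_gradient_imp_weak[OF vW] unfolding weak_gradient_def U_def G_def by blast+
  have Um [measurable]: "U \<in> borel_measurable borel" and Gm [measurable]: "G \<in> borel_measurable borel"
    using L2_measurable[OF UL] L2_measurable[OF GL] by auto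
  obtain \<beta> where \<beta>: "\<And>t. (plateau has_real_derivative \<beta> t) (at t)" "\<And>t. t \<le> 0 \<Longrightarrow> \<beta> t = 0"
    using plateau_derivative by metis
  define \<psi> where "\<psi> n z = Fx z * cutoff n z" for n z
  define \<chi>' where "\<chi>' n z = Fy z * cutoff n z" for n z
  have test: "\<psi> n \<in> test_planar D" "\<chi>' n \<in> test_planar D" for n
    unfolding \<psi>_def[abs_def] \<chi>'_def[abs_def] by (intro test_planar_mult Fx_planar Fy_planar cutoff_test)+
  have pd_cut: "pd w (cutoff n) z = \<beta> (real n * P z - 1) * (real n * pd w P z)" if "z \<in> D" for w n z
  proof -
    have pl: "(\<lambda>z. real n * P z - 1) \<in> planar" by (intro planar_intros P_planar)
    have "pd w (cutoff n) z = pd w (\<lambda>z. plateau (real n * P z - 1)) z"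
    proof (rule pd_transfer[OF _ open_D that])
      show "(\<lambda>z. plateau (real n * P z - 1)) \<in> planar" by (intro planar_intros P_planar)
      show "plateau (real n * P y - 1) = cutoff n y" if "y \<in> D" for y
        using that by (auto simp: cutoff_def D_def mem_Times_iff)
    qed
    also have "\<dots> = \<beta> (real n * P z - 1) * pd w (\<lambda>z. real n * P z - 1) z"
      by (rule pd_comp[OF pl \<beta>(1)])
    also have "pd w (\<lambda>z. real n * P z - 1) z = real n * pd w P z"
      using has_derivative_diff[OF has_derivative_mult_right[OF planar_has_derivative[OF P_planar], of "real n" z] has_derivative_const[of 1]]
      by (subst pd_eq) (auto simp: pd_planar_vec[OF P_planar, of w])
    finally show ?thesis .
  qed
  define R where "R n z = - E * F z * cutoff n z - \<kappa>\<^sup>2 * F z * (real n * P z * \<beta> (real n * P z - 1))" for n z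
  \<comment> \<open>The Laplacian contributes \<open>- E F\<close>; the derivative of the cutoff
    contributes through \<open>grad_F_grad_P\<close>, whose factor \<open>P\<close> balances the
    growing factor \<open>n\<close>.\<close>
  have div: "pd (1, 0) (\<psi> n) z + pd (0, 1) (\<chi>' n) z = R n z" if "z \<in> D" for n z
  proof -
    have "pd (1, 0) (\<psi> n) z + pd (0, 1) (\<chi>' n) z
        = (pd (1, 0) Fx z + pd (0, 1) Fy z) * cutoff n z + (Fx z * pd (1, 0) P z + Fy z * pd (0, 1) P z) * (real n * \<beta> (real n * P z - 1))"
      unfolding \<psi>_def[abs_def] \<chi>'_def[abs_def]
      by (simp add: pd_mult Fx_planar Fy_planar cutoff_planar pd_cut[OF that] algebra_simps)
    also have "pd (1, 0) Fx z + pd (0, 1) Fy z = - E * F z"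
      by (simp add: pd_Fx pd_Fy E_def F_def algebra_simps)
    finally show ?thesis unfolding grad_F_grad_P R_def by (simp add: algebra_simps)
  qed
  have gext: "ext D (grad f) z = (Fx z, Fy z)" if "z \<in> D" for z using that by (simp add: ext_def grad_f)
  have key: "(\<integral>z. U z * (pd (1, 0) (\<psi> n) z + pd (0, 1) (\<chi>' n) z) \<partial>lborel) = - (\<integral>z. (ext D (grad f) z \<bullet> G z) * cutoff n z \<partial>lborel)" for n
  proof -
    have i: "integrable lborel (\<lambda>z. U z * pd (1, 0) (\<psi> n) z)" "integrable lborel (\<lambda>z. U z * pd (0, 1) (\<chi>' n) z)"
      using L2_integrable_inner[OF UL test_planar_L2[OF test_planar_pd[OF test(1)]]]
        L2_integrable_inner[OF UL test_planar_L2[OF test_planar_pd[OF test(2)]]] by simp_all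
    have j: "integrable lborel (\<lambda>z. (G z \<bullet> b) * h z)" if h: "h \<in> test_planar D" for h b
    proof -
      have "(\<lambda>z. h z *\<^sub>R b) \<in> L2 lborel"
      proof -
        obtain C where "0 \<le> C" and C: "\<And>z. \<bar>h z\<bar> \<le> C * indicator D z" and "\<And>z. \<bar>h z\<bar> \<le> C"
          by (rule test_planar_bounded[OF h]) (rule that)
        have "\<bar>h z\<bar> * norm b \<le> C * norm b * indicator D z" for z
          using mult_right_mono[OF C[of z], of "norm b"] by (simp add: mult_ac)
        then show ?thesis
          by (intro bounded_L2[of _ "C * norm b"]) (use test_planar_measurable[OF h] in auto)
      qed
      from L2_integrable_inner[OF GL this] show ?thesis by (simp add: mult.commute)
    qed
    have "(\<integral>z. U z * (pd (1, 0) (\<psi> n) z + pd (0, 1) (\<chi>' n) z) \<partial>lborel)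
        = (\<integral>z. U z * pd (1, 0) (\<psi> n) z \<partial>lborel) + (\<integral>z. U z * pd (0, 1) (\<chi>' n) z \<partial>lborel)"
      using i by (simp add: distrib_left)
    also have "\<dots> = - (\<integral>z. (G z \<bullet> (1, 0)) * \<psi> n z \<partial>lborel) - (\<integral>z. (G z \<bullet> (0, 1)) * \<chi>' n z \<partial>lborel)"
      using weak[OF test(1), of "(1, 0)" n] weak[OF test(2), of "(0, 1)" n] by (simp add: Basis_real_prod)
    also have "\<dots> = - (\<integral>z. (G z \<bullet> (1, 0)) * \<psi> n z + (G z \<bullet> (0, 1)) * \<chi>' n z \<partial>lborel)"
      using j[OF test(1), of "(1, 0)" n] j[OF test(2), of "(0, 1)" n] by simp
    also have "(\<lambda>z. (G z \<bullet> (1, 0)) * \<psi> n z + (G z \<bullet> (0, 1)) * \<chi>' n z) = (\<lambda>z. (ext D (grad f) z \<bullet> G z) * cutoff n z)"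
    proof
      fix z
      show "(G z \<bullet> (1, 0)) * \<psi> n z + (G z \<bullet> (0, 1)) * \<chi>' n z = (ext D (grad f) z \<bullet> G z) * cutoff n z"
      proof (cases "z \<in> D")
        case True
        then show ?thesis by (simp add: gext \<psi>_def \<chi>'_def inner_prod_def algebra_simps)
      next
        case False
        then show ?thesis using off by simp
      qed
    qed
    finally show ?thesis .
  qed
  have "(\<lambda>n. \<integral>z. U z * (pd (1, 0) (\<psi> n) z + pd (0, 1) (\<chi>' n) z) \<partial>lborel) \<longlonglongrightarrow> (\<integral>z. U z * (- E * F z) \<partial>lborel)"
  proof (rule integral_dominated_convergence)
    show "(\<lambda>z. U z * (- E * F z)) \<in> borel_measurable lborel" using F_planar by measurable
    show "(\<lambda>z. U z * (pd (1, 0) (\<psi> n) z + pd (0, 1) (\<chi>' n) z)) \<in> borel_measurable lborel" for n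
      using test_planar_measurable[OF test_planar_pd[OF test(1)]] test_planar_measurable[OF test_planar_pd[OF test(2)]]
      by measurable
    have "integrable lborel (\<lambda>z. indicat_real D z \<bullet> U z)" by (rule L2_integrable_inner[OF indicator_D_L2 UL])
    moreover have "(\<lambda>z. indicat_real D z \<bullet> U z) = U"
    proof
      show "indicat_real D z \<bullet> U z = U z" for z using off[of z] by (cases "z \<in> D") auto
    qed
    ultimately have "integrable lborel U" by (simp only:)
    then show "integrable lborel (\<lambda>z. (E + 2 * \<kappa>\<^sup>2) * \<bar>U z\<bar>)" by simp
    have split: "U z * (pd (1, 0) (\<psi> n) z + pd (0, 1) (\<chi>' n) z) = U z * R n z" for n z
      using div off by (cases "z \<in> D") auto
    have lim: "(\<lambda>n. U z * R n z) \<longlonglongrightarrow> U z * (- E * F z)" for z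
    proof (cases "z \<in> D")
      case True
      then have "0 < P z" by (simp add: D_def)
      from tendsto_diff[OF tendsto_mult_left[OF cut_lim[OF True], of "- E * F z"] tendsto_mult_left[OF scaled_plateau_derivative(2)[OF \<beta> this], of "\<kappa>\<^sup>2 * F z"]]
      have "(\<lambda>n. R n z) \<longlonglongrightarrow> - E * F z" by (simp add: R_def)
      then show ?thesis by (rule tendsto_mult_left)
    qed (simp add: off)
    show "AE z in lborel. (\<lambda>n. U z * (pd (1, 0) (\<psi> n) z + pd (0, 1) (\<chi>' n) z)) \<longlonglongrightarrow> U z * (- E * F z)"
      unfolding split using lim by simp
    show "AE z in lborel. norm (U z * (pd (1, 0) (\<psi> n) z + pd (0, 1) (\<chi>' n) z)) \<le> (E + 2 * \<kappa>\<^sup>2) * \<bar>U z\<bar>" for n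
    proof (rule AE_I2)
      fix z
      show "norm (U z * (pd (1, 0) (\<psi> n) z + pd (0, 1) (\<chi>' n) z)) \<le> (E + 2 * \<kappa>\<^sup>2) * \<bar>U z\<bar>"
      proof (cases "z \<in> D")
        case True
        then have "0 \<le> real n * P z" by (simp add: D_def)
        note b = scaled_plateau_derivative(1)[OF \<beta> this]
        have E: "0 \<le> E" by (simp add: E_def)
        have c: "\<bar>cutoff n z\<bar> \<le> 1" using cut_bounds[of n z] by simp
        have 1: "\<bar>E * F z * cutoff n z\<bar> \<le> E * 1 * 1"
          unfolding abs_mult using F_bound[of z] E c by (intro mult_mono) auto
        have 2: "\<bar>\<kappa>\<^sup>2 * F z * (real n * P z * \<beta> (real n * P z - 1))\<bar> \<le> \<kappa>\<^sup>2 * 1 * 2"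
          unfolding abs_mult[of "\<kappa>\<^sup>2 * F z"] abs_mult[of "\<kappa>\<^sup>2"] using F_bound[of z] b by (intro mult_mono) auto
        have "\<bar>R n z\<bar> \<le> E + 2 * \<kappa>\<^sup>2" using 1 2 unfolding R_def by linarith
        then show ?thesis unfolding split real_norm_def abs_mult mult.commute[of "\<bar>U z\<bar>"] by (rule mult_right_mono) simp
      qed (simp add: off)
    qed
  qed
  moreover have "(\<lambda>n. - (\<integral>z. (ext D (grad f) z \<bullet> G z) * cutoff n z \<partial>lborel)) \<longlonglongrightarrow> - (\<integral>z. ext D (grad f) z \<bullet> G z \<partial>lborel)"
  proof (rule tendsto_minus, rule integral_dominated_convergence)
    have i: "integrable lborel (\<lambda>z. ext D (grad f) z \<bullet> G z)" by (rule L2_integrable_inner[OF ext_L2[OF gL] GL])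
    then show m: "(\<lambda>z. ext D (grad f) z \<bullet> G z) \<in> borel_measurable lborel" by auto
    show "integrable lborel (\<lambda>z. \<bar>ext D (grad f) z \<bullet> G z\<bar>)" using i by simp
    show "(\<lambda>z. (ext D (grad f) z \<bullet> G z) * cutoff n z) \<in> borel_measurable lborel" for n
      using m planar_measurable[OF cutoff_planar[of n]] by measurable
    have "(\<lambda>n. (ext D (grad f) z \<bullet> G z) * cutoff n z) \<longlonglongrightarrow> ext D (grad f) z \<bullet> G z" for z
    proof (cases "z \<in> D")
      case True
      then show ?thesis using tendsto_mult_left[OF cut_lim[OF True], of "ext D (grad f) z \<bullet> G z"] by simp
    qed (simp add: off)
    then show "AE z in lborel. (\<lambda>n. (ext D (grad f) z \<bullet> G z) * cutoff n z) \<longlonglongrightarrow> ext D (grad f) z \<bullet> G z" by simp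
    have "\<bar>ext D (grad f) z \<bullet> G z\<bar> * \<bar>cutoff n z\<bar> \<le> \<bar>ext D (grad f) z \<bullet> G z\<bar>" for n z
      using cut_bounds[of n z] by (intro mult_left_le) auto
    then show "AE z in lborel. norm ((ext D (grad f) z \<bullet> G z) * cutoff n z) \<le> \<bar>ext D (grad f) z \<bullet> G z\<bar>" for n
      by (simp add: abs_mult)
  qed
  ultimately have "(\<integral>z. U z * (- E * F z) \<partial>lborel) = - (\<integral>z. ext D (grad f) z \<bullet> G z \<partial>lborel)"
    unfolding key by (rule LIMSEQ_unique)
  moreover have "(\<integral>x. grad f x \<bullet> W x \<partial>M) = (\<integral>z. ext D (grad f) z \<bullet> G z \<partial>lborel)"
  proof -
    have "ext D (\<lambda>x. grad f x \<bullet> W x) = (\<lambda>z. ext D (grad f) z \<bullet> G z)" by (auto simp: G_def ext_def)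
    then show ?thesis
      using ext_integral(2)[of "\<lambda>x. grad f x \<bullet> W x"] L2_measurable[OF gL] L2_measurable[OF WL] by simp
  qed
  moreover have "(\<integral>x. f x * v x \<partial>M) = (\<integral>z. U z * F z \<partial>lborel)"
  proof -
    have "ext D (\<lambda>x. f x * v x) = (\<lambda>z. U z * F z)" by (auto simp: U_def ext_def)
    then show ?thesis
      using ext_integral(2)[of "\<lambda>x. f x * v x"] L2_measurable[OF fL] L2_measurable[OF vL] by simp
  qed
  moreover have "(\<integral>z. U z * (- E * F z) \<partial>lborel) = - E * (\<integral>z. U z * F z \<partial>lborel)"
  proof -
    have "(\<lambda>z. U z * (- E * F z)) = (\<lambda>z. - E * (U z * F z))" by (simp add: fun_eq_iff)
    then show ?thesis by (simp only: integral_mult_right_zero)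
  qed
  ultimately show "(\<integral>x. grad f x \<bullet> W x \<partial>M) = E * (\<integral>x. f x * v x \<partial>M)" by simp
qed

end

section \<open>The Neumann domain\<close>

lemma sin_cos_squares: "(sin a)\<^sup>2 = 1 \<longleftrightarrow> cos (a :: real) = 0" "(cos a)\<^sup>2 = 1 \<longleftrightarrow> sin a = 0"
proof -
  have "(sin a)\<^sup>2 = 1 \<longleftrightarrow> (cos a)\<^sup>2 = 0" "(cos a)\<^sup>2 = 1 \<longleftrightarrow> (sin a)\<^sup>2 = 0"
    using sin_cos_squared_add[of a] by linarith+
  then show "(sin a)\<^sup>2 = 1 \<longleftrightarrow> cos a = 0" "(cos a)\<^sup>2 = 1 \<longleftrightarrow> sin a = 0"
    by (simp_all only: zero_eq_power2)
qed

lemma middle_interval: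
  assumes "0 \<le> y" "y < 1" "cos (2 * pi * y) \<le> 0" shows "1/4 \<le> y" "y \<le> 3/4"
proof -
  show "1/4 \<le> y"
  proof (rule ccontr)
    assume "\<not> 1/4 \<le> y"
    then have *: "pi * y < pi * (1/4)" "0 \<le> pi * y" using assms by auto
    have "0 < cos (2 * pi * y)" by (intro cos_gt_zero_pi) (use * pi_gt_zero in linarith)+
    then show False using assms by simp
  qed
  show "y \<le> 3/4"
  proof (rule ccontr)
    assume "\<not> y \<le> 3/4"
    then have *: "pi * (3/4) < pi * y" "pi * y < pi * 1" using assms by auto
    have "0 < cos (2 * pi * y - 2 * pi)" by (intro cos_gt_zero_pi) (use * pi_gt_zero in linarith)+
    then show False using assms by (simp add: cos_diff)
  qed
qed

text \<open>The cosine inequality says that \<open>x\<close> is within \<open>w / 2\<close> of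
  \<open>w / 2\<close> modulo 1, a periodic way to express \<open>0 \<le> x \<le> w\<close> that
  makes sense on the torus.\<close>

lemma left_interval:
  assumes x: "0 \<le> x" "x < 1" and w: "0 < w" "w \<le> 1/2" and c: "cos (pi * w) \<le> cos (2 * pi * x - pi * w)"
  shows "x \<le> w"
proof (rule ccontr)
  assume "\<not> x \<le> w"
  then have 1: "pi * w < pi * x" "pi * x < pi * 1" "0 < pi * w" "pi * w \<le> pi * (1/2)" using x w by auto
  have "cos (2 * pi * x - pi * w) < cos (pi * w)"
  proof (cases "2 * pi * x - pi * w \<le> pi")
    case True
    then show ?thesis using 1 by (intro cos_monotone_0_pi) auto
  next
    case False
    have "cos (2 * pi * x - pi * w) = cos (2 * pi - (2 * pi * x - pi * w))" by simp
    also have "\<dots> < cos (pi * w)" using 1 False by (intro cos_monotone_0_pi) auto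
    finally show ?thesis .
  qed
  then show False using c by simp
qed

context product_eigenfunction begin

text \<open>Since \<open>P\<close> stays positive, the times spent in the open \<open>D\<close> are
  the times spent in the closed rectangle; this set of times is open and closed in the line.\<close>

lemma D_invariant:
  assumes sol: "solution \<gamma>" and \<gamma>0: "\<gamma> 0 \<in> D" shows "\<gamma> t \<in> D"
proof -
  have P: "0 < P (\<gamma> t)" for t using P_pos_invariant[OF sol, of 0] \<gamma>0 by (simp add: D_def)
  have cont: "continuous_on UNIV \<gamma>" using \<gamma>_isCont[OF sol] by (simp add: continuous_on_eq_continuous_at)
  have "\<gamma> -` D = \<gamma> -` cbox (0, 1/4) (width, 3/4)"
  proof -
    have "D \<subseteq> cbox (0, 1/4) (width, 3/4)" by (auto simp: D_def cbox_Pair_eq mem_Times_iff)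
    then show ?thesis using closed_rectangle_in_D P by blast
  qed
  moreover have "open (\<gamma> -` D)" by (rule open_vimage[OF open_D cont])
  moreover have "closed (\<gamma> -` cbox (0, 1/4) (width, 3/4))" by (rule closed_vimage[OF closed_cbox cont])
  ultimately have "\<gamma> -` D = {} \<or> \<gamma> -` D = UNIV" using clopen[of "\<gamma> -` D"] by simp
  then show ?thesis using \<gamma>0 by blast
qed

text \<open>Along the orbit the abscissa increases and the ordinate is eventually monotone, so the orbit
  converges to a critical point. The saddles are excluded because \<open>P\<close> and \<open>sin (\<kappa> x)\<close> solve the same
  linear equation, so that their ratio is a positive constant.\<close>
lemma tendsto_minimum:
  assumes sol: "solution \<gamma>" and \<gamma>0: "\<gamma> 0 \<in> D" shows "(\<gamma> \<longlongrightarrow> (width, 1/2)) at_top"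
proof -
  define x where "x t = fst (\<gamma> t)" for t
  define y where "y t = snd (\<gamma> t)" for t
  have inD: "\<gamma> t \<in> D" for t by (rule D_invariant[OF sol \<gamma>0])
  have b: "0 < x t" "x t < width" "1/4 < y t" "y t < 3/4" "0 < P (\<gamma> t)" for t
    using inD[of t] by (auto simp: D_def x_def y_def)
  have dx: "(x has_real_derivative - Fx (\<gamma> t)) (at t)" and dy: "(y has_real_derivative - Fy (\<gamma> t)) (at t)" for t
    using x_deriv[OF sol, of t] y_deriv[OF sol, of t] by (simp_all add: x_def[abs_def] y_def[abs_def])
  have sx: "0 < sin (\<kappa> * x t)" for t using \<kappa>_range[OF b(1,2)] by (intro sin_gt_zero) auto
  have Fx_neg: "Fx (\<gamma> t) < 0" for t
    using sx[of t] cos_neg_middle[OF b(3,4), of t] \<kappa>_pos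
    by (simp add: Fx_def x_def y_def mult_pos_neg)
  have x_mono: "x s \<le> x t" if "s \<le> t" for s t
    by (rule DERIV_nonneg_imp_nondecreasing[OF that]) (use dx Fx_neg in \<open>metis less_imp_le neg_0_le_iff_le\<close>)
  obtain xl where xl: "(x \<longlongrightarrow> xl) at_top"
    using monotone_bounded_convergent_at_top[of 0 x width] x_mono b(2) less_imp_le by blast
  have cx_mono: "cos (\<kappa> * x t) \<le> cos (\<kappa> * x s)" if "s \<le> t" for s t
    using \<kappa>_range[OF b(1,2), of s] \<kappa>_range[OF b(1,2), of t] x_mono[OF that] \<kappa>_pos
    by (intro cos_monotone_0_pi_le) auto
  \<comment> \<open>\<open>sin (2 \<pi> y)\<close> satisfies a linear equation along the orbit and
    so keeps its sign; together with the monotone \<open>cos (\<kappa> x)\<close> this gives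
    \<open>Fy\<close> a constant sign from some time on.\<close>
  have sy: "(\<forall>t. 0 \<le> sin (2 * pi * y t)) \<or> (\<forall>t. sin (2 * pi * y t) \<le> 0)"
  proof -
    note d = sin_y_deriv[OF sol, folded y_def]
    have d': "((\<lambda>t. - sin (2 * pi * y t)) has_real_derivative (2 * pi)\<^sup>2 * F (\<gamma> t) * (- sin (2 * pi * y t))) (at t)" for t
      using DERIV_minus[OF d, of t] by simp
    consider "sin (2 * pi * y 0) = 0" | "0 < sin (2 * pi * y 0)" | "0 < - sin (2 * pi * y 0)" by linarith
    then show ?thesis
    proof cases
      case 1
      then have "sin (2 * pi * y t) = 0" for t
        by (rule linear_differential_inequality_zero[OF d linear_bound])
      then show ?thesis by simp
    next
      case 2
      then have "0 < sin (2 * pi * y t)" for t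
        by (rule linear_differential_inequality_pos[OF d linear_bound])
      then show ?thesis using less_imp_le by blast
    next
      case 3
      then have "0 < - sin (2 * pi * y t)" for t
        by (rule linear_differential_inequality_pos[OF d' linear_bound])
      then show ?thesis using less_imp_le by (metis neg_0_less_iff_less)
    qed
  qed
  have "\<exists>t0. (\<forall>t\<ge>t0. 0 \<le> cos (\<kappa> * x t)) \<or> (\<forall>t\<ge>t0. cos (\<kappa> * x t) \<le> 0)"
  proof (cases "\<exists>t0. cos (\<kappa> * x t0) \<le> 0")
    case True
    then show ?thesis using cx_mono order_trans by blast
  next
    case False
    then show ?thesis by (meson linear)
  qed
  then obtain t0 where "(\<forall>t\<ge>t0. 0 \<le> Fy (\<gamma> t)) \<or> (\<forall>t\<ge>t0. Fy (\<gamma> t) \<le> 0)"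
    using sy unfolding Fy_def x_def[symmetric] y_def[symmetric]
    by (auto simp: zero_le_mult_iff mult_le_0_iff)
  then obtain yl where yl: "(y \<longlongrightarrow> yl) at_top"
  proof
    assume neg: "\<forall>t\<ge>t0. 0 \<le> Fy (\<gamma> t)"
    have "- y s \<le> - y t" if "t0 \<le> s" "s \<le> t" for s t
    proof -
      have "y t \<le> y s"
        by (rule DERIV_nonpos_imp_nonincreasing[OF that(2)]) (use dy neg that(1) in \<open>metis neg_le_0_iff_le order_trans\<close>)
      then show ?thesis by simp
    qed
    moreover have "- y t \<le> 0" for t using b(3)[of t] by simp
    ultimately obtain l where "((\<lambda>t. - y t) \<longlongrightarrow> l) at_top"
      using monotone_bounded_convergent_at_top[of t0 "\<lambda>t. - y t" 0] by blast
    from tendsto_minus[OF this] show thesis using that by simp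
  next
    assume pos: "\<forall>t\<ge>t0. Fy (\<gamma> t) \<le> 0"
    have "y s \<le> y t" if "t0 \<le> s" "s \<le> t" for s t
      by (rule DERIV_nonneg_imp_nondecreasing[OF that(2)]) (use dy pos that(1) in \<open>metis neg_0_le_iff_le order_trans\<close>)
    then show thesis
      using that monotone_bounded_convergent_at_top[of t0 y "3/4"] b(4) less_imp_le by blast
  qed
  have lim: "(\<gamma> \<longlongrightarrow> (xl, yl)) at_top"
    using tendsto_Pair[OF xl yl] by (simp add: x_def y_def)
  have comp: "((\<lambda>t. H (\<gamma> t)) \<longlongrightarrow> H (xl, yl)) at_top" if "H \<in> planar" for H
  proof (rule isCont_tendsto_compose[OF _ lim])
    show "isCont H (xl, yl)" using planar_continuous[OF that, of UNIV] by (simp add: continuous_on_eq_continuous_at)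
  qed
  have Fx0: "Fx (xl, yl) = 0" and Fy0: "Fy (xl, yl) = 0"
    using limit_of_derivative_zero[OF xl dx tendsto_minus[OF comp[OF Fx_planar]]]
      limit_of_derivative_zero[OF yl dy tendsto_minus[OF comp[OF Fy_planar]]] by simp_all
  have range: "0 < xl" "xl \<le> width" "1/4 \<le> yl" "yl \<le> 3/4"
  proof -
    have le: "x t \<le> width" "1/4 \<le> y t" "y t \<le> 3/4" for t using b[of t] by auto
    have "x 0 \<le> xl"
      by (rule tendsto_lowerbound[OF xl]) (use x_mono in \<open>auto intro: eventually_mono[OF eventually_ge_at_top[of 0]]\<close>)
    then show "0 < xl" using b(1)[of 0] by simp
    show "xl \<le> width" by (rule tendsto_upperbound[OF xl]) (intro always_eventually allI le trivial_limit_at_top_linorder)+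
    show "1/4 \<le> yl" by (rule tendsto_lowerbound[OF yl]) (intro always_eventually allI le trivial_limit_at_top_linorder)+
    show "yl \<le> 3/4" by (rule tendsto_upperbound[OF yl]) (intro always_eventually allI le trivial_limit_at_top_linorder)+
  qed
  \<comment> \<open>The abscissa increases, so \<open>xl > 0\<close> excludes the maximum. Of the
    remaining critical points in the rectangle, a vanishing sine in \<open>x\<close> means the
    minimum, and otherwise the limit would be a saddle.\<close>
  have "xl = width \<and> yl = 1/2"
  proof (cases "sin (\<kappa> * xl) = 0")
    case True
    have "\<not> xl < width"
    proof
      assume "xl < width"
      then have "0 < sin (\<kappa> * xl)" using \<kappa>_range[OF range(1)] by (intro sin_gt_zero) auto
      then show False using True by simp
    qed
    then have xl: "xl = width" using range by simp
    then have "sin (2 * pi * yl) = 0" using Fy0 width by (simp add: Fy_def)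
    then have s: "sin (2 * pi * yl - pi) = 0" by (simp add: sin_diff)
    have "pi * (1/4) \<le> pi * yl" "pi * yl \<le> pi * (3/4)" using range by auto
    then have "- pi < 2 * pi * yl - pi" "2 * pi * yl - pi < pi" using pi_gt_zero by linarith+
    then have "2 * pi * yl - pi = 0" by (rule sin_eq_0_pi[OF _ _ s])
    then show ?thesis using xl by (simp add: field_simps)
  next
    case False
    then have cy: "cos (2 * pi * yl) = 0" using Fx0 \<kappa>_pos by (simp add: Fx_def)
    then have sy2: "(sin (2 * pi * yl))\<^sup>2 = 1" by (simp add: sin_cos_squares)
    then have "cos (\<kappa> * xl) = 0" using Fy0 by (auto simp: Fy_def)
    then have sx2: "(sin (\<kappa> * xl))\<^sup>2 = 1" by (simp add: sin_cos_squares)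
    obtain r where r: "k\<^sup>2 = 2 * r" using ksq(1) by blast
    have "sin (2 * pi * yl) ^ (k\<^sup>2) = 1" unfolding r power_mult sy2 by simp
    moreover have "0 \<le> sin (\<kappa> * xl)"
      using \<kappa>_pos range mult_left_mono[of xl width \<kappa>] width(3) by (intro sin_ge_zero) auto
    ultimately have P0: "P (xl, yl) = 0" and s1: "sin (\<kappa> * xl) = 1"
      using sx2 by (auto simp: P_def power2_eq_1_iff)
    have "((\<lambda>t. P (\<gamma> t) / sin (\<kappa> * x t)) has_real_derivative 0) (at t)" for t
      using DERIV_divide[OF P_deriv[OF sol, of t] sin_x_deriv[OF sol, of t]] sx[of t]
      by (simp add: x_def mult_ac)
    moreover define c where "c = P (\<gamma> 0) / sin (\<kappa> * x 0)"
    ultimately have const: "P (\<gamma> t) / sin (\<kappa> * x t) = c" for t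
      using DERIV_isconst_all[of "\<lambda>t. P (\<gamma> t) / sin (\<kappa> * x t)"] by blast
    have "((\<lambda>t. P (\<gamma> t) / sin (\<kappa> * x t)) \<longlongrightarrow> P (xl, yl) / sin (\<kappa> * xl)) at_top"
      using comp[OF P_planar] xl s1 by (intro tendsto_intros) auto
    then have "((\<lambda>t::real. c) \<longlongrightarrow> 0) at_top" unfolding const P0 by simp
    then have "c = 0" by (simp add: tendsto_const_iff)
    then show ?thesis using b(5)[of 0] sx[of 0] by (simp add: c_def)
  qed
  then show ?thesis using lim by (simp only:)
qed

text \<open>The reflection \<open>x \<mapsto> width - x\<close> changes the sign of the eigenfunction, so that it reverses time.\<close>
lemma tendsto_maximum:
  assumes sol: "solution \<gamma>" and \<gamma>0: "\<gamma> 0 \<in> D" shows "(\<gamma> \<longlongrightarrow> (0, 1/2)) at_bot"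
proof -
  define \<delta> where "\<delta> t = (width - fst (\<gamma> (- t)), snd (\<gamma> (- t)))" for t
  have trig: "sin (\<kappa> * (width - a)) = sin (\<kappa> * a)" "cos (\<kappa> * (width - a)) = - cos (\<kappa> * a)" for a
    by (simp_all add: right_diff_distrib width(3) sin_diff cos_diff)
  have "solution \<delta>"
    unfolding solution_def
  proof
    fix t
    have 1: "((\<lambda>t. width - fst (\<gamma> (- t))) has_real_derivative - Fx (\<gamma> (- t))) (at t)"
      using DERIV_diff[OF DERIV_const DERIV_chain2[OF x_deriv[OF sol] DERIV_minus[OF DERIV_ident]]] by simp
    have 2: "((\<lambda>t. snd (\<gamma> (- t))) has_real_derivative Fy (\<gamma> (- t))) (at t)"
      using DERIV_chain2[OF y_deriv[OF sol] DERIV_minus[OF DERIV_ident]] by simp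
    have "(\<delta> has_vector_derivative (- Fx (\<gamma> (- t)), Fy (\<gamma> (- t)))) (at t)"
      unfolding \<delta>_def[abs_def]
      using has_vector_derivative_Pair[OF 1[unfolded has_real_derivative_iff_has_vector_derivative] 2[unfolded has_real_derivative_iff_has_vector_derivative]] .
    moreover have "vf (\<delta> t) = (- Fx (\<gamma> (- t)), Fy (\<gamma> (- t)))"
      by (simp add: vf_def Fx_def Fy_def \<delta>_def trig)
    ultimately show "(\<delta> has_vector_derivative vf (\<delta> t)) (at t)" by simp
  qed
  moreover have "\<delta> 0 \<in> D" using \<gamma>0 by (simp add: D_def \<delta>_def P_def trig)
  ultimately have "(\<delta> \<longlongrightarrow> (width, 1/2)) at_top" by (rule tendsto_minimum)
  from tendsto_fst[OF this] tendsto_snd[OF this]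
  have "((\<lambda>t. (width - fst (\<delta> t), snd (\<delta> t))) \<longlongrightarrow> (width - width, 1/2)) at_top"
    by (intro tendsto_intros) simp_all
  then have "((\<lambda>t. \<gamma> (- t)) \<longlongrightarrow> (0, 1/2)) at_top" by (simp add: \<delta>_def)
  then show ?thesis by (simp add: filterlim_at_bot_mirror)
qed

lemma abs_torus_tendsto: "(\<gamma> \<longlongrightarrow> z) G \<Longrightarrow> ((\<lambda>t. abs_torus (\<gamma> t)) \<longlongrightarrow> abs_torus z) G"
  by (rule isCont_tendsto_compose[OF continuous_on_eq_continuous_at[OF open_UNIV, THEN iffD1, OF continuous_on_abs_torus, rule_format, OF UNIV_I]])

text \<open>A zero of \<open>F\<close> on \<open>P = 0\<close> is a saddle, so an orbit in
  \<open>P = 0\<close> that passed from positive to negative values of \<open>F\<close> would be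
  stationary. This keeps the separatrices out of the orbits from the maximum to the minimum.\<close>

lemma separatrix_zero:
  assumes "P z = 0" "F z = 0" shows "vf z = 0"
proof -
  obtain r where r: "k\<^sup>2 = 2 * r" "0 < r" using ksq by (auto elim!: evenE)
  define s where "s = (sin (2 * pi * snd z))\<^sup>2"
  have s: "0 \<le> s" by (simp add: s_def)
  have P: "sin (\<kappa> * fst z) = s ^ r" using assms(1) by (simp add: P_def r power_mult s_def)
  have "cos (2 * pi * snd z) = 0 \<and> cos (\<kappa> * fst z) = 0"
  proof (cases "cos (2 * pi * snd z) = 0")
    case True
    then have "s = 1" by (simp add: s_def sin_cos_squares)
    then have "(sin (\<kappa> * fst z))\<^sup>2 = 1" using P by simp
    then show ?thesis using True by (simp add: sin_cos_squares)
  next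
    case False
    then have c: "cos (\<kappa> * fst z) = 0" using assms(2) by (simp add: F_def)
    then have "(s ^ r)\<^sup>2 = 1" unfolding P[symmetric] by (simp add: sin_cos_squares)
    then have "s ^ (r * 2) = 1" by (simp add: power_mult)
    then have "s = 1" using s r power_eq_iff_eq_base[of "r * 2" s 1] by simp
    then show ?thesis using c by (simp add: s_def sin_cos_squares)
  qed
  then show ?thesis by (simp add: vf_def Fx_def Fy_def zero_prod_def)
qed

text \<open>Maximality comes from a separation: every point of \<open>S\<close> lies in the image of
  \<open>D\<close> or in the open set \<open>O2\<close>, the complement of a closed set containing
  that image. What lies between them belongs to \<open>P = 0\<close> and thus to no orbit from
  \<open>q\<close> to \<open>p\<close>.\<close>

lemma neumann_domain_D: "neumann_domain f (abs_torus ` D)"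
proof -
  define p where "p = abs_torus (width, 1/2)"
  define q where "q = abs_torus (0, 1/2)"
  define S where "S = stable_set \<phi> p \<inter> unstable_set \<phi> q"
  have fp: "f p = - 1" "f q = 1" using width by (simp_all add: p_def q_def F_def)
  have fb: "- 1 \<le> f x" "f x \<le> 1" for x using F_bound[of "rep x"] by (auto simp: f_def abs_le_iff)
  have ends: "local_minimum f p" "local_maximum f q"
    unfolding local_minimum_def local_maximum_def using fb by (auto simp: fp)
  have sub: "\<Omega> \<subseteq> S"
  proof
    fix a assume "a \<in> \<Omega>"
    then obtain z where z: "a = abs_torus z" "z \<in> D" by blast
    obtain \<gamma> where \<gamma>: "solution \<gamma>" "\<gamma> 0 = rep a" "\<And>t. \<phi> t a = abs_torus (\<gamma> t)" using \<phi>_solution[of a] by blast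
    have "\<gamma> 0 \<in> D" using \<gamma>(2) z by simp
    then show "a \<in> S"
      unfolding S_def stable_set_def unstable_set_def p_def q_def
      using abs_torus_tendsto[OF tendsto_minimum[OF \<gamma>(1)]] abs_torus_tendsto[OF tendsto_maximum[OF \<gamma>(1)]]
      by (simp add: \<gamma>(3))
  qed
  have conn: "connected \<Omega>"
    by (rule connected_continuous_image[OF continuous_on_abs_torus convex_connected[OF convex_D]])
  have core: "(width / 2, 1/2) \<in> D"
  proof -
    have "\<kappa> * (width / 2) = pi / 2" using width by simp
    then show ?thesis using width k_ge_2 by (simp add: D_def P_def power_0_left)
  qed
  \<comment> \<open>The part \<open>P \<ge> 0\<close> of the closed rectangle, expressed by
    functions invariant under the lattice, so that its complement descends to an open subset of the
    torus.\<close>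
  define Z where "Z z \<longleftrightarrow> 0 \<le> P z \<and> cos (2 * pi * snd z) \<le> 0 \<and> cos (pi * width) \<le> cos (2 * pi * fst z - pi * width)"
    for z :: "real \<times> real"
  define O2 where "O2 = {a. \<not> Z (rep a)}"
  have Z_frac2: "Z (frac2 z) = Z z" for z by (simp add: Z_def P_def frac2_periodic)
  have "abs_torus -` O2 = {z. \<not> Z z}" by (simp only: O2_def vimage_def rep_abs Z_frac2 mem_Collect_eq)
  then have "abs_torus -` O2 = {z. P z < 0} \<union> {z. 0 < cos (2 * pi * snd z)} \<union> {z. cos (2 * pi * fst z - pi * width) < cos (pi * width)}"
    by (auto simp: Z_def)
  moreover have "open {z. P z < 0}"
    by (intro open_Collect_less planar_continuous P_planar continuous_on_const)
  moreover have "open {z :: real \<times> real. 0 < cos (2 * pi * snd z)}"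
    by (intro open_Collect_less continuous_intros)
  moreover have "open {z :: real \<times> real. cos (2 * pi * fst z - pi * width) < cos (pi * width)}"
    by (intro open_Collect_less continuous_intros)
  ultimately have open_O2: "open O2" unfolding open_torus_iff by (simp only: open_Un)
  have ZD: "Z z" if z: "z \<in> D" for z
  proof -
    have "pi * fst z \<le> pi * width" "0 \<le> pi * fst z" "pi * width \<le> pi * (1/4)" using z width by (auto simp: D_def)
    then have "cos (pi * width) \<le> cos \<bar>2 * pi * fst z - pi * width\<bar>"
      using pi_gt_zero by (intro cos_monotone_0_pi_le) (auto simp: abs_le_iff)
    then show ?thesis using z cos_neg_middle[of "snd z"] by (simp add: Z_def D_def less_imp_le)
  qed
  have SZ: "a \<in> \<Omega>" if a: "a \<in> S" "a \<notin> O2" for a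
  proof -
    obtain z where z: "a = abs_torus z" "frac2 z = z" using torus_cases by blast
    have unit: "z \<in> {0..<1} \<times> {0..<1}" using frac2_in[of z] z(2) by simp
    have Zz: "Z z" using a(2) by (simp add: O2_def z)
    have box: "z \<in> cbox (0, 1/4) (width, 3/4)"
      using middle_interval[of "snd z"] left_interval[of "fst z" width] Zz unit width
      by (cases z) (auto simp: Z_def)
    obtain \<gamma> where \<gamma>: "solution \<gamma>" "\<gamma> 0 = rep a" "\<And>t. \<phi> t a = abs_torus (\<gamma> t)" using \<phi>_solution[of a] by blast
    note fc = continuous_on_tendsto_compose[OF smooth_continuous0[OF smooth_f] _ UNIV_I]
    have lim: "((\<lambda>t. F (\<gamma> t)) \<longlongrightarrow> - 1) at_top" "((\<lambda>t. F (\<gamma> t)) \<longlongrightarrow> 1) at_bot"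
      using a(1) fc[of "\<lambda>t. \<phi> t a" p at_top] fc[of "\<lambda>t. \<phi> t a" q at_bot]
      by (simp_all add: S_def stable_set_def unstable_set_def \<gamma>(3) fp)
    have "P z \<noteq> 0"
    proof
      assume "P z = 0"
      then have P0: "P (\<gamma> t) = 0" for t using P_zero_invariant[OF \<gamma>(1), of 0 t] \<gamma>(2) by (simp add: z)
      have "\<forall>\<^sub>F t in at_top. F (\<gamma> t) < 0 \<and> 0 \<le> t"
        by (intro eventually_conj order_tendstoD(2)[OF lim(1)] eventually_ge_at_top) simp
      then obtain t2 where t2: "F (\<gamma> t2) < 0" "0 \<le> t2" by (auto simp: eventually_at_top_linorder)
      have "\<forall>\<^sub>F t in at_bot. 0 < F (\<gamma> t) \<and> t \<le> 0"
        by (intro eventually_conj order_tendstoD(1)[OF lim(2)] eventually_le_at_bot) simp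
      then obtain t1 where t1: "0 < F (\<gamma> t1)" "t1 \<le> 0" by (auto simp: eventually_at_bot_linorder)
      have "isCont (\<lambda>t. F (\<gamma> t)) t" for t
        by (rule isCont_o2[OF \<gamma>_isCont[OF \<gamma>(1)]])
           (rule continuous_on_eq_continuous_at[OF open_UNIV, THEN iffD1, OF planar_continuous[OF F_planar], rule_format, OF UNIV_I])
      then obtain t0 where t0: "F (\<gamma> t0) = 0"
        using IVT2[of "\<lambda>t. F (\<gamma> t)" t2 0 t1] t1 t2 by auto
      have "\<gamma> t = \<gamma> t0" for t by (rule solution_constant[OF \<gamma>(1) separatrix_zero[OF P0 t0]])
      then show False using t1 t0 by (metis less_irrefl)
    qed
    then have "z \<in> D" using closed_rectangle_in_D[OF box] Zz by (simp add: Z_def)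
    then show ?thesis using z by blast
  qed
  have "\<Omega> \<in> components S"
    unfolding in_components_maximal
  proof (intro conjI allI impI)
    show "\<Omega> \<noteq> {}" using core by blast
    fix d assume d: "d \<noteq> {} \<and> \<Omega> \<subseteq> d \<and> d \<subseteq> S \<and> connected d"
    have "O2 \<inter> \<Omega> = {}" using ZD by (auto simp: O2_def)
    moreover have "d \<subseteq> \<Omega> \<union> O2" using SZ d by blast
    ultimately have "\<Omega> \<inter> d = {} \<or> O2 \<inter> d = {}"
      using connectedD[OF _ open_Omega open_O2, of d] d by blast
    then show "d = \<Omega>" using d core \<open>d \<subseteq> \<Omega> \<union> O2\<close> by blast
  qed (rule sub conn)+
  then show ?thesis
    unfolding neumann_domain_def S_def using neg_gradient_flow_\<phi> ends by blast
qed

end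

theorem proposition1p7:
  shows "\<exists>(f :: nat \<Rightarrow> torus \<Rightarrow> real) (\<Omega> :: nat \<Rightarrow> torus set) (pos :: nat \<Rightarrow> nat).
    (\<forall>k. morse_eigenfunction (f k) \<and> neumann_domain (f k) (\<Omega> k) \<and> has_pos (f k) (\<Omega> k) (pos k)) \<and>
    \<not> bdd_above (range pos)"
proof -
  have "\<exists>f \<Omega> n. morse_eigenfunction f \<and> neumann_domain f \<Omega> \<and> has_pos f \<Omega> n \<and> N \<le> n" for N
  proof -
    obtain m where m: "bump_constant N < real m" using reals_Archimedean2 by blast
    \<comment> \<open>\<open>bump_constant N\<close> does not involve \<open>k\<close>, so
      \<open>k\<close> may be chosen after it. This \<open>k\<close> is even and at least 2, and
      \<open>\<kappa> \<ge> k \<ge> m\<close> with \<open>\<kappa> \<ge> 1\<close> gives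
      \<open>\<kappa>\<^sup>2 \<ge> m\<close>, hence \<open>E > bump_constant N\<close>.\<close>
    define k where "k = 2 * (m + 1)"
    interpret product_eigenfunction k by unfold_locales (simp_all add: k_def)
    have "1 * real k \<le> \<kappa>" unfolding \<kappa>_def using pi_ge_two by (intro mult_right_mono) auto
    then have "real m \<le> \<kappa>" "1 \<le> \<kappa>" by (auto simp: k_def)
    then have "real m \<le> \<kappa>\<^sup>2" using mult_left_mono[of 1 \<kappa> \<kappa>] unfolding power2_eq_square by linarith
    then have "bump_constant N < E" using m zero_le_power2[of "2 * pi"] unfolding E_def by linarith
    from has_pos_lower_bound[OF neumann_eigenfunction_f bump_family this]
    show ?thesis using morse_eigenfunction_f neumann_domain_D by blast
  qed
  then obtain f \<Omega> pos where *: "\<And>N :: nat. morse_eigenfunction (f N) \<and> neumann_domain (f N) (\<Omega> N) \<and> has_pos (f N) (\<Omega> N) (pos N) \<and> N \<le> pos N"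
    by metis
  have "\<not> bdd_above (range pos)"
  proof
    assume "bdd_above (range pos)"
    then obtain B where "\<And>N. pos N \<le> B" by (auto simp: bdd_above_def)
    then have "pos (Suc B) \<le> B" .
    moreover have "Suc B \<le> pos (Suc B)" using * by blast
    ultimately show False by simp
  qed
  with * show ?thesis by (intro exI[of _ f] exI[of _ \<Omega>] exI[of _ pos]) simp
qed

end
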